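(* Let $\alpha>0$ and let $\Gamma\subset\mathbb{R}^n$ be a $d$-set, $0<d<n$, preserving Markov's inequality. Then $\mathbb{H}^\alpha(\Gamma)=B^{2,2}_\alpha(\Gamma)$ with equivalence of norms.
   Context: A closed $\Gamma\subset\mathbb{R}^n$ is a $d$-set if there are $c_1,c_2>0$ with $c_1r^d\le\mathcal{H}^d(\Gamma\cap B_r(x))\le c_2r^d$ for all $x\in\Gamma$, $0<r\le1$ ($\mathcal{H}^d$ Hausdorff measure). $\Gamma$ preserves Markov's inequality if for every $k\in\mathbb{N}$ there is $c>0$ such that for all polynomials $P$ on $\mathbb{R}^n$ of degree at most $k$ and all closed balls $B=B_r(x)$ with $x\in\Gamma$, $0<r\le1$, $\max_{\Gamma\cap B}|\nabla P|\le\frac cr\max_{\Gamma\cap B}|P|$. $\mathbb{L}_p(\Gamma)$ is the $L_p$ space with respect to $\mathcal{H}^d|_\Gamma$. $\mathbb{H}^\alpha(\Gamma)$: with $s=\alpha+(n-d)/2$, $\mathrm{tr}_\Gamma:H^s(\mathbb{R}^n)\to\mathbb{L}_2(\Gamma)$ is the continuous extension of $\varphi\mapsto\varphi|_\Gamma$, $\varphi\in C_0^\infty(\mathbb{R}^n)$, and $\mathbb{H}^\alpha(\Gamma):=\mathrm{tr}_\Gamma(H^s(\mathbb{R}^n))$ with norm $\inf\{\|\varphi\|_{H^s(\mathbb{R}^n)}:\mathrm{tr}_\Gamma\varphi=f\}$, where $\|\varphi\|^2_{H^s(\mathbb{R}^n)}=\int(1+|\xi|^2)^s|\widehat\varphi(\xi)|^2d\xi$.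 $B^{p,q}_\alpha(\Gamma)$ ($1\le p,q<\infty$): fix $K\in\mathbb{N}$, $K>\lfloor\alpha\rfloor$ (the space does not depend on this choice, up to equivalent norms). For $\nu\in\mathbb{N}_0$, $m\in\mathbb{Z}^n$ let $Q^{\nu m}=\prod_{i=1}^n[2^{-\nu}m_i,2^{-\nu}(m_i+1)]$, and for a cube $Q$ let $rQ$ be the concentric cube with side length $r$ times that of $Q$. An $(\alpha,p)$-atom associated with $Q^{\nu m}$ is any $a^{\nu m}\in C^K(\mathbb{R}^n)$ with $\mathrm{supp}\,a^{\nu m}\subset3Q^{\nu m}$ and $|D^\beta a^{\nu m}(x)|\le2^{-\nu(\alpha-|\beta|-d/p)}$ for $x\in\mathbb{R}^n$, $|\beta|\le K$. Then $f\in B^{p,q}_\alpha(\Gamma)$ iff $f=\sum_{\nu=0}^\infty\sum_{m\in\mathbb{Z}^n}\lambda^{\nu m}a^{\nu m}$, with convergence in $\mathbb{L}_p(\Gamma)$, for some $(\alpha,p)$-atoms $a^{\nu m}$ and numbers $\lambda^{\nu m}$ with $\|\lambda\|_{b_{p,q}}:=\big(\sum_\nu(\sum_m|\lambda^{\nu m}|^p)^{q/p}\big)^{1/q}<\infty$; the norm of $f$ is the infimum of $\|\lambda\|_{b_{p,q}}$ over all such representations. *)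

theory Defs
  imports "HOL-Analysis.Analysis"
begin

section \<open>Hausdorff measure, d-sets, Markov's inequality\<close>

(* No normalising constant: it does not affect the notion of a d-set, and it
   changes norms only by a constant factor.  Boundedness of the covering sets is
   explicit because diameter is meaningful for bounded sets only. *)
definition hausdorff_content :: "real \<Rightarrow> real \<Rightarrow> 'a::metric_space set \<Rightarrow> ennreal" where
  "hausdorff_content d \<delta> A =
     (INF C \<in> {C :: nat \<Rightarrow> 'a set. A \<subseteq> (\<Union>i. C i) \<and> (\<forall>i. bounded (C i) \<and> diameter (C i) \<le> \<delta>)}.
        \<Sum>i. ennreal (diameter (C i) powr d))"

definition hausdorff_outer :: "real \<Rightarrow> 'a::metric_space set \<Rightarrow> ennreal" where
  "hausdorff_outer d A = (SUP \<delta> \<in> {0<..}. hausdorff_content d \<delta> A)"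

definition hausdorff_measure :: "real \<Rightarrow> 'a::metric_space measure" where
  "hausdorff_measure d = measure_of UNIV (sets borel) (hausdorff_outer d)"

definition hausdorff_on :: "real \<Rightarrow> 'a::metric_space set \<Rightarrow> 'a measure" where
  "hausdorff_on d \<Gamma> = restrict_space (hausdorff_measure d) \<Gamma>"

definition d_set :: "real \<Rightarrow> (real^'n) set \<Rightarrow> bool" where
  "d_set d \<Gamma> \<longleftrightarrow> closed \<Gamma> \<and>
     (\<exists>c1>0. \<exists>c2>0. \<forall>x\<in>\<Gamma>. \<forall>r. 0 < r \<and> r \<le> 1 \<longrightarrow>
        ennreal (c1 * r powr d) \<le> emeasure (hausdorff_measure d) (\<Gamma> \<inter> cball x r) \<and>
        emeasure (hausdorff_measure d) (\<Gamma> \<inter> cball x r) \<le> ennreal (c2 * r powr d))"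

definition partial_deriv :: "'n \<Rightarrow> (real^'n \<Rightarrow> 'b::real_normed_vector) \<Rightarrow> real^'n \<Rightarrow> 'b" where
  "partial_deriv i f x = frechet_derivative f (at x) (axis i 1)"

definition gradient :: "(real^'n \<Rightarrow> real) \<Rightarrow> real^'n \<Rightarrow> real^'n" where
  "gradient f x = (\<chi> i. partial_deriv i f x)"

(* The (finite) index set consists of the multi-indices of order at most k. *)
definition polynomial_of_degree_le :: "nat \<Rightarrow> (real^'n \<Rightarrow> real) \<Rightarrow> bool" where
  "polynomial_of_degree_le k P \<longleftrightarrow>
     (\<exists>c :: ('n \<Rightarrow> nat) \<Rightarrow> real.
        P = (\<lambda>x. \<Sum>\<beta> | (\<Sum>i\<in>UNIV. \<beta> i) \<le> k. c \<beta> * (\<Prod>i\<in>UNIV. (x $ i) ^ \<beta> i)))"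

(* For closed \<Gamma> both suprema are maxima over a nonempty compact set. *)
definition preserves_Markov :: "(real^'n) set \<Rightarrow> bool" where
  "preserves_Markov \<Gamma> \<longleftrightarrow>
     (\<forall>k. \<exists>c>0. \<forall>P. polynomial_of_degree_le k P \<longrightarrow>
        (\<forall>x\<in>\<Gamma>. \<forall>r. 0 < r \<and> r \<le> 1 \<longrightarrow>
           (SUP y \<in> \<Gamma> \<inter> cball x r. norm (gradient P y))
             \<le> c / r * (SUP y \<in> \<Gamma> \<inter> cball x r. \<bar>P y\<bar>)))"


section \<open>Lebesgue spaces\<close>

(* Elements are functions, not classes modulo null sets. *)
definition Lp :: "real \<Rightarrow> 'a measure \<Rightarrow> ('a \<Rightarrow> complex) set" where
  "Lp p M = {f \<in> borel_measurable M. integrable M (\<lambda>x. norm (f x) powr p)}"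

definition Lp_norm :: "real \<Rightarrow> 'a measure \<Rightarrow> ('a \<Rightarrow> complex) \<Rightarrow> real" where
  "Lp_norm p M f = (\<integral>x. norm (f x) powr p \<partial>M) powr (1 / p)"

definition Lp_tendsto ::
  "real \<Rightarrow> 'a measure \<Rightarrow> ('i \<Rightarrow> 'a \<Rightarrow> complex) \<Rightarrow> ('a \<Rightarrow> complex) \<Rightarrow> 'i filter \<Rightarrow> bool" where
  "Lp_tendsto p M F f N \<longleftrightarrow>
     f \<in> Lp p M \<and> (\<forall>i. F i \<in> Lp p M) \<and> ((\<lambda>i. Lp_norm p M (\<lambda>x. F i x - f x)) \<longlongrightarrow> 0) N"


section \<open>Smooth functions\<close>

fun C_k :: "nat \<Rightarrow> (real^'n \<Rightarrow> 'b::real_normed_vector) \<Rightarrow> bool" where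
  "C_k 0 f \<longleftrightarrow> continuous_on UNIV f"
| "C_k (Suc k) f \<longleftrightarrow> (\<forall>x. f differentiable (at x)) \<and> (\<forall>i. C_k k (partial_deriv i f))"

(* The list names the variables of the successive derivatives, so its length is
   the order of the multi-index.  Every multi-index is represented by a list, and
   for C_k functions the order of differentiation is immaterial up to order k. *)
definition iter_deriv ::
  "'n list \<Rightarrow> (real^'n \<Rightarrow> 'b::real_normed_vector) \<Rightarrow> real^'n \<Rightarrow> 'b" where
  "iter_deriv \<beta> f = foldr partial_deriv \<beta> f"

definition supp :: "(real^'n \<Rightarrow> complex) \<Rightarrow> (real^'n) set" where
  "supp f = closure {x. f x \<noteq> 0}"

definition test_functions :: "(real^'n \<Rightarrow> complex) set" where
  "test_functions = {\<phi>. (\<forall>k. C_k k \<phi>) \<and> compact (supp \<phi>)}"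

definition schwartz_functions :: "(real^'n \<Rightarrow> complex) set" where
  "schwartz_functions =
     {\<phi>. (\<forall>k. C_k k \<phi>) \<and>
          (\<forall>k \<beta>. \<exists>C. \<forall>x. (1 + norm x) ^ k * norm (iter_deriv \<beta> \<phi> x) \<le> C)}"


section \<open>Sobolev spaces on the whole space\<close>

definition fourier_integral :: "(real^'n \<Rightarrow> complex) \<Rightarrow> real^'n \<Rightarrow> complex" where
  "fourier_integral \<phi> \<xi> =
     of_real ((2 * pi) powr (- real CARD('n) / 2)) * (\<integral>x. cis (- (\<xi> \<bullet> x)) * \<phi> x \<partial>lborel)"

(* Fourier transform of a square integrable function, as a tempered distribution. *)
definition is_fourier_transform ::
  "(real^'n \<Rightarrow> complex) \<Rightarrow> (real^'n \<Rightarrow> complex) \<Rightarrow> bool" where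
  "is_fourier_transform u g \<longleftrightarrow>
     g \<in> Lp 2 lborel \<and>
     (\<forall>\<phi>\<in>schwartz_functions. (\<integral>x. g x * \<phi> x \<partial>lborel) = (\<integral>x. u x * fourier_integral \<phi> x \<partial>lborel))"

definition fourier :: "(real^'n \<Rightarrow> complex) \<Rightarrow> real^'n \<Rightarrow> complex" where
  "fourier u = (SOME g. is_fourier_transform u g)"

(* For s \<ge> 0 only, where every element is a square integrable function and
   fourier u is therefore determined up to a null set. *)
definition sobolev :: "real \<Rightarrow> (real^'n \<Rightarrow> complex) set" where
  "sobolev s = {u \<in> Lp 2 lborel.
     integrable lborel (\<lambda>\<xi>. (1 + (norm \<xi>)\<^sup>2) powr s * (norm (fourier u \<xi>))\<^sup>2)}"

definition sobolev_norm :: "real \<Rightarrow> (real^'n \<Rightarrow> complex) \<Rightarrow> real" where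
  "sobolev_norm s u = sqrt (\<integral>\<xi>. (1 + (norm \<xi>)\<^sup>2) powr s * (norm (fourier u \<xi>))\<^sup>2 \<partial>lborel)"


section \<open>Trace spaces\<close>

(* Bounded linear extension of the restriction map.  Functions represent their
   classes, hence linearity and the extension property hold almost everywhere. *)
definition is_trace_operator ::
  "real \<Rightarrow> real \<Rightarrow> (real^'n) set \<Rightarrow> ((real^'n \<Rightarrow> complex) \<Rightarrow> real^'n \<Rightarrow> complex) \<Rightarrow> bool" where
  "is_trace_operator s d \<Gamma> T \<longleftrightarrow>
     (\<forall>u\<in>sobolev s. T u \<in> Lp 2 (hausdorff_on d \<Gamma>)) \<and>
     (\<forall>u\<in>sobolev s. \<forall>v\<in>sobolev s. \<forall>a b. AE x in hausdorff_on d \<Gamma>.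
        T (\<lambda>y. a * u y + b * v y) x = a * T u x + b * T v x) \<and>
     (\<exists>C. \<forall>u\<in>sobolev s. Lp_norm 2 (hausdorff_on d \<Gamma>) (T u) \<le> C * sobolev_norm s u) \<and>
     (\<forall>\<phi>\<in>test_functions. AE x in hausdorff_on d \<Gamma>. T \<phi> x = \<phi> x)"

definition trace_op ::
  "real \<Rightarrow> real \<Rightarrow> (real^'n) set \<Rightarrow> (real^'n \<Rightarrow> complex) \<Rightarrow> real^'n \<Rightarrow> complex" where
  "trace_op s d \<Gamma> = (SOME T. is_trace_operator s d \<Gamma> T)"

definition trace_preimages ::
  "real \<Rightarrow> real \<Rightarrow> (real^'n) set \<Rightarrow> (real^'n \<Rightarrow> complex) \<Rightarrow> (real^'n \<Rightarrow> complex) set" where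
  "trace_preimages s d \<Gamma> f = {u \<in> sobolev s. AE x in hausdorff_on d \<Gamma>. trace_op s d \<Gamma> u x = f x}"

(* \<Gamma> only supplies the dimension of the ambient space. *)
definition trace_exponent :: "real \<Rightarrow> real \<Rightarrow> (real^'n) set \<Rightarrow> real" where
  "trace_exponent \<alpha> d \<Gamma> = \<alpha> + (real CARD('n) - d) / 2"

definition trace_space :: "real \<Rightarrow> real \<Rightarrow> (real^'n) set \<Rightarrow> (real^'n \<Rightarrow> complex) set" where
  "trace_space \<alpha> d \<Gamma> =
     {f \<in> Lp 2 (hausdorff_on d \<Gamma>). trace_preimages (trace_exponent \<alpha> d \<Gamma>) d \<Gamma> f \<noteq> {}}"

definition trace_space_norm :: "real \<Rightarrow> real \<Rightarrow> (real^'n) set \<Rightarrow> (real^'n \<Rightarrow> complex) \<Rightarrow> real" where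
  "trace_space_norm \<alpha> d \<Gamma> f =
     (INF u \<in> trace_preimages (trace_exponent \<alpha> d \<Gamma>) d \<Gamma> f. sobolev_norm (trace_exponent \<alpha> d \<Gamma>) u)"


section \<open>Besov spaces on d-sets by atomic decomposition\<close>

definition dyadic_cube :: "nat \<Rightarrow> int^'n \<Rightarrow> (real^'n) set" where
  "dyadic_cube \<nu> m =
     cbox (\<chi> i. 2 powr (- real \<nu>) * of_int (m $ i)) (\<chi> i. 2 powr (- real \<nu>) * (of_int (m $ i) + 1))"

definition cube_centre :: "nat \<Rightarrow> int^'n \<Rightarrow> real^'n" where
  "cube_centre \<nu> m = (\<chi> i. 2 powr (- real \<nu>) * (of_int (m $ i) + 1 / 2))"

definition dilated_cube :: "real \<Rightarrow> nat \<Rightarrow> int^'n \<Rightarrow> (real^'n) set" where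
  "dilated_cube r \<nu> m =
     (\<lambda>x. cube_centre \<nu> m + r *\<^sub>R (x - cube_centre \<nu> m)) ` dyadic_cube \<nu> m"

definition is_atom ::
  "nat \<Rightarrow> real \<Rightarrow> real \<Rightarrow> real \<Rightarrow> nat \<Rightarrow> int^'n \<Rightarrow> (real^'n \<Rightarrow> complex) \<Rightarrow> bool" where
  "is_atom K \<alpha> p d \<nu> m a \<longleftrightarrow>
     C_k K a \<and> supp a \<subseteq> dilated_cube 3 \<nu> m \<and>
     (\<forall>\<beta> x. length \<beta> \<le> K \<longrightarrow>
        norm (iter_deriv \<beta> a x) \<le> 2 powr (- real \<nu> * (\<alpha> - real (length \<beta>) - d / p)))"

definition b_seq :: "real \<Rightarrow> real \<Rightarrow> (nat \<Rightarrow> int^'n \<Rightarrow> complex) set" where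
  "b_seq p q = {l. (\<forall>\<nu>. (\<lambda>m. norm (l \<nu> m) powr p) summable_on UNIV) \<and>
                   summable (\<lambda>\<nu>. (\<Sum>\<^sub>\<infinity>m. norm (l \<nu> m) powr p) powr (q / p))}"

definition b_norm :: "real \<Rightarrow> real \<Rightarrow> (nat \<Rightarrow> int^'n \<Rightarrow> complex) \<Rightarrow> real" where
  "b_norm p q l = (\<Sum>\<nu>. (\<Sum>\<^sub>\<infinity>m. norm (l \<nu> m) powr p) powr (q / p)) powr (1 / q)"

(* Iterated sum: the sum over m is unconditional in Lp, giving g, and then the
   series over the levels converges in Lp to f. *)
definition atomic_sum ::
  "real \<Rightarrow> 'a measure \<Rightarrow> (nat \<Rightarrow> int^'n \<Rightarrow> complex) \<Rightarrow> (nat \<Rightarrow> int^'n \<Rightarrow> 'a \<Rightarrow> complex) \<Rightarrow>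
     ('a \<Rightarrow> complex) \<Rightarrow> bool" where
  "atomic_sum p M l a f \<longleftrightarrow>
     (\<exists>g. (\<forall>\<nu>. Lp_tendsto p M (\<lambda>S x. \<Sum>m\<in>S. l \<nu> m * a \<nu> m x) (g \<nu>) (finite_subsets_at_top UNIV)) \<and>
          Lp_tendsto p M (\<lambda>N x. \<Sum>\<nu><N. g \<nu> x) f sequentially)"

definition besov_coeffs ::
  "nat \<Rightarrow> real \<Rightarrow> real \<Rightarrow> real \<Rightarrow> real \<Rightarrow> (real^'n) set \<Rightarrow> (real^'n \<Rightarrow> complex) \<Rightarrow>
     (nat \<Rightarrow> int^'n \<Rightarrow> complex) set" where
  "besov_coeffs K \<alpha> p q d \<Gamma> f =
     {l \<in> b_seq p q. \<exists>a. (\<forall>\<nu> m. is_atom K \<alpha> p d \<nu> m (a \<nu> m)) \<and>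
                         atomic_sum p (hausdorff_on d \<Gamma>) l a f}"

definition besov ::
  "nat \<Rightarrow> real \<Rightarrow> real \<Rightarrow> real \<Rightarrow> real \<Rightarrow> (real^'n) set \<Rightarrow> (real^'n \<Rightarrow> complex) set" where
  "besov K \<alpha> p q d \<Gamma> = {f. besov_coeffs K \<alpha> p q d \<Gamma> f \<noteq> {}}"

definition besov_norm ::
  "nat \<Rightarrow> real \<Rightarrow> real \<Rightarrow> real \<Rightarrow> real \<Rightarrow> (real^'n) set \<Rightarrow> (real^'n \<Rightarrow> complex) \<Rightarrow> real" where
  "besov_norm K \<alpha> p q d \<Gamma> f = (INF l \<in> besov_coeffs K \<alpha> p q d \<Gamma> f. b_norm p q l)"

end

theory Submission
 imports Defs "HOL-Probability.Probability"
begin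

text \<open>
Let \<open>A\<^sub>j\<close> be convolution with a smooth bump at scale \<open>1 / 2 ^ j\<close>, and let \<open>s = \<alpha> + (n - d) / 2\<close>.  Both spaces consist
of the restrictions to \<open>\<Gamma>\<close> of the series \<open>synth w = (\<Sum>j. A\<^sub>j (w j))\<close> for which \<open>\<Sum>j. 4 powr (j s) * \<parallel>w j\<parallel>\<^sup>2\<close> is finite,
and this sum controls both norms.  For the Sobolev space, \<open>w j\<close> is obtained from a dyadic frequency band of \<open>u\<close> by
dividing by the Fourier multiplier of \<open>A\<^sub>j\<close>; conversely Plancherel's theorem bounds the Sobolev norm of \<open>synth w\<close>.
The series converges in \<open>L\<^sub>2(\<Gamma>)\<close> because \<open>\<parallel>A\<^sub>j w\<parallel>\<^sup>2\<close> on \<open>\<Gamma>\<close> is at most \<open>C 2 powr (j (n - d))\<close> times \<open>\<parallel>w\<parallel>\<^sup>2\<close>.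
Cutting \<open>w j\<close> along dyadic cubes turns \<open>synth w\<close> into an atomic series.  An atom of level \<open>\<nu>\<close> is smooth only up to order
\<open>K\<close>, possibly less than \<open>s\<close>; it telescopes into a series \<open>\<Sum>j. A\<^sub>j (\<omega> j)\<close> with \<open>\<omega> j = O(2 powr (- \<kappa> (j - \<nu>)))\<close> for some
\<open>\<kappa> > \<alpha>\<close>.  On \<open>\<Gamma>\<close> only the values of \<open>\<omega> j\<close> within distance \<open>1 / 2 ^ j\<close> of \<open>\<Gamma>\<close> matter; that neighbourhood has volume
\<open>O(2 powr (- j (n - d)))\<close> locally, and this supplies the missing \<open>(n - d) / 2\<close> orders of smoothness.
\<close>

text \<open>\<Gamma> may have Lebesgue measure zero, so an element of L2 has no values on it; all
  pointwise work is done on mollified functions, which are continuous and blind to null sets. Two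
  demands meet in the bump. Its support must be compact, for the supports of the atoms and for the
  cut of \<open>w j\<close> to a neighbourhood of \<Gamma>; and its Fourier transform must stay away
  from 0 on the unit ball, for the division on a band. Support radius 1/2 yields both. The
  \<open>w j\<close> satisfy no cancellation condition: the multiplier of level j decays rapidly
  beyond frequency 2^j, and below it the weight 2^(j s), s > 0, makes the levels summable, so
  Cauchy-Schwarz in j takes the place of orthogonality. Subtracting its mollification from an atom
  gains one order; repetition reaches order K, but each subtraction may double the remainder.
  Mollifying only at every M-th level reduces this loss to 1/M of an order, whence \<kappa> = K -
  1/M. Finally, the trace operator of the definition is merely chosen from a class, so every member
  of the class has to be determined on every \<open>synth w\<close>; truncated series are test
  functions, and that settles it.\<close>

section \<open>Square integrals with values in \<open>ennreal\<close>, and geometric series in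
  L2\<close>

definition l2sq :: "'a measure => ('a => complex) => ennreal" where
 "l2sq M f = (\<integral>\<^sup>+x. ennreal ((norm (f x))\<^sup>2) \<partial>M)"

text \<open>The pointwise inequality 2 f g \<le> t f^2 + g^2 / t, integrated and optimised in t. The
  measure is arbitrary because series are treated in the same way, through
  \<open>count_space\<close>.\<close>

lemma nn_integral_Cauchy_Schwarz:
 fixes f g :: "'a => real"
 assumes [measurable]: "f \<in> borel_measurable M" "g \<in> borel_measurable M"
  and f0: "\<And>x. 0 \<le> f x" and g0: "\<And>x. 0 \<le> g x"
 shows "(\<integral>\<^sup>+x. ennreal (f x * g x) \<partial>M)\<^sup>2
  \<le> (\<integral>\<^sup>+x. ennreal ((f x)\<^sup>2) \<partial>M) * (\<integral>\<^sup>+x. ennreal ((g x)\<^sup>2) \<partial>M)" (is "?I\<^sup>2 \<le> ?A * ?B")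
proof (cases "?A = 0 \<or> ?B = 0")
 case True
 then have "AE x in M. f x * g x = 0"
 proof
  assume "?A = 0"
  then have "AE x in M. ennreal ((f x)\<^sup>2) = 0" by (subst (asm) nn_integral_0_iff_AE) auto
  then show ?thesis by eventually_elim (auto simp: ennreal_eq_0_iff)
 next
  assume "?B = 0"
  then have "AE x in M. ennreal ((g x)\<^sup>2) = 0" by (subst (asm) nn_integral_0_iff_AE) auto
  then show ?thesis by eventually_elim (auto simp: ennreal_eq_0_iff)
 qed
 then have "?I = (\<integral>\<^sup>+x. 0 \<partial>M)"
  by (intro nn_integral_cong_AE) (auto elim!: eventually_mono)
 then show ?thesis by simp
next
 case False
 show ?thesis
 proof (cases "?A = \<infinity> \<or> ?B = \<infinity>")
  case True
  then show ?thesis using False by (auto simp: ennreal_mult_top ennreal_top_mult)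
 next
  case fin: False
  define a b where "a = enn2real ?A" and "b = enn2real ?B"
  have A: "?A = ennreal a" and B: "?B = ennreal b"
   using fin by (auto simp: a_def b_def top.not_eq_extremum)
  have ab: "a > 0" "b > 0" using False unfolding A B
   by (auto simp: ennreal_eq_0_iff not_le)
  \<comment> \<open>The minimiser of t a + b / t, with minimum 2 sqrt (a b). It exists only if both
    integrals are positive and finite, hence the case distinctions before.\<close>
  define t where "t = sqrt (b / a)"
  have t: "t > 0" using ab by (simp add: t_def)
  have am: "2 * (f x * g x) \<le> t * (f x)\<^sup>2 + (1/t) * (g x)\<^sup>2" for x
  proof -
   have "0 \<le> (sqrt t * f x - g x / sqrt t)\<^sup>2" by simp
   also have "\<dots> = t * (f x)\<^sup>2 + (1/t) * (g x)\<^sup>2 - 2 * (f x * g x)"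
    using t by (simp add: power2_diff power_mult_distrib power_divide)
   finally show ?thesis by simp
  qed
  have "2 * ?I = (\<integral>\<^sup>+x. ennreal (2 * (f x * g x)) \<partial>M)"
   by (subst nn_integral_cmult[symmetric]) (auto simp: ennreal_mult' f0 g0)
  also have "\<dots> \<le> (\<integral>\<^sup>+x. ennreal t * ennreal ((f x)\<^sup>2) + ennreal (1/t) * ennreal ((g x)\<^sup>2) \<partial>M)"
   using am t by (intro nn_integral_mono) (simp flip: ennreal_mult' ennreal_plus add: ennreal_leI)
  also have "\<dots> = ennreal t * ?A + ennreal (1/t) * ?B"
   by (subst nn_integral_add) (auto simp: nn_integral_cmult)
  also have "\<dots> = ennreal (t * a + (1/t) * b)"
   unfolding A B using t ab by (simp flip: ennreal_mult' ennreal_plus)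
  also have "t * a + (1/t) * b = 2 * sqrt (a * b)"
  proof -
   have sa: "sqrt a * sqrt a = a" "sqrt b * sqrt b = b" using ab by auto
   have pos: "sqrt a > 0" "sqrt b > 0" using ab by auto
   have "t * a = sqrt b * sqrt a" unfolding t_def real_sqrt_divide using sa pos
    by (metis nonzero_eq_divide_eq less_irrefl mult.assoc times_divide_eq_left)
   moreover have "(1/t) * b = sqrt a * sqrt b" unfolding t_def real_sqrt_divide
    using sa pos by (simp add: field_simps)
   ultimately show ?thesis by (simp add: real_sqrt_mult)
  qed
  finally have "2 * ?I \<le> 2 * ennreal (sqrt (a * b))" using ab by (simp add: ennreal_mult')
  then have "?I \<le> ennreal (sqrt (a * b))"
   by (simp add: ennreal_mult_le_mult_iff)
  then have "?I\<^sup>2 \<le> (ennreal (sqrt (a * b)))\<^sup>2" by (rule power_mono) simp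
  also have "\<dots> = ennreal (a * b)" using ab by (simp add: ennreal_power)
  finally show ?thesis unfolding A B using ab by (simp add: ennreal_mult')
 qed
qed

lemma l2sq_cong_AE: "AE x in M. f x = g x ==> l2sq M f = l2sq M g"
 unfolding l2sq_def by (rule nn_integral_cong_AE) (auto elim!: eventually_mono)

lemma l2sq_mono: "(\<And>x. x \<in> space M ==> norm (f x) \<le> norm (g x)) ==> l2sq M f \<le> l2sq M g"
 unfolding l2sq_def by (rule nn_integral_mono) (auto intro!: ennreal_leI power_mono)

lemma l2sq_add:
 assumes [measurable]: "f \<in> borel_measurable M" "g \<in> borel_measurable M"
 shows "l2sq M (\<lambda>x. f x + g x) \<le> 2 * l2sq M f + 2 * l2sq M g"
proof -
 have sq: "(norm (f x + g x))\<^sup>2 \<le> 2 * (norm (f x))\<^sup>2 + 2 * (norm (g x))\<^sup>2" for x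
 proof -
  have "(norm (f x + g x))\<^sup>2 \<le> (norm (f x) + norm (g x))\<^sup>2"
   by (intro power_mono norm_triangle_ineq) auto
  also have "\<dots> \<le> 2 * (norm (f x))\<^sup>2 + 2 * (norm (g x))\<^sup>2"
   using sum_squares_bound[of "norm (f x)" "norm (g x)"] by (simp add: power2_sum)
  finally show ?thesis .
 qed
 have "l2sq M (\<lambda>x. f x + g x) \<le> (\<integral>\<^sup>+x. 2 * ennreal ((norm (f x))\<^sup>2) + 2 * ennreal ((norm (g x))\<^sup>2) \<partial>M)"
  unfolding l2sq_def
 proof (rule nn_integral_mono)
  fix x
  have "ennreal ((norm (f x + g x))\<^sup>2) \<le> ennreal (2 * (norm (f x))\<^sup>2 + 2 * (norm (g x))\<^sup>2)"
   by (rule ennreal_leI[OF sq])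
  also have "\<dots> = 2 * ennreal ((norm (f x))\<^sup>2) + 2 * ennreal ((norm (g x))\<^sup>2)"
   by (simp add: ennreal_plus ennreal_mult')
  finally show "ennreal ((norm (f x + g x))\<^sup>2) \<le> 2 * ennreal ((norm (f x))\<^sup>2) + 2 * ennreal ((norm (g x))\<^sup>2)" .
 qed
 also have "\<dots> = 2 * l2sq M f + 2 * l2sq M g"
  unfolding l2sq_def by (subst nn_integral_add) (auto simp: nn_integral_cmult)
 finally show ?thesis .
qed

lemma l2sq_uminus [simp]: "l2sq M (\<lambda>x. - f x) = l2sq M f"
 by (simp add: l2sq_def)

lemma l2sq_commute: "l2sq M (\<lambda>x. f x - g x) = l2sq M (\<lambda>x. g x - f x)"
 by (simp add: l2sq_def norm_minus_commute)

lemma l2sq_diff: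
 assumes "f \<in> borel_measurable M" "g \<in> borel_measurable M"
 shows "l2sq M (\<lambda>x. f x - g x) \<le> 2 * l2sq M f + 2 * l2sq M g"
 using l2sq_add[OF assms(1), of "\<lambda>x. - g x"] assms(2) by simp

lemma l2sq_cmult:
 assumes "f \<in> borel_measurable M"
 shows "l2sq M (\<lambda>x. c * f x) = ennreal ((norm c)\<^sup>2) * l2sq M f"
 using assms unfolding l2sq_def
 by (subst nn_integral_cmult[symmetric]) (auto simp: norm_mult power_mult_distrib ennreal_mult')

lemma l2sq_zero_iff:
 assumes [measurable]: "f \<in> borel_measurable M"
 shows "l2sq M f = 0 \<longleftrightarrow> (AE x in M. f x = 0)"
 unfolding l2sq_def by (subst nn_integral_0_iff_AE) (auto simp: ennreal_eq_0_iff)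

text \<open>Cauchy-Schwarz over n with the weights q^n, where q = sqrt r: the integral of F_n^2 /
  q^n is still at most B q^n, so two geometric sums with ratio q remain.\<close>

lemma nn_integral_geometric_series:
 fixes F :: "nat => 'a => real"
 assumes [measurable]: "\<And>n. F n \<in> borel_measurable M" and F0: "\<And>n x. 0 \<le> F n x"
  and B: "0 \<le> B" and r: "0 < r" "r < 1"
  and bd: "\<And>n. (\<integral>\<^sup>+x. ennreal ((F n x)\<^sup>2) \<partial>M) \<le> ennreal (B * r ^ n)"
 shows "(\<integral>\<^sup>+x. (\<Sum>n. ennreal (F n x))\<^sup>2 \<partial>M) \<le> ennreal (B / (1 - sqrt r)\<^sup>2)"
proof -
 define q where "q = sqrt r"
 have q: "0 < q" "q < 1" "q * q = r" using r by (auto simp: q_def)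
 have geo: "(\<Sum>n. ennreal (q ^ n)) = ennreal (1 / (1 - q))"
  using q by (subst suminf_ennreal2) (auto simp: suminf_geometric summable_geometric)
 have pt: "(\<Sum>n. ennreal (F n x))\<^sup>2 \<le> ennreal (1 / (1 - q)) * (\<Sum>n. ennreal ((F n x)\<^sup>2 / q ^ n))" for x
 proof -
  have e: "sqrt (q ^ n) * (F n x / sqrt (q ^ n)) = F n x" for n using q by simp
  have "(\<integral>\<^sup>+n. ennreal (sqrt (q ^ n) * (F n x / sqrt (q ^ n))) \<partial>count_space UNIV)\<^sup>2
   \<le> (\<integral>\<^sup>+n. ennreal ((sqrt (q ^ n))\<^sup>2) \<partial>count_space UNIV)
    * (\<integral>\<^sup>+n. ennreal ((F n x / sqrt (q ^ n))\<^sup>2) \<partial>count_space UNIV)"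
   using q F0 by (intro nn_integral_Cauchy_Schwarz) auto
  then show ?thesis
   using q geo by (simp add: e nn_integral_count_space_nat power_divide)
 qed
 have "(\<integral>\<^sup>+x. (\<Sum>n. ennreal (F n x))\<^sup>2 \<partial>M)
   \<le> (\<integral>\<^sup>+x. ennreal (1 / (1 - q)) * (\<Sum>n. ennreal ((F n x)\<^sup>2 / q ^ n)) \<partial>M)"
  by (intro nn_integral_mono pt)
 also have "\<dots> = ennreal (1 / (1 - q)) * (\<Sum>n. \<integral>\<^sup>+x. ennreal ((F n x)\<^sup>2 / q ^ n) \<partial>M)"
  by (subst nn_integral_cmult) (auto simp: nn_integral_suminf)
 also have "\<dots> \<le> ennreal (1 / (1 - q)) * (\<Sum>n. ennreal (B * q ^ n))"
 proof (intro mult_left_mono suminf_le)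
  fix n
  have "(\<integral>\<^sup>+x. ennreal ((F n x)\<^sup>2 / q ^ n) \<partial>M) = (\<integral>\<^sup>+x. ennreal (1 / q ^ n) * ennreal ((F n x)\<^sup>2) \<partial>M)"
   using q by (simp flip: ennreal_mult')
  also have "\<dots> = ennreal (1 / q ^ n) * (\<integral>\<^sup>+x. ennreal ((F n x)\<^sup>2) \<partial>M)"
   by (rule nn_integral_cmult) auto
  also have "\<dots> \<le> ennreal (1 / q ^ n) * ennreal (B * r ^ n)"
   by (intro mult_left_mono bd) auto
  also have "\<dots> = ennreal (B * q ^ n)"
   using q B by (simp flip: ennreal_mult' q(3) add: power_mult_distrib)
  finally show "(\<integral>\<^sup>+x. ennreal ((F n x)\<^sup>2 / q ^ n) \<partial>M) \<le> ennreal (B * q ^ n)" .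
 qed auto
 also have "(\<Sum>n. ennreal (B * q ^ n)) = ennreal B * (\<Sum>n. ennreal (q ^ n))"
  using B q by (simp add: ennreal_mult' ennreal_suminf_cmult)
 also have "ennreal (1 / (1 - q)) * (ennreal B * (\<Sum>n. ennreal (q ^ n))) = ennreal (B / (1 - q)\<^sup>2)"
  using B q by (simp add: geo power2_eq_square flip: ennreal_mult')
 finally show ?thesis by (simp add: q_def)
qed

text \<open>The substitute for completeness of L2: geometric decay forces absolute convergence
  almost everywhere, so the pointwise sum is the limit, and the tail from N on is again such a
  series with B r^N in place of B.\<close>

lemma l2_geometric_series:
 fixes F :: "nat => 'a => complex"
 assumes [measurable]: "\<And>n. F n \<in> borel_measurable M"
  and B: "0 \<le> B" and r: "0 < r" "r < 1"
  and bd: "\<And>n. l2sq M (F n) \<le> ennreal (B * r ^ n)"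
 shows "AE x in M. summable (\<lambda>n. norm (F n x))"
  and "(\<lambda>x. \<Sum>n. F n x) \<in> borel_measurable M"
  and "l2sq M (\<lambda>x. (\<Sum>n. F n x) - (\<Sum>n<N. F n x)) \<le> ennreal (B * r ^ N / (1 - sqrt r)\<^sup>2)"
proof -
 show AEs: "AE x in M. summable (\<lambda>n. norm (F n x))"
 proof -
  have "(\<integral>\<^sup>+x. (\<Sum>n. ennreal (norm (F n x)))\<^sup>2 \<partial>M) \<le> ennreal (B / (1 - sqrt r)\<^sup>2)"
   using bd r B by (intro nn_integral_geometric_series) (auto simp: l2sq_def)
  then have "AE x in M. (\<Sum>n. ennreal (norm (F n x)))\<^sup>2 \<noteq> \<infinity>"
   by (intro nn_integral_PInf_AE) (auto simp: top_unique)
  then show ?thesis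
   by eventually_elim (auto intro!: summable_suminf_not_top)
 qed
 show "(\<lambda>x. \<Sum>n. F n x) \<in> borel_measurable M" by measurable
 show "l2sq M (\<lambda>x. (\<Sum>n. F n x) - (\<Sum>n<N. F n x)) \<le> ennreal (B * r ^ N / (1 - sqrt r)\<^sup>2)"
 proof -
  have "l2sq M (\<lambda>x. (\<Sum>n. F n x) - (\<Sum>n<N. F n x)) \<le> (\<integral>\<^sup>+x. (\<Sum>n. ennreal (norm (F (n + N) x)))\<^sup>2 \<partial>M)"
   unfolding l2sq_def
  proof (rule nn_integral_mono_AE, use AEs in eventually_elim)
   case (elim x)
   then have s: "summable (\<lambda>n. F n x)" by (rule summable_norm_cancel)
   have s2: "summable (\<lambda>n. norm (F (n + N) x))" using elim by (rule summable_ignore_initial_segment)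
   have "norm ((\<Sum>n. F n x) - (\<Sum>n<N. F n x)) = norm (\<Sum>n. F (n + N) x)"
    by (simp add: suminf_minus_initial_segment[OF s])
   also have "\<dots> \<le> (\<Sum>n. norm (F (n + N) x))" by (rule summable_norm[OF s2])
   finally have "ennreal ((norm ((\<Sum>n. F n x) - (\<Sum>n<N. F n x)))\<^sup>2) \<le> ennreal ((\<Sum>n. norm (F (n + N) x))\<^sup>2)"
    by (intro ennreal_leI power_mono) auto
   also have "\<dots> = (\<Sum>n. ennreal (norm (F (n + N) x)))\<^sup>2"
    by (subst suminf_ennreal2[OF _ s2]) (auto simp: ennreal_power suminf_nonneg[OF s2])
   finally show ?case .
  qed
  also have "\<dots> \<le> ennreal ((B * r ^ N) / (1 - sqrt r)\<^sup>2)"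
  proof (rule nn_integral_geometric_series)
   show "(\<integral>\<^sup>+x. ennreal ((norm (F (n + N) x))\<^sup>2) \<partial>M) \<le> ennreal (B * r ^ N * r ^ n)" for n
    using bd[of "n + N"] by (simp add: l2sq_def power_add mult_ac)
  qed (use r B in auto)
  finally show ?thesis .
 qed
qed

lemma l2sq_geometric_bound:
 fixes F :: "nat => 'a => complex"
 assumes "\<And>n. F n \<in> borel_measurable M"
  and "0 \<le> B" and "0 < r" "r < 1"
  and "\<And>n. l2sq M (F n) \<le> ennreal (B * r ^ n)"
 shows "l2sq M (\<lambda>x. \<Sum>n. F n x) \<le> ennreal (B / (1 - sqrt r)\<^sup>2)"
 using l2_geometric_series(3)[OF assms, of 0] by simp

lemma l2_geometric_series_tendsto:
 fixes F :: "nat => 'a => complex"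
 assumes "\<And>n. F n \<in> borel_measurable M"
  and "0 \<le> B" and r: "0 < r" "r < 1"
  and "\<And>n. l2sq M (F n) \<le> ennreal (B * r ^ n)"
 shows "(\<lambda>N. l2sq M (\<lambda>x. (\<Sum>n. F n x) - (\<Sum>n<N. F n x))) \<longlonglongrightarrow> 0"
proof (rule tendsto_sandwich[OF _ _ tendsto_const])
 have "(\<lambda>N. B * r ^ N / (1 - sqrt r)\<^sup>2) \<longlonglongrightarrow> B * 0 / (1 - sqrt r)\<^sup>2"
  using r by (intro tendsto_intros LIMSEQ_realpow_zero) auto
 then show "(\<lambda>N. ennreal (B * r ^ N / (1 - sqrt r)\<^sup>2)) \<longlonglongrightarrow> 0"
  using tendsto_ennrealI by fastforce
 show "\<forall>\<^sub>F N in sequentially. l2sq M (\<lambda>x. (\<Sum>n. F n x) - (\<Sum>n<N. F n x)) \<le> ennreal (B * r ^ N / (1 - sqrt r)\<^sup>2)"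
  using l2_geometric_series(3)[OF assms] by auto
qed auto

text \<open>Fatou's lemma for |F k - g|^2. It identifies limits known only in L2 with sums that are
  computed pointwise.\<close>

lemma l2_limit_unique_AE:
 assumes [measurable]: "\<And>k. F k \<in> borel_measurable M" "g \<in> borel_measurable M"
  and lim: "(\<lambda>k. l2sq M (\<lambda>x. F k x - g x)) \<longlonglongrightarrow> 0"
  and pt: "AE x in M. (\<lambda>k. F k x) \<longlonglongrightarrow> f x"
 shows "AE x in M. f x = g x"
proof -
 have "(\<integral>\<^sup>+x. liminf (\<lambda>k. ennreal ((norm (F k x - g x))\<^sup>2)) \<partial>M) \<le> liminf (\<lambda>k. l2sq M (\<lambda>x. F k x - g x))"
  unfolding l2sq_def by (rule nn_integral_liminf) auto
 also have "\<dots> = 0" using lim by (intro lim_imp_Liminf) auto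
 finally have "AE x in M. liminf (\<lambda>k. ennreal ((norm (F k x - g x))\<^sup>2)) = 0"
  by (subst nn_integral_0_iff_AE[symmetric]) auto
 with pt show ?thesis
 proof eventually_elim
  case (elim x)
  have "(\<lambda>k. ennreal ((norm (F k x - g x))\<^sup>2)) \<longlonglongrightarrow> ennreal ((norm (f x - g x))\<^sup>2)"
   by (intro tendsto_ennrealI tendsto_intros elim)
  then have "liminf (\<lambda>k. ennreal ((norm (F k x - g x))\<^sup>2)) = ennreal ((norm (f x - g x))\<^sup>2)"
   by (intro lim_imp_Liminf) auto
  with elim show ?case by (simp add: ennreal_eq_0_iff)
 qed
qed

text \<open>Fatou's lemma; it carries a uniform L2 bound over to a limit known only almost
  everywhere.\<close>

lemma l2sq_le_liminf:
 assumes [measurable]: "\<And>k. F k \<in> borel_measurable M"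
  and pt: "AE x in M. (\<lambda>k. F k x) \<longlonglongrightarrow> f x" and bd: "\<And>k. l2sq M (F k) \<le> C"
 shows "l2sq M f \<le> C"
proof -
 have "l2sq M f = (\<integral>\<^sup>+x. liminf (\<lambda>k. ennreal ((norm (F k x))\<^sup>2)) \<partial>M)"
  unfolding l2sq_def
 proof (rule nn_integral_cong_AE, use pt in eventually_elim)
  case (elim x)
  have "(\<lambda>k. ennreal ((norm (F k x))\<^sup>2)) \<longlonglongrightarrow> ennreal ((norm (f x))\<^sup>2)"
   by (intro tendsto_ennrealI tendsto_intros elim)
  then show ?case by (intro lim_imp_Liminf[symmetric]) auto
 qed
 also have "\<dots> \<le> liminf (\<lambda>k. l2sq M (F k))"
  unfolding l2sq_def by (rule nn_integral_liminf) auto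
 also have "\<dots> \<le> liminf (\<lambda>k::nat. C)"
  using bd by (intro Liminf_mono always_eventually allI)
 also have "\<dots> = C" by (simp add: Liminf_const)
 finally show ?thesis .
qed

lemma nn_integral_mult_le_l2sq:
 assumes [measurable]: "f \<in> borel_measurable M" "g \<in> borel_measurable M"
 shows "(\<integral>\<^sup>+x. ennreal (norm (f x * g x)) \<partial>M)\<^sup>2 \<le> l2sq M f * l2sq M g"
 unfolding l2sq_def norm_mult by (rule nn_integral_Cauchy_Schwarz) auto

lemma integrable_mult_l2:
 assumes [measurable]: "f \<in> borel_measurable M" "g \<in> borel_measurable M"
  and "l2sq M f < \<infinity>" "l2sq M g < \<infinity>"
 shows "integrable M (\<lambda>x. f x * g x)"
proof (rule integrableI_bounded)
 have "(\<integral>\<^sup>+x. ennreal (norm (f x * g x)) \<partial>M)\<^sup>2 < \<infinity>"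
  using nn_integral_mult_le_l2sq[OF assms(1,2)] assms(3,4) by (simp add: ennreal_mult_less_top le_less_trans)
 then show "(\<integral>\<^sup>+x. ennreal (norm (f x * g x)) \<partial>M) < \<infinity>"
  by (auto simp: power_less_top_ennreal)
qed measurable

lemma norm_integral_mult_le:
 assumes [measurable]: "f \<in> borel_measurable M" "g \<in> borel_measurable M"
 shows "ennreal ((norm (\<integral>x. f x * g x \<partial>M))\<^sup>2) \<le> l2sq M f * l2sq M g"
proof -
 have "ennreal (norm (\<integral>x. f x * g x \<partial>M)) \<le> (\<integral>\<^sup>+x. ennreal (norm (f x * g x)) \<partial>M)"
  by (cases "integrable M (\<lambda>x. f x * g x)")
    (auto intro: integral_norm_bound_ennreal simp: not_integrable_integral_eq)
 then have "(ennreal (norm (\<integral>x. f x * g x \<partial>M)))\<^sup>2 \<le> (\<integral>\<^sup>+x. ennreal (norm (f x * g x)) \<partial>M)\<^sup>2"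
  by (rule power_mono) simp
 also have "\<dots> \<le> l2sq M f * l2sq M g" by (rule nn_integral_mult_le_l2sq) auto
 finally show ?thesis by (simp add: ennreal_power)
qed

text \<open>By \<open>norm_integral_mult_le\<close> the error is at most the L2 distance times the
  norm of \<open>v\<close>. In this way duality formulas for the Fourier transform pass to L2
  limits.\<close>

lemma tendsto_integral_mult_l2:
 assumes [measurable]: "\<And>k. F k \<in> borel_measurable M" "g \<in> borel_measurable M" "v \<in> borel_measurable M"
  and fin: "\<And>k. l2sq M (F k) < \<infinity>" "l2sq M g < \<infinity>" "l2sq M v < \<infinity>"
  and lim: "(\<lambda>k. l2sq M (\<lambda>x. F k x - g x)) \<longlonglongrightarrow> 0"
 shows "(\<lambda>k. \<integral>x. F k x * v x \<partial>M) \<longlonglongrightarrow> (\<integral>x. g x * v x \<partial>M)"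
proof -
 define D where "D k = (\<integral>x. F k x * v x \<partial>M) - (\<integral>x. g x * v x \<partial>M)" for k
 have D: "D k = (\<integral>x. (F k x - g x) * v x \<partial>M)" for k
  unfolding D_def left_diff_distrib
  by (subst Bochner_Integration.integral_diff) (auto intro!: integrable_mult_l2 fin)
 have "(\<lambda>k. ennreal ((norm (D k))\<^sup>2)) \<longlonglongrightarrow> 0"
 proof (rule tendsto_sandwich[OF _ _ tendsto_const])
  show "\<forall>\<^sub>F k in sequentially. ennreal ((norm (D k))\<^sup>2) \<le> l2sq M (\<lambda>x. F k x - g x) * l2sq M v"
   unfolding D by (intro always_eventually allI norm_integral_mult_le) auto
  have "(\<lambda>k. l2sq M (\<lambda>x. F k x - g x) * l2sq M v) \<longlonglongrightarrow> 0 * l2sq M v"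
   using fin(3) by (intro tendsto_mult_ennreal tendsto_const lim) auto
  then show "(\<lambda>k. l2sq M (\<lambda>x. F k x - g x) * l2sq M v) \<longlonglongrightarrow> 0" by simp
 qed auto
 then have "(\<lambda>k. (norm (D k))\<^sup>2) \<longlonglongrightarrow> 0" by (simp add: ennreal_tendsto_0_iff)
 then have "(\<lambda>k. norm (D k)) \<longlonglongrightarrow> 0"
  using tendsto_real_sqrt[of "\<lambda>k. (norm (D k))\<^sup>2" 0] by simp
 then have "D \<longlonglongrightarrow> 0" by (rule tendsto_norm_zero_cancel)
 then show ?thesis unfolding D_def by (rule LIM_zero_cancel)
qed

lemma powr_2_eq: "norm x powr 2 = (norm (x::complex))\<^sup>2"
 by (cases "x = 0") (auto simp: powr_numeral)

text \<open>From here on \<open>Lp\<close> and \<open>Lp_norm\<close> with exponent 2 are read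
  through \<open>l2sq\<close>; its values in \<open>ennreal\<close> allow estimates before
  finiteness is known.\<close>

lemma Lp2_iff: "f \<in> Lp 2 M \<longleftrightarrow> f \<in> borel_measurable M \<and> l2sq M f < \<infinity>"
 unfolding Lp_def l2sq_def powr_2_eq by (auto simp: integrable_iff_bounded)

lemma Lp_norm2: "f \<in> borel_measurable M ==> Lp_norm 2 M f = sqrt (enn2real (l2sq M f))"
 unfolding Lp_norm_def l2sq_def powr_2_eq
 by (subst integral_eq_nn_integral) (auto simp: powr_half_sqrt)

lemma Lp_norm2_le_iff:
 assumes "f \<in> Lp 2 M" "0 \<le> c"
 shows "Lp_norm 2 M f \<le> c \<longleftrightarrow> l2sq M f \<le> ennreal (c\<^sup>2)"
proof -
 have 1: "f \<in> borel_measurable M" "l2sq M f < \<infinity>" using assms by (auto simp: Lp2_iff)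
 then obtain a where a: "l2sq M f = ennreal a" "a \<ge> 0" by (cases "l2sq M f") auto
 have "sqrt a \<le> c \<longleftrightarrow> a \<le> c\<^sup>2" using assms(2) a(2)
  by (metis real_sqrt_le_iff real_sqrt_abs abs_of_nonneg)
 then show ?thesis using 1 a by (simp add: Lp_norm2)
qed

lemma Lp_norm2_tendsto_0_iff:
 assumes "\<And>i. F i \<in> Lp 2 M"
 shows "((\<lambda>i. Lp_norm 2 M (F i)) \<longlongrightarrow> 0) N \<longleftrightarrow> ((\<lambda>i. l2sq M (F i)) \<longlongrightarrow> 0) N"
proof -
 have e: "l2sq M (F i) = ennreal (enn2real (l2sq M (F i)))" for i
  using assms[of i] by (auto simp: Lp2_iff less_top)
 have "((\<lambda>i. l2sq M (F i)) \<longlongrightarrow> 0) N \<longleftrightarrow> ((\<lambda>i. enn2real (l2sq M (F i))) \<longlongrightarrow> 0) N"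
  using tendsto_ennreal_iff[of "\<lambda>i. enn2real (l2sq M (F i))" N 0] e by simp
 also have "\<dots> \<longleftrightarrow> ((\<lambda>i. Lp_norm 2 M (F i)) \<longlongrightarrow> 0) N"
 proof -
  have "Lp_norm 2 M (F i) = sqrt (enn2real (l2sq M (F i)))" for i
   using assms[of i] by (auto simp: Lp2_iff Lp_norm2)
  then show ?thesis
   using tendsto_real_sqrt[of "\<lambda>i. enn2real (l2sq M (F i))" 0 N]
    tendsto_power[of "\<lambda>i. sqrt (enn2real (l2sq M (F i)))" 0 N 2] by auto
 qed
 finally show ?thesis by simp
qed

lemma Lp2_diff: "f \<in> Lp 2 M ==> g \<in> Lp 2 M ==> (\<lambda>x. f x - g x) \<in> Lp 2 M"
 using l2sq_diff[of f M g] by (auto simp: Lp2_iff ennreal_mult_less_top intro: le_less_trans)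

lemma Lp2_add: "f \<in> Lp 2 M ==> g \<in> Lp 2 M ==> (\<lambda>x. f x + g x) \<in> Lp 2 M"
 using l2sq_add[of f M g] by (auto simp: Lp2_iff ennreal_mult_less_top intro: le_less_trans)

lemma Lp2_cmult: "f \<in> Lp 2 M ==> (\<lambda>x. c * f x) \<in> Lp 2 M"
 using l2sq_cmult[of f M c] by (auto simp: Lp2_iff ennreal_mult_less_top)

lemma Lp2_zero: "(\<lambda>x. 0) \<in> Lp 2 M"
 by (simp add: Lp2_iff l2sq_def)

lemma Lp2_sum: "(\<And>i. i \<in> I ==> f i \<in> Lp 2 M) ==> (\<lambda>x. \<Sum>i\<in>I. f i x) \<in> Lp 2 M"
 by (induction I rule: infinite_finite_induct) (auto intro: Lp2_zero Lp2_add)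

lemma Lp_tendsto_2_iff:
 "Lp_tendsto 2 M F f N \<longleftrightarrow> f \<in> Lp 2 M \<and> (\<forall>i. F i \<in> Lp 2 M) \<and> ((\<lambda>i. l2sq M (\<lambda>x. F i x - f x)) \<longlongrightarrow> 0) N"
 unfolding Lp_tendsto_def
 using Lp_norm2_tendsto_0_iff[of "\<lambda>i x. F i x - f x" M N] by (auto intro: Lp2_diff)

section \<open>Calculus\<close>

lemma nn_integral_lborel_affine:
 fixes f :: "'a::euclidean_space => ennreal"
 assumes [measurable]: "f \<in> borel_measurable borel" and c: "c \<noteq> 0"
 shows "(\<integral>\<^sup>+y. f y \<partial>lborel) = ennreal (\<bar>c\<bar> ^ DIM('a)) * (\<integral>\<^sup>+y. f (t + c *\<^sub>R y) \<partial>lborel)"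
 by (subst lborel_affine[OF c, of t])
   (simp add: nn_integral_density nn_integral_distr nn_integral_cmult)

lemma nn_integral_lborel_reflect:
 fixes f :: "'a::euclidean_space => ennreal"
 assumes "f \<in> borel_measurable borel"
 shows "(\<integral>\<^sup>+y. f (x - y) \<partial>lborel) = (\<integral>\<^sup>+y. f y \<partial>lborel)"
 using nn_integral_lborel_affine[OF assms, of "-1" x] by simp

lemma integral_lborel_affine:
 fixes f :: "'a::euclidean_space => 'b::{banach, second_countable_topology}"
 assumes [measurable]: "f \<in> borel_measurable borel" and c: "c \<noteq> 0"
 shows "(\<integral>y. f y \<partial>lborel) = \<bar>c\<bar> ^ DIM('a) *\<^sub>R (\<integral>y. f (t + c *\<^sub>R y) \<partial>lborel)"
 by (subst lborel_affine[OF c, of t])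
   (simp add: integral_density integral_distr)

lemma integral_lborel_reflect:
 fixes f :: "'a::euclidean_space => 'b::{banach, second_countable_topology}"
 assumes "f \<in> borel_measurable borel"
 shows "(\<integral>y. f (x - y) \<partial>lborel) = (\<integral>y. f y \<partial>lborel)"
 using integral_lborel_affine[OF assms, of "-1" x] by simp

lemma integral_lborel_shift:
 fixes f :: "'a::euclidean_space => 'b::{banach, second_countable_topology}"
 assumes "f \<in> borel_measurable borel"
 shows "(\<integral>y. f (x + y) \<partial>lborel) = (\<integral>y. f y \<partial>lborel)"
 using integral_lborel_affine[OF assms, of 1 x] by simp

lemma integrable_lborel_reflect:
 fixes f :: "'a::euclidean_space => 'b::{banach, second_countable_topology}"
 assumes "integrable lborel f"
 shows "integrable lborel (\<lambda>y. f (x - y))"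
proof -
 have [measurable]: "f \<in> borel_measurable borel" using assms by auto
 show ?thesis using assms nn_integral_lborel_reflect[of "\<lambda>y. ennreal (norm (f y))" x]
  by (simp add: integrable_iff_bounded)
qed

lemma sets_cball [measurable, simp]: "cball (x::'a::metric_space) r \<in> sets borel"
 by (rule borel_closed) simp

lemma vec_expand: "h = (\<Sum>i\<in>UNIV. h $ i *\<^sub>R axis i (1::real))"
 by (rule basis_expansion[of h, unfolded scalar_mult_eq_scaleR, symmetric])

lemma frechet_eq_sum:
 fixes f :: "real^'n => 'b::real_normed_vector"
 assumes "f differentiable (at x)"
 shows "frechet_derivative f (at x) h = (\<Sum>i\<in>UNIV. h $ i *\<^sub>R partial_deriv i f x)"
proof -
 interpret linear "frechet_derivative f (at x)"
  by (rule linear_frechet_derivative[OF assms])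
 have "frechet_derivative f (at x) h = frechet_derivative f (at x) (\<Sum>i\<in>UNIV. h $ i *\<^sub>R axis i 1)"
  by (rule arg_cong[OF vec_expand])
 also have "\<dots> = (\<Sum>i\<in>UNIV. h $ i *\<^sub>R partial_deriv i f x)"
  by (simp add: sum scale partial_deriv_def)
 finally show ?thesis .
qed

lemma has_derivative_partial:
 fixes f :: "real^'n => 'b::real_normed_vector"
 assumes "f differentiable (at x)"
 shows "(f has_derivative (\<lambda>h. \<Sum>i\<in>UNIV. h $ i *\<^sub>R partial_deriv i f x)) (at x)"
proof -
 have "frechet_derivative f (at x) = (\<lambda>h. \<Sum>i\<in>UNIV. h $ i *\<^sub>R partial_deriv i f x)"
  by (rule ext) (rule frechet_eq_sum[OF assms])
 then show ?thesis using assms by (simp add: frechet_derivative_works)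
qed

lemma partial_deriv_eq:
 assumes "(f has_derivative D) (at x)"
 shows "partial_deriv i f x = D (axis i 1)"
 unfolding partial_deriv_def using frechet_derivative_at[OF assms] by simp

text \<open>The form in which concrete derivatives are computed: once the total derivative is a
  combination of the coordinates of h, its coefficients are the partial derivatives.\<close>

lemma partial_deriv_eqI:
 fixes f :: "real^'n => 'b::real_normed_vector"
 assumes "(f has_derivative (\<lambda>h. \<Sum>i\<in>UNIV. h $ i *\<^sub>R G i)) (at x)"
 shows "partial_deriv i f x = G i"
proof -
 have "(\<Sum>k\<in>UNIV. axis i (1::real) $ k *\<^sub>R G k) = (\<Sum>k\<in>UNIV. if k = i then G k else 0)"
  by (rule sum.cong) (auto simp: axis_def)
 then show ?thesis using partial_deriv_eq[OF assms, of i] by simp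
qed

lemma partial_deriv_zero [simp]: "partial_deriv i (\<lambda>x. 0) = (\<lambda>x. 0)"
 by (rule ext) (simp add: partial_deriv_eq[OF has_derivative_const])

lemma C_k_zero: "C_k k (\<lambda>x. 0)"
 by (induction k) auto

lemma C_k_continuous: "C_k k f ==> continuous_on UNIV f"
 by (cases k) (auto intro!: differentiable_imp_continuous_on simp: differentiable_on_def
   intro: differentiable_at_withinI)

lemma C_k_Suc: "C_k (Suc k) f ==> C_k k f"
proof (induction k arbitrary: f)
 case 0
 then show ?case using C_k_continuous[OF 0] by simp
next
 case (Suc k)
 then show ?case by (metis C_k.simps(2))
qed

lemma C_k_mono: "C_k k f ==> l \<le> k ==> C_k l f"
proof (induction k)
 case (Suc k)
 then show ?case using C_k_Suc[of k f] by (cases "l = Suc k") (auto simp del: C_k.simps)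
qed simp

lemma iter_deriv_Nil [simp]: "iter_deriv [] f = f"
 by (simp add: iter_deriv_def)

lemma iter_deriv_Cons [simp]: "iter_deriv (i # b) f = partial_deriv i (iter_deriv b f)"
 by (simp add: iter_deriv_def)

text \<open>\<open>C_k\<close> peels off the derivative next to the function, whereas the head of a
  list is the outermost one. Inductions on derivative lists therefore run from the right end, with
  this rule.\<close>

lemma iter_deriv_snoc: "iter_deriv (b @ [i]) f = iter_deriv b (partial_deriv i f)"
 by (simp add: iter_deriv_def)

lemma C_k_iter_deriv: "C_k (k + length b) f ==> C_k k (iter_deriv b f)"
proof (induction b arbitrary: f rule: rev_induct)
 case (snoc i b)
 then show ?case by (auto simp: iter_deriv_snoc)
qed simp

lemma iter_deriv_continuous: "C_k k f ==> length b \<le> k ==> continuous_on UNIV (iter_deriv b f)"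
 using C_k_iter_deriv[of 0 b f] C_k_mono[of k f "length b"] by simp

lemma partial_deriv_scaled:
 fixes f :: "real^'n => complex"
 assumes "f differentiable (at (a *\<^sub>R x))"
 shows "(\<lambda>x. c * f (a *\<^sub>R x)) differentiable (at x)"
  and "partial_deriv i (\<lambda>x. c * f (a *\<^sub>R x)) x = (of_real a * c) * partial_deriv i f (a *\<^sub>R x)"
proof -
 have 1: "(f has_derivative (\<lambda>h. \<Sum>i\<in>UNIV. h $ i *\<^sub>R partial_deriv i f (a *\<^sub>R x))) (at (a *\<^sub>R x))"
  by (rule has_derivative_partial[OF assms])
 have "((\<lambda>x. a *\<^sub>R x) has_derivative (\<lambda>h. a *\<^sub>R h)) (at x)"
  by (auto intro!: derivative_eq_intros)
 from has_derivative_compose[OF this 1]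
 have "((\<lambda>x. c * f (a *\<^sub>R x)) has_derivative (\<lambda>h. c * (\<Sum>i\<in>UNIV. (a *\<^sub>R h) $ i *\<^sub>R partial_deriv i f (a *\<^sub>R x)))) (at x)"
  by (rule has_derivative_mult_right)
 then have d: "((\<lambda>x. c * f (a *\<^sub>R x)) has_derivative
   (\<lambda>h. \<Sum>i\<in>UNIV. h $ i *\<^sub>R ((of_real a * c) * partial_deriv i f (a *\<^sub>R x)))) (at x)"
  by (rule has_derivative_eq_rhs)
   (simp add: sum_distrib_left scaleR_conv_of_real[where 'a=complex] mult_ac)
 show "(\<lambda>x. c * f (a *\<^sub>R x)) differentiable (at x)" using d differentiableI by blast
 show "partial_deriv i (\<lambda>x. c * f (a *\<^sub>R x)) x = (of_real a * c) * partial_deriv i f (a *\<^sub>R x)"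
  by (rule partial_deriv_eqI[OF d])
qed

lemma C_k_scaled: "C_k k f ==> C_k k (\<lambda>x. c * (f (a *\<^sub>R x) :: complex))"
proof (induction k arbitrary: f c)
 case 0
 then have "continuous_on UNIV f" by simp
 then have "continuous_on UNIV (\<lambda>x. f (a *\<^sub>R x))"
  by (rule continuous_on_compose2) (auto intro!: continuous_intros)
 then show ?case by (auto intro!: continuous_intros)
next
 case (Suc k)
 then have d: "f differentiable (at x)" for x by simp
 have "partial_deriv i (\<lambda>x. c * f (a *\<^sub>R x)) = (\<lambda>x. (of_real a * c) * partial_deriv i f (a *\<^sub>R x))" for i
  by (rule ext) (rule partial_deriv_scaled(2)[OF d])
 then show ?case using Suc partial_deriv_scaled(1)[OF d] by auto
qed

lemma iter_deriv_scaled: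
 fixes f :: "real^'n => complex"
 assumes "C_k (length b) f"
 shows "iter_deriv b (\<lambda>x. c * f (a *\<^sub>R x)) = (\<lambda>x. (of_real a ^ length b * c) * iter_deriv b f (a *\<^sub>R x))"
 using assms
proof (induction b arbitrary: f c rule: rev_induct)
 case (snoc i b)
 then have d: "f differentiable (at x)" for x by simp
 have e: "partial_deriv i (\<lambda>x. c * f (a *\<^sub>R x)) = (\<lambda>x. (of_real a * c) * partial_deriv i f (a *\<^sub>R x))"
  by (rule ext) (rule partial_deriv_scaled(2)[OF d])
 have "iter_deriv b (\<lambda>x. (of_real a * c) * partial_deriv i f (a *\<^sub>R x))
   = (\<lambda>x. (of_real a ^ length b * (of_real a * c)) * iter_deriv b (partial_deriv i f) (a *\<^sub>R x))"
  by (rule snoc.IH) (use snoc.prems in auto)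
 then show ?case unfolding iter_deriv_snoc e by (simp add: mult_ac)
qed simp

lemma partial_deriv_lin:
 fixes f g :: "real^'n => complex"
 assumes "\<And>x. f differentiable (at x)" "\<And>x. g differentiable (at x)"
 shows "\<And>x. (\<lambda>x. c * f x + e * g x) differentiable (at x)"
  and "partial_deriv i (\<lambda>x. c * f x + e * g x) = (\<lambda>x. c * partial_deriv i f x + e * partial_deriv i g x)"
proof -
 have d: "((\<lambda>x. c * f x + e * g x) has_derivative
   (\<lambda>h. \<Sum>i\<in>UNIV. h $ i *\<^sub>R (c * partial_deriv i f x + e * partial_deriv i g x))) (at x)" for x
 proof (rule has_derivative_eq_rhs)
  show "((\<lambda>x. c * f x + e * g x) has_derivative (\<lambda>h. c * (\<Sum>i\<in>UNIV. h $ i *\<^sub>R partial_deriv i f x)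
    + e * (\<Sum>i\<in>UNIV. h $ i *\<^sub>R partial_deriv i g x))) (at x)"
   by (intro has_derivative_add has_derivative_mult_right has_derivative_partial assms)
 qed (simp add: sum_distrib_left scaleR_conv_of_real[where 'a=complex] algebra_simps sum.distrib)
 show "\<And>x. (\<lambda>x. c * f x + e * g x) differentiable (at x)" using d differentiableI by blast
 show "partial_deriv i (\<lambda>x. c * f x + e * g x) = (\<lambda>x. c * partial_deriv i f x + e * partial_deriv i g x)"
  by (rule ext) (rule partial_deriv_eqI[OF d])
qed

lemma C_k_lin: "C_k k f ==> C_k k g ==> C_k k (\<lambda>x. c * f x + e * (g x :: complex))"
proof (induction k arbitrary: f g)
 case 0
 then show ?case by (auto intro!: continuous_intros)
next
 case (Suc k)
 then have "\<And>x. f differentiable (at x)" "\<And>x. g differentiable (at x)" by auto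
 from partial_deriv_lin[OF this] show ?case using Suc by auto
qed

lemma iter_deriv_lin:
 fixes f g :: "real^'n => complex"
 assumes "C_k (length b) f" "C_k (length b) g"
 shows "iter_deriv b (\<lambda>x. c * f x + e * g x) = (\<lambda>x. c * iter_deriv b f x + e * iter_deriv b g x)"
 using assms
proof (induction b arbitrary: f g rule: rev_induct)
 case (snoc i b)
 then have "\<And>x. f differentiable (at x)" "\<And>x. g differentiable (at x)" by auto
 from partial_deriv_lin[OF this] show ?case using snoc by (simp add: iter_deriv_snoc)
qed simp

lemma C_k_sum: "(\<And>i. i \<in> I ==> C_k k (f i)) ==> C_k k (\<lambda>x. \<Sum>i\<in>I. (f i x :: complex))"
proof (induction I rule: infinite_finite_induct)
 case (insert a I)
 then show ?case using C_k_lin[of k "f a" "\<lambda>x. \<Sum>i\<in>I. f i x" 1 1] by auto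
qed (auto intro: C_k_zero)

section \<open>Functions vanishing outside a ball\<close>

text \<open>Compact support with an explicit radius: differentiation keeps the radius, and for
  translated kernels only arithmetic with norms is left.\<close>

definition vanishes_beyond :: "real => (real^'n => complex) => bool" where
 "vanishes_beyond R f \<longleftrightarrow> (\<forall>x. R < norm x --> f x = 0)"

lemma partial_deriv_local_zero:
 fixes f :: "real^'n => complex"
 assumes "open S" "x \<in> S" "\<And>y. y \<in> S ==> f y = 0"
 shows "partial_deriv i f x = 0"
proof -
 have "(f has_derivative (\<lambda>h. 0)) (at x)"
  by (rule has_derivative_transform_within_open[of "\<lambda>x. 0" _ _ _ S]) (use assms in auto)
 then show ?thesis by (simp add: partial_deriv_eq)
qed

lemma iter_deriv_local_zero:
 fixes f :: "real^'n => complex"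
 assumes "open S" "\<And>y. y \<in> S ==> f y = 0"
 shows "x \<in> S ==> iter_deriv b f x = 0"
 by (induction b arbitrary: x) (auto intro!: partial_deriv_local_zero[OF assms(1)] assms)

lemma vanishes_beyond_iter_deriv:
 assumes "vanishes_beyond R f"
 shows "vanishes_beyond R (iter_deriv b f)"
proof -
 have "open {x::real^'n. R < norm x}" by (intro open_Collect_less continuous_intros)
 then show ?thesis using assms iter_deriv_local_zero[of "{x. R < norm x}" f]
  by (auto simp: vanishes_beyond_def)
qed

lemma vanishes_beyond_partial_deriv: "vanishes_beyond R f ==> vanishes_beyond R (partial_deriv i f)"
 using vanishes_beyond_iter_deriv[of R f "[i]"] by simp

lemma continuous_vanishing_bounded:
 assumes "continuous_on UNIV f" "vanishes_beyond R f"
 obtains B where "0 < B" "\<And>x. norm (f x) \<le> B"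
proof -
 have "bounded (f ` cball 0 R)"
  by (intro compact_imp_bounded compact_continuous_image continuous_on_subset[OF assms(1)]) auto
 then obtain B where B: "0 < B" "\<And>x. x \<in> cball 0 R ==> norm (f x) \<le> B"
  by (auto simp: bounded_pos)
 have "norm (f x) \<le> B" for x
  using B(1) B(2)[of x] assms(2) by (cases "norm x \<le> R") (auto simp: vanishes_beyond_def)
 with B(1) that show ?thesis by blast
qed

lemma continuous_vanishing_unif:
 fixes f :: "real^'n => complex"
 assumes "continuous_on UNIV f" "vanishes_beyond R f" "0 < e"
 obtains \<delta> where "0 < \<delta>" "\<And>x y. dist x y < \<delta> ==> norm (f x - f y) < e"
proof -
 have "uniformly_continuous_on (cball 0 (R + 1)) f"
  by (intro compact_uniformly_continuous continuous_on_subset[OF assms(1)]) auto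
 then obtain \<delta> where d: "0 < \<delta>" "\<And>x y. x \<in> cball 0 (R+1) ==> y \<in> cball 0 (R+1) ==> dist x y < \<delta> ==> dist (f x) (f y) < e"
  using assms(3) unfolding uniformly_continuous_on_def by metis
 \<comment> \<open>At distance below 1, a point outside the ball of radius R + 1 forces both points
   outside radius R, where \<open>f\<close> vanishes; otherwise uniform continuity on the larger
   ball applies.\<close>
 show ?thesis
 proof (rule that[of "min \<delta> 1"])
  show "0 < min \<delta> 1" using d by simp
  fix x y :: "real^'n" assume xy: "dist x y < min \<delta> 1"
  show "norm (f x - f y) < e"
  proof (cases "x \<in> cball 0 (R+1) \<and> y \<in> cball 0 (R+1)")
   case True
   then show ?thesis using d(2)[of x y] xy by (simp add: dist_norm)
  next
   case False
   have "norm x \<le> norm y + dist x y" "norm y \<le> norm x + dist x y"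
    using norm_triangle_sub[of x y] norm_triangle_sub[of y x] by (auto simp: dist_norm norm_minus_commute)
   then have "R < norm x" "R < norm y" using False xy by auto
   then show ?thesis using assms by (simp add: vanishes_beyond_def)
  qed
 qed
qed

text \<open>Mean value inequality plus uniform continuity of the partial derivatives. Uniformity in
  x is the point: it permits differentiation under the convolution integral.\<close>

lemma C_k_unif_linearization:
 fixes f :: "real^'n => complex"
 assumes f: "C_k (Suc 0) f" "vanishes_beyond R f" "0 < e"
 obtains \<delta> where "0 < \<delta>"
  "\<And>x h. norm h < \<delta> ==> norm (f (x + h) - f x - (\<Sum>i\<in>UNIV. h $ i *\<^sub>R partial_deriv i f x)) \<le> e * norm h"
proof -
 have df: "\<And>x. f differentiable (at x)" and cont: "\<And>i. continuous_on UNIV (partial_deriv i f)"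
  using f(1) by auto
 \<comment> \<open>The norm of the difference of two derivatives is bounded by a sum of
   \<open>CARD('n)\<close> differences of partial derivatives.\<close>
 define e' where "e' = e / real CARD('n)"
 have e': "0 < e'" using f(3) by (simp add: e'_def)
 have "\<forall>i. \<exists>\<delta>>0. \<forall>x y. dist x y < \<delta> --> norm (partial_deriv i f x - partial_deriv i f y) < e'"
  using continuous_vanishing_unif[OF cont vanishes_beyond_partial_deriv[OF f(2)] e'] by metis
 then obtain D where D: "\<And>i. D i > 0"
  "\<And>i x y. dist x y < D i ==> norm (partial_deriv i f x - partial_deriv i f y) < e'" by metis
 define \<delta> where "\<delta> = Min (range D)"
 have \<delta>: "0 < \<delta>" "\<And>i. \<delta> \<le> D i" unfolding \<delta>_def using D(1) by auto
 show ?thesis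
 proof (rule that[of \<delta>])
  show "0 < \<delta>" by fact
  fix x h :: "real^'n" assume h: "norm h < \<delta>"
  let ?F = "\<lambda>y h. \<Sum>i\<in>UNIV. h $ i *\<^sub>R partial_deriv i f y"
  have "norm (f (x + h) - f x - ?F x ((x + h) - x)) \<le> norm ((x + h) - x) * e"
  proof (rule differentiable_bound_linearization[where S="cball x (norm h)"])
   show "x + t *\<^sub>R (x + h - x) \<in> cball x (norm h)" if "t \<in> {0..1}" for t
    using that by (simp add: dist_norm mult_left_le_one_le)
   show "(f has_derivative ?F y) (at y within cball x (norm h))" for y
    by (rule has_derivative_at_withinI[OF has_derivative_partial[OF df]])
   show "onorm (?F y - ?F x) \<le> e" if y: "y \<in> cball x (norm h)" for y
   proof (rule onorm_le)
    fix k :: "real^'n"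
    have "norm ((?F y - ?F x) k) = norm (\<Sum>i\<in>UNIV. k $ i *\<^sub>R (partial_deriv i f y - partial_deriv i f x))"
     by (simp add: scaleR_diff_right sum_subtractf)
    also have "\<dots> \<le> (\<Sum>i\<in>(UNIV :: 'n set). norm k * e')"
    proof (rule sum_norm_le)
     fix i
     have "dist y x < D i" using y h \<delta>(2)[of i] by (auto simp: dist_commute)
     then show "norm (k $ i *\<^sub>R (partial_deriv i f y - partial_deriv i f x)) \<le> norm k * e'"
      using D(2)[of y x i] component_le_norm_cart[of k i] by (auto intro!: mult_mono)
    qed
    also have "\<dots> = e * norm k" by (simp add: e'_def)
    finally show "norm ((?F y - ?F x) k) \<le> e * norm k" .
   qed
   show "x \<in> cball x (norm h)" by simp
  qed
  then show "norm (f (x + h) - f x - ?F x h) \<le> e * norm h" by (simp add: mult.commute)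
 qed
qed

section \<open>Convolution with compactly supported functions\<close>

text \<open>A common home for L2 functions and continuous functions, and enough for convolution with
  a continuous compactly supported kernel.\<close>

definition loc_int :: "(real^'n => complex) => bool" where
 "loc_int g \<longleftrightarrow> g \<in> borel_measurable borel \<and>
   (\<forall>R. (\<integral>\<^sup>+y. ennreal (norm (g y)) * indicator (cball 0 R) y \<partial>lborel) < \<infinity>)"

definition conv :: "(real^'n => complex) => (real^'n => complex) => real^'n => complex" where
 "conv f g x = (\<integral>y. f (x - y) * g y \<partial>lborel)"

lemma loc_int_measurable: "loc_int g ==> g \<in> borel_measurable borel"
 by (simp add: loc_int_def)

lemma l2_loc_int:
 fixes g :: "real^'n => complex"
 assumes [measurable]: "g \<in> borel_measurable borel" and "l2sq lborel g < \<infinity>"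
 shows "loc_int g"
 unfolding loc_int_def
proof safe
 fix R :: real
 have "(\<integral>\<^sup>+y. ennreal (norm (g y) * indicator (cball 0 R) y) \<partial>lborel)\<^sup>2
  \<le> (\<integral>\<^sup>+y. ennreal ((norm (g y))\<^sup>2) \<partial>lborel) * (\<integral>\<^sup>+y. ennreal ((indicator (cball (0::real^'n) R) y)\<^sup>2) \<partial>lborel)"
  by (rule nn_integral_Cauchy_Schwarz) auto
 also have "(\<integral>\<^sup>+y. ennreal ((indicator (cball (0::real^'n) R) y)\<^sup>2) \<partial>lborel) = (\<integral>\<^sup>+y. indicator (cball (0::real^'n) R) y \<partial>lborel)"
  by (intro nn_integral_cong) (auto simp: indicator_def)
 also have "\<dots> = emeasure lborel (cball (0::real^'n) R)"
  by (rule nn_integral_indicator) simp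
 also have "(\<integral>\<^sup>+y. ennreal ((norm (g y))\<^sup>2) \<partial>lborel) * emeasure lborel (cball (0::real^'n) R) < \<infinity>"
  using assms(2) emeasure_lborel_cball_finite[of "0::real^'n" R] by (simp add: l2sq_def ennreal_mult_less_top)
 finally have "(\<integral>\<^sup>+y. ennreal (norm (g y) * indicator (cball 0 R) y) \<partial>lborel) < \<infinity>"
  by (simp add: power_less_top_ennreal)
 then show "(\<integral>\<^sup>+y. ennreal (norm (g y)) * indicator (cball 0 R) y \<partial>lborel) < \<infinity>"
  by (simp add: ennreal_mult' ennreal_indicator)
qed fact

lemma continuous_loc_int:
 fixes g :: "real^'n => complex"
 assumes "continuous_on UNIV g"
 shows "loc_int g"
 unfolding loc_int_def
proof safe
 show "g \<in> borel_measurable borel" using assms by (rule borel_measurable_continuous_onI)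
 fix R :: real
 have "bounded (g ` cball 0 R)"
  by (intro compact_imp_bounded compact_continuous_image continuous_on_subset[OF assms]) auto
 then obtain B where B: "0 < B" "\<And>x. x \<in> cball 0 R ==> norm (g x) \<le> B"
  by (auto simp: bounded_pos)
 have "(\<integral>\<^sup>+y. ennreal (norm (g y)) * indicator (cball 0 R) y \<partial>lborel)
   \<le> (\<integral>\<^sup>+y. ennreal B * indicator (cball (0::real^'n) R) y \<partial>lborel)"
  using B by (intro nn_integral_mono) (auto simp: indicator_def intro!: ennreal_leI)
 also have "\<dots> = ennreal B * emeasure lborel (cball (0::real^'n) R)"
  by (rule nn_integral_cmult_indicator) auto
 also have "\<dots> < \<infinity>" using emeasure_lborel_cball_finite[of "0::real^'n" R] by (simp add: ennreal_mult_less_top)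
 finally show "(\<integral>\<^sup>+y. ennreal (norm (g y)) * indicator (cball 0 R) y \<partial>lborel) < \<infinity>" .
qed

text \<open>The kernel sees only a ball, on which \<open>g\<close> has finite mass. Continuity and
  differentiability of convolutions apply this bound to differences of translated kernels.\<close>

lemma integral_vanishing_bound:
 fixes k g :: "real^'n => complex"
 assumes g: "loc_int g" and [measurable]: "k \<in> borel_measurable borel"
  and k: "\<And>y. norm (k y) \<le> B" "\<And>y. R < norm y ==> k y = 0" and B: "0 \<le> B"
 shows "integrable lborel (\<lambda>y. k y * g y)"
  and "norm (\<integral>y. k y * g y \<partial>lborel) \<le> B * enn2real (\<integral>\<^sup>+y. ennreal (norm (g y)) * indicator (cball 0 R) y \<partial>lborel)"
proof -
 have [measurable]: "g \<in> borel_measurable borel" using g by (rule loc_int_measurable)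
 let ?J = "\<integral>\<^sup>+y. ennreal (norm (g y)) * indicator (cball 0 R) y \<partial>lborel"
 have fin: "?J < \<infinity>" using g by (simp add: loc_int_def)
 have "(\<integral>\<^sup>+y. ennreal (norm (k y * g y)) \<partial>lborel) \<le> (\<integral>\<^sup>+y. ennreal B * (ennreal (norm (g y)) * indicator (cball 0 R) y) \<partial>lborel)"
 proof (rule nn_integral_mono)
  fix y
  show "ennreal (norm (k y * g y)) \<le> ennreal B * (ennreal (norm (g y)) * indicator (cball 0 R) y)"
   using k[of y] B by (cases "R < norm y")
    (auto simp: norm_mult indicator_def not_less mult_right_mono simp flip: ennreal_mult' intro!: ennreal_leI)
 qed
 also have "\<dots> = ennreal B * ?J" by (rule nn_integral_cmult) measurable
 finally have le: "(\<integral>\<^sup>+y. ennreal (norm (k y * g y)) \<partial>lborel) \<le> ennreal B * ?J" .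
 also have "\<dots> < \<infinity>" using fin by (simp add: ennreal_mult_less_top)
 finally show int: "integrable lborel (\<lambda>y. k y * g y)" by (intro integrableI_bounded) auto
 have "ennreal (norm (\<integral>y. k y * g y \<partial>lborel)) \<le> ennreal B * ?J"
  using integral_norm_bound_ennreal[OF int] le by (rule order_trans)
 also have "\<dots> = ennreal (B * enn2real ?J)" using fin B by (simp add: ennreal_mult' less_top)
 finally show "norm (\<integral>y. k y * g y \<partial>lborel) \<le> B * enn2real ?J"
  using B by (simp add: enn2real_nonneg)
qed

lemma conv_integrable:
 fixes f g :: "real^'n => complex"
 assumes "continuous_on UNIV f" "vanishes_beyond R f" "loc_int g"
 shows "integrable lborel (\<lambda>y. f (x - y) * g y)"
proof -
 obtain B where B: "0 < B" "\<And>x. norm (f x) \<le> B" using continuous_vanishing_bounded[OF assms(1,2)] by blast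
 show ?thesis
 proof (rule integral_vanishing_bound(1)[OF assms(3), of _ B "R + norm x"])
  have "continuous_on UNIV (\<lambda>y::real^'n. f (x - y))"
   by (rule continuous_on_compose2[OF assms(1)]) (auto intro!: continuous_intros)
  then show "(\<lambda>y::real^'n. f (x - y)) \<in> borel_measurable borel" by (rule borel_measurable_continuous_onI)
  fix y :: "real^'n" assume "R + norm x < norm y"
  then have "R < norm (x - y)" using norm_triangle_sub[of y x] by (simp add: norm_minus_commute)
  then show "f (x - y) = 0" using assms(2) by (simp add: vanishes_beyond_def)
 qed (use B in auto)
qed

lemma continuous_shift: "continuous_on UNIV f ==> continuous_on UNIV (\<lambda>y. f (x - y :: real^'n))"
 by (rule continuous_on_compose2) (auto intro!: continuous_intros)

lemma conv_continuous:
 fixes f :: "real^'n => complex"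
 assumes f: "continuous_on UNIV f" "vanishes_beyond R f" and g: "loc_int g"
 shows "continuous_on UNIV (conv f g)"
 unfolding continuous_on_iff
proof (intro ballI allI impI)
 fix x :: "real^'n" and e :: real assume e: "0 < e"
 \<comment> \<open>The radius covers the supports of the kernels translated to any point within 1 of
   x. The later division by J + 1 avoids the case J = 0.\<close>
 define J where "J = enn2real (\<integral>\<^sup>+y. ennreal (norm (g y)) * indicator (cball 0 (R + norm x + 1)) y \<partial>lborel)"
 have J: "J \<ge> 0" by (simp add: J_def)
 obtain \<delta> where d: "0 < \<delta>" "\<And>x y. dist x y < \<delta> ==> norm (f x - f y) < e / (J + 1)"
  using continuous_vanishing_unif[OF f, of "e / (J+1)"] e J by auto
 have "dist (conv f g x') (conv f g x) < e" if x': "dist x' x < min \<delta> 1" for x'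
 proof -
  have "conv f g x' - conv f g x = (\<integral>y. (f (x' - y) - f (x - y)) * g y \<partial>lborel)"
   unfolding conv_def left_diff_distrib
   by (subst Bochner_Integration.integral_diff) (auto intro!: conv_integrable[OF f g])
  also have "norm \<dots> \<le> e / (J + 1) * J"
  proof (rule integral_vanishing_bound(2)[OF g, of _ _ "R + norm x + 1", folded J_def])
   show "(\<lambda>y::real^'n. f (x' - y) - f (x - y)) \<in> borel_measurable borel"
    by (intro borel_measurable_continuous_onI continuous_intros continuous_shift f)
   show "norm (f (x' - y) - f (x - y)) \<le> e / (J + 1)" for y
    using d(2)[of "x' - y" "x - y"] x' by (simp add: dist_norm)
   fix y :: "real^'n" assume y: "R + norm x + 1 < norm y"
   have 1: "norm y \<le> norm (x - y) + norm x" using norm_triangle_sub[of y x] by (simp add: norm_minus_commute)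
   have "norm y \<le> norm (x' - y) + norm x'" using norm_triangle_sub[of y x'] by (simp add: norm_minus_commute)
   moreover have "norm x' \<le> norm x + 1" using norm_triangle_sub[of x' x] x' by (simp add: dist_norm)
   ultimately have "R < norm (x - y)" "R < norm (x' - y)" using y 1 by auto
   then show "f (x' - y) - f (x - y) = 0" using f by (simp add: vanishes_beyond_def)
  qed (use e J in auto)
  also have "\<dots> < e" using e J by (simp add: field_simps)
  finally show ?thesis by (simp add: dist_norm)
 qed
 then show "\<exists>d>0. \<forall>x'\<in>UNIV. dist x' x < d --> dist (conv f g x') (conv f g x) < e"
  using d(1) by (intro exI[of _ "min \<delta> 1"]) auto
qed

text \<open>The linearisation of \<open>f\<close> is integrated against \<open>g\<close>: its error
  is at most e / (J + 1) times |h|, uniformly, and only the mass J of \<open>g\<close> near x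
  enters.\<close>

lemma conv_has_derivative:
 fixes f :: "real^'n => complex"
 assumes f: "C_k (Suc 0) f" "vanishes_beyond R f" and g: "loc_int g"
 shows "(conv f g has_derivative (\<lambda>h. \<Sum>i\<in>UNIV. h $ i *\<^sub>R conv (partial_deriv i f) g x)) (at x)"
 unfolding has_derivative_at_alt
proof safe
 show "bounded_linear (\<lambda>h. \<Sum>i\<in>UNIV. h $ i *\<^sub>R conv (partial_deriv i f) g x)"
  by (intro bounded_linear_sum bounded_linear_scaleR_const bounded_linear_vec_nth)
 fix e :: real assume e: "0 < e"
 have fc: "continuous_on UNIV f" using f(1) by (rule C_k_continuous)
 have pc: "continuous_on UNIV (partial_deriv i f)" for i using f(1) by simp
 have pv: "vanishes_beyond R (partial_deriv i f)" for i by (rule vanishes_beyond_partial_deriv[OF f(2)])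
 define J where "J = enn2real (\<integral>\<^sup>+y. ennreal (norm (g y)) * indicator (cball 0 (R + norm x + 1)) y \<partial>lborel)"
 have J: "J \<ge> 0" by (simp add: J_def)
 obtain \<delta> where d: "0 < \<delta>" "\<And>x h. norm h < \<delta> ==> norm (f (x + h) - f x - (\<Sum>i\<in>UNIV. h $ i *\<^sub>R partial_deriv i f x)) \<le> e / (J+1) * norm h"
  using C_k_unif_linearization[OF f, of "e / (J+1)"] e J by auto
 have "norm (conv f g y - conv f g x - (\<Sum>i\<in>UNIV. (y - x) $ i *\<^sub>R conv (partial_deriv i f) g x)) \<le> e * norm (y - x)"
  if y: "norm (y - x) < min \<delta> 1" for y
 proof -
  define h where "h = y - x"
  define k where "k z = f (y - z) - f (x - z) - (\<Sum>i\<in>UNIV. h $ i *\<^sub>R partial_deriv i f (x - z))" for z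
  have "conv f g y - conv f g x - (\<Sum>i\<in>UNIV. h $ i *\<^sub>R conv (partial_deriv i f) g x)
    = (\<integral>z. f (y - z) * g z - f (x - z) * g z - (\<Sum>i\<in>UNIV. h $ i *\<^sub>R (partial_deriv i f (x - z) * g z)) \<partial>lborel)"
  proof -
   have I1: "integrable lborel (\<lambda>z::real^'n. f (y - z) * g z)" "integrable lborel (\<lambda>z::real^'n. f (x - z) * g z)"
    by (rule conv_integrable[OF fc f(2) g])+
   have I3: "integrable lborel (\<lambda>z::real^'n. h $ i *\<^sub>R (partial_deriv i f (x - z) * g z))" for i
    by (intro integrable_scaleR_right conv_integrable[OF pc pv g])
   have I4: "integrable lborel (\<lambda>z::real^'n. \<Sum>i\<in>UNIV. h $ i *\<^sub>R (partial_deriv i f (x - z) * g z))"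
    by (intro Bochner_Integration.integrable_sum I3)
   have 3: "h $ i *\<^sub>R conv (partial_deriv i f) g x = (\<integral>z. h $ i *\<^sub>R (partial_deriv i f (x - z) * g z) \<partial>lborel)" for i
    unfolding conv_def by simp
   show ?thesis
    unfolding 3 Bochner_Integration.integral_sum[OF I3, symmetric]
    unfolding conv_def
     Bochner_Integration.integral_diff[OF I1, symmetric]
    by (rule Bochner_Integration.integral_diff[OF _ I4, symmetric])
      (rule Bochner_Integration.integrable_diff[OF I1])
  qed
  also have "\<dots> = (\<integral>z. k z * g z \<partial>lborel)"
   by (simp add: k_def algebra_simps sum_distrib_left)
  also have "norm \<dots> \<le> (e / (J+1) * norm h) * J"
  proof (rule integral_vanishing_bound(2)[OF g, of k _ "R + norm x + 1", folded J_def])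
   show "k \<in> borel_measurable borel" unfolding k_def
    by (intro borel_measurable_continuous_onI continuous_intros continuous_shift fc pc)
   show "norm (k z) \<le> e / (J+1) * norm h" for z
   proof -
    have "x - z + h = y - z" by (simp add: h_def)
    then show ?thesis using d(2)[of h "x - z"] y by (simp add: k_def h_def)
   qed
   fix z :: "real^'n" assume z: "R + norm x + 1 < norm z"
   have 1: "norm z \<le> norm (x - z) + norm x" using norm_triangle_sub[of z x] by (simp add: norm_minus_commute)
   have "norm z \<le> norm (y - z) + norm y" using norm_triangle_sub[of z y] by (simp add: norm_minus_commute)
   moreover have "norm y \<le> norm x + 1" using norm_triangle_sub[of y x] y by simp
   ultimately have "R < norm (x - z)" "R < norm (y - z)" using z 1 by auto
   then show "k z = 0" using f(2) pv by (simp add: k_def vanishes_beyond_def)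
  qed (use e J in auto)
  also have "\<dots> \<le> e * norm h"
  proof -
   have "e / (J+1) * J \<le> e" using e J by (simp add: field_simps)
   from mult_right_mono[OF this, of "norm h"] show ?thesis by (simp add: mult_ac)
  qed
  finally show ?thesis by (simp add: h_def)
 qed
 then show "\<exists>d>0. \<forall>y. norm (y - x) < d -->
   norm (conv f g y - conv f g x - (\<Sum>i\<in>UNIV. (y - x) $ i *\<^sub>R conv (partial_deriv i f) g x)) \<le> e * norm (y - x)"
  using d(1) by (intro exI[of _ "min \<delta> 1"]) auto
qed

lemma conv_partial_deriv:
 assumes "C_k (Suc 0) f" "vanishes_beyond R f" "loc_int g"
 shows "partial_deriv i (conv f g) = conv (partial_deriv i f) g"
 by (rule ext) (rule partial_deriv_eqI[OF conv_has_derivative[OF assms]])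

lemma conv_C_k: "C_k k f ==> vanishes_beyond R f ==> loc_int g ==> C_k k (conv f g)"
proof (induction k arbitrary: f)
 case 0
 then show ?case using conv_continuous by auto
next
 case (Suc k)
 have 1: "C_k (Suc 0) f" using Suc.prems(1) by (rule C_k_mono) simp
 have "conv f g differentiable (at x)" for x
  using conv_has_derivative[OF 1 Suc.prems(2,3)] differentiableI by blast
 moreover have "C_k k (conv (partial_deriv i f) g)" for i
  using Suc.prems by (intro Suc.IH vanishes_beyond_partial_deriv) auto
 ultimately show ?case using conv_partial_deriv[OF 1 Suc.prems(2,3)] by simp
qed

lemma conv_iter_deriv:
 "C_k (length b) f ==> vanishes_beyond R f ==> loc_int g ==> iter_deriv b (conv f g) = conv (iter_deriv b f) g"
proof (induction b arbitrary: f rule: rev_induct)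
 case (snoc i b)
 have 1: "C_k (Suc 0) f" using snoc.prems(1) by (rule C_k_mono) simp
 show ?case unfolding iter_deriv_snoc conv_partial_deriv[OF 1 snoc.prems(2,3)]
  using snoc.prems by (intro snoc.IH vanishes_beyond_partial_deriv) auto
qed simp

lemma conv_commute:
 assumes [measurable]: "f \<in> borel_measurable borel" "g \<in> borel_measurable borel"
 shows "conv f g = conv g f"
proof
 fix x
 have "conv f g x = (\<integral>y. f (x - (x - y)) * g (x - y) \<partial>lborel)"
  unfolding conv_def by (rule integral_lborel_reflect[symmetric]) measurable
 then show "conv f g x = conv g f x" by (simp add: conv_def mult.commute)
qed

lemma conv_cong_AE:
 assumes [measurable]: "f \<in> borel_measurable borel" "g \<in> borel_measurable borel" "h \<in> borel_measurable borel"
  and "AE y in lborel. g y = h y"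
 shows "conv f g = conv f h"
 unfolding conv_def by (intro ext integral_cong_AE) (use assms(4) in auto)

section \<open>A smooth bump function\<close>

text \<open>The powers of t in the denominator make the family closed under differentiation, see
  \<open>flat_exp_deriv\<close>; smoothness at 0 then needs no formula for higher
  derivatives.\<close>

definition flat_exp :: "nat => real => real" where
 "flat_exp k t = (if 0 < t then exp (- 1 / t) / t ^ k else 0)"

lemma flat_exp_tendsto_0: "(flat_exp k \<longlongrightarrow> 0) (at 0)"
proof (rule filterlim_split_at)
 show "(flat_exp k \<longlongrightarrow> 0) (at_left 0)"
  by (rule tendsto_eventually) (auto simp: eventually_at_filter flat_exp_def)
 have "((\<lambda>h::real. (inverse h) ^ k / exp (inverse h)) \<longlongrightarrow> 0) (at_right 0)"
  by (rule filterlim_compose[OF tendsto_power_div_exp_0 filterlim_inverse_at_top_right])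
 moreover have "\<forall>\<^sub>F h in at_right 0. inverse h ^ k / exp (inverse h) = flat_exp k (h::real)"
  by (auto simp: eventually_at_filter flat_exp_def exp_minus field_simps power_inverse)
 ultimately show "(flat_exp k \<longlongrightarrow> 0) (at_right 0)" by (rule Lim_transform_eventually)
qed

lemma flat_exp_deriv:
 "(flat_exp k has_real_derivative (flat_exp (k + 2) t - real k * flat_exp (k + 1) t)) (at t)"
proof (cases t "0::real" rule: linorder_cases)
 case less
 have "((\<lambda>t. 0) has_real_derivative 0) (at t)" by simp
 moreover have "\<forall>\<^sub>F x in nhds t. flat_exp k x = 0"
  using less eventually_nhds_in_open[of "{..<0}" t] by (auto simp: flat_exp_def elim!: eventually_mono)
 ultimately have "(flat_exp k has_real_derivative 0) (at t)"
  by (subst DERIV_cong_ev[OF refl _ refl]) (auto elim!: eventually_mono)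
 then show ?thesis using less by (simp add: flat_exp_def)
next
 case equal
 \<comment> \<open>At 0 the difference quotient of \<open>flat_exp k\<close> is
   \<open>flat_exp (k + 1)\<close> itself, so \<open>flat_exp_tendsto_0\<close> applies
   again.\<close>
 have "(\<lambda>h. (flat_exp k (0 + h) - flat_exp k 0) / h) = (\<lambda>h. if h = 0 then 0 else flat_exp (k + 1) h)"
  by (auto simp: flat_exp_def fun_eq_iff)
 moreover have "((\<lambda>h. if h = 0 then 0 else flat_exp (k + 1) h) \<longlongrightarrow> 0) (at 0)"
  using flat_exp_tendsto_0[of "k+1"] by (rule Lim_transform_eventually) (auto simp: eventually_at_filter)
 ultimately have "(flat_exp k has_real_derivative 0) (at 0)" by (simp add: DERIV_def)
 then show ?thesis using equal by (simp add: flat_exp_def)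
next
 case greater
 have "((\<lambda>t. exp (- 1 / t) / t ^ k) has_real_derivative
   (exp (- 1 / t) * (1 / t\<^sup>2) * t ^ k - exp (- 1 / t) * (real k * t ^ (k - 1))) / (t ^ k * t ^ k)) (at t)"
  using greater by (auto intro!: derivative_eq_intros simp: power2_eq_square field_simps)
 also have "(exp (- 1 / t) * (1 / t\<^sup>2) * t ^ k - exp (- 1 / t) * (real k * t ^ (k - 1))) / (t ^ k * t ^ k)
   = flat_exp (k + 2) t - real k * flat_exp (k + 1) t"
  using greater by (cases k) (auto simp: flat_exp_def field_simps power2_eq_square)
 finally have d: "((\<lambda>t. exp (- 1 / t) / t ^ k) has_real_derivative (flat_exp (k + 2) t - real k * flat_exp (k + 1) t)) (at t)" .
 have "\<forall>\<^sub>F x in nhds t. flat_exp k x = exp (- 1 / x) / x ^ k"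
  using greater eventually_nhds_in_open[of "{0<..}" t] by (auto simp: flat_exp_def elim!: eventually_mono)
 then show ?thesis using d by (subst DERIV_cong_ev[OF refl _ refl]) (auto elim!: eventually_mono)
qed

text \<open>An algebra that contains the bump and is closed under partial derivatives. Membership
  gives every \<open>C_k\<close> at once, without formulas for the derivatives.\<close>

inductive_set bump_algebra :: "(real^'n => complex) set" where
 flat: "(\<lambda>x. of_real (flat_exp k (1/4 - x \<bullet> x))) \<in> bump_algebra"
| coord: "(\<lambda>x. of_real (x $ i)) \<in> bump_algebra"
| const: "(\<lambda>x. c) \<in> bump_algebra"
| add: "f \<in> bump_algebra ==> g \<in> bump_algebra ==> (\<lambda>x. f x + g x) \<in> bump_algebra"
| mult: "f \<in> bump_algebra ==> g \<in> bump_algebra ==> (\<lambda>x. f x * g x) \<in> bump_algebra"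

lemma bump_algebra_deriv:
 fixes f :: "real^'n => complex"
 assumes "f \<in> bump_algebra"
 shows "\<exists>G. (\<forall>i. G i \<in> bump_algebra) \<and>
  (\<forall>x. (f has_derivative (\<lambda>h. \<Sum>i\<in>UNIV. h $ i *\<^sub>R G i x)) (at x))"
 using assms
proof induction
 case (flat k)
 define G where "G i x = (of_real (flat_exp (k + 2) (1/4 - x \<bullet> x))
   + of_real (- real k) * of_real (flat_exp (k + 1) (1/4 - x \<bullet> x))) * (of_real (-2) * of_real (x $ i) :: complex)"
  for i and x :: "real^'n"
 have "G i \<in> bump_algebra" for i
  unfolding G_def by (intro bump_algebra.intros)
 moreover have "((\<lambda>x. of_real (flat_exp k (1/4 - x \<bullet> x)) :: complex) has_derivative (\<lambda>h. \<Sum>i\<in>UNIV. h $ i *\<^sub>R G i x)) (at x)"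
  for x :: "real^'n"
 proof -
  have "((\<lambda>x::real^'n. 1/4 - x \<bullet> x) has_derivative (\<lambda>h. - 2 * (x \<bullet> h))) (at x)"
   by (auto intro!: derivative_eq_intros simp: inner_commute)
  from has_derivative_compose[OF this flat_exp_deriv[of k "1/4 - x \<bullet> x", unfolded has_field_derivative_def]]
  have "((\<lambda>x::real^'n. of_real (flat_exp k (1/4 - x \<bullet> x)) :: complex) has_derivative
    (\<lambda>h. of_real ((flat_exp (k + 2) (1/4 - x \<bullet> x) - real k * flat_exp (k + 1) (1/4 - x \<bullet> x)) * (- 2 * (x \<bullet> h))))) (at x)"
   by (rule has_derivative_of_real)
  then show ?thesis
  proof (rule has_derivative_eq_rhs, intro ext)
   fix h
   show "of_real ((flat_exp (k + 2) (1/4 - x \<bullet> x) - real k * flat_exp (k + 1) (1/4 - x \<bullet> x)) * (- 2 * (x \<bullet> h)))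
     = (\<Sum>i\<in>UNIV. h $ i *\<^sub>R G i x)"
    unfolding inner_vec_def[of x h] sum_distrib_left of_real_sum
    by (rule sum.cong) (simp_all add: G_def scaleR_conv_of_real[where 'a=complex] mult_ac)
  qed
 qed
 ultimately show ?case by blast
next
 case (coord i)
 define G where "G k x = (if k = i then 1 else 0 :: complex)" for k and x :: "real^'n"
 have "G k \<in> bump_algebra" for k unfolding G_def by (rule bump_algebra.const)
 moreover have "((\<lambda>x. of_real (x $ i) :: complex) has_derivative (\<lambda>h. \<Sum>k\<in>UNIV. h $ k *\<^sub>R G k x)) (at x)" for x :: "real^'n"
 proof (rule has_derivative_eq_rhs)
  show "((\<lambda>x::real^'n. of_real (x $ i) :: complex) has_derivative (\<lambda>h. of_real (h $ i))) (at x)"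
   by (intro has_derivative_of_real bounded_linear_imp_has_derivative bounded_linear_vec_nth)
  show "(\<lambda>h::real^'n. of_real (h $ i) :: complex) = (\<lambda>h. \<Sum>k\<in>UNIV. h $ k *\<^sub>R G k x)"
   by (simp add: G_def scaleR_conv_of_real[where 'a=complex] mult_delta_right)
 qed
 ultimately show ?case by blast
next
 case (const c)
 have "((\<lambda>x. c) has_derivative (\<lambda>h. \<Sum>k\<in>UNIV. h $ k *\<^sub>R (0::complex))) (at x)" for x :: "real^'n"
  by simp
 then show ?case using bump_algebra.const[of 0] by (intro exI[of _ "\<lambda>i x. 0"]) auto
next
 case (add f g)
 then obtain F G where FG: "\<And>i. F i \<in> bump_algebra" "\<And>i. G i \<in> bump_algebra"
  "\<And>x. (f has_derivative (\<lambda>h. \<Sum>i\<in>UNIV. h $ i *\<^sub>R F i x)) (at x)"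
  "\<And>x. (g has_derivative (\<lambda>h. \<Sum>i\<in>UNIV. h $ i *\<^sub>R G i x)) (at x)" by blast
 have "((\<lambda>x. f x + g x) has_derivative (\<lambda>h. \<Sum>i\<in>UNIV. h $ i *\<^sub>R (F i x + G i x))) (at x)" for x
  by (rule has_derivative_eq_rhs[OF has_derivative_add[OF FG(3,4)]])
    (simp add: scaleR_right_distrib sum.distrib)
 moreover have "(\<lambda>x. F i x + G i x) \<in> bump_algebra" for i by (intro bump_algebra.add FG)
 ultimately show ?case by (intro exI[of _ "\<lambda>i x. F i x + G i x"]) auto
next
 case (mult f g)
 then obtain F G where FG: "\<And>i. F i \<in> bump_algebra" "\<And>i. G i \<in> bump_algebra"
  "\<And>x. (f has_derivative (\<lambda>h. \<Sum>i\<in>UNIV. h $ i *\<^sub>R F i x)) (at x)"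
  "\<And>x. (g has_derivative (\<lambda>h. \<Sum>i\<in>UNIV. h $ i *\<^sub>R G i x)) (at x)" by blast
 have "((\<lambda>x. f x * g x) has_derivative (\<lambda>h. \<Sum>i\<in>UNIV. h $ i *\<^sub>R (f x * G i x + F i x * g x))) (at x)" for x
  by (rule has_derivative_eq_rhs[OF has_derivative_mult[OF FG(3,4)]])
    (simp add: scaleR_right_distrib sum.distrib sum_distrib_left sum_distrib_right)
 moreover have "(\<lambda>x. f x * G i x + F i x * g x) \<in> bump_algebra" for i
  by (intro bump_algebra.add bump_algebra.mult FG mult.hyps)
 ultimately show ?case by (intro exI[of _ "\<lambda>i x. f x * G i x + F i x * g x"]) auto
qed

lemma bump_algebra_C_k: "f \<in> bump_algebra ==> C_k k f"
proof (induction k arbitrary: f)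
 case 0
 from bump_algebra_deriv[OF 0] have "f differentiable (at x)" for x using differentiableI by blast
 then show ?case by (auto intro!: differentiable_imp_continuous_on simp: differentiable_on_def
   intro: differentiable_at_withinI)
next
 case (Suc k)
 from bump_algebra_deriv[OF Suc.prems] obtain G where G: "\<And>i. G i \<in> bump_algebra"
  "\<And>x. (f has_derivative (\<lambda>h. \<Sum>i\<in>UNIV. h $ i *\<^sub>R G i x)) (at x)" by blast
 have "partial_deriv i f = G i" for i by (rule ext) (rule partial_deriv_eqI[OF G(2)])
 moreover have "f differentiable (at x)" for x using G(2) differentiableI by blast
 ultimately show ?case using Suc.IH[OF G(1)] by simp
qed

text \<open>The constant 1/4 makes the bump vanish outside the ball of radius 1/2;
  \<open>bump_hat_lower\<close> depends on this radius.\<close>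

definition bump0 :: "real^'n => real" where
 "bump0 x = flat_exp 0 (1/4 - x \<bullet> x)"

definition bump :: "real^'n => real" where
 "bump x = bump0 x / (\<integral>y. bump0 (y::real^'n) \<partial>lborel)"

lemma bump0_nonneg: "0 \<le> bump0 x" and bump0_le_1: "bump0 x \<le> 1"
 by (auto simp: bump0_def flat_exp_def)

lemma bump0_pos_iff: "0 < bump0 x \<longleftrightarrow> norm x < 1/2"
proof -
 have "x \<bullet> x < 1/4 \<longleftrightarrow> norm x < 1/2"
  using power_mono_iff[of "1/2" "norm x" 2]
  by (simp add: power2_norm_eq_inner[symmetric] power2_eq_square[of "1/2"] not_le[symmetric])
 then show ?thesis by (auto simp: bump0_def flat_exp_def)
qed

lemma bump0_C_k: "C_k k (\<lambda>x. of_real (bump0 x) :: complex)"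
 unfolding bump0_def by (intro bump_algebra_C_k bump_algebra.flat)

lemma bump0_continuous: "continuous_on UNIV bump0"
proof -
 have "continuous_on UNIV (\<lambda>x. Re (of_real (bump0 x)))"
  by (intro continuous_intros C_k_continuous[OF bump0_C_k])
 then show ?thesis by simp
qed

lemma bump0_measurable [measurable]: "bump0 \<in> borel_measurable borel"
 by (rule borel_measurable_continuous_onI[OF bump0_continuous])

lemma bump0_integrable: "integrable lborel (bump0 :: real^'n => real)"
proof (rule integrableI_bounded)
 have "(\<integral>\<^sup>+x. ennreal (norm (bump0 (x::real^'n))) \<partial>lborel) \<le> (\<integral>\<^sup>+x. indicator (cball (0::real^'n) 1) x \<partial>lborel)"
 proof (rule nn_integral_mono)
  fix x :: "real^'n"
  show "ennreal (norm (bump0 x)) \<le> indicator (cball 0 1) x"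
   using bump0_nonneg[of x] bump0_le_1[of x] bump0_pos_iff[of x]
   by (cases "bump0 x = 0") (auto simp: indicator_def ennreal_le_1)
 qed
 also have "\<dots> = emeasure lborel (cball (0::real^'n) 1)" by (rule nn_integral_indicator) simp
 also have "\<dots> < \<infinity>" using emeasure_lborel_cball_finite[of "0::real^'n" 1] by simp
 finally show "(\<integral>\<^sup>+x. ennreal (norm (bump0 (x::real^'n))) \<partial>lborel) < \<infinity>" .
qed measurable

lemma bump0_integral_pos: "0 < (\<integral>y. bump0 (y::real^'n) \<partial>lborel)"
proof -
 have "(\<integral>y. bump0 (y::real^'n) \<partial>lborel) \<noteq> 0"
 proof
  assume "(\<integral>y. bump0 (y::real^'n) \<partial>lborel) = 0"
  then have "AE x in lborel. bump0 (x::real^'n) = 0"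
   by (subst (asm) integral_nonneg_eq_0_iff_AE[OF bump0_integrable]) (simp_all add: bump0_nonneg)
  then have "AE x in lborel. x \<notin> ball (0::real^'n) (1/2)"
   by eventually_elim (metis bump0_pos_iff dist_0_norm less_irrefl mem_ball)
  then have "emeasure lborel (ball (0::real^'n) (1/2)) = 0"
   by (subst (asm) AE_iff_measurable[of "ball (0::real^'n) (1/2)"]) auto
  then have "measure lborel (ball (0::real^'n) (1/2)) = 0" by (simp add: measure_def)
  then show False using content_ball_gt_0_iff[of "0::real^'n" "1/2"] by simp
 qed
 moreover have "0 \<le> (\<integral>y. bump0 (y::real^'n) \<partial>lborel)"
  by (intro integral_nonneg_AE) (simp add: bump0_nonneg)
 ultimately show ?thesis by simp
qed

lemma bump_nonneg: "0 \<le> bump x"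
 unfolding bump_def by (intro divide_nonneg_nonneg bump0_nonneg less_imp_le[OF bump0_integral_pos])

lemma bump_eq_0: "1/2 \<le> norm x ==> bump x = 0"
 using bump0_pos_iff[of x] bump0_nonneg[of x] by (simp add: bump_def)

lemma bump_integrable: "integrable lborel (bump :: real^'n => real)"
 unfolding bump_def[abs_def] by (intro integrable_divide_zero impI bump0_integrable)

lemma bump_integral: "(\<integral>x. bump (x::real^'n) \<partial>lborel) = 1"
 unfolding bump_def using bump0_integral_pos[where 'n='n] by simp

lemma bump_C_k: "C_k k (\<lambda>x. of_real (bump x) :: complex)"
 using C_k_scaled[OF bump0_C_k, of k "1 / of_real (\<integral>y. bump0 y \<partial>lborel)" 1]
 by (simp add: bump_def)

lemma bump_continuous: "continuous_on UNIV bump"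
 unfolding bump_def[abs_def]
 by (intro continuous_on_divide bump0_continuous continuous_on_const ballI less_imp_neq[OF bump0_integral_pos, symmetric])

lemma bump_measurable [measurable]: "bump \<in> borel_measurable borel"
 by (rule borel_measurable_continuous_onI[OF bump_continuous])

section \<open>Mollifiers at dyadic scales\<close>

text \<open>\<open>conv (kern j)\<close> is the operator A_j of the overview. The kernel has
  integral 1 at every level and vanishes outside the ball of radius 1/2 / 2^j.\<close>

definition kern :: "nat => real^'n => complex" where
 "kern j x = of_real ((2 ^ j) ^ CARD('n) * bump (2 ^ j *\<^sub>R x))"

lemma kern_eq: "kern j x = of_real ((2 ^ j) ^ CARD('n)) * of_real (bump (2 ^ j *\<^sub>R (x::real^'n)))"
 by (simp add: kern_def)

lemma kern_C_k: "C_k k (kern j :: real^'n => complex)"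
proof -
 have "C_k k (\<lambda>x::real^'n. of_real ((2 ^ j) ^ CARD('n)) * (\<lambda>x. of_real (bump x) :: complex) ((2 ^ j) *\<^sub>R x))"
  by (rule C_k_scaled[OF bump_C_k])
 then show ?thesis by (simp add: kern_def[abs_def])
qed

lemma kern_continuous: "continuous_on UNIV (kern j)"
 by (rule C_k_continuous[OF kern_C_k])

lemma kern_measurable [measurable]: "kern j \<in> borel_measurable borel"
 by (rule borel_measurable_continuous_onI[OF kern_continuous])

lemma kern_eq_0: "1 / 2 / 2 ^ j \<le> norm x ==> kern j x = 0"
 by (simp add: kern_def bump_eq_0 field_simps)

lemma kern_vanishes: "vanishes_beyond (1 / 2 / 2 ^ j) (kern j)"
 by (auto simp: vanishes_beyond_def intro!: kern_eq_0)

lemma norm_kern: "norm (kern j (x::real^'n)) = (2 ^ j) ^ CARD('n) * bump (2 ^ j *\<^sub>R x)"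
 unfolding kern_def norm_of_real by (simp add: bump_nonneg)

lemma kern_eq_norm: "kern j x = of_real (norm (kern j x))"
 by (simp add: norm_kern) (simp add: kern_def)

lemma nn_integral_norm_kern: "(\<integral>\<^sup>+x. ennreal (norm (kern j (x::real^'n))) \<partial>lborel) = 1"
proof -
 have "(\<integral>\<^sup>+x. ennreal (bump (x::real^'n)) \<partial>lborel) = ennreal 1"
  by (subst nn_integral_eq_integral[OF bump_integrable]) (simp_all add: bump_nonneg bump_integral)
 then have "1 = ennreal (\<bar>2 ^ j\<bar> ^ DIM(real^'n)) * (\<integral>\<^sup>+x. ennreal (bump (0 + 2 ^ j *\<^sub>R (x::real^'n))) \<partial>lborel)"
  by (subst nn_integral_lborel_affine[symmetric]) auto
 also have "\<dots> = (\<integral>\<^sup>+x. ennreal (norm (kern j (x::real^'n))) \<partial>lborel)"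
  by (subst nn_integral_cmult[symmetric]) (auto simp: norm_kern ennreal_mult' bump_nonneg)
 finally show ?thesis by simp
qed

lemma nn_integral_norm_kern_shift: "(\<integral>\<^sup>+y. ennreal (norm (kern j (x - y :: real^'n))) \<partial>lborel) = 1"
 by (subst nn_integral_lborel_reflect[of "\<lambda>y. ennreal (norm (kern j y))"]) (auto simp: nn_integral_norm_kern)

lemma kern_integrable: "integrable lborel (kern j :: real^'n => complex)"
 by (rule integrableI_bounded) (auto simp: nn_integral_norm_kern)

lemma kern_integral: "(\<integral>x. kern j (x::real^'n) \<partial>lborel) = 1"
proof -
 have "(\<integral>x. norm (kern j (x::real^'n)) \<partial>lborel) = 1"
  by (subst integral_eq_nn_integral) (auto simp: nn_integral_norm_kern)
 then show ?thesis by (subst kern_eq_norm) (simp only: integral_complex_of_real of_real_1)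
qed

text \<open>By scaling, each derivative costs a factor 2^j. One constant serves all derivatives up
  to order K because there are finitely many lists of that length.\<close>

lemma kern_deriv_bound:
 obtains C where "0 < C" "\<And>b j x. length b \<le> K ==>
   norm (iter_deriv b (kern j) (x::real^'n)) \<le> C * (2 ^ j) ^ (CARD('n) + length b)"
proof -
 let ?\<theta> = "\<lambda>x::real^'n. of_real (bump x) :: complex"
 have v: "vanishes_beyond 1 ?\<theta>" by (auto simp: vanishes_beyond_def bump_eq_0)
 have "\<forall>b. \<exists>B>0. \<forall>x. norm (iter_deriv b ?\<theta> x) \<le> B"
 proof
  fix b
  obtain B where "0 < B" "\<And>x. norm (iter_deriv b ?\<theta> x) \<le> B"
   using continuous_vanishing_bounded[OF iter_deriv_continuous[OF bump_C_k order_refl] vanishes_beyond_iter_deriv[OF v, of b]]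
   by blast
  then show "\<exists>B>0. \<forall>x. norm (iter_deriv b ?\<theta> x) \<le> B" by (intro exI[of _ B] conjI allI)
 qed
 from choice[OF this] obtain B where B: "\<And>b. 0 < B b" "\<And>b x. norm (iter_deriv b ?\<theta> x) \<le> B b" by auto
 let ?L = "{b::'n list. length b \<le> K}"
 have fin: "finite ?L" using finite_lists_length_le[of "UNIV :: 'n set" K] by simp
 define C where "C = sum B ?L + 1"
 have "0 < C" unfolding C_def using B(1) by (intro add_nonneg_pos sum_nonneg) (auto simp: less_imp_le)
 moreover have "norm (iter_deriv b (kern j) x) \<le> C * (2 ^ j) ^ (CARD('n) + length b)"
  if "length b \<le> K" for b :: "'n list" and j and x :: "real^'n"
 proof -
  have k: "kern j = (\<lambda>x::real^'n. of_real ((2 ^ j) ^ CARD('n)) * ?\<theta> (2 ^ j *\<^sub>R x))"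
   by (rule ext) (rule kern_eq)
  have "iter_deriv b (kern j) x = (of_real (2 ^ j) ^ length b * of_real ((2 ^ j) ^ CARD('n))) * iter_deriv b ?\<theta> (2 ^ j *\<^sub>R x)"
   unfolding k by (rule fun_cong[OF iter_deriv_scaled[OF bump_C_k]])
  then have "norm (iter_deriv b (kern j) x) = norm ((of_real (2 ^ j) ^ length b * of_real ((2 ^ j) ^ CARD('n))) * iter_deriv b ?\<theta> (2 ^ j *\<^sub>R x))"
   by (rule arg_cong)
  also have "\<dots> = (2 ^ j) ^ (CARD('n) + length b) * norm (iter_deriv b ?\<theta> (2 ^ j *\<^sub>R x))"
   unfolding norm_mult norm_power norm_of_real power_add by simp
  also have "\<dots> \<le> (2 ^ j) ^ (CARD('n) + length b) * C"
  proof (intro mult_left_mono)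
   have "B b \<le> sum B ?L" using that fin B(1) by (intro member_le_sum) (auto simp: less_imp_le)
   then show "norm (iter_deriv b ?\<theta> (2 ^ j *\<^sub>R x)) \<le> C" using B(2)[of b "2 ^ j *\<^sub>R x"] by (simp add: C_def)
  qed simp
  finally show ?thesis by (simp add: mult.commute)
 qed
 ultimately show ?thesis by (rule that)
qed

lemma conv_kern_nn_bound:
 assumes [measurable]: "g \<in> borel_measurable borel"
 shows "ennreal (norm (conv (kern j) g x)) \<le> (\<integral>\<^sup>+y. ennreal (norm (kern j (x - y)) * norm (g y)) \<partial>lborel)"
proof (cases "integrable lborel (\<lambda>y. kern j (x - y) * g y)")
 case True
 then show ?thesis unfolding conv_def using integral_norm_bound_ennreal[OF True] by (simp add: norm_mult)
next
 case False
 then show ?thesis by (simp add: conv_def not_integrable_integral_eq)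
qed

text \<open>Jensen's inequality for the probability density \<open>norm (kern j (x - y))\<close> in
  y, by splitting off its square root. It stays pointwise in x so that it can be integrated against
  Lebesgue measure as well as against a measure on \<Gamma>.\<close>

lemma conv_kern_sq_bound:
 fixes g :: "real^'n => complex"
 assumes [measurable]: "g \<in> borel_measurable borel"
 shows "ennreal ((norm (conv (kern j) g x))\<^sup>2) \<le> (\<integral>\<^sup>+y. ennreal (norm (kern j (x - y)) * (norm (g y))\<^sup>2) \<partial>lborel)"
proof -
 let ?k = "\<lambda>y. norm (kern j (x - y))"
 have "ennreal ((norm (conv (kern j) g x))\<^sup>2) \<le> (\<integral>\<^sup>+y. ennreal (?k y * norm (g y)) \<partial>lborel)\<^sup>2"
  using power_mono[OF conv_kern_nn_bound[OF assms, of j x], of 2] by (simp add: ennreal_power)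
 also have "(\<integral>\<^sup>+y. ennreal (?k y * norm (g y)) \<partial>lborel) = (\<integral>\<^sup>+y. ennreal (sqrt (?k y) * (sqrt (?k y) * norm (g y))) \<partial>lborel)"
  by (simp flip: mult.assoc)
 also have "\<dots>\<^sup>2 \<le> (\<integral>\<^sup>+y. ennreal ((sqrt (?k y))\<^sup>2) \<partial>lborel) * (\<integral>\<^sup>+y. ennreal ((sqrt (?k y) * norm (g y))\<^sup>2) \<partial>lborel)"
  by (rule nn_integral_Cauchy_Schwarz) auto
 also have "\<dots> = (\<integral>\<^sup>+y. ennreal (?k y * (norm (g y))\<^sup>2) \<partial>lborel)"
  by (simp add: power_mult_distrib nn_integral_norm_kern_shift)
 finally show ?thesis .
qed

lemma conv_kern_bound:
 fixes g :: "real^'n => complex"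
 assumes [measurable]: "g \<in> borel_measurable borel" and B: "\<And>y. norm (x - y) < 1 / 2 / 2 ^ j ==> norm (g y) \<le> B" "0 \<le> B"
 shows "norm (conv (kern j) g x) \<le> B"
proof -
 have "ennreal (norm (conv (kern j) g x)) \<le> (\<integral>\<^sup>+y. ennreal (norm (kern j (x - y)) * norm (g y)) \<partial>lborel)"
  by (rule conv_kern_nn_bound) fact
 also have "\<dots> \<le> (\<integral>\<^sup>+y. ennreal (norm (kern j (x - y))) * ennreal B \<partial>lborel)"
 proof (rule nn_integral_mono)
  fix y
  show "ennreal (norm (kern j (x - y)) * norm (g y)) \<le> ennreal (norm (kern j (x - y))) * ennreal B"
   using B kern_eq_0[of j "x - y"]
   by (cases "norm (x - y) < 1 / 2 / 2 ^ j") (auto simp flip: ennreal_mult' intro!: ennreal_leI mult_left_mono)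
 qed
 also have "\<dots> = ennreal B" by (subst nn_integral_multc) (auto simp: nn_integral_norm_kern_shift)
 finally show ?thesis using B(2) by simp
qed

text \<open>Locality of the mollifier: a function may be altered away from \<Gamma> without changing
  its mollification on \<Gamma>.\<close>

lemma conv_kern_cong:
 assumes "\<And>y. norm (x - y) < 1 / 2 / 2 ^ j ==> g y = h y"
 shows "conv (kern j) g x = conv (kern j) h x"
 unfolding conv_def
proof (rule Bochner_Integration.integral_cong[OF refl])
 fix y show "kern j (x - y) * g y = kern j (x - y) * h y"
  using assms[of y] kern_eq_0[of j "x - y"] by (cases "norm (x - y) < 1 / 2 / 2 ^ j") auto
qed

text \<open>The kernel has mass 1, so the difference is an average of g x - g y over nearby y. The
  gain is of first order; higher orders come from the iteration in \<open>resid\<close>.\<close>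

lemma conv_kern_diff_bound:
 fixes g :: "real^'n => complex"
 assumes g: "C_k (Suc 0) g" and D: "\<And>i y. norm (partial_deriv i g y) \<le> D"
 shows "norm (g x - conv (kern j) g x) \<le> real CARD('n) * D / 2 ^ j"
proof -
 have D0: "0 \<le> D" using order_trans[OF norm_ge_zero D] .
 have c: "continuous_on UNIV g" using g by (rule C_k_continuous)
 have lip: "norm (g x - g y) \<le> real CARD('n) * D * norm (x - y)" for y
 proof (rule differentiable_bound[of UNIV])
  show "(g has_derivative (\<lambda>h. \<Sum>i\<in>UNIV. h $ i *\<^sub>R partial_deriv i g z)) (at z within UNIV)" for z
   by (rule has_derivative_partial) (use g in simp)
  show "onorm (\<lambda>h. \<Sum>i\<in>UNIV. h $ i *\<^sub>R partial_deriv i g z) \<le> real CARD('n) * D" for z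
  proof (rule onorm_le)
   fix h :: "real^'n"
   have "norm (\<Sum>i\<in>UNIV. h $ i *\<^sub>R partial_deriv i g z) \<le> (\<Sum>i\<in>(UNIV::'n set). norm h * D)"
    by (rule sum_norm_le) (auto intro!: mult_mono D component_le_norm_cart)
   then show "norm (\<Sum>i\<in>UNIV. h $ i *\<^sub>R partial_deriv i g z) \<le> real CARD('n) * D * norm h"
    by (simp add: mult_ac)
  qed
 qed auto
 have [measurable]: "g \<in> borel_measurable borel" by (rule borel_measurable_continuous_onI[OF c])
 have "conv (kern j) (\<lambda>y. g x - g y) x = (\<integral>y. g x * kern j (x - y) - kern j (x - y) * g y \<partial>lborel)"
  unfolding conv_def by (simp add: algebra_simps)
 also have "\<dots> = g x * (\<integral>y. kern j (x - y) \<partial>lborel) - conv (kern j) g x"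
  unfolding conv_def
  by (subst Bochner_Integration.integral_diff)
    (auto intro!: conv_integrable[OF kern_continuous kern_vanishes] continuous_loc_int[OF c] integrable_lborel_reflect kern_integrable)
 also have "(\<integral>y. kern j (x - y) \<partial>lborel) = 1"
  by (subst integral_lborel_reflect) (auto simp: kern_integral)
 finally have "g x - conv (kern j) g x = conv (kern j) (\<lambda>y. g x - g y) x" by simp
 also have "norm \<dots> \<le> real CARD('n) * D * (1 / 2 ^ j)"
 proof (rule conv_kern_bound)
  fix y assume y: "norm (x - y) < 1 / 2 / 2 ^ j"
  have "norm (x - y) \<le> 1 / 2 ^ j" using y zero_le_power[of "2::real" j] by (simp add: field_simps)
  then have "real CARD('n) * D * norm (x - y) \<le> real CARD('n) * D * (1 / 2 ^ j)"
   using D0 by (intro mult_left_mono) auto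
  with lip[of y] show "norm (g x - g y) \<le> real CARD('n) * D * (1 / 2 ^ j)" by simp
 qed (use D0 in auto)
 finally show ?thesis by simp
qed

lemma conv_kern_C_k: "loc_int g ==> C_k k (conv (kern j) g)"
 by (rule conv_C_k[OF kern_C_k kern_vanishes])

lemma conv_kern_continuous: "loc_int g ==> continuous_on UNIV (conv (kern j) g)"
 by (rule C_k_continuous[OF conv_kern_C_k])

section \<open>Fubini and Gaussian integrals\<close>

lemma cis_measurable [measurable]: "cis \<in> borel_measurable borel"
 by (intro borel_measurable_continuous_onI continuous_intros)

lemma cnj_measurable [measurable]: "cnj \<in> borel_measurable borel"
 by (intro borel_measurable_continuous_onI continuous_intros)

lemma integrable_lborel_pairI:
 fixes f :: "'a::euclidean_space => 'b::euclidean_space => complex"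
 assumes [measurable]: "case_prod f \<in> borel_measurable (lborel \<Otimes>\<^sub>M lborel)"
  and "(\<integral>\<^sup>+x. (\<integral>\<^sup>+y. ennreal (norm (f x y)) \<partial>lborel) \<partial>lborel) < \<infinity>"
 shows "integrable (lborel \<Otimes>\<^sub>M lborel) (case_prod f)"
proof (rule integrableI_bounded)
 have "(\<integral>\<^sup>+p. ennreal (norm (case_prod f p)) \<partial>(lborel \<Otimes>\<^sub>M lborel))
   = (\<integral>\<^sup>+x. (\<integral>\<^sup>+y. ennreal (norm (case_prod f (x, y))) \<partial>lborel) \<partial>lborel)"
  by (rule lborel.nn_integral_fst[symmetric]) measurable
 then show "(\<integral>\<^sup>+p. ennreal (norm (case_prod f p)) \<partial>(lborel \<Otimes>\<^sub>M lborel)) < \<infinity>" using assms(2) by simp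
qed fact

lemma Fubini_lborel:
 fixes f :: "'a::euclidean_space => 'b::euclidean_space => complex"
 assumes "case_prod f \<in> borel_measurable (lborel \<Otimes>\<^sub>M lborel)"
  and "(\<integral>\<^sup>+x. (\<integral>\<^sup>+y. ennreal (norm (f x y)) \<partial>lborel) \<partial>lborel) < \<infinity>"
 shows "(\<integral>x. (\<integral>y. f x y \<partial>lborel) \<partial>lborel) = (\<integral>y. (\<integral>x. f x y \<partial>lborel) \<partial>lborel)"
proof -
 have "pair_sigma_finite (lborel :: 'a measure) (lborel :: 'b measure)" ..
 from pair_sigma_finite.Fubini_integral[OF this integrable_lborel_pairI[OF assms]] show ?thesis by simp
qed

lemma Tonelli_lborel:
 fixes f :: "'a::euclidean_space => 'b::euclidean_space => ennreal"
 assumes "case_prod f \<in> borel_measurable (lborel \<Otimes>\<^sub>M lborel)"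
 shows "(\<integral>\<^sup>+x. (\<integral>\<^sup>+y. f x y \<partial>lborel) \<partial>lborel) = (\<integral>\<^sup>+y. (\<integral>\<^sup>+x. f x y \<partial>lborel) \<partial>lborel)"
proof -
 have "pair_sigma_finite (lborel :: 'a measure) (lborel :: 'b measure)" ..
 from pair_sigma_finite.Fubini'[OF this assms] show ?thesis by simp
qed

text \<open>Lebesgue measure is the image of the product measure over \<open>Basis\<close>. This
  serves the Gaussian integrals and the integrable majorant in
  \<open>decay_integrable\<close>.\<close>

lemma integral_lborel_prod:
 fixes f :: "'a::euclidean_space => real => complex"
 assumes int: "\<And>b. b \<in> Basis ==> integrable lborel (f b)"
 shows "integrable lborel (\<lambda>x::'a. \<Prod>b\<in>Basis. f b (x \<bullet> b))"
  and "(\<integral>x. (\<Prod>b\<in>Basis. f b ((x::'a) \<bullet> b)) \<partial>lborel) = (\<Prod>b\<in>Basis. (\<integral>x. f b x \<partial>lborel))"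
proof -
 interpret product_sigma_finite "\<lambda>_::'a. lborel :: real measure" ..
 have [measurable]: "f b \<in> borel_measurable borel" if "b \<in> Basis" for b using int[OF that] by auto
 have m: "(\<lambda>f. \<Sum>b\<in>Basis. f b *\<^sub>R b) \<in> (\<Pi>\<^sub>M b\<in>(Basis::'a set). lborel) \<rightarrow>\<^sub>M borel" by measurable
 have p: "(\<lambda>x::'a. \<Prod>b\<in>Basis. f b (x \<bullet> b)) \<in> borel_measurable borel" by measurable
 have e: "(\<Prod>b\<in>Basis. f b ((\<Sum>c\<in>Basis. g c *\<^sub>R c) \<bullet> b)) = (\<Prod>b\<in>(Basis::'a set). f b (g b))" for g
  by (intro prod.cong refl) simp
 show "integrable lborel (\<lambda>x::'a. \<Prod>b\<in>Basis. f b (x \<bullet> b))"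
  unfolding lborel_eq[where 'a='a]
  by (subst integrable_distr_eq[OF m p]) (simp only: e, rule product_integrable_prod, auto intro: int)
 show "(\<integral>x. (\<Prod>b\<in>Basis. f b ((x::'a) \<bullet> b)) \<partial>lborel) = (\<Prod>b\<in>Basis. (\<integral>x. f b x \<partial>lborel))"
  by (subst lborel_eq, subst integral_distr[OF m p]) (simp only: e, rule product_integral_prod, auto intro: int)
qed

text \<open>The characteristic function of the standard normal distribution, after the substitution
  x = sqrt t times a new variable.\<close>

lemma integral_gauss_1d:
 assumes t: "0 < t"
 shows "integrable lborel (\<lambda>x. cis (- (u * x)) * of_real (exp (- t * x\<^sup>2 / 2)))"
  and "(\<integral>x. cis (- (u * x)) * of_real (exp (- t * x\<^sup>2 / 2)) \<partial>lborel)
    = of_real (sqrt (2 * pi / t) * exp (- u\<^sup>2 / (2 * t)))"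
proof -
 define v where "v = - u / sqrt t"
 define h where "h x = std_normal_density x *\<^sub>R cis (v * x)" for x
 have nd: "integrable lborel std_normal_density"
  by (rule integrable_normal_density) simp
 have hint: "integrable lborel h"
 proof (rule Bochner_Integration.integrable_bound[OF nd])
  show "AE x in lborel. norm (h x) \<le> norm (std_normal_density x)" by (simp add: h_def)
 qed (simp add: h_def[abs_def])
 have "(\<integral>x. h x \<partial>lborel) = char std_normal_distribution v"
  unfolding char_def h_def cis_conv_exp by (subst integral_density) auto
 then have "(\<integral>x. h x \<partial>lborel) = of_real (exp (- v\<^sup>2 / 2))"
  by (simp add: char_std_normal_distribution)
 moreover have "(\<integral>x. h x \<partial>lborel) = \<bar>sqrt t\<bar> *\<^sub>R (\<integral>x. h (0 + sqrt t * x) \<partial>lborel)"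
  by (rule lborel_integral_real_affine) (use t in auto)
 ultimately have 1: "of_real (sqrt t) * (\<integral>x. h (sqrt t * x) \<partial>lborel) = of_real (exp (- v\<^sup>2 / 2))"
  using t by (simp add: scaleR_conv_of_real)
 have 2: "cis (- (u * x)) * of_real (exp (- t * x\<^sup>2 / 2)) = of_real (sqrt (2 * pi)) * h (sqrt t * x)" for x
  using t by (simp add: h_def v_def std_normal_density_def scaleR_conv_of_real power_mult_distrib)
 have "integrable lborel (\<lambda>x. h (0 + sqrt t * x))"
  by (rule lborel_integrable_real_affine[OF hint]) (use t in auto)
 then show "integrable lborel (\<lambda>x. cis (- (u * x)) * of_real (exp (- t * x\<^sup>2 / 2)))"
  unfolding 2 by simp
 have "(\<integral>x. h (sqrt t * x) \<partial>lborel) = of_real (exp (- v\<^sup>2 / 2)) / of_real (sqrt t)"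
  using 1 t by (simp add: field_simps)
 then show "(\<integral>x. cis (- (u * x)) * of_real (exp (- t * x\<^sup>2 / 2)) \<partial>lborel)
    = of_real (sqrt (2 * pi / t) * exp (- u\<^sup>2 / (2 * t)))"
  unfolding 2 using t by (simp add: v_def power_divide real_sqrt_divide)
qed

definition gauss :: "real => real^'n => real" where
 "gauss t x = exp (- t * (norm x)\<^sup>2 / 2)"

lemma gauss_measurable [measurable]: "gauss t \<in> borel_measurable borel"
 unfolding gauss_def[abs_def] by measurable

lemma gauss_pos: "0 < gauss t x" and gauss_le_1: "0 \<le> t ==> gauss t x \<le> 1"
 by (auto simp: gauss_def)

lemma integral_gauss:
 assumes t: "0 < t"
 shows "integrable lborel (\<lambda>x::real^'n. cis (- (\<xi> \<bullet> x)) * of_real (gauss t x))" (is ?A)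
  and "(\<integral>x. cis (- (\<xi> \<bullet> x)) * of_real (gauss t (x::real^'n)) \<partial>lborel)
    = of_real ((2 * pi / t) powr (real CARD('n) / 2) * gauss (1 / t) \<xi>)" (is ?B)
proof -
 define f where "f b r = cis (- ((\<xi> \<bullet> b) * r)) * of_real (exp (- t * r\<^sup>2 / 2))" for b :: "real^'n" and r :: real
 have e: "cis (- (\<xi> \<bullet> x)) * of_real (gauss t x) = (\<Prod>b\<in>Basis. f b (x \<bullet> b))" for x
 proof -
  have "cis (- (\<xi> \<bullet> x)) = (\<Prod>b\<in>Basis. cis (- ((\<xi> \<bullet> b) * (x \<bullet> b))))"
   by (subst euclidean_inner) (simp add: cis_conv_exp sum_negf sum_distrib_left exp_sum[symmetric] )
  moreover have "gauss t x = (\<Prod>b\<in>Basis. exp (- t * (x \<bullet> b)\<^sup>2 / 2))"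
   unfolding gauss_def power2_norm_eq_inner
   by (subst euclidean_inner) (simp add: power2_eq_square sum_distrib_left sum_divide_distrib sum_negf exp_sum[symmetric])
  ultimately show ?thesis by (simp add: f_def prod.distrib)
 qed
 have fi: "integrable lborel (f b)" for b unfolding f_def[abs_def] by (rule integral_gauss_1d(1)[OF t])
 show ?A unfolding e by (rule integral_lborel_prod(1)[OF fi])
 have "(\<integral>x. cis (- (\<xi> \<bullet> x)) * of_real (gauss t (x::real^'n)) \<partial>lborel) = (\<Prod>b\<in>Basis. (\<integral>x. f b x \<partial>lborel))"
  unfolding e by (rule integral_lborel_prod(2)[OF fi])
 also have "\<dots> = (\<Prod>b\<in>Basis. of_real (sqrt (2 * pi / t) * exp (- (\<xi> \<bullet> b)\<^sup>2 / (2 * t))))"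
  unfolding f_def by (intro prod.cong refl integral_gauss_1d(2)[OF t])
 also have "\<dots> = of_real ((\<Prod>b\<in>(Basis::(real^'n) set). sqrt (2 * pi / t)) * (\<Prod>b\<in>Basis. exp (- (\<xi> \<bullet> b)\<^sup>2 / (2 * t))))"
  by (simp add: prod.distrib)
 also have "(\<Prod>b\<in>(Basis::(real^'n) set). sqrt (2 * pi / t)) = (2 * pi / t) powr (real CARD('n) / 2)"
 proof -
  have "0 < 2 * pi / t" using t by simp
  then have "sqrt (2 * pi / t) ^ CARD('n) = ((2 * pi / t) powr (1 / 2)) powr real CARD('n)"
   by (subst powr_realpow) (auto simp: powr_half_sqrt)
  also have "\<dots> = (2 * pi / t) powr (real CARD('n) / 2)" by (simp add: powr_powr)
  finally show ?thesis by simp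
 qed
 also have "(\<Prod>b\<in>Basis. exp (- (\<xi> \<bullet> b)\<^sup>2 / (2 * t))) = gauss (1 / t) \<xi>"
  unfolding gauss_def power2_norm_eq_inner
  by (subst euclidean_inner[of \<xi> \<xi>]) (simp add: mult.commute[of t] power2_eq_square sum_distrib_left sum_divide_distrib sum_negf exp_sum[symmetric])
 finally show ?B .
qed

lemma nn_integral_gauss:
 assumes t: "0 < t"
 shows "(\<integral>\<^sup>+x. ennreal (gauss t (x::real^'n)) \<partial>lborel) = ennreal ((2 * pi / t) powr (real CARD('n) / 2))"
proof -
 have i: "integrable lborel (\<lambda>x::real^'n. complex_of_real (gauss t x))"
  using integral_gauss(1)[OF t, of 0] by simp
 then have i2: "integrable lborel (\<lambda>x::real^'n. gauss t x)" by (simp add: complex_of_real_integrable_eq)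
 have "(\<integral>x. complex_of_real (gauss t (x::real^'n)) \<partial>lborel) = of_real ((2 * pi / t) powr (real CARD('n) / 2))"
  using integral_gauss(2)[OF t, of 0] by (simp add: gauss_def)
 then have "(\<integral>x. gauss t (x::real^'n) \<partial>lborel) = (2 * pi / t) powr (real CARD('n) / 2)"
  unfolding integral_complex_of_real of_real_eq_iff .
 then show ?thesis
  by (subst nn_integral_eq_integral[OF i2]) (auto simp: gauss_pos less_imp_le)
qed

section \<open>The Fourier integral\<close>

definition fconst :: "'n itself => real" where
 "fconst _ = (2 * pi) powr (- real CARD('n) / 2)"

lemma fconst_pos: "0 < fconst TYPE('n)"
 by (simp add: fconst_def)

lemma fconst_mult: "fconst TYPE('n) * (2 * pi) powr (real CARD('n) / 2) = 1"
 by (simp add: fconst_def powr_minus)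

lemma fourier_integral_eq:
 "fourier_integral f \<xi> = of_real (fconst TYPE('n)) * (\<integral>x. cis (- (\<xi> \<bullet> x)) * f x \<partial>lborel)" for \<xi> :: "real^'n"
 by (simp add: fourier_integral_def fconst_def)

lemma integrable_cis_mult:
 fixes f :: "real^'n => complex"
 assumes "integrable lborel f"
 shows "integrable lborel (\<lambda>x. cis (c * (\<xi> \<bullet> x)) * f x)"
proof (rule Bochner_Integration.integrable_bound[OF assms])
 have [measurable]: "f \<in> borel_measurable borel" using assms by auto
 show "(\<lambda>x. cis (c * (\<xi> \<bullet> x)) * f x) \<in> borel_measurable lborel" by measurable
qed (simp add: norm_mult)

lemma fourier_integral_measurable [measurable]:
 fixes f :: "real^'n => complex"
 assumes [measurable]: "f \<in> borel_measurable borel"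
 shows "fourier_integral f \<in> borel_measurable borel"
proof -
 have "(\<lambda>\<xi>. (\<integral>x. cis (- (\<xi> \<bullet> x)) * f x \<partial>lborel)) \<in> borel_measurable borel"
  by (rule lborel.borel_measurable_lebesgue_integral) measurable
 then show ?thesis unfolding fourier_integral_eq[abs_def] by measurable
qed

lemma fourier_integral_bound:
 fixes f :: "real^'n => complex"
 shows "norm (fourier_integral f \<xi>) \<le> fconst TYPE('n) * (\<integral>x. norm (f x) \<partial>lborel)"
proof -
 have "norm (\<integral>x. cis (- (\<xi> \<bullet> x)) * f x \<partial>lborel) \<le> (\<integral>x. norm (cis (- (\<xi> \<bullet> x)) * f x) \<partial>lborel)"
  by (rule integral_norm_bound)
 also have "\<dots> = (\<integral>x. norm (f x) \<partial>lborel)" by (simp add: norm_mult)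
 finally show ?thesis using fconst_pos[where 'n='n]
  by (simp add: fourier_integral_eq norm_mult)
qed

text \<open>Fubini. The transform on L2 is built and identified through this duality.\<close>

lemma fourier_swap:
 fixes f g :: "real^'n => complex"
 assumes f: "integrable lborel f" and g: "integrable lborel g"
 shows "(\<integral>\<xi>. fourier_integral f \<xi> * g \<xi> \<partial>lborel) = (\<integral>x. f x * fourier_integral g x \<partial>lborel)"
proof -
 have [measurable]: "f \<in> borel_measurable borel" "g \<in> borel_measurable borel" using f g by auto
 have "(\<integral>\<xi>. (\<integral>x. cis (- (\<xi> \<bullet> x)) * f x * g \<xi> \<partial>lborel) \<partial>lborel)
   = (\<integral>x. (\<integral>\<xi>. cis (- (\<xi> \<bullet> x)) * f x * g \<xi> \<partial>lborel) \<partial>lborel)"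
 proof (rule Fubini_lborel)
  show "(\<lambda>(\<xi>, x). cis (- (\<xi> \<bullet> x)) * f x * g \<xi>) \<in> borel_measurable (lborel \<Otimes>\<^sub>M lborel)" by measurable
  have "(\<integral>\<^sup>+\<xi>. (\<integral>\<^sup>+x. ennreal (norm (cis (- (\<xi> \<bullet> x)) * f x * g \<xi>)) \<partial>lborel) \<partial>lborel)
    = (\<integral>\<^sup>+\<xi>. (\<integral>\<^sup>+x. ennreal (norm (f x)) \<partial>lborel) * ennreal (norm (g \<xi>)) \<partial>lborel)"
   by (subst nn_integral_multc[symmetric]) (auto simp: norm_mult ennreal_mult')
  also have "\<dots> = (\<integral>\<^sup>+x. ennreal (norm (f x)) \<partial>lborel) * (\<integral>\<^sup>+\<xi>. ennreal (norm (g \<xi>)) \<partial>lborel)"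
   by (rule nn_integral_cmult) measurable
  also have "\<dots> < \<infinity>" using f g by (simp add: integrable_iff_bounded ennreal_mult_less_top)
  finally show "(\<integral>\<^sup>+\<xi>. (\<integral>\<^sup>+x. ennreal (norm (cis (- (\<xi> \<bullet> x)) * f x * g \<xi>)) \<partial>lborel) \<partial>lborel) < \<infinity>" .
 qed
 moreover have "(\<integral>\<xi>. cis (- (\<xi> \<bullet> x)) * f x * g \<xi> \<partial>lborel) = f x * (\<integral>\<xi>. cis (- (x \<bullet> \<xi>)) * g \<xi> \<partial>lborel)" for x
 proof -
  have "(\<integral>\<xi>. cis (- (\<xi> \<bullet> x)) * f x * g \<xi> \<partial>lborel) = (\<integral>\<xi>. f x * (cis (- (x \<bullet> \<xi>)) * g \<xi>) \<partial>lborel)"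
   by (simp add: inner_commute mult_ac)
  then show ?thesis by simp
 qed
 ultimately have "(\<integral>\<xi>. (\<integral>x. cis (- (\<xi> \<bullet> x)) * f x \<partial>lborel) * g \<xi> \<partial>lborel)
   = (\<integral>x. f x * (\<integral>\<xi>. cis (- (x \<bullet> \<xi>)) * g \<xi> \<partial>lborel) \<partial>lborel)"
  by simp
 then show ?thesis by (simp add: fourier_integral_eq mult.assoc mult.left_commute[of _ "of_real (fconst _)"])
qed

lemma fourier_integral_cnj:
 fixes f :: "real^'n => complex"
 assumes f: "integrable lborel f"
 shows "fourier_integral (\<lambda>y. cnj (f (- y))) \<xi> = cnj (fourier_integral f \<xi>)"
proof -
 have [measurable]: "f \<in> borel_measurable borel" using f by auto
 have "(\<integral>x. cis (- (\<xi> \<bullet> x)) * cnj (f (- x)) \<partial>lborel) = (\<integral>x. cis (- (\<xi> \<bullet> (0 - x))) * cnj (f (- (0 - x))) \<partial>lborel)"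
  by (rule integral_lborel_reflect[symmetric]) measurable
 also have "\<dots> = (\<integral>x. cnj (cis (- (\<xi> \<bullet> x)) * f x) \<partial>lborel)" by (simp add: cis_cnj)
 also have "\<dots> = cnj (\<integral>x. cis (- (\<xi> \<bullet> x)) * f x \<partial>lborel)"
  using integral_bounded_linear[OF bounded_linear_cnj integrable_cis_mult[OF f, of "-1" \<xi>]] by simp
 finally show ?thesis by (simp add: fourier_integral_eq)
qed

lemma fourier_gauss_modulated:
 fixes a :: "real^'n"
 assumes t: "0 < t"
 shows "fourier_integral (\<lambda>\<xi>. cis (- (a \<bullet> \<xi>)) * of_real (gauss t \<xi>)) y
   = of_real (fconst TYPE('n) * (2 * pi / t) powr (real CARD('n) / 2) * gauss (1 / t) (y + a))"
proof -
 have "cis (- (y \<bullet> x)) * (cis (- (a \<bullet> x)) * of_real (gauss t x)) = cis (- ((y + a) \<bullet> x)) * of_real (gauss t x)" for x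
  by (simp add: cis_mult inner_add_left mult.assoc[symmetric])
 then show ?thesis by (simp only: fourier_integral_eq integral_gauss(2)[OF t]) (simp add: mult.assoc)
qed

text \<open>The left side pairs the transform of \<open>f\<close> with v, its conjugate damped by a
  Gaussian. Duality turns this into a pairing of \<open>f\<close> with the transform of v, which is
  the conjugate of \<open>f\<close> averaged by a Gaussian density; a Schur estimate finishes. The
  damping makes all integrals converge absolutely.\<close>

lemma l2sq_fourier_integral_gauss_le:
 fixes f :: "real^'n => complex"
 assumes f: "integrable lborel f" and t: "0 < t"
 shows "(\<integral>\<^sup>+\<xi>. ennreal ((norm (fourier_integral f \<xi>))\<^sup>2 * gauss t \<xi>) \<partial>lborel) \<le> l2sq lborel f"
proof -
 have [measurable]: "f \<in> borel_measurable borel" using f by auto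
 let ?F = "fourier_integral f"
 define c where "c = fconst TYPE('n)"
 define G where "G z = (2 * pi / t) powr (real CARD('n) / 2) * gauss (1 / t) z" for z :: "real^'n"
 have [measurable]: "G \<in> borel_measurable borel" unfolding G_def by measurable
 have G0: "0 \<le> G z" for z by (simp add: G_def gauss_pos less_imp_le)
 have Gsym: "G (x - y) = G (y - x)" for x y by (simp add: G_def gauss_def norm_minus_commute)
 have c0: "0 < c" by (simp add: c_def fconst_pos)
 have gi: "integrable lborel (\<lambda>\<xi>::real^'n. of_real (gauss t \<xi>) :: complex)"
  using integral_gauss(1)[OF t, of 0] by simp
 \<comment> \<open>c^2 G is a probability density: the Gaussian integral and the prefactor of G
   multiply to (2 pi)^n, which c^2 cancels.\<close>
 have Gint: "(\<integral>\<^sup>+y. ennreal (c\<^sup>2 * G (x - y)) \<partial>lborel) = 1" for x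
 proof -
  have "(\<integral>\<^sup>+y. ennreal (c\<^sup>2 * G (x - y)) \<partial>lborel) = (\<integral>\<^sup>+y. ennreal (c\<^sup>2 * G y) \<partial>lborel)"
   by (rule nn_integral_lborel_reflect[of "\<lambda>y. ennreal (c\<^sup>2 * G y)"]) measurable
  also have "\<dots> = (\<integral>\<^sup>+y. ennreal (c\<^sup>2 * (2 * pi / t) powr (real CARD('n) / 2)) * ennreal (gauss (1 / t) (y::real^'n)) \<partial>lborel)"
   by (simp add: G_def mult.assoc flip: ennreal_mult')
  also have "\<dots> = ennreal (c\<^sup>2 * (2 * pi / t) powr (real CARD('n) / 2)) * ennreal ((2 * pi / (1 / t)) powr (real CARD('n) / 2))"
   by (subst nn_integral_cmult) (use t in \<open>auto simp: nn_integral_gauss\<close>)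
  also have "\<dots> = ennreal (c\<^sup>2 * ((2 * pi / t) powr (real CARD('n) / 2) * (2 * pi * t) powr (real CARD('n) / 2)))"
   using t by (simp add: mult.assoc flip: ennreal_mult')
  also have "(2 * pi / t) powr (real CARD('n) / 2) * (2 * pi * t) powr (real CARD('n) / 2)
    = ((2 * pi) powr (real CARD('n) / 2))\<^sup>2"
   using t by (simp add: powr_mult[symmetric] powr_divide[symmetric] power2_eq_square)
  also have "c\<^sup>2 * \<dots> = 1" using fconst_mult[where 'n='n] by (simp add: c_def flip: power_mult_distrib)
  finally show ?thesis by simp
 qed
 define v where "v \<xi> = of_real (gauss t \<xi>) * cnj (?F \<xi>)" for \<xi>
 have [measurable]: "v \<in> borel_measurable borel" unfolding v_def by measurable
 obtain B where B: "\<And>\<xi>. norm (?F \<xi>) \<le> B" using fourier_integral_bound[of f] by blast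
 have vi: "integrable lborel v"
 proof (rule Bochner_Integration.integrable_bound[of _ "\<lambda>\<xi>. of_real B * (of_real (gauss t \<xi>) :: complex)"])
  show "integrable lborel (\<lambda>\<xi>::real^'n. of_real B * (of_real (gauss t \<xi>) :: complex))" using gi by simp
  show "AE \<xi> in lborel. norm (v \<xi>) \<le> norm (of_real B * (of_real (gauss t \<xi>) :: complex))"
  proof (rule AE_I2)
   fix \<xi> show "norm (v \<xi>) \<le> norm (of_real B * (of_real (gauss t \<xi>) :: complex))"
    using B[of \<xi>] order_trans[OF norm_ge_zero B[of \<xi>]] gauss_pos[of t \<xi>]
    by (simp add: v_def norm_mult mult.commute mult_left_mono)
  qed
 qed simp
 have vhat: "fourier_integral v x = of_real (c\<^sup>2) * (\<integral>y. cnj (f y) * of_real (G (x - y)) \<partial>lborel)" for x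
 proof -
  let ?g = "\<lambda>y. cnj (f (- y))"
  let ?w = "\<lambda>\<xi>. cis (- (x \<bullet> \<xi>)) * of_real (gauss t \<xi>)"
  have gint: "integrable lborel ?g" using integrable_lborel_reflect[OF f, of 0] by simp
  have "fourier_integral v x = of_real c * (\<integral>\<xi>. fourier_integral ?g \<xi> * ?w \<xi> \<partial>lborel)"
   by (simp add: fourier_integral_eq[of v] c_def v_def fourier_integral_cnj[OF f] mult_ac)
  also have "(\<integral>\<xi>. fourier_integral ?g \<xi> * ?w \<xi> \<partial>lborel) = (\<integral>y. ?g y * fourier_integral ?w y \<partial>lborel)"
   by (rule fourier_swap[OF gint integral_gauss(1)[OF t]])
  also have "\<dots> = (\<integral>y. of_real c * (?g y * of_real (G (y + x))) \<partial>lborel)"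
  proof -
   have "fourier_integral ?w y = of_real (c * G (y + x))" for y
    by (simp only: fourier_gauss_modulated[OF t]) (simp add: c_def G_def mult.assoc)
   then show ?thesis by (simp add: mult_ac)
  qed
  also have "\<dots> = of_real c * (\<integral>y. ?g y * of_real (G (y + x)) \<partial>lborel)" by simp
  also have "(\<integral>y. ?g y * of_real (G (y + x)) \<partial>lborel) = (\<integral>y. ?g (0 - y) * of_real (G ((0 - y) + x)) \<partial>lborel)"
   by (rule integral_lborel_reflect[symmetric]) measurable
  finally show ?thesis by (simp add: power2_eq_square algebra_simps)
 qed
 have vb: "ennreal (norm (fourier_integral v x)) \<le> (\<integral>\<^sup>+y. ennreal (norm (f y) * (c\<^sup>2 * G (x - y))) \<partial>lborel)" for x
 proof -
  have i: "integrable lborel (\<lambda>y. cnj (f y) * of_real (G (x - y)))"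
  proof (rule Bochner_Integration.integrable_bound[of _ "\<lambda>y. of_real ((2 * pi / t) powr (real CARD('n) / 2)) * f y"])
   show "AE y in lborel. norm (cnj (f y) * of_real (G (x - y))) \<le> norm (of_real ((2 * pi / t) powr (real CARD('n) / 2)) * f y)"
   proof (rule AE_I2)
    fix y
    have "G (x - y) \<le> (2 * pi / t) powr (real CARD('n) / 2)"
     using gauss_le_1[of "1/t" "x - y"] t by (simp add: G_def mult_left_le)
    then show "norm (cnj (f y) * of_real (G (x - y))) \<le> norm (of_real ((2 * pi / t) powr (real CARD('n) / 2)) * f y)"
     using G0[of "x - y"] by (simp add: norm_mult mult.commute mult_left_mono)
   qed
  qed (use f in auto)
  have "ennreal (norm (fourier_integral v x)) = ennreal (c\<^sup>2) * ennreal (norm (\<integral>y. cnj (f y) * of_real (G (x - y)) \<partial>lborel))"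
   by (simp add: vhat norm_mult norm_power power2_eq_square flip: ennreal_mult')
  also have "\<dots> \<le> ennreal (c\<^sup>2) * (\<integral>\<^sup>+y. ennreal (norm (cnj (f y) * of_real (G (x - y)))) \<partial>lborel)"
   by (intro mult_left_mono integral_norm_bound_ennreal[OF i]) simp
  also have "\<dots> = (\<integral>\<^sup>+y. ennreal (norm (f y) * (c\<^sup>2 * G (x - y))) \<partial>lborel)"
   using G0 by (subst nn_integral_cmult[symmetric]) (auto simp: norm_mult mult_ac simp flip: ennreal_mult')
  finally show ?thesis .
 qed
 have "(\<integral>\<^sup>+\<xi>. ennreal ((norm (?F \<xi>))\<^sup>2 * gauss t \<xi>) \<partial>lborel) = ennreal (norm (\<integral>\<xi>. ?F \<xi> * v \<xi> \<partial>lborel))"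
 proof -
  have e: "?F \<xi> * v \<xi> = of_real ((norm (?F \<xi>))\<^sup>2 * gauss t \<xi>)" for \<xi>
   by (simp only: v_def of_real_mult complex_norm_square mult_ac)
  have i: "integrable lborel (\<lambda>\<xi>. ?F \<xi> * v \<xi>)"
   by (rule Bochner_Integration.integrable_bound[of _ "\<lambda>\<xi>. of_real B * v \<xi>"])
     (use vi B order_trans[OF norm_ge_zero B] in \<open>auto simp: norm_mult intro!: mult_right_mono AE_I2\<close>)
  then have i': "integrable lborel (\<lambda>\<xi>. (norm (?F \<xi>))\<^sup>2 * gauss t \<xi>)"
   unfolding e complex_of_real_integrable_eq .
  have nn: "0 \<le> (\<integral>\<xi>. (norm (?F \<xi>))\<^sup>2 * gauss t \<xi> \<partial>lborel)"
   by (intro integral_nonneg_AE AE_I2) (simp add: gauss_pos less_imp_le)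
  show ?thesis unfolding e integral_complex_of_real norm_of_real
   using nn by (subst nn_integral_eq_integral[OF i']) (auto simp: gauss_pos less_imp_le)
 qed
 also have "(\<integral>\<xi>. ?F \<xi> * v \<xi> \<partial>lborel) = (\<integral>x. f x * fourier_integral v x \<partial>lborel)"
  by (rule fourier_swap[OF f vi])
 also have "ennreal (norm \<dots>) \<le> (\<integral>\<^sup>+x. ennreal (norm (f x)) * ennreal (norm (fourier_integral v x)) \<partial>lborel)"
  by (cases "integrable lborel (\<lambda>x. f x * fourier_integral v x)")
    (auto simp: not_integrable_integral_eq norm_mult ennreal_mult' dest: integral_norm_bound_ennreal)
 also have "\<dots> \<le> (\<integral>\<^sup>+x. ennreal (norm (f x)) * (\<integral>\<^sup>+y. ennreal (norm (f y) * (c\<^sup>2 * G (x - y))) \<partial>lborel) \<partial>lborel)"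
  by (intro nn_integral_mono mult_left_mono vb) simp
 finally have I: "(\<integral>\<^sup>+\<xi>. ennreal ((norm (?F \<xi>))\<^sup>2 * gauss t \<xi>) \<partial>lborel)
   \<le> (\<integral>\<^sup>+x. (\<integral>\<^sup>+y. ennreal (norm (f x) * norm (f y) * (c\<^sup>2 * G (x - y))) \<partial>lborel) \<partial>lborel)" (is "_ \<le> ?D")
  using G0 by (subst (asm) nn_integral_cmult[symmetric]) (auto simp: mult_ac simp flip: ennreal_mult')
 \<comment> \<open>Schur test: 2 |f x| |f y| \<le> |f x|^2 + |f y|^2, and the kernel has mass 1 in
   either variable.\<close>
 have "2 * ?D = (\<integral>\<^sup>+x. (\<integral>\<^sup>+y. ennreal (2 * (norm (f x) * norm (f y) * (c\<^sup>2 * G (x - y)))) \<partial>lborel) \<partial>lborel)"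
  using G0 by (simp add: nn_integral_cmult ennreal_mult')
 also have "\<dots> \<le> (\<integral>\<^sup>+x. (\<integral>\<^sup>+y. ennreal ((norm (f x))\<^sup>2) * ennreal (c\<^sup>2 * G (x - y))
    + ennreal ((norm (f y))\<^sup>2) * ennreal (c\<^sup>2 * G (x - y)) \<partial>lborel) \<partial>lborel)"
 proof (intro nn_integral_mono)
  fix x y
  have "2 * (norm (f x) * norm (f y)) * (c\<^sup>2 * G (x - y)) \<le> ((norm (f x))\<^sup>2 + (norm (f y))\<^sup>2) * (c\<^sup>2 * G (x - y))"
   using sum_squares_bound[of "norm (f x)" "norm (f y)"] G0 by (intro mult_right_mono) auto
  then show "ennreal (2 * (norm (f x) * norm (f y) * (c\<^sup>2 * G (x - y)))) \<le> ennreal ((norm (f x))\<^sup>2) * ennreal (c\<^sup>2 * G (x - y))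
    + ennreal ((norm (f y))\<^sup>2) * ennreal (c\<^sup>2 * G (x - y))"
   using G0 by (simp add: distrib_right mult.assoc flip: ennreal_mult' ennreal_plus)
 qed
 also have "\<dots> = (\<integral>\<^sup>+x. ennreal ((norm (f x))\<^sup>2) * (\<integral>\<^sup>+y. ennreal (c\<^sup>2 * G (x - y)) \<partial>lborel) \<partial>lborel)
   + (\<integral>\<^sup>+x. (\<integral>\<^sup>+y. ennreal ((norm (f y))\<^sup>2) * ennreal (c\<^sup>2 * G (x - y)) \<partial>lborel) \<partial>lborel)"
  by (simp add: nn_integral_add nn_integral_cmult)
 also have "(\<integral>\<^sup>+x. (\<integral>\<^sup>+y. ennreal ((norm (f y))\<^sup>2) * ennreal (c\<^sup>2 * G (x - y)) \<partial>lborel) \<partial>lborel)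
   = (\<integral>\<^sup>+y. (\<integral>\<^sup>+x. ennreal ((norm (f y))\<^sup>2) * ennreal (c\<^sup>2 * G (x - y)) \<partial>lborel) \<partial>lborel)"
  by (rule Tonelli_lborel) measurable
 also have "\<dots> = (\<integral>\<^sup>+y. ennreal ((norm (f y))\<^sup>2) * (\<integral>\<^sup>+x. ennreal (c\<^sup>2 * G (y - x)) \<partial>lborel) \<partial>lborel)"
  by (simp add: nn_integral_cmult Gsym)
 finally have "2 * ?D \<le> 2 * l2sq lborel f"
  by (simp add: Gint l2sq_def mult_2)
 then have "?D \<le> l2sq lborel f" by (simp add: ennreal_mult_le_mult_iff)
 with I show ?thesis by (rule order_trans)
qed

text \<open>The damping parameter tends to 0 and Fatou's lemma applies. The square root of the
  Gaussian appears because \<open>l2sq\<close> squares it.\<close>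

lemma l2sq_fourier_integral_le:
 fixes f :: "real^'n => complex"
 assumes f: "integrable lborel f"
 shows "l2sq lborel (fourier_integral f) \<le> l2sq lborel f"
proof -
 have [measurable]: "f \<in> borel_measurable borel" using f by auto
 have "l2sq lborel (\<lambda>\<xi>. fourier_integral f \<xi>) \<le> l2sq lborel f"
 proof (rule l2sq_le_liminf)
  fix k :: nat
  let ?t = "1 / real (Suc k)"
  have "l2sq lborel (\<lambda>\<xi>. of_real (sqrt (gauss ?t \<xi>)) * fourier_integral f \<xi>)
    = (\<integral>\<^sup>+\<xi>. ennreal ((norm (fourier_integral f \<xi>))\<^sup>2 * gauss ?t \<xi>) \<partial>lborel)"
   unfolding l2sq_def norm_mult norm_of_real power_mult_distrib
   by (simp add: less_imp_le[OF gauss_pos] mult.commute)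
  also have "\<dots> \<le> l2sq lborel f" by (rule l2sq_fourier_integral_gauss_le[OF f]) simp
  finally show "l2sq lborel (\<lambda>\<xi>. of_real (sqrt (gauss ?t \<xi>)) * fourier_integral f \<xi>) \<le> l2sq lborel f" .
  show "(\<lambda>\<xi>. of_real (sqrt (gauss ?t \<xi>)) * fourier_integral f \<xi>) \<in> borel_measurable lborel" by measurable
 next
  show "AE \<xi> in lborel. (\<lambda>k. of_real (sqrt (gauss (1 / real (Suc k)) \<xi>)) * fourier_integral f \<xi>) \<longlonglongrightarrow> fourier_integral f \<xi>"
  proof (rule AE_I2)
   fix \<xi> :: "real^'n"
   have "(\<lambda>k. gauss (1 / real (Suc k)) \<xi>) \<longlonglongrightarrow> exp (- 0 * (norm \<xi>)\<^sup>2 / 2)"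
    unfolding gauss_def by (intro tendsto_intros LIMSEQ_Suc[OF lim_1_over_n]) auto
   then have "(\<lambda>k. of_real (sqrt (gauss (1 / real (Suc k)) \<xi>)) * fourier_integral f \<xi>)
     \<longlonglongrightarrow> of_real (sqrt (exp (- 0 * (norm \<xi>)\<^sup>2 / 2))) * fourier_integral f \<xi>"
    by (intro tendsto_intros)
   then show "(\<lambda>k. of_real (sqrt (gauss (1 / real (Suc k)) \<xi>)) * fourier_integral f \<xi>) \<longlonglongrightarrow> fourier_integral f \<xi>"
    by simp
  qed
 qed
 then show ?thesis .
qed

section \<open>Test functions separate locally integrable functions\<close>

lemma conv_kern_const:
 fixes g :: "real^'n => complex"
 assumes "\<And>y. norm (x - y) < 1 / 2 / 2 ^ j ==> g y = c"
 shows "conv (kern j) g x = c"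
proof -
 have "conv (kern j) g x = conv (kern j) (\<lambda>y. c) x" by (rule conv_kern_cong) fact
 also have "\<dots> = (\<integral>y. kern j (x - y) \<partial>lborel) * c" by (simp add: conv_def)
 also have "(\<integral>y. kern j (x - y) \<partial>lborel) = 1"
  by (subst integral_lborel_reflect) (auto simp: kern_integral)
 finally show ?thesis by simp
qed

lemma half_power_le_1: "1 / 2 / 2 ^ j \<le> (1::real)"
proof -
 have "1 / 2 / 2 ^ j \<le> 1 / 2 / (1::real)" by (intro divide_left_mono) auto
 also have "\<dots> \<le> 1" by simp
 finally show ?thesis .
qed

lemma half_power_tendsto_0: "0 < e ==> \<forall>\<^sub>F j in sequentially. 1 / 2 / 2 ^ j < (e::real)"
proof -
 assume e: "0 < e"
 have "(\<lambda>j. (1/2) * (1/2) ^ j :: real) \<longlonglongrightarrow> (1/2) * 0"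
  by (intro tendsto_intros LIMSEQ_realpow_zero) auto
 then have "\<forall>\<^sub>F j in sequentially. (1/2) * (1/2) ^ j < e"
  using e by (intro order_tendstoD(2)) auto
 then show ?thesis by (simp add: power_divide)
qed

lemma conv_kern_tendsto_interior:
 fixes g :: "real^'n => complex"
 assumes "open S" "x \<in> S" "\<And>y. y \<in> S ==> g y = c"
 shows "(\<lambda>j. conv (kern j) g x) \<longlonglongrightarrow> c"
proof -
 obtain e where e: "0 < e" "ball x e \<subseteq> S" using assms(1,2) open_contains_ball by blast
 have "\<forall>\<^sub>F j in sequentially. conv (kern j) g x = c"
  using half_power_tendsto_0[OF e(1)]
 proof eventually_elim
  case (elim j)
  show ?case by (rule conv_kern_const) (use elim e assms(3) in \<open>auto simp: dist_norm subset_iff\<close>)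
 qed
 then show ?thesis by (rule tendsto_eventually)
qed

lemma test_functionsI:
 assumes "\<And>k. C_k k f" "vanishes_beyond R f"
 shows "f \<in> test_functions"
proof -
 have "supp f \<subseteq> cball 0 R" unfolding supp_def
  by (rule closure_minimal) (use assms(2) in \<open>auto simp: vanishes_beyond_def not_less[symmetric]\<close>)
 then have "compact (supp f)"
  unfolding supp_def by (metis bounded_cball bounded_subset closed_closure compact_eq_bounded_closed)
 then show ?thesis using assms(1) by (simp add: test_functions_def)
qed

lemma test_functions_vanish:
 assumes "f \<in> test_functions"
 obtains R where "0 < R" "vanishes_beyond R f"
proof -
 have "bounded (supp f)" using assms by (auto simp: test_functions_def compact_imp_bounded)
 then obtain R where R: "0 < R" "\<forall>x\<in>supp f. norm x \<le> R" by (auto simp: bounded_pos)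
 have "vanishes_beyond R f"
  unfolding vanishes_beyond_def
 proof (intro allI impI)
  fix x :: "real^'a" assume x: "R < norm x"
  show "f x = 0"
  proof (rule ccontr)
   assume "f x \<noteq> 0"
   then have "x \<in> supp f" unfolding supp_def by (intro closure_subset[THEN subsetD]) simp
   then show False using R x by auto
  qed
 qed
 with R(1) show ?thesis by (rule that)
qed

lemma test_C_k: "f \<in> test_functions ==> C_k k f"
 by (simp add: test_functions_def)

lemma test_continuous: "f \<in> test_functions ==> continuous_on UNIV f"
 using test_C_k[of f 0] by simp

lemma test_measurable: "f \<in> test_functions ==> f \<in> borel_measurable borel"
 by (intro borel_measurable_continuous_onI test_continuous)

lemma AE_not_box_boundary: "AE x in lborel. x \<notin> cbox a b - box a (b::real^'n)"
proof -
 have "emeasure lborel (cbox a b - box a b) = emeasure lborel (cbox a b) - emeasure lborel (box a b)"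
  by (rule emeasure_Diff) (auto simp: box_subset_cbox emeasure_lborel_box_eq)
 also have "\<dots> = 0" by (simp add: emeasure_lborel_box_eq emeasure_lborel_cbox_eq)
 finally show ?thesis by (intro AE_not_in null_setsI) auto
qed

lemma enn2real_inj: "enn2real a = enn2real b ==> a \<noteq> \<infinity> ==> b \<noteq> \<infinity> ==> a = b"
 by (cases a; cases b) auto

text \<open>The positive and the negative part of \<open>h\<close> are densities of measures that
  agree on boxes, an intersection-stable generator. So the two parts agree almost everywhere, which
  makes both vanish.\<close>

lemma real_AE_zero_of_boxes:
 fixes h :: "real^'n => real"
 assumes [measurable]: "h \<in> borel_measurable borel"
  and int: "\<And>a b. integrable lborel (\<lambda>x. h x * indicator (box a b) x)"
  and zero: "\<And>a b. (\<integral>x. h x * indicator (box a b) x \<partial>lborel) = 0"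
 shows "AE x in lborel. h x = 0"
proof -
 have fin: "(\<integral>\<^sup>+x. ennreal (h x) * indicator (box a b) x \<partial>lborel) < \<infinity>"
  "(\<integral>\<^sup>+x. ennreal (- h x) * indicator (box a b) x \<partial>lborel) < \<infinity>"
  "(\<integral>\<^sup>+x. ennreal (h x) * indicator (box a b) x \<partial>lborel) = (\<integral>\<^sup>+x. ennreal (- h x) * indicator (box a b) x \<partial>lborel)" for a b
 proof -
  have e: "(\<integral>\<^sup>+x. ennreal (h x) * indicator (box a b) x \<partial>lborel) = (\<integral>\<^sup>+x. ennreal (h x * indicator (box a b) x) \<partial>lborel)"
   "(\<integral>\<^sup>+x. ennreal (- h x) * indicator (box a b) x \<partial>lborel) = (\<integral>\<^sup>+x. ennreal (- (h x * indicator (box a b) x)) \<partial>lborel)"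
   by (auto intro!: nn_integral_cong simp: indicator_def)
  have f: "(\<integral>\<^sup>+x. ennreal (h x * indicator (box a b) x) \<partial>lborel) \<noteq> \<infinity>" "(\<integral>\<^sup>+x. ennreal (- (h x * indicator (box a b) x)) \<partial>lborel) \<noteq> \<infinity>"
   using int[of a b] unfolding real_integrable_def by auto
  have "enn2real (\<integral>\<^sup>+x. ennreal (h x * indicator (box a b) x) \<partial>lborel) = enn2real (\<integral>\<^sup>+x. ennreal (- (h x * indicator (box a b) x)) \<partial>lborel)"
   using zero[of a b] real_lebesgue_integral_def[OF int[of a b]] by simp
  then have "(\<integral>\<^sup>+x. ennreal (h x * indicator (box a b) x) \<partial>lborel) = (\<integral>\<^sup>+x. ennreal (- (h x * indicator (box a b) x)) \<partial>lborel)"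
   by (rule enn2real_inj) (use f in auto)
  then show "(\<integral>\<^sup>+x. ennreal (h x) * indicator (box a b) x \<partial>lborel) < \<infinity>"
   "(\<integral>\<^sup>+x. ennreal (- h x) * indicator (box a b) x \<partial>lborel) < \<infinity>"
   "(\<integral>\<^sup>+x. ennreal (h x) * indicator (box a b) x \<partial>lborel) = (\<integral>\<^sup>+x. ennreal (- h x) * indicator (box a b) x \<partial>lborel)"
   using f unfolding e by (auto simp: less_top[symmetric])
 qed
 have "density lborel (\<lambda>x. ennreal (h x)) = density lborel (\<lambda>x. ennreal (- h x))"
 proof (rule measure_eqI_generator_eq)
  let ?E = "range (\<lambda>(a, b). box a b::(real^'n) set)"
  show "Int_stable ?E" by (auto simp: Int_stable_def box_Int_box)
  show "?E \<subseteq> Pow UNIV" by simp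
  show "sets (density lborel (\<lambda>x. ennreal (h x))) = sigma_sets UNIV ?E" "sets (density lborel (\<lambda>x. ennreal (- h x))) = sigma_sets UNIV ?E"
   by (simp_all add: borel_eq_box)
  let ?A = "\<lambda>n::nat. box (- (real n *\<^sub>R One)) (real n *\<^sub>R One) :: (real^'n) set"
  show "range ?A \<subseteq> ?E" "(\<Union>i. ?A i) = UNIV"
   unfolding UN_box_eq_UNIV by auto
  show "emeasure (density lborel (\<lambda>x. ennreal (h x))) (?A i) \<noteq> \<infinity>" for i
   using fin(1) by (simp add: emeasure_density less_top[symmetric])
  show "emeasure (density lborel (\<lambda>x. ennreal (h x))) X = emeasure (density lborel (\<lambda>x. ennreal (- h x))) X" if "X \<in> ?E" for X
   using that fin(3) by (auto simp: emeasure_density)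
 qed
 then have "AE x in lborel. ennreal (h x) = ennreal (- h x)"
  by (subst (asm) sigma_finite_measure.density_unique_iff[OF sigma_finite_lborel]) auto
 then show ?thesis
 proof eventually_elim
  case (elim x)
  then show ?case by (cases "h x" "0::real" rule: linorder_cases) (auto simp: ennreal_neg dest!: sym[of _ "ennreal (- _)"])
 qed
qed

text \<open>Mollified indicators of a box are test functions, bounded by 1 with a common support,
  and converge off the boundary of the box, a null set. Hence all integrals of \<open>g\<close> over
  boxes vanish.\<close>

lemma AE_zero_of_test_functions:
 fixes g :: "real^'n => complex"
 assumes g: "loc_int g" and zero: "\<And>\<phi>. \<phi> \<in> test_functions ==> (\<integral>x. g x * \<phi> x \<partial>lborel) = 0"
 shows "AE x in lborel. g x = 0"
proof -
 have [measurable]: "g \<in> borel_measurable borel" using g by (rule loc_int_measurable)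
 have box: "integrable lborel (\<lambda>x. g x * indicator (box a b) x) \<and> (\<integral>x. g x * indicator (box a b) x \<partial>lborel) = 0" for a b
 proof -
  obtain R where R: "0 < R" "box a b \<subseteq> cball 0 R"
   using bounded_subset_ballD[OF bounded_box[of a b], of 0] ball_subset_cball by blast
  let ?I = "\<lambda>x. indicator (box a b) x :: complex"
  let ?w = "\<lambda>x. norm (g x) * indicator (cball 0 (R+1)) x"
  have Im: "?I \<in> borel_measurable borel" by measurable
  have li: "loc_int ?I"
  proof (rule l2_loc_int[OF Im])
   have "l2sq lborel ?I = (\<integral>\<^sup>+x. indicator (box a b) x \<partial>lborel)"
    unfolding l2sq_def by (intro nn_integral_cong) (auto simp: indicator_def)
   also have "\<dots> < \<infinity>" by (simp add: emeasure_lborel_box_eq)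
   finally show "l2sq lborel ?I < \<infinity>" .
  qed
  have b1: "norm (conv (kern j) ?I x) \<le> 1" for j x
   by (rule conv_kern_bound[OF Im]) (auto simp: indicator_def)
  have v: "vanishes_beyond (R + 1) (conv (kern j) ?I)" for j
   unfolding vanishes_beyond_def
  proof (intro allI impI conv_kern_const)
   fix x y :: "real^'n" assume x: "R + 1 < norm x" and y: "norm (x - y) < 1 / 2 / 2 ^ j"
   have "norm (x - y) < 1" using y by (rule less_le_trans) (rule half_power_le_1)
   then have "R < norm y" using x norm_triangle_sub[of x y] by simp
   then show "?I y = 0" using R by (auto simp: indicator_def)
  qed
  have t: "conv (kern j) ?I \<in> test_functions" for j
   by (rule test_functionsI[OF conv_kern_C_k[OF li] v])
  have cm [measurable]: "conv (kern j) ?I \<in> borel_measurable borel" for j by (rule test_measurable[OF t])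
  have wi: "integrable lborel ?w"
  proof (rule integrableI_bounded)
   have "(\<integral>\<^sup>+x. ennreal (norm (?w x)) \<partial>lborel) = (\<integral>\<^sup>+x. ennreal (norm (g x)) * indicator (cball 0 (R+1)) x \<partial>lborel)"
    by (intro nn_integral_cong) (auto simp: indicator_def)
   then show "(\<integral>\<^sup>+x. ennreal (norm (?w x)) \<partial>lborel) < \<infinity>" using g by (simp add: loc_int_def)
  qed measurable
  have lim: "AE x in lborel. (\<lambda>j. g x * conv (kern j) ?I x) \<longlonglongrightarrow> g x * ?I x"
   using AE_not_box_boundary[of a b]
  proof eventually_elim
   case (elim x)
   have "(\<lambda>j. conv (kern j) ?I x) \<longlonglongrightarrow> ?I x"
   proof (cases "x \<in> box a b")
    case True
    have "(\<lambda>j. conv (kern j) ?I x) \<longlonglongrightarrow> 1"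
     by (rule conv_kern_tendsto_interior[OF open_box True]) auto
    then show ?thesis using True by simp
   next
    case False
    have "(\<lambda>j. conv (kern j) ?I x) \<longlonglongrightarrow> 0"
     by (rule conv_kern_tendsto_interior[of "- cbox a b"])
      (use False elim box_subset_cbox[of a b] in \<open>auto simp: closed_cbox open_Compl indicator_def dest: subsetD\<close>)
    then show ?thesis using False by simp
   qed
   then show ?case by (intro tendsto_intros)
  qed
  have bd: "AE x in lborel. norm (g x * conv (kern j) ?I x) \<le> ?w x" for j
  proof (rule AE_I2)
   fix x
   show "norm (g x * conv (kern j) ?I x) \<le> ?w x"
    using b1[of j x] v[of j] by (cases "R + 1 < norm x") (auto simp: norm_mult vanishes_beyond_def mult_left_le)
  qed
  have "(\<lambda>j. \<integral>x. g x * conv (kern j) ?I x \<partial>lborel) \<longlonglongrightarrow> (\<integral>x. g x * ?I x \<partial>lborel)"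
   by (rule integral_dominated_convergence[OF _ _ wi lim bd]) measurable
  then have "(\<integral>x. g x * ?I x \<partial>lborel) = 0"
   unfolding zero[OF t] by (rule LIMSEQ_unique[OF _ tendsto_const])
  moreover have "integrable lborel (\<lambda>x. g x * ?I x)"
  proof (rule Bochner_Integration.integrable_bound[OF wi])
   show "AE x in lborel. norm (g x * ?I x) \<le> norm (?w x)"
   proof (rule AE_I2)
    fix x
    have "x \<in> box a b ==> norm x \<le> R + 1" using subsetD[OF R(2), of x] by simp
    then show "norm (g x * ?I x) \<le> norm (?w x)" by (auto simp: norm_mult indicator_def)
   qed
  qed measurable
  ultimately show ?thesis by blast
 qed
 have Re0: "AE x in lborel. Re (g x) = 0"
 proof (rule real_AE_zero_of_boxes)
  fix a b
  have e: "Re (g x) * indicator (box a b) x = Re (g x * indicator (box a b) x)" for x by (simp add: indicator_def)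
  show "integrable lborel (\<lambda>x. Re (g x) * indicator (box a b) x)" unfolding e using box[of a b] by (intro integrable_Re) simp
  show "(\<integral>x. Re (g x) * indicator (box a b) x \<partial>lborel) = 0" unfolding e using box[of a b] by (subst integral_Re) simp_all
 qed measurable
 have Im0: "AE x in lborel. Im (g x) = 0"
 proof (rule real_AE_zero_of_boxes)
  fix a b
  have e: "Im (g x) * indicator (box a b) x = Im (g x * indicator (box a b) x)" for x by (simp add: indicator_def)
  show "integrable lborel (\<lambda>x. Im (g x) * indicator (box a b) x)" unfolding e using box[of a b] by (intro integrable_Im) simp
  show "(\<integral>x. Im (g x) * indicator (box a b) x \<partial>lborel) = 0" unfolding e using box[of a b] by (subst integral_Im) simp_all
 qed measurable
 from Re0 Im0 show ?thesis by eventually_elim (simp add: complex_eq_iff)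
qed

section \<open>Decay at infinity\<close>

lemma integrable_inverse_prod:
 "integrable lborel (\<lambda>x::real^'n. complex_of_real (\<Prod>b\<in>Basis. inverse (1 + (x \<bullet> b)\<^sup>2)))"
proof -
 have "integrable lborel (\<lambda>x::real. inverse (1 + x\<^sup>2))"
  using integrable_inverse_1_plus_square by (simp add: set_integrable_def einterval_def)
 then have "integrable lborel (\<lambda>r. complex_of_real (inverse (1 + r\<^sup>2)))" by (simp only: complex_of_real_integrable_eq)
 from integral_lborel_prod(1)[OF this, where 'a="real^'n"]
 show ?thesis by simp
qed

text \<open>The exponent is dictated by the majorant, a product of n factors 1 / (1 + x_i^2), each
  of which is at least 1 / (1 + |x|)^2.\<close>

lemma decay_integrable:
 fixes f :: "real^'n => complex"
 assumes [measurable]: "f \<in> borel_measurable borel"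
  and C: "\<And>x. (1 + norm x) ^ (2 * CARD('n)) * norm (f x) \<le> C"
 shows "integrable lborel f" "l2sq lborel f < \<infinity>"
proof -
 have C0: "0 \<le> C" using order_trans[OF _ C[of 0]] by simp
 let ?p = "\<lambda>x::real^'n. (\<Prod>b\<in>Basis. inverse (1 + (x \<bullet> b)\<^sup>2))"
 have p0: "0 < ?p x" for x by (intro prod_pos) (auto simp: add_pos_nonneg)
 have bd: "norm (f x) \<le> C * ?p x" for x
 proof -
  have "(\<Prod>b\<in>Basis. (1 + (x \<bullet> b)\<^sup>2)) \<le> (\<Prod>b\<in>(Basis::(real^'n) set). (1 + norm x)\<^sup>2)"
  proof (intro prod_mono conjI)
   fix b :: "real^'n" assume b: "b \<in> Basis"
   have "(x \<bullet> b)\<^sup>2 \<le> (norm x)\<^sup>2" using Basis_le_norm[OF b, of x] by (simp add: abs_le_square_iff[symmetric])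
   then show "1 + (x \<bullet> b)\<^sup>2 \<le> (1 + norm x)\<^sup>2" by (simp add: power2_sum add_increasing2)
  qed simp
  also have "\<dots> = (1 + norm x) ^ (2 * CARD('n))" by (simp add: power_mult)
  finally have "(\<Prod>b\<in>Basis. (1 + (x \<bullet> b)\<^sup>2)) * norm (f x) \<le> C"
   using C[of x] by (meson mult_right_mono norm_ge_zero order_trans)
  moreover have "?p x = inverse (\<Prod>b\<in>Basis. (1 + (x \<bullet> b)\<^sup>2))" by (simp add: prod_inversef[symmetric] o_def)
  moreover have "0 < (\<Prod>b\<in>Basis. (1 + (x \<bullet> b)\<^sup>2))" by (intro prod_pos) (auto simp: add_pos_nonneg)
  ultimately show ?thesis by (simp add: field_simps)
 qed
 have pi: "integrable lborel (\<lambda>x. complex_of_real (C * ?p x))"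
  using integrable_mult_right[OF integrable_inverse_prod, of "of_real C"] by simp
 show fi: "integrable lborel f"
 proof (rule Bochner_Integration.integrable_bound[OF pi])
  show "AE x in lborel. norm (f x) \<le> norm (complex_of_real (C * ?p x))"
   unfolding norm_of_real by (intro AE_I2 order_trans[OF bd abs_ge_self])
 qed simp
 have fC: "norm (f x) \<le> C" for x
 proof -
  have "1 * norm (f x) \<le> (1 + norm x) ^ (2 * CARD('n)) * norm (f x)"
   by (intro mult_right_mono one_le_power) auto
  then show ?thesis using C[of x] by simp
 qed
 have "l2sq lborel f \<le> (\<integral>\<^sup>+x. ennreal C * ennreal (norm (f x)) \<partial>lborel)"
  unfolding l2sq_def
  by (intro nn_integral_mono)
    (use fC C0 in \<open>auto simp: power2_eq_square intro!: ennreal_leI mult_right_mono simp flip: ennreal_mult'\<close>)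
 also have "\<dots> = ennreal C * (\<integral>\<^sup>+x. ennreal (norm (f x)) \<partial>lborel)" by (rule nn_integral_cmult) measurable
 also have "\<dots> < \<infinity>" using fi by (simp add: integrable_iff_bounded ennreal_mult_less_top)
 finally show "l2sq lborel f < \<infinity>" .
qed

lemma C_k_iter_deriv_test: "f \<in> test_functions ==> iter_deriv b f \<in> test_functions"
proof -
 assume f: "f \<in> test_functions"
 then obtain R where "vanishes_beyond R f" by (rule test_functions_vanish)
 then have "vanishes_beyond R (iter_deriv b f)" by (rule vanishes_beyond_iter_deriv)
 moreover have "C_k k (iter_deriv b f)" for k by (rule C_k_iter_deriv[OF test_C_k[OF f]])
 ultimately show ?thesis by (rule test_functionsI[rotated])
qed

lemma test_bounded_decay:
 assumes f: "f \<in> test_functions"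
 obtains C where "\<And>x. (1 + norm x) ^ k * norm (f x) \<le> C"
proof -
 obtain R where R: "0 < R" "vanishes_beyond R f" using f by (rule test_functions_vanish)
 obtain B where B: "0 < B" "\<And>x. norm (f x) \<le> B"
  using continuous_vanishing_bounded[OF test_continuous[OF f] R(2)] by blast
 have "(1 + norm x) ^ k * norm (f x) \<le> (1 + R) ^ k * B" for x
 proof (cases "R < norm x")
  case True
  then show ?thesis using R B by (simp add: vanishes_beyond_def)
 next
  case False
  then show ?thesis using R B by (intro mult_mono power_mono) auto
 qed
 then show ?thesis by (rule that)
qed

lemma test_integrable:
 fixes f :: "real^'n => complex"
 assumes "f \<in> test_functions"
 shows "integrable lborel f" "l2sq lborel f < \<infinity>"
proof -
 obtain C where C: "\<And>x. (1 + norm x) ^ (2 * CARD('n)) * norm (f x) \<le> C" using assms by (rule test_bounded_decay) blast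
 show "integrable lborel f" "l2sq lborel f < \<infinity>"
  using decay_integrable[OF test_measurable[OF assms] C] by auto
qed

lemma test_imp_schwartz: "f \<in> test_functions ==> f \<in> schwartz_functions"
proof -
 assume f: "f \<in> test_functions"
 have "\<exists>C. \<forall>x. (1 + norm x) ^ k * norm (iter_deriv b f x) \<le> C" for k b
 proof -
  obtain C where "\<And>x. (1 + norm x) ^ k * norm (iter_deriv b f x) \<le> C"
   using test_bounded_decay[OF C_k_iter_deriv_test[OF f, of b], of k] by blast
  then show ?thesis by (intro exI allI)
 qed
 then show ?thesis using test_C_k[OF f] by (simp add: schwartz_functions_def)
qed

lemma schwartz_integrable:
 fixes f :: "real^'n => complex"
 assumes "f \<in> schwartz_functions"
 shows "integrable lborel f" "l2sq lborel f < \<infinity>"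
proof -
 have "\<exists>C. \<forall>x. (1 + norm x) ^ (2 * CARD('n)) * norm (iter_deriv [] f x) \<le> C"
  using assms unfolding schwartz_functions_def by blast
 then obtain C where C: "\<And>x. (1 + norm x) ^ (2 * CARD('n)) * norm (f x) \<le> C" by auto
 have "C_k 0 f" using assms by (simp add: schwartz_functions_def del: C_k.simps)
 then have "f \<in> borel_measurable borel" by (intro borel_measurable_continuous_onI) simp
 from decay_integrable[OF this C] show "integrable lborel f" "l2sq lborel f < \<infinity>" by auto
qed

text \<open>Convolution of g with the constant 1 is a constant function whose value is the integral
  of g. Its derivative is 0, and by \<open>conv_partial_deriv\<close> it is also the integral of the
  partial derivative.\<close>

lemma integral_partial_deriv_zero:
 fixes g :: "real^'n => complex"
 assumes g: "C_k (Suc 0) g" "vanishes_beyond R g"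
 shows "(\<integral>x. partial_deriv i g x \<partial>lborel) = 0"
proof -
 have gm [measurable]: "g \<in> borel_measurable borel"
  by (rule borel_measurable_continuous_onI[OF C_k_continuous[OF g(1)]])
 have pm: "partial_deriv i g \<in> borel_measurable borel"
  using g(1) by (intro borel_measurable_continuous_onI) simp
 have li: "loc_int (\<lambda>x::real^'n. 1)" by (rule continuous_loc_int) (rule continuous_on_const)
 have c: "conv f (\<lambda>x. 1) = (\<lambda>x. \<integral>y. f y \<partial>lborel)" if "f \<in> borel_measurable borel" for f :: "real^'n => complex"
  by (rule ext) (simp add: conv_def integral_lborel_reflect[OF that])
 have "partial_deriv i (conv g (\<lambda>x. 1)) = conv (partial_deriv i g) (\<lambda>x. 1)"
  by (rule conv_partial_deriv[OF g li])
 then have "partial_deriv i (\<lambda>x::real^'n. \<integral>y. g y \<partial>lborel) = (\<lambda>x. \<integral>y. partial_deriv i g y \<partial>lborel)"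
  by (simp only: c[OF gm] c[OF pm])
 moreover have "partial_deriv i (\<lambda>x::real^'n. \<integral>y. g y \<partial>lborel) 0 = 0"
  by (simp add: partial_deriv_eq[OF has_derivative_const])
 ultimately show ?thesis by (metis (no_types))
qed

text \<open>Integration by parts, obtained from \<open>integral_partial_deriv_zero\<close> for the
  product of \<open>f\<close> with the character.\<close>

lemma fourier_integral_partial_deriv:
 fixes f :: "real^'n => complex"
 assumes f: "f \<in> test_functions"
 shows "fourier_integral (partial_deriv i f) \<xi> = \<i> * of_real (\<xi> $ i) * fourier_integral f \<xi>"
proof -
 obtain R where R: "0 < R" "vanishes_beyond R f" using f by (rule test_functions_vanish)
 let ?g = "\<lambda>x. cis (- (\<xi> \<bullet> x)) * f x"
 have fd: "f differentiable (at x)" for x using test_C_k[OF f, of "Suc 0"] by simp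
 have d: "(?g has_derivative (\<lambda>h. \<Sum>k\<in>UNIV. h $ k *\<^sub>R (- \<i> * of_real (\<xi> $ k) * ?g x + cis (- (\<xi> \<bullet> x)) * partial_deriv k f x))) (at x)" for x
 proof -
  have "((\<lambda>x. cis (- (\<xi> \<bullet> x))) has_derivative (\<lambda>h. (- (\<xi> \<bullet> h)) *\<^sub>R (\<i> * cis (- (\<xi> \<bullet> x))))) (at x)"
  proof -
   have "(cis has_derivative (\<lambda>h. h *\<^sub>R (\<i> * cis (- (\<xi> \<bullet> x))))) (at (- (\<xi> \<bullet> x)))"
   proof -
    have "((\<lambda>t. \<i> * complex_of_real t) has_derivative (\<lambda>h. \<i> * complex_of_real h)) (at (- (\<xi> \<bullet> x)))"
     by (intro has_derivative_mult_right has_derivative_of_real has_derivative_ident)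
    from has_derivative_compose[OF this DERIV_exp[unfolded has_field_derivative_def]]
    show ?thesis unfolding cis_conv_exp[abs_def]
     by (rule has_derivative_eq_rhs) (simp add: fun_eq_iff scaleR_conv_of_real mult_ac)
   qed
   moreover have "((\<lambda>x. - (\<xi> \<bullet> x)) has_derivative (\<lambda>h. - (\<xi> \<bullet> h))) (at x)" by (auto intro!: derivative_eq_intros)
   ultimately show ?thesis by (rule has_derivative_compose[rotated])
  qed
  from has_derivative_mult[OF this has_derivative_partial[OF fd]]
  show ?thesis
  proof (rule has_derivative_eq_rhs, intro ext)
   fix h
   have E: "- (\<xi> \<bullet> h) *\<^sub>R (\<i> * cis (- (\<xi> \<bullet> x))) * f x = (\<Sum>k\<in>UNIV. h $ k *\<^sub>R (- \<i> * of_real (\<xi> $ k) * ?g x))"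
    unfolding inner_vec_def by (simp add: scaleR_conv_of_real[where 'a=complex] sum_distrib_left sum_distrib_right sum_negf mult_ac)
   show "cis (- (\<xi> \<bullet> x)) * (\<Sum>i\<in>UNIV. h $ i *\<^sub>R partial_deriv i f x) + (- (\<xi> \<bullet> h)) *\<^sub>R (\<i> * cis (- (\<xi> \<bullet> x))) * f x
    = (\<Sum>k\<in>UNIV. h $ k *\<^sub>R (- \<i> * of_real (\<xi> $ k) * ?g x + cis (- (\<xi> \<bullet> x)) * partial_deriv k f x))"
    unfolding E by (simp only: scaleR_right_distrib sum.distrib sum_distrib_left mult_scaleR_right add.commute)
  qed
 qed
 have pd: "partial_deriv k ?g = (\<lambda>x. - \<i> * of_real (\<xi> $ k) * ?g x + cis (- (\<xi> \<bullet> x)) * partial_deriv k f x)" for k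
  by (rule ext) (rule partial_deriv_eqI[OF d])
 have dt: "partial_deriv k f \<in> test_functions" for k using C_k_iter_deriv_test[OF f, of "[k]"] by simp
 have "C_k (Suc 0) ?g"
  unfolding C_k.simps pd
 proof (intro conjI allI)
  show "?g differentiable (at x)" for x using d differentiableI by blast
 qed (intro continuous_intros test_continuous f dt)
 moreover have "vanishes_beyond R ?g" using R by (simp add: vanishes_beyond_def)
 ultimately have "(\<integral>x. - \<i> * of_real (\<xi> $ i) * ?g x + cis (- (\<xi> \<bullet> x)) * partial_deriv i f x \<partial>lborel) = 0"
  using integral_partial_deriv_zero[of ?g R i] unfolding pd by simp
 moreover have "integrable lborel ?g" "integrable lborel (\<lambda>x. cis (- (\<xi> \<bullet> x)) * partial_deriv i f x)"
  using integrable_cis_mult[OF test_integrable(1)[OF f], of "-1" \<xi>] integrable_cis_mult[OF test_integrable(1)[OF dt], of "-1" \<xi>] by auto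
 ultimately have "- \<i> * of_real (\<xi> $ i) * (\<integral>x. ?g x \<partial>lborel) + (\<integral>x. cis (- (\<xi> \<bullet> x)) * partial_deriv i f x \<partial>lborel) = 0"
  by (subst (asm) Bochner_Integration.integral_add) (simp_all add: mult.assoc)
 then show ?thesis by (simp add: fourier_integral_eq mult_ac add_eq_0_iff2)
qed

lemma fourier_integral_iter_deriv:
 "f \<in> test_functions ==> fourier_integral (iter_deriv (replicate L i) f) \<xi> = (\<i> * of_real (\<xi> $ i)) ^ L * fourier_integral f \<xi>"
 by (induction L) (auto simp: fourier_integral_partial_deriv C_k_iter_deriv_test)

lemma fourier_integral_decay:
 fixes f :: "real^'n => complex"
 assumes f: "f \<in> test_functions"
 obtains C where "0 < C" "\<And>\<xi>. (1 + norm \<xi>) ^ L * norm (fourier_integral f \<xi>) \<le> C"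
proof -
 have "\<exists>B. \<forall>\<xi>. \<bar>\<xi> $ i\<bar> ^ L * norm (fourier_integral f \<xi>) \<le> B" for i
 proof -
  have "\<bar>\<xi> $ i\<bar> ^ L * norm (fourier_integral f \<xi>) = norm (fourier_integral (iter_deriv (replicate L i) f) \<xi>)" for \<xi>
   by (simp add: fourier_integral_iter_deriv[OF f] norm_mult norm_power)
  then show ?thesis using fourier_integral_bound[of "iter_deriv (replicate L i) f"] by auto
 qed
 then have "\<forall>i. \<exists>B. \<forall>\<xi>. \<bar>\<xi> $ i\<bar> ^ L * norm (fourier_integral f \<xi>) \<le> B" by blast
 from choice[OF this] obtain B where B: "\<And>i \<xi>. \<bar>\<xi> $ i\<bar> ^ L * norm (fourier_integral f \<xi>) \<le> B i" by blast
 define B0 where "B0 = fconst TYPE('n) * (\<integral>x. norm (f x) \<partial>lborel)"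
 have B0: "norm (fourier_integral f \<xi>) \<le> B0" for \<xi> unfolding B0_def by (rule fourier_integral_bound)
 define C where "C = (real CARD('n) + 1) ^ L * (B0 + sum B UNIV)"
 have le: "(1 + norm \<xi>) ^ L * norm (fourier_integral f \<xi>) \<le> C" for \<xi>
 proof -
  \<comment> \<open>The largest coordinate of \<xi> controls |\<xi>| up to the factor n, and the
    pure derivative in that coordinate supplies the decay.\<close>
  define m where "m = Max (range (\<lambda>i. \<bar>\<xi> $ i\<bar>))"
  have mi: "\<bar>\<xi> $ i\<bar> \<le> m" for i unfolding m_def by (rule Max_ge) auto
  have "m \<in> range (\<lambda>i. \<bar>\<xi> $ i\<bar>)" unfolding m_def by (rule Max_in) auto
  then obtain k where k: "m = \<bar>\<xi> $ k\<bar>" by auto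
  have "norm \<xi> \<le> (\<Sum>i\<in>UNIV. \<bar>\<xi> $ i\<bar>)" by (rule norm_le_l1_cart)
  also have "\<dots> \<le> (\<Sum>i\<in>(UNIV::'n set). m)" by (intro sum_mono mi)
  finally have "1 + norm \<xi> \<le> (real CARD('n) + 1) * max 1 m" using k by (simp add: distrib_right max_def mult_left_mono not_le)
   (smt (verit) mult_left_mono of_nat_0_le_iff mult_cancel_left1)
  then have "(1 + norm \<xi>) ^ L \<le> ((real CARD('n) + 1) * max 1 m) ^ L" by (rule power_mono) simp
  also have "\<dots> = (real CARD('n) + 1) ^ L * (max 1 m) ^ L" by (rule power_mult_distrib)
  also have "\<dots> \<le> (real CARD('n) + 1) ^ L * (1 + \<bar>\<xi> $ k\<bar> ^ L)"
   by (intro mult_left_mono) (auto simp: max_def k)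
  finally have "(1 + norm \<xi>) ^ L * norm (fourier_integral f \<xi>)
    \<le> (real CARD('n) + 1) ^ L * (1 + \<bar>\<xi> $ k\<bar> ^ L) * norm (fourier_integral f \<xi>)"
   by (rule mult_right_mono) simp
  also have "\<dots> = (real CARD('n) + 1) ^ L * (norm (fourier_integral f \<xi>) + \<bar>\<xi> $ k\<bar> ^ L * norm (fourier_integral f \<xi>))"
   by (simp add: algebra_simps)
  also have "\<dots> \<le> (real CARD('n) + 1) ^ L * (B0 + sum B UNIV)"
  proof (intro mult_left_mono add_mono B0)
   have "0 \<le> B i" for i using B[of 0 i] by (rule order_trans[rotated]) simp
   then have "B k \<le> sum B UNIV" by (intro member_le_sum) auto
   then show "\<bar>\<xi> $ k\<bar> ^ L * norm (fourier_integral f \<xi>) \<le> sum B UNIV" using B[where i=k and \<xi>=\<xi>] by simp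
  qed simp
  finally show ?thesis by (simp add: C_def)
 qed
 have "0 \<le> C" using le[of 0] by (rule order_trans[rotated]) simp
 show ?thesis
 proof (rule that[of "C + 1"])
  show "0 < C + 1" using \<open>0 \<le> C\<close> by simp
  show "(1 + norm \<xi>) ^ L * norm (fourier_integral f \<xi>) \<le> C + 1" for \<xi> using le[of \<xi>] by linarith
 qed
qed

section \<open>The Fourier transform on L2\<close>

text \<open>Stronger than \<open>is_fourier_transform\<close>: v ranges over all integrable and
  square integrable functions. Later v is a transform of a test function or a test function times a
  multiplier, for which these two properties are what has been established.\<close>

definition l2_fourier :: "(real^'n => complex) => (real^'n => complex) => bool" where
 "l2_fourier u g \<longleftrightarrow> g \<in> Lp 2 lborel \<and>
   (\<forall>v. integrable lborel v --> l2sq lborel v < \<infinity> -->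
    (\<integral>x. g x * v x \<partial>lborel) = (\<integral>x. u x * fourier_integral v x \<partial>lborel))"

lemma Lp2_borel: "f \<in> Lp 2 lborel ==> f \<in> borel_measurable borel"
 by (simp add: Lp2_iff)

lemma Lp2_fin: "f \<in> Lp 2 M ==> l2sq M f < \<infinity>"
 by (simp add: Lp2_iff)

lemma Lp2_loc_int: "f \<in> Lp 2 lborel ==> loc_int f"
 by (intro l2_loc_int) (auto simp: Lp2_iff)

lemma fourier_integral_diff:
 fixes f g :: "real^'n => complex"
 assumes "integrable lborel f" "integrable lborel g"
 shows "fourier_integral (\<lambda>x. f x - g x) \<xi> = fourier_integral f \<xi> - fourier_integral g \<xi>"
proof -
 have "(\<integral>x. cis (- (\<xi> \<bullet> x)) * f x - cis (- (\<xi> \<bullet> x)) * g x \<partial>lborel)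
   = (\<integral>x. cis (- (\<xi> \<bullet> x)) * f x \<partial>lborel) - (\<integral>x. cis (- (\<xi> \<bullet> x)) * g x \<partial>lborel)"
  using integrable_cis_mult[OF assms(1), of "-1" \<xi>] integrable_cis_mult[OF assms(2), of "-1" \<xi>]
  by (intro Bochner_Integration.integral_diff) auto
 then show ?thesis by (simp add: fourier_integral_eq right_diff_distrib)
qed

lemma l2sq_truncation_tendsto:
 fixes u :: "real^'n => complex"
 assumes u: "u \<in> Lp 2 lborel"
 shows "(\<lambda>k. l2sq lborel (\<lambda>x. u x * indicator (cball 0 (real k)) x - u x)) \<longlonglongrightarrow> 0"
proof -
 have [measurable]: "u \<in> borel_measurable borel" using u by (rule Lp2_borel)
 have "(\<lambda>k. \<integral>\<^sup>+x. ennreal ((norm (u x * indicator (cball 0 (real k)) x - u x))\<^sup>2) \<partial>lborel) \<longlonglongrightarrow> (\<integral>\<^sup>+x. (0::ennreal) \<partial>(lborel :: (real^'n) measure))"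
 proof (rule nn_integral_dominated_convergence[where w="\<lambda>x. ennreal ((norm (u x))\<^sup>2)"])
  show "(\<integral>\<^sup>+x. ennreal ((norm (u x))\<^sup>2) \<partial>lborel) < \<infinity>" using Lp2_fin[OF u] by (simp add: l2sq_def)
  show "AE x in lborel. (\<lambda>k. ennreal ((norm (u x * indicator (cball 0 (real k)) x - u x))\<^sup>2)) \<longlonglongrightarrow> 0"
  proof (rule AE_I2, rule tendsto_eventually)
   fix x :: "real^'n"
   obtain N :: nat where N: "norm x \<le> real N" using real_arch_simple by blast
   show "\<forall>\<^sub>F k in sequentially. ennreal ((norm (u x * indicator (cball 0 (real k)) x - u x))\<^sup>2) = 0"
    using eventually_ge_at_top[of N] by eventually_elim (use N in auto)
  qed
  show "AE x in lborel. ennreal ((norm (u x * indicator (cball 0 (real j)) x - u x))\<^sup>2) \<le> ennreal ((norm (u x))\<^sup>2)" for j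
   by (rule AE_I2) (auto simp: indicator_def)
 qed measurable
 then show ?thesis by (simp add: l2sq_def)
qed

text \<open>Truncations of u to balls are integrable, and \<open>l2sq_fourier_integral_le\<close>
  makes their transforms converge; the duality formula and the bound pass to the limit.\<close>

lemma l2_fourier_exists:
 fixes u :: "real^'n => complex"
 assumes u: "u \<in> Lp 2 lborel"
 obtains g where "l2_fourier u g" "l2sq lborel g \<le> l2sq lborel u"
proof -
 have um [measurable]: "u \<in> borel_measurable borel" using u by (rule Lp2_borel)
 define T where "T k x = u x * indicator (cball 0 (real k)) x" for k :: nat and x
 have Tm [measurable]: "T k \<in> borel_measurable borel" for k unfolding T_def by measurable
 have Tle: "l2sq lborel (T k) \<le> l2sq lborel u" for k
  by (rule l2sq_mono) (auto simp: T_def indicator_def)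
 have Ti: "integrable lborel (T k)" for k
 proof (rule integrableI_bounded)
  have "(\<integral>\<^sup>+x. ennreal (norm (T k x)) \<partial>lborel) = (\<integral>\<^sup>+x. ennreal (norm (u x)) * indicator (cball 0 (real k)) x \<partial>lborel)"
   by (intro nn_integral_cong) (auto simp: T_def indicator_def)
  then show "(\<integral>\<^sup>+x. ennreal (norm (T k x)) \<partial>lborel) < \<infinity>" using Lp2_loc_int[OF u] by (simp add: loc_int_def)
 qed measurable
 have lim0: "(\<lambda>k. l2sq lborel (\<lambda>x. T k x - u x)) \<longlonglongrightarrow> 0"
  unfolding T_def by (rule l2sq_truncation_tendsto[OF u])
 have "\<exists>k. l2sq lborel (\<lambda>x. T k x - u x) \<le> ennreal ((1/4) ^ N)" for N
 proof -
  have "\<forall>\<^sub>F k in sequentially. l2sq lborel (\<lambda>x. T k x - u x) < ennreal ((1/4) ^ N)"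
   by (rule order_tendstoD(2)[OF lim0]) simp
  then show ?thesis by (auto simp: eventually_sequentially intro: less_imp_le)
 qed
 then have "\<forall>N. \<exists>k. l2sq lborel (\<lambda>x. T k x - u x) \<le> ennreal ((1/4) ^ N)" by blast
 from choice[OF this] obtain r where r: "\<And>N. l2sq lborel (\<lambda>x. T (r N) x - u x) \<le> ennreal ((1/4) ^ N)" by blast
 \<comment> \<open>A selection with errors below 4^(-N): the successive differences of the
   transforms then form a geometric series, so the limit exists in L2 and almost everywhere.\<close>
 define U where "U N = T (r N)" for N
 define f where "f N = fourier_integral (U N)" for N
 have Um [measurable]: "U N \<in> borel_measurable borel" for N unfolding U_def by measurable
 have fm [measurable]: "f N \<in> borel_measurable borel" for N unfolding f_def by measurable
 have Ui: "integrable lborel (U N)" for N unfolding U_def by (rule Ti)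
 have fle: "l2sq lborel (f N) \<le> l2sq lborel u" for N
  unfolding f_def using l2sq_fourier_integral_le[OF Ui, of N] Tle[of "r N"] by (simp add: U_def)
 define D where "D N x = f (Suc N) x - f N x" for N x
 have Dm [measurable]: "D N \<in> borel_measurable lborel" for N unfolding D_def by measurable
 have Dle: "l2sq lborel (D N) \<le> ennreal (4 * (1/4) ^ N)" for N
 proof -
  have "l2sq lborel (D N) = l2sq lborel (fourier_integral (\<lambda>x. U (Suc N) x - U N x))"
   by (intro arg_cong[of _ _ "l2sq lborel"] ext) (simp add: D_def f_def fourier_integral_diff[OF Ui Ui])
  also have "\<dots> \<le> l2sq lborel (\<lambda>x. U (Suc N) x - U N x)"
   by (rule l2sq_fourier_integral_le) (intro Bochner_Integration.integrable_diff Ui)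
  also have "\<dots> = l2sq lborel (\<lambda>x. (U (Suc N) x - u x) - (U N x - u x))" by simp
  also have "\<dots> \<le> 2 * l2sq lborel (\<lambda>x. U (Suc N) x - u x) + 2 * l2sq lborel (\<lambda>x. U N x - u x)"
   by (rule l2sq_diff) measurable
  also have "\<dots> \<le> 2 * ennreal ((1/4) ^ N) + 2 * ennreal ((1/4) ^ N)"
  proof (intro add_mono mult_left_mono)
   show "l2sq lborel (\<lambda>x. U N x - u x) \<le> ennreal ((1/4) ^ N)" using r by (simp add: U_def)
   have "l2sq lborel (\<lambda>x. U (Suc N) x - u x) \<le> ennreal ((1/4) ^ Suc N)" unfolding U_def by (rule r)
   also have "\<dots> \<le> ennreal ((1/4) ^ N)" by (intro ennreal_leI power_decreasing) auto
   finally show "l2sq lborel (\<lambda>x. U (Suc N) x - u x) \<le> ennreal ((1/4) ^ N)" .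
  qed auto
  also have "\<dots> = ennreal (2 * (1/4) ^ N + 2 * (1/4) ^ N)" by (subst ennreal_plus) (simp_all add: ennreal_mult')
  also have "\<dots> = ennreal (4 * (1/4) ^ N)" by simp
  finally show ?thesis .
 qed
 have tel: "(\<Sum>N<K. D N x) = f K x - f 0 x" for K x
  unfolding D_def by (rule sum_lessThan_telescope)
 define g where "g x = (\<Sum>N. D N x) + f 0 x" for x
 have gm [measurable]: "g \<in> borel_measurable borel"
  unfolding g_def using l2_geometric_series(2)[of D lborel] by simp
 have gf: "(\<Sum>N. D N x) - (\<Sum>N<K. D N x) = g x - f K x" for K x by (simp add: g_def tel)
 have "(\<lambda>K. l2sq lborel (\<lambda>x. (\<Sum>N. D N x) - (\<Sum>N<K. D N x))) \<longlonglongrightarrow> 0"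
  by (rule l2_geometric_series_tendsto[OF Dm _ _ _ Dle]) auto
 then have lim: "(\<lambda>K. l2sq lborel (\<lambda>x. f K x - g x)) \<longlonglongrightarrow> 0"
  unfolding gf by (simp add: l2sq_commute[of lborel _ g])
 have "AE x in lborel. summable (\<lambda>N. norm (D N x))"
  by (rule l2_geometric_series(1)[OF Dm _ _ _ Dle]) auto
 then have pt: "AE x in lborel. (\<lambda>K. f K x) \<longlonglongrightarrow> g x"
 proof eventually_elim
  case (elim x)
  then have "(\<lambda>K. (\<Sum>N<K. D N x)) \<longlonglongrightarrow> (\<Sum>N. D N x)"
   by (rule summable_LIMSEQ[OF summable_norm_cancel])
  then have "(\<lambda>K. (\<Sum>N<K. D N x) + f 0 x) \<longlonglongrightarrow> g x" unfolding g_def by (intro tendsto_intros)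
  then show ?case by (simp add: tel)
 qed
 have gle: "l2sq lborel g \<le> l2sq lborel u"
  by (rule l2sq_le_liminf[OF _ pt fle]) simp
 have g2: "g \<in> Lp 2 lborel" using gle Lp2_fin[OF u] by (simp add: Lp2_iff)
 have "l2_fourier u g"
  unfolding l2_fourier_def
 proof (intro conjI allI impI g2)
  fix v :: "real^'n => complex" assume v: "integrable lborel v" "l2sq lborel v < \<infinity>"
  have vm [measurable]: "v \<in> borel_measurable borel" using v by auto
  have vh: "l2sq lborel (fourier_integral v) < \<infinity>" using l2sq_fourier_integral_le[OF v(1)] v(2) by simp
  have "(\<lambda>K. \<integral>x. f K x * v x \<partial>lborel) \<longlonglongrightarrow> (\<integral>x. g x * v x \<partial>lborel)"
   by (rule tendsto_integral_mult_l2[OF _ _ _ _ _ v(2) lim])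
     (use fle gle Lp2_fin[OF u] in \<open>auto intro: le_less_trans\<close>)
  moreover have "(\<lambda>K. \<integral>x. U K x * fourier_integral v x \<partial>lborel) \<longlonglongrightarrow> (\<integral>x. u x * fourier_integral v x \<partial>lborel)"
  proof (rule tendsto_integral_mult_l2[OF _ _ _ _ _ vh])
   show "l2sq lborel (U k) < \<infinity>" for k unfolding U_def using Tle[of "r k"] Lp2_fin[OF u] by (rule le_less_trans)
   show "l2sq lborel u < \<infinity>" by (rule Lp2_fin[OF u])
   show "(\<lambda>k. l2sq lborel (\<lambda>x. U k x - u x)) \<longlonglongrightarrow> 0"
   proof (rule tendsto_sandwich[OF _ _ tendsto_const])
    show "\<forall>\<^sub>F k in sequentially. l2sq lborel (\<lambda>x. U k x - u x) \<le> ennreal ((1/4) ^ k)"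
     unfolding U_def by (intro always_eventually allI r)
    have "(\<lambda>k. (1/4) ^ k :: real) \<longlonglongrightarrow> 0" by (intro LIMSEQ_realpow_zero) auto
    then show "(\<lambda>k. ennreal ((1/4) ^ k)) \<longlonglongrightarrow> 0" using tendsto_ennrealI by fastforce
   qed auto
  qed auto
  moreover have "(\<integral>x. f K x * v x \<partial>lborel) = (\<integral>x. U K x * fourier_integral v x \<partial>lborel)" for K
   unfolding f_def by (rule fourier_swap[OF Ui v(1)])
  ultimately show "(\<integral>x. g x * v x \<partial>lborel) = (\<integral>x. u x * fourier_integral v x \<partial>lborel)"
   by (simp add: LIMSEQ_unique)
 qed
 with gle show ?thesis by (intro that)
qed

lemma AE_eq_of_test_functions:
 fixes g h :: "real^'n => complex"
 assumes g: "g \<in> Lp 2 lborel" and h: "h \<in> Lp 2 lborel"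
  and eq: "\<And>\<phi>. \<phi> \<in> test_functions ==> (\<integral>x. g x * \<phi> x \<partial>lborel) = (\<integral>x. h x * \<phi> x \<partial>lborel)"
 shows "AE x in lborel. g x = h x"
proof -
 have "AE x in lborel. g x - h x = 0"
 proof (rule AE_zero_of_test_functions)
  show "loc_int (\<lambda>x. g x - h x)" by (intro Lp2_loc_int Lp2_diff g h)
  fix \<phi> :: "real^'n => complex" assume \<phi>: "\<phi> \<in> test_functions"
  have "integrable lborel (\<lambda>x. g x * \<phi> x)" "integrable lborel (\<lambda>x. h x * \<phi> x)"
   using Lp2_fin[OF g] Lp2_fin[OF h] test_integrable(2)[OF \<phi>] Lp2_borel[OF g] Lp2_borel[OF h] test_measurable[OF \<phi>]
   by (auto intro!: integrable_mult_l2)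
  then show "(\<integral>x. (g x - h x) * \<phi> x \<partial>lborel) = 0"
   using eq[OF \<phi>] by (simp add: left_diff_distrib)
 qed
 then show ?thesis by eventually_elim simp
qed

text \<open>\<open>fourier\<close> is a choice among all candidates tested against Schwartz
  functions. One candidate exists, so the choice has the property, and test functions, being
  Schwartz functions, determine it up to a null set.\<close>

lemma fourier_AE_eq_l2_fourier:
 fixes u :: "real^'n => complex"
 assumes g: "l2_fourier u g"
 shows "AE x in lborel. fourier u x = g x" "fourier u \<in> Lp 2 lborel"
proof -
 have "is_fourier_transform u g"
  using g schwartz_integrable unfolding l2_fourier_def is_fourier_transform_def by blast
 then have F: "is_fourier_transform u (fourier u)"
  unfolding fourier_def by (rule someI[of "is_fourier_transform u" g])
 then show f2: "fourier u \<in> Lp 2 lborel" by (simp add: is_fourier_transform_def)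
 show "AE x in lborel. fourier u x = g x"
 proof (rule AE_eq_of_test_functions[OF f2])
  show "g \<in> Lp 2 lborel" using g by (simp add: l2_fourier_def)
  fix \<phi> :: "real^'n => complex" assume \<phi>: "\<phi> \<in> test_functions"
  then have "(\<integral>x. fourier u x * \<phi> x \<partial>lborel) = (\<integral>x. u x * fourier_integral \<phi> x \<partial>lborel)"
   using F test_imp_schwartz unfolding is_fourier_transform_def by blast
  moreover have "(\<integral>x. g x * \<phi> x \<partial>lborel) = (\<integral>x. u x * fourier_integral \<phi> x \<partial>lborel)"
   using g test_integrable[OF \<phi>] unfolding l2_fourier_def by blast
  ultimately show "(\<integral>x. fourier u x * \<phi> x \<partial>lborel) = (\<integral>x. g x * \<phi> x \<partial>lborel)" by simp
 qed
qed

lemma fourier_Lp2: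
 assumes "u \<in> Lp 2 lborel"
 shows "fourier u \<in> Lp 2 lborel"
 using l2_fourier_exists[OF assms] fourier_AE_eq_l2_fourier(2) by blast

lemma fourier_l2sq_le:
 assumes "u \<in> Lp 2 lborel"
 shows "l2sq lborel (fourier u) \<le> l2sq lborel u"
proof -
 obtain g where g: "l2_fourier u g" "l2sq lborel g \<le> l2sq lborel u" using l2_fourier_exists[OF assms] by blast
 then show ?thesis using l2sq_cong_AE[OF fourier_AE_eq_l2_fourier(1)[OF g(1)]] by simp
qed

lemma fourier_duality:
 assumes u: "u \<in> Lp 2 lborel" and v: "integrable lborel v" "l2sq lborel v < \<infinity>"
 shows "(\<integral>x. fourier u x * v x \<partial>lborel) = (\<integral>x. u x * fourier_integral v x \<partial>lborel)"
proof -
 obtain g where g: "l2_fourier u g" using l2_fourier_exists[OF u] by blast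
 have [measurable]: "g \<in> borel_measurable borel" "v \<in> borel_measurable borel" "fourier u \<in> borel_measurable borel"
  using g v Lp2_borel[OF fourier_Lp2[OF u]] by (auto simp: l2_fourier_def Lp2_iff)
 have "(\<integral>x. fourier u x * v x \<partial>lborel) = (\<integral>x. g x * v x \<partial>lborel)"
  by (rule integral_cong_AE) (use fourier_AE_eq_l2_fourier(1)[OF g] in auto)
 then show ?thesis using g v by (simp add: l2_fourier_def)
qed

text \<open>The identification principle: a transform is computed by verifying the duality formula
  on test functions.\<close>

lemma fourier_unique:
 fixes u h :: "real^'n => complex"
 assumes u: "u \<in> Lp 2 lborel" and h: "h \<in> Lp 2 lborel"
  and eq: "\<And>\<phi>. \<phi> \<in> test_functions ==> (\<integral>x. h x * \<phi> x \<partial>lborel) = (\<integral>x. u x * fourier_integral \<phi> x \<partial>lborel)"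
 shows "AE x in lborel. fourier u x = h x"
proof (rule AE_eq_of_test_functions[OF fourier_Lp2[OF u] h])
 fix \<phi> :: "real^'n => complex" assume \<phi>: "\<phi> \<in> test_functions"
 show "(\<integral>x. fourier u x * \<phi> x \<partial>lborel) = (\<integral>x. h x * \<phi> x \<partial>lborel)"
  unfolding eq[OF \<phi>] by (rule fourier_duality[OF u test_integrable[OF \<phi>]])
qed

lemma fourier_lin_AE:
 fixes u v :: "real^'n => complex"
 assumes u: "u \<in> Lp 2 lborel" and v: "v \<in> Lp 2 lborel"
 shows "AE x in lborel. fourier (\<lambda>x. a * u x + b * v x) x = a * fourier u x + b * fourier v x"
proof (rule fourier_unique)
 show "(\<lambda>x. a * u x + b * v x) \<in> Lp 2 lborel" by (intro Lp2_add Lp2_cmult u v)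
 show "(\<lambda>x. a * fourier u x + b * fourier v x) \<in> Lp 2 lborel" by (intro Lp2_add Lp2_cmult fourier_Lp2 u v)
 fix \<phi> :: "real^'n => complex" assume \<phi>: "\<phi> \<in> test_functions"
 note t = test_integrable[OF \<phi>]
 have pm: "\<phi> \<in> borel_measurable borel" using \<phi> by (rule test_measurable)
 have h: "l2sq lborel (fourier_integral \<phi>) < \<infinity>" using l2sq_fourier_integral_le[OF t(1)] t(2) by simp
 have i1: "integrable lborel (\<lambda>x. fourier w x * \<phi> x)" if "w \<in> Lp 2 lborel" for w
  using Lp2_fin[OF fourier_Lp2[OF that]] Lp2_borel[OF fourier_Lp2[OF that]] t(2) pm by (intro integrable_mult_l2) auto
 have i2: "integrable lborel (\<lambda>x. w x * fourier_integral \<phi> x)" if "w \<in> Lp 2 lborel" for w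
  using Lp2_fin[OF that] Lp2_borel[OF that] h pm by (intro integrable_mult_l2) auto
 have "(\<integral>x. (a * fourier u x + b * fourier v x) * \<phi> x \<partial>lborel)
   = a * (\<integral>x. fourier u x * \<phi> x \<partial>lborel) + b * (\<integral>x. fourier v x * \<phi> x \<partial>lborel)"
  using i1[OF u] i1[OF v] by (simp add: distrib_right mult.assoc)
 also have "\<dots> = a * (\<integral>x. u x * fourier_integral \<phi> x \<partial>lborel) + b * (\<integral>x. v x * fourier_integral \<phi> x \<partial>lborel)"
  by (simp add: fourier_duality[OF u t] fourier_duality[OF v t])
 also have "\<dots> = (\<integral>x. (a * u x + b * v x) * fourier_integral \<phi> x \<partial>lborel)"
  using i2[OF u] i2[OF v] by (simp add: distrib_right mult.assoc)
 finally show "(\<integral>x. (a * fourier u x + b * fourier v x) * \<phi> x \<partial>lborel) = (\<integral>x. (a * u x + b * v x) * fourier_integral \<phi> x \<partial>lborel)" .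
qed

lemma fourier_cong_AE:
 fixes u v :: "real^'n => complex"
 assumes u: "u \<in> Lp 2 lborel" and v: "v \<in> Lp 2 lborel" and eq: "AE x in lborel. u x = v x"
 shows "AE x in lborel. fourier u x = fourier v x"
proof (rule fourier_unique[OF u fourier_Lp2[OF v]])
 fix \<phi> :: "real^'n => complex" assume \<phi>: "\<phi> \<in> test_functions"
 have [measurable]: "\<phi> \<in> borel_measurable borel" "u \<in> borel_measurable borel" "v \<in> borel_measurable borel"
  using test_measurable[OF \<phi>] Lp2_borel u v by auto
 have "(\<integral>x. v x * fourier_integral \<phi> x \<partial>lborel) = (\<integral>x. u x * fourier_integral \<phi> x \<partial>lborel)"
  by (rule integral_cong_AE) (use eq in auto)
 then show "(\<integral>x. fourier v x * \<phi> x \<partial>lborel) = (\<integral>x. u x * fourier_integral \<phi> x \<partial>lborel)"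
  by (simp add: fourier_duality[OF v test_integrable[OF \<phi>]])
qed

lemma fourier_test_AE:
 assumes \<phi>: "\<phi> \<in> test_functions"
 shows "AE x in lborel. fourier \<phi> x = fourier_integral \<phi> x"
proof (rule fourier_unique)
 have pm: "\<phi> \<in> borel_measurable borel" using \<phi> by (rule test_measurable)
 show "\<phi> \<in> Lp 2 lborel" using test_integrable(2)[OF \<phi>] pm by (simp add: Lp2_iff)
 show "fourier_integral \<phi> \<in> Lp 2 lborel"
  using l2sq_fourier_integral_le[OF test_integrable(1)[OF \<phi>]] test_integrable(2)[OF \<phi>] fourier_integral_measurable[OF pm]
  by (auto simp: Lp2_iff)
 show "(\<integral>x. fourier_integral \<phi> x * \<psi> x \<partial>lborel) = (\<integral>x. \<phi> x * fourier_integral \<psi> x \<partial>lborel)" if "\<psi> \<in> test_functions" for \<psi>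
  by (intro fourier_swap test_integrable \<phi> that)
qed

lemma test_hat_integrable:
 fixes \<phi> :: "real^'n => complex"
 assumes \<phi>: "\<phi> \<in> test_functions"
 shows "integrable lborel (fourier_integral \<phi>)" "l2sq lborel (fourier_integral \<phi>) < \<infinity>"
proof -
 obtain C where "\<And>\<xi>. (1 + norm \<xi>) ^ (2 * CARD('n)) * norm (fourier_integral \<phi> \<xi>) \<le> C"
  using fourier_integral_decay[OF \<phi>] by blast
 from decay_integrable[OF fourier_integral_measurable[OF test_measurable[OF \<phi>]] this]
 show "integrable lborel (fourier_integral \<phi>)" "l2sq lborel (fourier_integral \<phi>) < \<infinity>" by auto
qed

text \<open>The inversion integral is damped by a Gaussian. By duality it becomes a Gaussian average
  of \<phi> around x and tends to \<phi> x; the damped integral itself converges by domination, the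
  transform of a test function being integrable.\<close>

lemma fourier_inversion_test:
 fixes \<phi> :: "real^'n => complex"
 assumes \<phi>: "\<phi> \<in> test_functions"
 shows "fourier_integral (fourier_integral \<phi>) (- x) = \<phi> x"
proof -
 let ?c = "fconst TYPE('n)"
 \<comment> \<open>A square, so that the averaging Gaussian has width 1 / (k + 1) and a substitution
   turns it into a fixed Gaussian.\<close>
 let ?e = "\<lambda>k::nat. 1 / (real (Suc k))\<^sup>2"
 have pm [measurable]: "\<phi> \<in> borel_measurable borel" using \<phi> by (rule test_measurable)
 obtain B where B: "0 < B" "\<And>x. norm (\<phi> x) \<le> B"
  using test_functions_vanish[OF \<phi>] continuous_vanishing_bounded[OF test_continuous[OF \<phi>]] by metis
 have cis: "cis (x \<bullet> \<xi>) = cis (- ((- x) \<bullet> \<xi>))" for \<xi> by simp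
 have gi: "integrable lborel (\<lambda>z::real^'n. complex_of_real (gauss 1 z))"
  using integral_gauss(1)[of 1 "0::real^'n"] by simp
 have step: "of_real ?c * (\<integral>\<xi>. fourier_integral \<phi> \<xi> * (cis (x \<bullet> \<xi>) * of_real (gauss (?e k) \<xi>)) \<partial>lborel)
   = of_real ?c * of_real ?c * (of_real ((2 * pi) powr (real CARD('n) / 2)) * (\<integral>z. \<phi> (x + (1 / real (Suc k)) *\<^sub>R z) * of_real (gauss 1 z) \<partial>lborel))" (is "_ = ?R k") for k
 proof -
  let ?s = "real (Suc k)"
  have e0: "0 < ?e k" by simp
  have "(\<integral>\<xi>. fourier_integral \<phi> \<xi> * (cis (x \<bullet> \<xi>) * of_real (gauss (?e k) \<xi>)) \<partial>lborel)
    = (\<integral>y. \<phi> y * fourier_integral (\<lambda>\<xi>. cis (- ((- x) \<bullet> \<xi>)) * of_real (gauss (?e k) \<xi>)) y \<partial>lborel)"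
   unfolding cis by (rule fourier_swap[OF test_integrable(1)[OF \<phi>] integral_gauss(1)[OF e0]])
  also have "\<dots> = (\<integral>y. of_real (?c * (2 * pi / ?e k) powr (real CARD('n) / 2)) * (\<phi> y * of_real (gauss (1 / ?e k) (y + - x))) \<partial>lborel)"
   by (simp only: fourier_gauss_modulated[OF e0]) (simp add: mult_ac)
  also have "\<dots> = of_real (?c * (2 * pi / ?e k) powr (real CARD('n) / 2)) * (\<integral>y. \<phi> y * of_real (gauss (1 / ?e k) (y + - x)) \<partial>lborel)"
   by simp
  also have "(\<integral>y. \<phi> y * of_real (gauss (1 / ?e k) (y + - x)) \<partial>lborel)
    = \<bar>1 / ?s\<bar> ^ DIM(real^'n) *\<^sub>R (\<integral>z. \<phi> (x + (1 / ?s) *\<^sub>R z) * of_real (gauss 1 z) \<partial>lborel)"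
  proof -
   have g1: "gauss (1 / ?e k) (x + (1 / ?s) *\<^sub>R z + - x) = gauss 1 z" for z :: "real^'n"
    by (simp add: gauss_def power_divide power_mult_distrib)
   have "(\<integral>y. \<phi> y * of_real (gauss (1 / ?e k) (y + - x)) \<partial>lborel)
    = \<bar>1 / ?s\<bar> ^ DIM(real^'n) *\<^sub>R (\<integral>z. \<phi> (x + (1 / ?s) *\<^sub>R z) * of_real (gauss (1 / ?e k) (x + (1 / ?s) *\<^sub>R z + - x)) \<partial>lborel)"
    by (rule integral_lborel_affine) auto
   then show ?thesis by (simp only: g1)
  qed
  also have "(2 * pi / ?e k) powr (real CARD('n) / 2) = (2 * pi) powr (real CARD('n) / 2) * ?s ^ CARD('n)"
  proof -
   have "2 * pi / ?e k = (2 * pi) * ?s powr 2" by simp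
   then have "(2 * pi / ?e k) powr (real CARD('n) / 2) = (2 * pi) powr (real CARD('n) / 2) * (?s powr 2) powr (real CARD('n) / 2)"
    by (simp only: powr_mult)
   also have "(?s powr 2) powr (real CARD('n) / 2) = ?s ^ CARD('n)" by (simp only: powr_powr) (simp add: powr_realpow)
   finally show ?thesis .
  qed
  finally show ?thesis by (simp add: scaleR_conv_of_real power_divide field_simps del: of_nat_Suc)
 qed
 have L: "(\<lambda>k. \<integral>\<xi>. fourier_integral \<phi> \<xi> * (cis (x \<bullet> \<xi>) * of_real (gauss (?e k) \<xi>)) \<partial>lborel)
   \<longlonglongrightarrow> (\<integral>\<xi>. fourier_integral \<phi> \<xi> * (cis (x \<bullet> \<xi>) * of_real 1) \<partial>lborel)"
 proof (rule integral_dominated_convergence[where w="\<lambda>\<xi>. norm (fourier_integral \<phi> \<xi>)"])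
  show "integrable lborel (\<lambda>\<xi>. norm (fourier_integral \<phi> \<xi>))" using test_hat_integrable(1)[OF \<phi>] by simp
  show "AE \<xi> in lborel. (\<lambda>k. fourier_integral \<phi> \<xi> * (cis (x \<bullet> \<xi>) * of_real (gauss (?e k) \<xi>))) \<longlonglongrightarrow> fourier_integral \<phi> \<xi> * (cis (x \<bullet> \<xi>) * of_real 1)"
  proof (rule AE_I2)
   fix \<xi> :: "real^'n"
   have "(\<lambda>k. (1 / real (Suc k))\<^sup>2) \<longlonglongrightarrow> 0\<^sup>2" by (intro tendsto_intros LIMSEQ_Suc[OF lim_1_over_n])
   then have e: "?e \<longlonglongrightarrow> 0" by (simp add: power_divide)
   have "(\<lambda>k. gauss (?e k) \<xi>) \<longlonglongrightarrow> exp (- 0 * (norm \<xi>)\<^sup>2 / 2)"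
    unfolding gauss_def by (intro tendsto_intros e) auto
   then have "(\<lambda>k. gauss (?e k) \<xi>) \<longlonglongrightarrow> 1" by simp
   then show "(\<lambda>k. fourier_integral \<phi> \<xi> * (cis (x \<bullet> \<xi>) * of_real (gauss (?e k) \<xi>))) \<longlonglongrightarrow> fourier_integral \<phi> \<xi> * (cis (x \<bullet> \<xi>) * of_real 1)"
    by (intro tendsto_intros)
  qed
  show "AE \<xi> in lborel. norm (fourier_integral \<phi> \<xi> * (cis (x \<bullet> \<xi>) * of_real (gauss (?e k) \<xi>))) \<le> norm (fourier_integral \<phi> \<xi>)" for k
   by (intro AE_I2) (simp add: norm_mult gauss_le_1 less_imp_le[OF gauss_pos] mult_left_le)
 qed measurable
 have R: "(\<lambda>k. \<integral>z. \<phi> (x + (1 / real (Suc k)) *\<^sub>R z) * of_real (gauss 1 z) \<partial>lborel) \<longlonglongrightarrow> (\<integral>z. \<phi> x * of_real (gauss 1 z) \<partial>(lborel :: (real^'n) measure))"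
 proof (rule integral_dominated_convergence[where w="\<lambda>z. B * gauss 1 z"])
  show "integrable lborel (\<lambda>z::real^'n. B * gauss 1 z)" using gi by (simp add: complex_of_real_integrable_eq)
  show "AE z in lborel. (\<lambda>k. \<phi> (x + (1 / real (Suc k)) *\<^sub>R z) * of_real (gauss 1 z)) \<longlonglongrightarrow> \<phi> x * of_real (gauss 1 z)"
  proof (rule AE_I2)
   fix z :: "real^'n"
   have "(\<lambda>k. x + (1 / real (Suc k)) *\<^sub>R z) \<longlonglongrightarrow> x + 0 *\<^sub>R z"
    by (intro tendsto_intros LIMSEQ_Suc[OF lim_1_over_n])
   then have t: "(\<lambda>k. x + (1 / real (Suc k)) *\<^sub>R z) \<longlonglongrightarrow> x" by simp
   have c: "isCont \<phi> x" using test_continuous[OF \<phi>] by (simp add: continuous_on_eq_continuous_at)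
   have "(\<lambda>k. \<phi> (x + (1 / real (Suc k)) *\<^sub>R z)) \<longlonglongrightarrow> \<phi> x"
    by (rule isCont_tendsto_compose[OF c t])
   then show "(\<lambda>k. \<phi> (x + (1 / real (Suc k)) *\<^sub>R z) * of_real (gauss 1 z)) \<longlonglongrightarrow> \<phi> x * of_real (gauss 1 z)"
    by (intro tendsto_intros)
  qed
  show "AE z in lborel. norm (\<phi> (x + (1 / real (Suc k)) *\<^sub>R z) * of_real (gauss 1 z)) \<le> B * gauss 1 z" for k
   by (intro AE_I2) (simp add: norm_mult less_imp_le[OF gauss_pos] mult_right_mono B)
 qed measurable
 have G: "(\<integral>z. \<phi> x * of_real (gauss 1 z) \<partial>(lborel :: (real^'n) measure)) = \<phi> x * of_real ((2 * pi) powr (real CARD('n) / 2))"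
  using integral_gauss(2)[of 1 "0::real^'n"] by (simp add: gauss_def)
 have "(\<lambda>k. of_real ?c * (\<integral>\<xi>. fourier_integral \<phi> \<xi> * (cis (x \<bullet> \<xi>) * of_real (gauss (?e k) \<xi>)) \<partial>lborel))
   \<longlonglongrightarrow> of_real ?c * (\<integral>\<xi>. fourier_integral \<phi> \<xi> * (cis (x \<bullet> \<xi>) * of_real 1) \<partial>lborel)"
  by (intro tendsto_intros L)
 moreover have "(\<lambda>k. of_real ?c * of_real ?c * (of_real ((2 * pi) powr (real CARD('n) / 2)) * (\<integral>z. \<phi> (x + (1 / real (Suc k)) *\<^sub>R z) * of_real (gauss 1 z) \<partial>lborel)))
   \<longlonglongrightarrow> of_real ?c * of_real ?c * (of_real ((2 * pi) powr (real CARD('n) / 2)) * (\<phi> x * of_real ((2 * pi) powr (real CARD('n) / 2))))"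
  unfolding G[symmetric] by (intro tendsto_intros R)
 ultimately have "of_real ?c * (\<integral>\<xi>. fourier_integral \<phi> \<xi> * (cis (x \<bullet> \<xi>) * of_real 1) \<partial>lborel)
   = of_real ?c * of_real ?c * (of_real ((2 * pi) powr (real CARD('n) / 2)) * (\<phi> x * of_real ((2 * pi) powr (real CARD('n) / 2))))"
  unfolding step by (rule LIMSEQ_unique)
 also have "\<dots> = \<phi> x * of_real (?c * (2 * pi) powr (real CARD('n) / 2)) * of_real (?c * (2 * pi) powr (real CARD('n) / 2))"
  by (simp add: mult_ac)
 also have "\<dots> = \<phi> x" by (simp only: fconst_mult) simp
 finally show ?thesis by (simp add: fourier_integral_eq[of "fourier_integral \<phi>"] mult.commute)
qed

text \<open>Reflection of the transform; membership in L2 and the norm identity are inherited from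
  \<open>fourier\<close>.\<close>

definition inv_fourier :: "(real^'n => complex) => real^'n => complex" where
 "inv_fourier g x = fourier g (- x)"

lemma l2sq_uminus_arg:
 fixes f :: "real^'n => complex"
 assumes [measurable]: "f \<in> borel_measurable borel"
 shows "l2sq lborel (\<lambda>x. f (- x)) = l2sq lborel f"
 using nn_integral_lborel_reflect[of "\<lambda>x. ennreal ((norm (f x))\<^sup>2)" 0] by (simp add: l2sq_def)

lemma inv_fourier_Lp2: "g \<in> Lp 2 lborel ==> inv_fourier g \<in> Lp 2 lborel"
proof -
 assume g: "g \<in> Lp 2 lborel"
 have m [measurable]: "fourier g \<in> borel_measurable borel" by (intro Lp2_borel fourier_Lp2 g)
 have "(\<lambda>x. fourier g (- x)) \<in> borel_measurable borel" by measurable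
 then show ?thesis
  using fourier_Lp2[OF g] l2sq_uminus_arg[OF m] by (simp add: Lp2_iff inv_fourier_def[abs_def])
qed

lemma test_uminus:
 assumes \<phi>: "\<phi> \<in> test_functions"
 shows "(\<lambda>x. \<phi> (- x)) \<in> test_functions"
proof -
 obtain R where "vanishes_beyond R \<phi>" using \<phi> by (rule test_functions_vanish)
 then have "vanishes_beyond R (\<lambda>x. \<phi> (- x))" by (simp add: vanishes_beyond_def)
 moreover have "C_k k (\<lambda>x. \<phi> (- x))" for k using C_k_scaled[OF test_C_k[OF \<phi>], of k 1 "-1"] by simp
 ultimately show ?thesis by (rule test_functionsI[rotated])
qed

lemma fourier_integral_uminus:
 fixes f :: "real^'n => complex"
 assumes [measurable]: "f \<in> borel_measurable borel"
 shows "fourier_integral (\<lambda>x. f (- x)) \<xi> = fourier_integral f (- \<xi>)"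
proof -
 have "(\<integral>x. cis (- (\<xi> \<bullet> (0 - x))) * f (- (0 - x)) \<partial>lborel) = (\<integral>x. cis (- (\<xi> \<bullet> x)) * f (- x) \<partial>lborel)"
  by (rule integral_lborel_reflect) measurable
 then show ?thesis by (simp add: fourier_integral_eq)
qed

text \<open>Duality, used twice, moves both transforms onto the reflected test function, where
  \<open>fourier_inversion_test\<close> applies. The second use pairs with the transform of a test
  function, admissible by \<open>test_hat_integrable\<close>.\<close>

lemma inv_fourier_fourier:
 assumes u: "u \<in> Lp 2 lborel"
 shows "AE x in lborel. inv_fourier (fourier u) x = u x"
proof (rule AE_eq_of_test_functions[OF inv_fourier_Lp2[OF fourier_Lp2[OF u]] u])
 fix \<phi> :: "real^'a => complex" assume \<phi>: "\<phi> \<in> test_functions"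
 have [measurable]: "\<phi> \<in> borel_measurable borel" "fourier (fourier u) \<in> borel_measurable borel"
  using test_measurable[OF \<phi>] Lp2_borel[OF fourier_Lp2[OF fourier_Lp2[OF u]]] by auto
 have "(\<integral>x. inv_fourier (fourier u) x * \<phi> x \<partial>lborel) = (\<integral>x. inv_fourier (fourier u) (0 - x) * \<phi> (0 - x) \<partial>lborel)"
  unfolding inv_fourier_def by (rule integral_lborel_reflect[symmetric]) measurable
 also have "\<dots> = (\<integral>x. fourier (fourier u) x * \<phi> (- x) \<partial>lborel)" by (simp add: inv_fourier_def)
 also have "\<dots> = (\<integral>x. fourier u x * fourier_integral (\<lambda>x. \<phi> (- x)) x \<partial>lborel)"
  by (intro fourier_duality fourier_Lp2 u test_integrable test_uminus \<phi>)
 also have "\<dots> = (\<integral>x. u x * fourier_integral (fourier_integral (\<lambda>x. \<phi> (- x))) x \<partial>lborel)"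
  by (intro fourier_duality u test_hat_integrable test_uminus \<phi>)
 also have "\<dots> = (\<integral>x. u x * \<phi> x \<partial>lborel)"
  using fourier_inversion_test[OF test_uminus[OF \<phi>], of "- x" for x] by simp
 finally show "(\<integral>x. inv_fourier (fourier u) x * \<phi> x \<partial>lborel) = (\<integral>x. u x * \<phi> x \<partial>lborel)" .
qed

text \<open>The converse of \<open>fourier_l2sq_le\<close> is the same inequality for the transform
  of u, combined with inversion.\<close>

lemma l2sq_fourier:
 assumes u: "u \<in> Lp 2 lborel"
 shows "l2sq lborel (fourier u) = l2sq lborel u"
proof (rule antisym)
 have "l2sq lborel u = l2sq lborel (inv_fourier (fourier u))"
  by (rule l2sq_cong_AE[OF inv_fourier_fourier[OF u], symmetric])
 also have "\<dots> = l2sq lborel (fourier (fourier u))"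
  unfolding inv_fourier_def by (intro l2sq_uminus_arg Lp2_borel fourier_Lp2 u)
 also have "\<dots> \<le> l2sq lborel (fourier u)" by (intro fourier_l2sq_le fourier_Lp2 u)
 finally show "l2sq lborel u \<le> l2sq lborel (fourier u)" .
qed (rule fourier_l2sq_le[OF u])

lemma l2sq_inv_fourier:
 assumes g: "g \<in> Lp 2 lborel"
 shows "l2sq lborel (inv_fourier g) = l2sq lborel g"
 using l2sq_uminus_arg[OF Lp2_borel[OF fourier_Lp2[OF g]]] l2sq_fourier[OF g]
 by (simp add: inv_fourier_def[abs_def])

lemma fourier_inv_fourier:
 assumes g: "g \<in> Lp 2 lborel"
 shows "AE x in lborel. fourier (inv_fourier g) x = g x"
proof (rule fourier_unique[OF inv_fourier_Lp2[OF g] g])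
 fix \<phi> :: "real^'a => complex" assume \<phi>: "\<phi> \<in> test_functions"
 have [measurable]: "\<phi> \<in> borel_measurable borel" "fourier g \<in> borel_measurable borel"
  using test_measurable[OF \<phi>] Lp2_borel[OF fourier_Lp2[OF g]] by auto
 have "(\<integral>x. inv_fourier g x * fourier_integral \<phi> x \<partial>lborel) = (\<integral>x. inv_fourier g (0 - x) * fourier_integral \<phi> (0 - x) \<partial>lborel)"
  unfolding inv_fourier_def by (rule integral_lborel_reflect[symmetric]) measurable
 also have "\<dots> = (\<integral>x. fourier g x * fourier_integral (\<lambda>x. \<phi> (- x)) x \<partial>lborel)"
  by (simp add: inv_fourier_def fourier_integral_uminus)
 also have "\<dots> = (\<integral>x. g x * fourier_integral (fourier_integral (\<lambda>x. \<phi> (- x))) x \<partial>lborel)"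
  by (intro fourier_duality g test_hat_integrable test_uminus \<phi>)
 also have "\<dots> = (\<integral>x. g x * \<phi> x \<partial>lborel)"
  using fourier_inversion_test[OF test_uminus[OF \<phi>], of "- x" for x] by simp
 finally show "(\<integral>x. g x * \<phi> x \<partial>lborel) = (\<integral>x. inv_fourier g x * fourier_integral \<phi> x \<partial>lborel)" ..
qed

lemma AE_eq_of_fourier_eq:
 assumes u: "u \<in> Lp 2 lborel" and v: "v \<in> Lp 2 lborel" and eq: "AE x in lborel. fourier u x = fourier v x"
 shows "AE x in lborel. u x = v x"
proof -
 have "AE x in lborel. fourier (\<lambda>x. 1 * u x + (-1) * v x) x = 0"
  using fourier_lin_AE[OF u v, of 1 "-1"] eq by eventually_elim simp
 moreover have m: "(\<lambda>x. 1 * u x + (-1) * v x) \<in> Lp 2 lborel" by (intro Lp2_add Lp2_cmult u v)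
 ultimately have "l2sq lborel (\<lambda>x. 1 * u x + (-1) * v x) = 0"
  using l2sq_fourier[OF m] fourier_Lp2[OF m] by (subst (asm) l2sq_zero_iff[symmetric]) (auto simp: Lp2_iff)
 then have "AE x in lborel. 1 * u x + (-1) * v x = 0"
  using m by (subst (asm) l2sq_zero_iff) (auto simp: Lp2_iff)
 then show ?thesis by eventually_elim simp
qed

section \<open>Fourier transform of a mollification\<close>

text \<open>Without the factor \<open>fconst\<close>: thus the value at 0 is 1, and the function is
  exactly the multiplier of convolution with the bump.\<close>

definition bump_hat :: "real^'n => complex" where
 "bump_hat \<zeta> = (\<integral>y. cis (- (\<zeta> \<bullet> y)) * of_real (bump y) \<partial>lborel)"

lemma bump_test: "(\<lambda>x. of_real (bump x) :: complex) \<in> test_functions"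
 by (rule test_functionsI[of _ 1, OF bump_C_k]) (auto simp: vanishes_beyond_def bump_eq_0)

lemma bump_hat_eq: "bump_hat \<zeta> = of_real (1 / fconst TYPE('n)) * fourier_integral (\<lambda>x. of_real (bump x)) (\<zeta>::real^'n)"
 using fconst_pos[where 'n='n] by (simp add: bump_hat_def fourier_integral_eq)

lemma bump_hat_measurable [measurable]: "bump_hat \<in> borel_measurable borel"
 unfolding bump_hat_eq[abs_def] using fourier_integral_measurable[OF test_measurable[OF bump_test]] by measurable

lemma bump_hat_decay:
 obtains C where "0 < C" "\<And>\<zeta>::real^'n. (1 + norm \<zeta>) ^ L * norm (bump_hat \<zeta>) \<le> C"
proof -
 obtain C where C: "0 < C" "\<And>\<zeta>::real^'n. (1 + norm \<zeta>) ^ L * norm (fourier_integral (\<lambda>x. of_real (bump x)) \<zeta>) \<le> C"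
  using fourier_integral_decay[OF bump_test] by blast
 show ?thesis
 proof (rule that[of "C / fconst TYPE('n)"])
  show "0 < C / fconst TYPE('n)" using C fconst_pos[where 'n='n] by simp
  show "(1 + norm \<zeta>) ^ L * norm (bump_hat \<zeta>) \<le> C / fconst TYPE('n)" for \<zeta> :: "real^'n"
  proof -
   have "(1 + norm \<zeta>) ^ L * norm (bump_hat \<zeta>) = ((1 + norm \<zeta>) ^ L * norm (fourier_integral (\<lambda>x. of_real (bump x)) \<zeta>)) / fconst TYPE('n)"
    using fconst_pos[where 'n='n] by (simp add: bump_hat_eq norm_mult norm_divide)
   also have "\<dots> \<le> C / fconst TYPE('n)" using C fconst_pos[where 'n='n] by (intro divide_right_mono) auto
   finally show ?thesis .
  qed
 qed
qed

text \<open>The bump is a probability density that vanishes for |y| \<ge> 1/2, and |exp (i t) - 1|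
  \<le> |t|; so the transform differs from 1 by at most 1/2. This makes the division in
  \<open>piece_hat\<close> safe.\<close>

lemma bump_hat_lower:
 fixes \<zeta> :: "real^'n"
 assumes "norm \<zeta> \<le> 1"
 shows "1 / 2 \<le> norm (bump_hat \<zeta>)"
proof -
 have bi: "integrable lborel (\<lambda>x::real^'n. of_real (bump x) :: complex)" by (rule test_integrable(1)[OF bump_test])
 have b1: "(\<integral>x. of_real (bump x) \<partial>(lborel::(real^'n) measure)) = (1::complex)"
  by (simp only: integral_complex_of_real bump_integral of_real_1)
 have ci: "integrable lborel (\<lambda>y. cis (- (\<zeta> \<bullet> y)) * (of_real (bump y) :: complex))"
  using integrable_cis_mult[OF bi, of "-1" \<zeta>] by simp
 have "bump_hat \<zeta> - 1 = (\<integral>y. cis (- (\<zeta> \<bullet> y)) * of_real (bump y) - of_real (bump y) \<partial>lborel)"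
  unfolding bump_hat_def Bochner_Integration.integral_diff[OF ci bi] by (simp only: b1)
 also have "norm \<dots> \<le> (\<integral>y. norm (cis (- (\<zeta> \<bullet> y)) * of_real (bump y) - (of_real (bump y)::complex)) \<partial>lborel)"
  by (rule integral_norm_bound)
 also have "\<dots> \<le> (\<integral>y. 1 / 2 * bump y \<partial>(lborel::(real^'n) measure))"
 proof (rule integral_mono)
  show "integrable lborel (\<lambda>y. norm (cis (- (\<zeta> \<bullet> y)) * of_real (bump y) - (of_real (bump y)::complex)))"
   by (intro integrable_norm Bochner_Integration.integrable_diff ci bi)
  show "integrable lborel (\<lambda>y::real^'n. 1 / 2 * bump y)" by (simp add: bump_integrable)
  fix y
  show "norm (cis (- (\<zeta> \<bullet> y)) * of_real (bump y) - (of_real (bump y)::complex)) \<le> 1 / 2 * bump y"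
  proof (cases "1 / 2 \<le> norm y")
   case True
   then show ?thesis by (simp add: bump_eq_0)
  next
   case False
   have "norm (cis (- (\<zeta> \<bullet> y)) - 1) \<le> \<bar>- (\<zeta> \<bullet> y)\<bar>"
    using iexp_approx1[of "- (\<zeta> \<bullet> y)" 0] by (simp add: cis_conv_exp)
   also have "\<dots> \<le> norm \<zeta> * norm y" using Cauchy_Schwarz_ineq2[of \<zeta> y] by simp
   also have "\<dots> \<le> 1 * (1 / 2)" using False assms by (intro mult_mono) auto
   finally have "norm (cis (- (\<zeta> \<bullet> y)) - 1) * bump y \<le> 1 / 2 * bump y"
    by (intro mult_right_mono) (auto simp: bump_nonneg)
   moreover have "cis (- (\<zeta> \<bullet> y)) * of_real (bump y) - (of_real (bump y)::complex) = (cis (- (\<zeta> \<bullet> y)) - 1) * of_real (bump y)"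
    by (simp add: left_diff_distrib)
   ultimately show ?thesis by (simp only: norm_mult norm_of_real abs_of_nonneg[OF bump_nonneg])
  qed
 qed
 also have "\<dots> = 1 / 2" by (simp add: bump_integral)
 finally have "norm (bump_hat \<zeta> - 1) \<le> 1 / 2" .
 then show ?thesis using norm_triangle_ineq2[of 1 "1 - bump_hat \<zeta>"] by (simp add: norm_minus_commute)
qed

lemma kern_hat: "(\<integral>z. kern j z * cis (- (\<xi> \<bullet> z)) \<partial>lborel) = bump_hat ((1 / 2 ^ j) *\<^sub>R (\<xi>::real^'n))"
proof -
 have "bump_hat ((1 / 2 ^ j) *\<^sub>R \<xi>)
  = \<bar>2 ^ j\<bar> ^ DIM(real^'n) *\<^sub>R (\<integral>y. cis (- (((1 / 2 ^ j) *\<^sub>R \<xi>) \<bullet> (0 + 2 ^ j *\<^sub>R y))) * of_real (bump (0 + 2 ^ j *\<^sub>R y)) \<partial>lborel)"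
  unfolding bump_hat_def by (rule integral_lborel_affine) auto
 also have "\<dots> = of_real ((2 ^ j) ^ CARD('n)) * (\<integral>y. cis (- (\<xi> \<bullet> y)) * of_real (bump (2 ^ j *\<^sub>R y)) \<partial>lborel)"
  by (simp add: scaleR_conv_of_real[where 'a=complex])
 also have "\<dots> = (\<integral>z. kern j z * cis (- (\<xi> \<bullet> z)) \<partial>lborel)"
  unfolding integral_mult_right_zero[symmetric] by (simp add: kern_eq mult_ac)
 finally show ?thesis ..
qed

text \<open>Integrates \<open>conv_kern_sq_bound\<close>, the kernel having mass 1 in x for each
  y.\<close>

lemma conv_kern_l2sq_le:
 fixes w :: "real^'n => complex"
 assumes [measurable]: "w \<in> borel_measurable borel"
 shows "l2sq lborel (conv (kern j) w) \<le> l2sq lborel w"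
proof -
 have "l2sq lborel (conv (kern j) w) \<le> (\<integral>\<^sup>+x. (\<integral>\<^sup>+y. ennreal (norm (kern j (x - y)) * (norm (w y))\<^sup>2) \<partial>lborel) \<partial>lborel)"
  unfolding l2sq_def by (intro nn_integral_mono conv_kern_sq_bound[OF assms])
 also have "\<dots> = (\<integral>\<^sup>+y. (\<integral>\<^sup>+x. ennreal (norm (kern j (x - y)) * (norm (w y))\<^sup>2) \<partial>lborel) \<partial>lborel)"
  by (rule Tonelli_lborel) measurable
 also have "\<dots> = (\<integral>\<^sup>+y. (\<integral>\<^sup>+x. ennreal (norm (kern j (x - y))) \<partial>lborel) * ennreal ((norm (w y))\<^sup>2) \<partial>lborel)"
  by (subst nn_integral_multc[symmetric]) (auto simp: ennreal_mult')
 finally have le: "l2sq lborel (conv (kern j) w) \<le> (\<integral>\<^sup>+y. (\<integral>\<^sup>+x. ennreal (norm (kern j (x - y))) \<partial>lborel) * ennreal ((norm (w y))\<^sup>2) \<partial>lborel)" .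
 have K1: "(\<integral>\<^sup>+x. ennreal (norm (kern j (x - y))) \<partial>lborel) = 1" for y :: "real^'n"
 proof -
  have "(\<integral>\<^sup>+x. ennreal (norm (kern j (x::real^'n))) \<partial>lborel) = ennreal (\<bar>1\<bar> ^ DIM(real^'n)) * (\<integral>\<^sup>+x. ennreal (norm (kern j (- y + 1 *\<^sub>R x))) \<partial>lborel)"
   by (rule nn_integral_lborel_affine[of "\<lambda>x. ennreal (norm (kern j x))" 1 "- y"]) auto
  then show ?thesis by (simp add: nn_integral_norm_kern)
 qed
 from le show ?thesis unfolding K1 by (simp add: l2sq_def)
qed

lemma conv_kern_Lp2:
 assumes w: "w \<in> Lp 2 lborel"
 shows "conv (kern j) w \<in> Lp 2 lborel"
proof -
 have "continuous_on UNIV (conv (kern j) w)" by (intro conv_kern_continuous Lp2_loc_int w)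
 then have "conv (kern j) w \<in> borel_measurable borel" by (rule borel_measurable_continuous_onI)
 then show ?thesis using conv_kern_l2sq_le[OF Lp2_borel[OF w], of j] Lp2_fin[OF w] by (auto simp: Lp2_iff)
qed

text \<open>By \<open>fourier_unique\<close>. One use of Fubini writes the transform of multiplier
  times test function as an integral of the kernel against the transformed test function; a second
  one moves the kernel away from \<open>w\<close>.\<close>

lemma fourier_conv_kern:
 fixes w :: "real^'n => complex"
 assumes w: "w \<in> Lp 2 lborel"
 shows "AE \<xi> in lborel. fourier (conv (kern j) w) \<xi> = bump_hat ((1 / 2 ^ j) *\<^sub>R \<xi>) * fourier w \<xi>"
proof (rule fourier_unique[OF conv_kern_Lp2[OF w]])
 have [measurable]: "w \<in> borel_measurable borel" "fourier w \<in> borel_measurable borel"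
  using Lp2_borel[OF w] Lp2_borel[OF fourier_Lp2[OF w]] by auto
 let ?b = "\<lambda>\<xi>::real^'n. bump_hat ((1 / 2 ^ j) *\<^sub>R \<xi>)"
 obtain B where B: "0 < B" "\<And>\<zeta>::real^'n. norm (bump_hat \<zeta>) \<le> B"
  using bump_hat_decay[of 0] by auto
 show "(\<lambda>\<xi>. ?b \<xi> * fourier w \<xi>) \<in> Lp 2 lborel"
 proof -
  have "l2sq lborel (\<lambda>\<xi>. ?b \<xi> * fourier w \<xi>) \<le> l2sq lborel (\<lambda>\<xi>. of_real B * fourier w \<xi>)"
   using B by (intro l2sq_mono) (auto simp: norm_mult intro!: mult_right_mono)
  also have "\<dots> < \<infinity>" using Lp2_fin[OF Lp2_cmult[OF fourier_Lp2[OF w]]] by blast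
  finally show ?thesis by (simp add: Lp2_iff)
 qed
 fix \<phi> :: "real^'n => complex" assume \<phi>: "\<phi> \<in> test_functions"
 have [measurable]: "\<phi> \<in> borel_measurable borel" using \<phi> by (rule test_measurable)
 let ?h = "fourier_integral \<phi>"
 have vi: "integrable lborel (\<lambda>\<xi>. ?b \<xi> * \<phi> \<xi>)" "l2sq lborel (\<lambda>\<xi>. ?b \<xi> * \<phi> \<xi>) < \<infinity>"
 proof -
  show "integrable lborel (\<lambda>\<xi>. ?b \<xi> * \<phi> \<xi>)"
   by (rule Bochner_Integration.integrable_bound[of _ "\<lambda>\<xi>. of_real B * \<phi> \<xi>"])
     (use B test_integrable(1)[OF \<phi>] in \<open>auto simp: norm_mult intro!: mult_right_mono AE_I2\<close>)
  have "l2sq lborel (\<lambda>\<xi>. ?b \<xi> * \<phi> \<xi>) \<le> l2sq lborel (\<lambda>\<xi>. of_real B * \<phi> \<xi>)"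
   using B by (intro l2sq_mono) (auto simp: norm_mult intro!: mult_right_mono)
  also have "\<dots> < \<infinity>" using test_integrable(2)[OF \<phi>] by (subst l2sq_cmult) (auto simp: ennreal_mult_less_top)
  finally show "l2sq lborel (\<lambda>\<xi>. ?b \<xi> * \<phi> \<xi>) < \<infinity>" .
 qed
 have hat: "fourier_integral (\<lambda>\<xi>. ?b \<xi> * \<phi> \<xi>) y = (\<integral>x. kern j (x - y) * ?h x \<partial>lborel)" for y
 proof -
  have "(\<integral>\<xi>. (\<integral>z. cis (- (y \<bullet> \<xi>)) * \<phi> \<xi> * (kern j z * cis (- (\<xi> \<bullet> z))) \<partial>lborel) \<partial>lborel)
    = (\<integral>z. (\<integral>\<xi>. cis (- (y \<bullet> \<xi>)) * \<phi> \<xi> * (kern j z * cis (- (\<xi> \<bullet> z))) \<partial>lborel) \<partial>lborel)"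
  proof (rule Fubini_lborel)
   have "(\<integral>\<^sup>+\<xi>. (\<integral>\<^sup>+z. ennreal (norm (cis (- (y \<bullet> \<xi>)) * \<phi> \<xi> * (kern j z * cis (- (\<xi> \<bullet> z))))) \<partial>lborel) \<partial>lborel)
     = (\<integral>\<^sup>+\<xi>. ennreal (norm (\<phi> \<xi>)) * (\<integral>\<^sup>+z. ennreal (norm (kern j (z::real^'n))) \<partial>lborel) \<partial>lborel)"
    by (subst nn_integral_cmult[symmetric]) (auto simp: norm_mult ennreal_mult')
   also have "\<dots> < \<infinity>" using test_integrable(1)[OF \<phi>] by (simp add: nn_integral_norm_kern integrable_iff_bounded)
   finally show "(\<integral>\<^sup>+\<xi>. (\<integral>\<^sup>+z. ennreal (norm (cis (- (y \<bullet> \<xi>)) * \<phi> \<xi> * (kern j z * cis (- (\<xi> \<bullet> z))))) \<partial>lborel) \<partial>lborel) < \<infinity>" .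
  qed measurable
  moreover have "(\<integral>z. cis (- (y \<bullet> \<xi>)) * \<phi> \<xi> * (kern j z * cis (- (\<xi> \<bullet> z))) \<partial>lborel) = cis (- (y \<bullet> \<xi>)) * \<phi> \<xi> * ?b \<xi>" for \<xi>
   by (simp only: integral_mult_right_zero kern_hat)
  moreover have "(\<integral>\<xi>. cis (- (y \<bullet> \<xi>)) * \<phi> \<xi> * (kern j z * cis (- (\<xi> \<bullet> z))) \<partial>lborel)
    = kern j z * (\<integral>\<xi>. cis (- ((y + z) \<bullet> \<xi>)) * \<phi> \<xi> \<partial>lborel)" for z
  proof -
   have "cis (- (y \<bullet> \<xi>)) * \<phi> \<xi> * (kern j z * cis (- (\<xi> \<bullet> z))) = kern j z * (cis (- ((y + z) \<bullet> \<xi>)) * \<phi> \<xi>)" for \<xi>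
   proof -
    have "cis (- ((y + z) \<bullet> \<xi>)) = cis (- (y \<bullet> \<xi>)) * cis (- (\<xi> \<bullet> z))"
     by (simp add: cis_mult inner_add_left inner_commute[of \<xi> z])
    then show ?thesis by simp
   qed
   then show ?thesis by (simp only: integral_mult_right_zero)
  qed
  ultimately have E: "(\<integral>\<xi>. cis (- (y \<bullet> \<xi>)) * \<phi> \<xi> * ?b \<xi> \<partial>lborel) = (\<integral>z. kern j z * (\<integral>\<xi>. cis (- ((y + z) \<bullet> \<xi>)) * \<phi> \<xi> \<partial>lborel) \<partial>lborel)"
   by (simp only:)
  let ?c = "of_real (fconst TYPE('n)) :: complex"
  have "fourier_integral (\<lambda>\<xi>. ?b \<xi> * \<phi> \<xi>) y = ?c * (\<integral>\<xi>. cis (- (y \<bullet> \<xi>)) * \<phi> \<xi> * ?b \<xi> \<partial>lborel)"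
   by (simp add: fourier_integral_eq mult_ac)
  also have "\<dots> = (\<integral>z. ?c * (kern j z * (\<integral>\<xi>. cis (- ((y + z) \<bullet> \<xi>)) * \<phi> \<xi> \<partial>lborel)) \<partial>lborel)"
   by (simp only: E integral_mult_right_zero)
  also have "\<dots> = (\<integral>z. kern j ((y + z) - y) * ?h (y + z) \<partial>lborel)"
   by (simp add: fourier_integral_eq mult_ac)
  also have "\<dots> = (\<integral>x. kern j (x - y) * ?h x \<partial>lborel)"
   by (rule integral_lborel_shift[of "\<lambda>x. kern j (x - y) * ?h x"]) measurable
  finally show ?thesis .
 qed
 have "(\<integral>x. conv (kern j) w x * ?h x \<partial>lborel) = (\<integral>x. (\<integral>y. kern j (x - y) * w y * ?h x \<partial>lborel) \<partial>lborel)"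
  by (simp add: conv_def)
 also have "\<dots> = (\<integral>y. (\<integral>x. kern j (x - y) * w y * ?h x \<partial>lborel) \<partial>lborel)"
 proof (rule Fubini_lborel)
  \<comment> \<open>Absolute convergence although \<open>w\<close> and \<open>?h\<close> enter only
    through L2: 2 |w y| |h x| \<le> |w y|^2 + |h x|^2, and each square meets a kernel of mass
    1.\<close>
  have "2 * (\<integral>\<^sup>+x. (\<integral>\<^sup>+y. ennreal (norm (kern j (x - y) * w y * ?h x)) \<partial>lborel) \<partial>lborel)
    = (\<integral>\<^sup>+x. (\<integral>\<^sup>+y. ennreal (2 * norm (kern j (x - y) * w y * ?h x)) \<partial>lborel) \<partial>lborel)"
   by (simp add: nn_integral_cmult ennreal_mult')
  also have "\<dots> \<le> (\<integral>\<^sup>+x. (\<integral>\<^sup>+y. ennreal (norm (kern j (x - y)) * (norm (w y))\<^sup>2) + ennreal (norm (kern j (x - y))) * ennreal ((norm (?h x))\<^sup>2) \<partial>lborel) \<partial>lborel)"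
  proof (intro nn_integral_mono)
   fix x y :: "real^'n"
   have "norm (kern j (x - y)) * (2 * norm (w y) * norm (?h x)) \<le> norm (kern j (x - y)) * ((norm (w y))\<^sup>2 + (norm (?h x))\<^sup>2)"
    using sum_squares_bound[of "norm (w y)" "norm (?h x)"] by (intro mult_left_mono) auto
   then have "2 * norm (kern j (x - y) * w y * ?h x) \<le> norm (kern j (x - y)) * (norm (w y))\<^sup>2 + norm (kern j (x - y)) * (norm (?h x))\<^sup>2"
    by (simp add: norm_mult algebra_simps)
   then show "ennreal (2 * norm (kern j (x - y) * w y * ?h x)) \<le> ennreal (norm (kern j (x - y)) * (norm (w y))\<^sup>2) + ennreal (norm (kern j (x - y))) * ennreal ((norm (?h x))\<^sup>2)"
    by (simp add: ennreal_leI flip: ennreal_mult' ennreal_plus)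
  qed
  also have "\<dots> = (\<integral>\<^sup>+x. (\<integral>\<^sup>+y. ennreal (norm (kern j (x - y)) * (norm (w y))\<^sup>2) \<partial>lborel) \<partial>lborel)
    + (\<integral>\<^sup>+x. (\<integral>\<^sup>+y. ennreal (norm (kern j (x - y :: real^'n))) \<partial>lborel) * ennreal ((norm (?h x))\<^sup>2) \<partial>lborel)"
   by (simp add: nn_integral_add nn_integral_multc)
  also have "(\<integral>\<^sup>+x. (\<integral>\<^sup>+y. ennreal (norm (kern j (x - y)) * (norm (w y))\<^sup>2) \<partial>lborel) \<partial>lborel)
    = (\<integral>\<^sup>+y. (\<integral>\<^sup>+x. ennreal (norm (kern j (x - y)) * (norm (w y))\<^sup>2) \<partial>lborel) \<partial>lborel)"
   by (rule Tonelli_lborel) measurable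
  also have "\<dots> = (\<integral>\<^sup>+y. (\<integral>\<^sup>+x. ennreal (norm (kern j (y - x))) \<partial>lborel) * ennreal ((norm (w y))\<^sup>2) \<partial>lborel)"
  proof -
   \<comment> \<open>The bump is even, since it depends on x only through x \<bullet> x.\<close>
   have "bump (2 ^ j *\<^sub>R (x - y)) = bump (2 ^ j *\<^sub>R (y - x))" for x y :: "real^'n"
   proof -
    have "(2 ^ j *\<^sub>R (x - y)) \<bullet> (2 ^ j *\<^sub>R (x - y)) = (2 ^ j *\<^sub>R (y - x)) \<bullet> (2 ^ j *\<^sub>R (y - x))"
     by (simp add: inner_diff_left inner_diff_right algebra_simps)
    then show ?thesis by (simp only: bump_def bump0_def)
   qed
   then have "norm (kern j (x - y)) = norm (kern j (y - x))" for x y :: "real^'n" by (simp add: norm_kern)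
   then show ?thesis by (subst nn_integral_multc[symmetric]) (auto simp: ennreal_mult')
  qed
  also have "\<dots> + (\<integral>\<^sup>+x. (\<integral>\<^sup>+y. ennreal (norm (kern j (x - y :: real^'n))) \<partial>lborel) * ennreal ((norm (?h x))\<^sup>2) \<partial>lborel)
    = l2sq lborel w + l2sq lborel ?h"
   by (simp add: nn_integral_norm_kern_shift l2sq_def)
  also have "\<dots> < \<infinity>" using Lp2_fin[OF w] test_hat_integrable(2)[OF \<phi>] by simp
  finally show "(\<integral>\<^sup>+x. (\<integral>\<^sup>+y. ennreal (norm (kern j (x - y) * w y * ?h x)) \<partial>lborel) \<partial>lborel) < \<infinity>"
   by (auto simp: ennreal_mult_less_top)
 qed measurable
 also have "\<dots> = (\<integral>y. w y * (\<integral>x. kern j (x - y) * ?h x \<partial>lborel) \<partial>lborel)"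
 proof -
  have "kern j (x - y) * w y * ?h x = w y * (kern j (x - y) * ?h x)" for x y by simp
  then show ?thesis by (simp only: integral_mult_right_zero)
 qed
 also have "(\<integral>y. w y * (\<integral>x. kern j (x - y) * ?h x \<partial>lborel) \<partial>lborel) = (\<integral>y. fourier w y * (?b y * \<phi> y) \<partial>lborel)"
  unfolding hat[symmetric] by (rule fourier_duality[OF w vi, symmetric])
 finally show "(\<integral>\<xi>. (?b \<xi> * fourier w \<xi>) * \<phi> \<xi> \<partial>lborel) = (\<integral>x. conv (kern j) w x * ?h x \<partial>lborel)"
  by (simp add: mult_ac)
qed

section \<open>Sums of mollified functions\<close>

lemma pow2_powr: "(2 ^ j :: real) powr a = (2 powr a) ^ j"
 by (simp add: powr_realpow[symmetric] powr_powr mult.commute)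

definition level_norm :: "real => (nat => real^'n => complex) => ennreal" where
 "level_norm s w = (\<Sum>j. ennreal ((2 ^ j) powr (2 * s)) * l2sq lborel (w j))"

definition synth :: "(nat => real^'n => complex) => real^'n => complex" where
 "synth w x = (\<Sum>j. conv (kern j) (w j) x)"

lemma level_norm_term_le: "ennreal ((2 ^ j) powr (2 * s)) * l2sq lborel (w j) \<le> level_norm s w"
proof -
 have "sum (\<lambda>j. ennreal ((2 ^ j) powr (2 * s)) * l2sq lborel (w j)) {j} \<le> (\<Sum>j. ennreal ((2 ^ j) powr (2 * s)) * l2sq lborel (w j))"
  by (rule sum_le_suminf) auto
 then show ?thesis by (simp add: level_norm_def)
qed

lemma l2sq_level_le:
 assumes "level_norm s w \<le> ennreal N" "0 \<le> N"
 shows "l2sq lborel (w j) \<le> ennreal (N * (2 ^ j) powr (- 2 * s))"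
proof -
 have "l2sq lborel (w j) = ennreal ((2 ^ j) powr (- 2 * s)) * (ennreal ((2 ^ j) powr (2 * s)) * l2sq lborel (w j))"
  by (simp add: mult.assoc[symmetric] ennreal_mult'[symmetric] powr_add[symmetric])
 also have "\<dots> \<le> ennreal ((2 ^ j) powr (- 2 * s)) * ennreal N"
  using order_trans[OF level_norm_term_le assms(1)] by (intro mult_left_mono) auto
 also have "\<dots> = ennreal (N * (2 ^ j) powr (- 2 * s))"
  using assms(2) by (simp add: ennreal_mult'[symmetric] mult.commute)
 finally show ?thesis .
qed

lemma level_norm_Lp2:
 assumes "level_norm s w < \<infinity>" "w j \<in> borel_measurable borel"
 shows "w j \<in> Lp 2 lborel"
proof -
 obtain N where "level_norm s w = ennreal N" "0 \<le> N" using assms(1) by (cases "level_norm s w") auto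
 then have "l2sq lborel (w j) \<le> ennreal (N * (2 ^ j) powr (- 2 * s))" by (intro l2sq_level_le) auto
 also have "\<dots> < \<infinity>" by simp
 finally show ?thesis using assms(2) by (simp add: Lp2_iff)
qed

section \<open>Measures with an upper bound on small balls\<close>

text \<open>Both the measure on \<Gamma> and Lebesgue measure (with d = n) are instances, so that
  one convergence lemma serves both. The centre y is arbitrary, as the estimate of the kernel
  requires.\<close>

locale upper_regular = sigma_finite_measure M for M :: "(real^'n) measure" +
 fixes d c :: real
 assumes id_measurable: "(\<lambda>x. x) \<in> M \<rightarrow>\<^sub>M borel"
  and d_nonneg: "0 \<le> d" and c_nonneg: "0 \<le> c"
  and emeasure_ball_le: "\<And>y r. 0 < r ==> r \<le> 1/2 ==> emeasure M {x \<in> space M. dist y x \<le> r} \<le> ennreal (c * r powr d)"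
begin

lemma borel_imp_measurable: "f \<in> borel_measurable borel ==> f \<in> borel_measurable M"
 by (rule measurable_compose[OF id_measurable])

lemma continuous_imp_measurable: "continuous_on UNIV f ==> f \<in> borel_measurable M"
 by (intro borel_imp_measurable borel_measurable_continuous_onI)

lemma sets_dist_le: "{x \<in> space M. dist y x \<le> r} \<in> sets M"
proof -
 have "(\<lambda>x. dist y x) \<in> borel_measurable M" by (intro continuous_imp_measurable continuous_intros)
 then show ?thesis by measurable
qed

lemma fst_measurable: "fst \<in> M \<Otimes>\<^sub>M lborel \<rightarrow>\<^sub>M borel"
 by (rule measurable_compose[OF measurable_fst id_measurable])

lemma Tonelli_M:
 assumes "case_prod f \<in> borel_measurable (M \<Otimes>\<^sub>M (lborel :: (real^'n) measure))"
 shows "(\<integral>\<^sup>+x. (\<integral>\<^sup>+y. f x y \<partial>lborel) \<partial>M) = (\<integral>\<^sup>+y. (\<integral>\<^sup>+x. f x y \<partial>M) \<partial>lborel)"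
proof -
 have "pair_sigma_finite M (lborel :: (real^'n) measure)" ..
 from pair_sigma_finite.Fubini'[OF this assms] show ?thesis by simp
qed

text \<open>Integrates \<open>conv_kern_sq_bound\<close> over \<open>M\<close>. For fixed y the
  kernel is at most a multiple of 2^(j n) and lives on a ball of measure at most a multiple of 2^(-j
  d), whence the exponent n - d.\<close>

lemma l2sq_conv_kern_le:
 obtains K where "0 < K" "\<And>j w. w \<in> borel_measurable borel ==>
   l2sq M (conv (kern j) w) \<le> ennreal (K * (2 ^ j) powr (real CARD('n) - d)) * l2sq lborel w"
proof -
 obtain B where B: "0 < B" "\<And>b j x. length b \<le> 0 ==>
   norm (iter_deriv b (kern j) (x::real^'n)) \<le> B * (2 ^ j) ^ (CARD('n) + length b)"
  using kern_deriv_bound[of 0] by blast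
 have kb: "norm (kern j x) \<le> B * (2 ^ j) ^ CARD('n)" for j and x :: "real^'n"
  using B(2)[of "[]" j x] by simp
 \<comment> \<open>The summand 1 keeps K positive also for c = 0.\<close>
 define K where "K = B * c + 1"
 have K0: "0 < K" using B c_nonneg by (simp add: K_def add_nonneg_pos)
 have "l2sq M (conv (kern j) w) \<le> ennreal (K * (2 ^ j) powr (real CARD('n) - d)) * l2sq lborel w"
  if w [measurable]: "w \<in> borel_measurable borel" for j and w :: "real^'n => complex"
 proof -
  note fst_measurable [measurable]
  have inner: "(\<integral>\<^sup>+x. ennreal (norm (kern j (x - y))) \<partial>M) \<le> ennreal (K * (2 ^ j) powr (real CARD('n) - d))" for y
  proof -
   let ?r = "1 / 2 / 2 ^ j :: real"
   have "(\<integral>\<^sup>+x. ennreal (norm (kern j (x - y))) \<partial>M)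
     \<le> (\<integral>\<^sup>+x. ennreal (B * (2 ^ j) ^ CARD('n)) * indicator {x \<in> space M. dist y x \<le> ?r} x \<partial>M)"
   proof (rule nn_integral_mono)
    fix x assume x: "x \<in> space M"
    show "ennreal (norm (kern j (x - y))) \<le> ennreal (B * (2 ^ j) ^ CARD('n)) * indicator {x \<in> space M. dist y x \<le> ?r} x"
     using kb[of j "x - y"] x kern_eq_0[of j "x - y"]
     by (cases "dist y x \<le> ?r") (auto simp: dist_norm norm_minus_commute intro!: ennreal_leI)
   qed
   also have "\<dots> = ennreal (B * (2 ^ j) ^ CARD('n)) * emeasure M {x \<in> space M. dist y x \<le> ?r}"
    by (rule nn_integral_cmult_indicator[OF sets_dist_le])
   also have "\<dots> \<le> ennreal (B * (2 ^ j) ^ CARD('n)) * ennreal (c * ?r powr d)"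
   proof (intro mult_left_mono emeasure_ball_le)
    have "1 / 2 / 2 ^ j \<le> 1 / 2 / (1::real)" by (intro divide_left_mono) auto
    then show "?r \<le> 1/2" by simp
   qed auto
   also have "\<dots> = ennreal (B * c * ((2 ^ j) ^ CARD('n) * ?r powr d))"
    using B c_nonneg by (simp add: ennreal_mult'[symmetric] mult_ac)
   also have "\<dots> \<le> ennreal (K * (2 ^ j) powr (real CARD('n) - d))"
   proof (rule ennreal_leI, rule mult_mono)
    have "?r powr d \<le> (1 / 2 ^ j) powr d" using d_nonneg by (intro powr_mono2) (auto simp: field_simps)
    also have "\<dots> = (2 ^ j) powr (- d)" by (simp add: powr_divide powr_minus field_simps)
    finally have "(2 ^ j) ^ CARD('n) * ?r powr d \<le> (2 ^ j) ^ CARD('n) * (2 ^ j) powr (- d)" by (intro mult_left_mono) auto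
    also have "\<dots> = (2 ^ j) powr (real CARD('n) - d)"
    proof -
     have "(2 ^ j :: real) ^ CARD('n) = (2 ^ j) powr real CARD('n)" by (rule powr_realpow[symmetric]) simp
     then show ?thesis by (simp add: powr_add[symmetric])
    qed
    finally show "(2 ^ j) ^ CARD('n) * ?r powr d \<le> (2 ^ j) powr (real CARD('n) - d)" .
   qed (use K0 B c_nonneg in \<open>auto simp: K_def\<close>)
   finally show ?thesis .
  qed
  have "l2sq M (conv (kern j) w) \<le> (\<integral>\<^sup>+x. (\<integral>\<^sup>+y. ennreal (norm (kern j (x - y)) * (norm (w y))\<^sup>2) \<partial>lborel) \<partial>M)"
   unfolding l2sq_def by (intro nn_integral_mono conv_kern_sq_bound[OF w])
  also have "\<dots> = (\<integral>\<^sup>+y. (\<integral>\<^sup>+x. ennreal (norm (kern j (x - y)) * (norm (w y))\<^sup>2) \<partial>M) \<partial>lborel)"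
   by (rule Tonelli_M) measurable
  also have "\<dots> = (\<integral>\<^sup>+y. (\<integral>\<^sup>+x. ennreal (norm (kern j (x - y))) \<partial>M) * ennreal ((norm (w y))\<^sup>2) \<partial>lborel)"
  proof (rule nn_integral_cong)
   fix y
   have [measurable]: "(\<lambda>x. norm (kern j (x - y))) \<in> borel_measurable M"
    by (intro borel_imp_measurable) measurable
   show "(\<integral>\<^sup>+x. ennreal (norm (kern j (x - y)) * (norm (w y))\<^sup>2) \<partial>M) = (\<integral>\<^sup>+x. ennreal (norm (kern j (x - y))) \<partial>M) * ennreal ((norm (w y))\<^sup>2)"
    by (subst nn_integral_multc[symmetric]) (auto simp: ennreal_mult')
  qed
  also have "\<dots> \<le> (\<integral>\<^sup>+y. ennreal (K * (2 ^ j) powr (real CARD('n) - d)) * ennreal ((norm (w y))\<^sup>2) \<partial>lborel)"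
   by (intro nn_integral_mono mult_right_mono inner) auto
  also have "\<dots> = ennreal (K * (2 ^ j) powr (real CARD('n) - d)) * l2sq lborel w"
   unfolding l2sq_def by (rule nn_integral_cmult) measurable
  finally show ?thesis .
 qed
 with K0 show ?thesis by (rule that)
qed

lemma conv_kern_measurable:
 "w \<in> Lp 2 lborel ==> conv (kern j) w \<in> borel_measurable M"
 by (intro continuous_imp_measurable conv_kern_continuous Lp2_loc_int)

text \<open>The squared norm of the term of level j is at most a multiple of (2^(n - d - 2 s))^j, so
  the hypothesis on s makes the series geometric.\<close>

lemma synth_l2:
 assumes s: "real CARD('n) - d < 2 * s"
 obtains C where "0 < C"
  "\<And>w. (\<And>j. w j \<in> borel_measurable borel) ==> level_norm s w < \<infinity> ==> AE x in M. summable (\<lambda>j. norm (conv (kern j) (w j) x))"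
  "\<And>w. (\<And>j. w j \<in> borel_measurable borel) ==> level_norm s w < \<infinity> ==> synth w \<in> borel_measurable M"
  "\<And>w. (\<And>j. w j \<in> borel_measurable borel) ==> level_norm s w < \<infinity> ==> l2sq M (synth w) \<le> ennreal C * level_norm s w"
  "\<And>w. (\<And>j. w j \<in> borel_measurable borel) ==> level_norm s w < \<infinity> ==>
    (\<lambda>J. l2sq M (\<lambda>x. synth w x - (\<Sum>j<J. conv (kern j) (w j) x))) \<longlonglongrightarrow> 0"
proof -
 obtain K where K: "0 < K" "\<And>j w. w \<in> borel_measurable borel ==>
   l2sq M (conv (kern j) w) \<le> ennreal (K * (2 ^ j) powr (real CARD('n) - d)) * l2sq lborel w"
  by (rule l2sq_conv_kern_le) (rule that)
 define r where "r = 2 powr (real CARD('n) - d - 2 * s)"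
 have r: "0 < r" "r < 1" using s by (auto simp: r_def powr_less_one)
 define C where "C = K / (1 - sqrt r)\<^sup>2"
 have C0: "0 < C" using K(1) r by (simp add: C_def)
 have main: "(\<forall>j. conv (kern j) (w j) \<in> borel_measurable M) \<and> (\<exists>N\<ge>0. level_norm s w = ennreal N \<and>
    (\<forall>j. l2sq M (conv (kern j) (w j)) \<le> ennreal ((K * N) * r ^ j)))"
  if m: "\<And>j. w j \<in> borel_measurable borel" and fin: "level_norm s w < \<infinity>" for w
 proof (intro conjI allI)
  show "conv (kern j) (w j) \<in> borel_measurable M" for j
   by (intro conv_kern_measurable level_norm_Lp2[OF fin m])
  obtain N where N: "level_norm s w = ennreal N" "0 \<le> N" using fin by (cases "level_norm s w") auto
  have "l2sq M (conv (kern j) (w j)) \<le> ennreal ((K * N) * r ^ j)" for j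
  proof -
   have "l2sq M (conv (kern j) (w j)) \<le> ennreal (K * (2 ^ j) powr (real CARD('n) - d)) * l2sq lborel (w j)"
    by (rule K(2)[OF m])
   also have "\<dots> \<le> ennreal (K * (2 ^ j) powr (real CARD('n) - d)) * ennreal (N * (2 ^ j) powr (- 2 * s))"
    using N by (intro mult_left_mono l2sq_level_le) auto
   also have "\<dots> = ennreal (K * N * ((2 ^ j) powr (real CARD('n) - d) * (2 ^ j) powr (- 2 * s)))"
    using K N by (simp add: ennreal_mult'[symmetric] mult_ac)
   also have "(2 ^ j) powr (real CARD('n) - d) * (2 ^ j) powr (- 2 * s) = r ^ j"
    by (simp only: powr_add[symmetric]) (simp add: r_def pow2_powr)
   finally show ?thesis .
  qed
  with N show "\<exists>N\<ge>0. level_norm s w = ennreal N \<and> (\<forall>j. l2sq M (conv (kern j) (w j)) \<le> ennreal ((K * N) * r ^ j))"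
   by blast
 qed
 show ?thesis
 proof (rule that[OF C0])
  fix w :: "nat => real^'n => complex"
  assume m: "\<And>j. w j \<in> borel_measurable borel" and fin: "level_norm s w < \<infinity>"
  from main[OF m fin] obtain N where cm: "\<And>j. conv (kern j) (w j) \<in> borel_measurable M"
   and N: "0 \<le> N" "level_norm s w = ennreal N" and bd: "\<And>j. l2sq M (conv (kern j) (w j)) \<le> ennreal ((K * N) * r ^ j)"
   by blast
  have KN: "0 \<le> K * N" using K N by simp
  note G = cm KN r bd
  show "AE x in M. summable (\<lambda>j. norm (conv (kern j) (w j) x))" by (rule l2_geometric_series(1)[OF G])
  show "synth w \<in> borel_measurable M" unfolding synth_def[abs_def] by (rule l2_geometric_series(2)[OF G])
  have "l2sq M (synth w) \<le> ennreal (K * N / (1 - sqrt r)\<^sup>2)"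
   unfolding synth_def[abs_def] by (rule l2sq_geometric_bound[OF G])
  also have "\<dots> = ennreal C * level_norm s w" using N C0 by (simp add: C_def ennreal_mult'[symmetric])
  finally show "l2sq M (synth w) \<le> ennreal C * level_norm s w" .
  show "(\<lambda>J. l2sq M (\<lambda>x. synth w x - (\<Sum>j<J. conv (kern j) (w j) x))) \<longlonglongrightarrow> 0"
   unfolding synth_def by (rule l2_geometric_series_tendsto[OF G])
 qed
qed

end

text \<open>Here d = n, and the condition of \<open>synth_l2\<close> becomes s > 0.\<close>

lemma upper_regular_lborel:
 "upper_regular (lborel :: (real^'n) measure) (real CARD('n)) (unit_ball_vol (real CARD('n)))"
proof -
 have e: "emeasure lborel {x \<in> space lborel. dist y x \<le> r} \<le> ennreal (unit_ball_vol (real CARD('n)) * r powr real CARD('n))"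
  if "0 < r" for y :: "real^'n" and r :: real
 proof -
  have "{x \<in> space lborel. dist y x \<le> r} = cball y r" by auto
  then show ?thesis using that by (simp add: emeasure_cball powr_realpow)
 qed
 interpret sigma_finite_measure "lborel :: (real^'n) measure" ..
 show ?thesis
  by unfold_locales (use e in \<open>auto simp: unit_ball_vol_nonneg\<close>)
qed

section \<open>Sobolev spaces through mollified pieces\<close>

definition sob_sq :: "real => (real^'n => complex) => ennreal" where
 "sob_sq s u = (\<integral>\<^sup>+\<xi>. ennreal ((1 + (norm \<xi>)\<^sup>2) powr s * (norm (fourier u \<xi>))\<^sup>2) \<partial>lborel)"

lemma sobolev_iff: "u \<in> sobolev s \<longleftrightarrow> u \<in> Lp 2 lborel \<and> sob_sq s u < \<infinity>"
proof (cases "u \<in> Lp 2 lborel")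
 case True
 have [measurable]: "fourier u \<in> borel_measurable borel" by (intro Lp2_borel fourier_Lp2 True)
 have [measurable]: "(\<lambda>\<xi>. (1 + (norm \<xi>)\<^sup>2) powr s * (norm (fourier u \<xi>))\<^sup>2) \<in> borel_measurable borel" by measurable
 show ?thesis using True unfolding sobolev_def sob_sq_def by (auto simp: integrable_iff_bounded abs_mult)
qed (simp add: sobolev_def)

lemma sobolev_norm_eq:
 assumes "u \<in> Lp 2 lborel"
 shows "sobolev_norm s u = sqrt (enn2real (sob_sq s u))"
proof -
 have [measurable]: "fourier u \<in> borel_measurable borel" by (intro Lp2_borel fourier_Lp2 assms)
 have "(\<lambda>\<xi>. (1 + (norm \<xi>)\<^sup>2) powr s * (norm (fourier u \<xi>))\<^sup>2) \<in> borel_measurable lborel" by measurable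
 then show ?thesis unfolding sobolev_norm_def sob_sq_def
  by (subst integral_eq_nn_integral) auto
qed

lemma sob_sq_cong_AE:
 assumes "u \<in> Lp 2 lborel" "v \<in> Lp 2 lborel" "AE x in lborel. u x = v x"
 shows "sob_sq s u = sob_sq s v"
 unfolding sob_sq_def by (rule nn_integral_cong_AE) (use fourier_cong_AE[OF assms] in auto)

text \<open>The terms grow like 2^j until 2^j reaches X and decay like 2^(-j s) afterwards. The
  growing part sums to at most 2, the decaying part to at most 1 / (1 - 2^(-s)).\<close>

lemma dyadic_min_sum:
 fixes X s :: real
 assumes X: "1 \<le> X" and s: "0 < s"
 shows "summable (\<lambda>j. min ((X / 2 ^ j) powr s) (2 ^ j / X))"
  and "(\<Sum>j. min ((X / 2 ^ j) powr s) (2 ^ j / X)) \<le> 2 + 1 / (1 - 2 powr (- s))"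
proof -
 define q where "q = 2 powr (- s)"
 have q: "0 < q" "q < 1" using s by (auto simp: q_def powr_less_one)
 \<comment> \<open>The level at which the two estimates change roles: 2^J \<le> X \<le> 2^(J +
   1).\<close>
 define J where "J = nat \<lfloor>log 2 X\<rfloor>"
 have lg: "0 \<le> log 2 X" using X by simp
 have J1: "2 ^ J \<le> X"
 proof -
  have "(2::real) ^ J = 2 powr real J" by (simp add: powr_realpow)
  also have "\<dots> \<le> 2 powr (log 2 X)" using lg by (intro powr_mono) (auto simp: J_def)
  also have "\<dots> = X" using X by simp
  finally show ?thesis .
 qed
 have J2: "X \<le> 2 ^ Suc J"
 proof -
  have "real J = of_int \<lfloor>log 2 X\<rfloor>" using lg by (simp add: J_def)
  then have "log 2 X \<le> real (Suc J)"
   using real_of_int_floor_add_one_ge[of "log 2 X"] unfolding of_nat_Suc by linarith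
  have "X = 2 powr (log 2 X)" using X by simp
  also have "\<dots> \<le> 2 powr real (Suc J)"
   using \<open>log 2 X \<le> real (Suc J)\<close> by (intro powr_mono) auto
  finally show ?thesis by (simp only: powr_realpow)
 qed
 let ?m = "\<lambda>j. min ((X / 2 ^ j) powr s) (2 ^ j / X)"
 let ?a = "\<lambda>j. if j \<le> J then 2 ^ j / 2 ^ J else (0::real)"
 let ?b = "\<lambda>j. if j < Suc J then 0 else q ^ (j - Suc J)"
 have le: "?m j \<le> ?a j + ?b j" for j
 proof (cases "j \<le> J")
  case True
  have "2 ^ j / X \<le> 2 ^ j / 2 ^ J" using J1 by (intro divide_left_mono) (use X in auto)
  then show ?thesis using True by auto
 next
  case False
  have "(X / 2 ^ j) powr s \<le> (2 ^ Suc J / 2 ^ j) powr s"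
   using J2 X s by (intro powr_mono2 divide_right_mono) auto
  also have "(2 ^ Suc J / 2 ^ j :: real) = 2 powr (- real (j - Suc J))"
  proof -
   obtain k where k: "j = Suc J + k" using False le_Suc_ex[of "Suc J" j] by auto
   have "2 powr (- real k) = 1 / (2::real) ^ k" by (simp add: powr_minus powr_realpow divide_inverse)
   then show ?thesis unfolding k power_add by (simp del: power_Suc)
  qed
  also have "(2 powr (- real (j - Suc J))) powr s = q ^ (j - Suc J)"
   by (simp add: q_def powr_powr powr_realpow[symmetric] mult.commute)
  finally show ?thesis using False by auto
 qed
 have sa: "?a sums (\<Sum>j\<le>J. 2 ^ j / 2 ^ J)"
  using sums_If_finite_set[of "{..J}" "\<lambda>j. 2 ^ j / 2 ^ J :: real"] by simp
 have "(\<Sum>j\<le>J. (2::real) ^ j / 2 ^ J) = (2 ^ Suc J - 1) / 2 ^ J"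
  using geometric_sum[of "2::real" "Suc J"] by (simp add: sum_divide_distrib[symmetric] lessThan_Suc_atMost)
 also have "\<dots> \<le> 2" by (simp add: field_simps)
 finally have a2: "(\<Sum>j\<le>J. (2::real) ^ j / 2 ^ J) \<le> 2" .
 have sb: "?b sums (1 / (1 - q))"
 proof -
  have "(\<lambda>j. ?b (j + Suc J)) sums (1 / (1 - q))" using geometric_sums[of q] q by simp
  then have "?b sums (1 / (1 - q) + (\<Sum>j<Suc J. ?b j))" by (subst (asm) sums_iff_shift)
  then show ?thesis by simp
 qed
 have sab: "(\<lambda>j. ?a j + ?b j) sums ((\<Sum>j\<le>J. 2 ^ j / 2 ^ J) + 1 / (1 - q))" by (rule sums_add[OF sa sb])
 have m0: "0 \<le> ?m j" for j using X by simp
 show sm: "summable ?m"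
  by (rule summable_comparison_test'[OF sums_summable[OF sab], of 0]) (use le m0 in auto)
 have "suminf ?m \<le> (\<Sum>j\<le>J. 2 ^ j / 2 ^ J) + 1 / (1 - q)"
  using suminf_le[OF le sm sums_summable[OF sab]] sums_unique[OF sab] by simp
 then show "suminf ?m \<le> 2 + 1 / (1 - 2 powr (- s))" using a2 by (simp add: q_def)
qed

text \<open>The two halves of a Schur test between levels and frequencies: a weighted sum over the
  levels and a bound for single entries. Both rest on the rapid decay of
  \<open>bump_hat\<close>.\<close>

lemma multiplier_bounds:
 assumes s: "0 < s"
 obtains C where "0 < C"
  "\<And>\<xi>::real^'n. (\<Sum>j. ennreal (norm (bump_hat ((1 / 2 ^ j) *\<^sub>R \<xi>)) * (2 ^ j) powr (- s))) \<le> ennreal (C * (1 + norm \<xi>) powr (- s))"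
  "\<And>j (\<xi>::real^'n). (1 + norm \<xi>) powr s * norm (bump_hat ((1 / 2 ^ j) *\<^sub>R \<xi>)) \<le> C * (2 ^ j) powr s"
proof -
 \<comment> \<open>Decay of order s bounds a single entry; one further order sums the levels with
   2^j below the frequency.\<close>
 obtain L :: nat where L: "s + 1 \<le> real L" using real_arch_simple by blast
 obtain D where D: "0 < D" "\<And>\<zeta>::real^'n. (1 + norm \<zeta>) ^ L * norm (bump_hat \<zeta>) \<le> D" using bump_hat_decay[of L] by blast
 define E where "E = 2 + 1 / (1 - 2 powr (- s))"
 have "2 powr (- s) < 1" using s by (simp add: powr_less_one)
 then have E1: "1 \<le> E" by (simp add: E_def add_increasing2)
 define C where "C = D * E"
 have C0: "0 < C" using D E1 by (simp add: C_def)
 have DC: "D \<le> C" using D E1 by (simp add: C_def)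
 have b: "norm (bump_hat ((1 / 2 ^ j) *\<^sub>R \<xi>)) \<le> D"
  "((1 + norm \<xi>) / 2 ^ j) powr (s + 1) * norm (bump_hat ((1 / 2 ^ j) *\<^sub>R \<xi>)) \<le> D"
  "((1 + norm \<xi>) / 2 ^ j) powr s * norm (bump_hat ((1 / 2 ^ j) *\<^sub>R \<xi>)) \<le> D" for j and \<xi> :: "real^'n"
 proof -
  let ?Y = "1 + norm ((1 / 2 ^ j) *\<^sub>R \<xi>)"
  have t: "0 \<le> (1 + norm \<xi>) / 2 ^ j" "(1 + norm \<xi>) / 2 ^ j \<le> ?Y"
   by (auto simp: add_divide_distrib)
  have Y1: "1 \<le> ?Y" by simp
  have p: "((1 + norm \<xi>) / 2 ^ j) powr a * norm (bump_hat ((1 / 2 ^ j) *\<^sub>R \<xi>)) \<le> D" if "0 \<le> a" "a \<le> real L" for a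
  proof -
   have "((1 + norm \<xi>) / 2 ^ j) powr a \<le> ?Y powr a" using t that by (intro powr_mono2) auto
   also have "\<dots> \<le> ?Y powr (real L)" using that Y1 by (intro powr_mono) auto
   also have "\<dots> = ?Y ^ L" using Y1 by (intro powr_realpow) linarith
   finally have "((1 + norm \<xi>) / 2 ^ j) powr a * norm (bump_hat ((1 / 2 ^ j) *\<^sub>R \<xi>)) \<le> ?Y ^ L * norm (bump_hat ((1 / 2 ^ j) *\<^sub>R \<xi>))"
    by (rule mult_right_mono) simp
   then show ?thesis using D(2)[of "(1 / 2 ^ j) *\<^sub>R \<xi>"] by linarith
  qed
  show "((1 + norm \<xi>) / 2 ^ j) powr (s + 1) * norm (bump_hat ((1 / 2 ^ j) *\<^sub>R \<xi>)) \<le> D"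
   "((1 + norm \<xi>) / 2 ^ j) powr s * norm (bump_hat ((1 / 2 ^ j) *\<^sub>R \<xi>)) \<le> D" using s L by (auto intro!: p)
  have "1 * norm (bump_hat ((1 / 2 ^ j) *\<^sub>R \<xi>)) \<le> ?Y ^ L * norm (bump_hat ((1 / 2 ^ j) *\<^sub>R \<xi>))"
   by (intro mult_right_mono one_le_power) auto
  then show "norm (bump_hat ((1 / 2 ^ j) *\<^sub>R \<xi>)) \<le> D" using D(2)[of "(1 / 2 ^ j) *\<^sub>R \<xi>"] by linarith
 qed
 show ?thesis
 proof (rule that[OF C0])
  fix \<xi> :: "real^'n"
  let ?X = "1 + norm \<xi>"
  have X1: "1 \<le> ?X" by simp
  have X0: "0 < ?X" by (rule less_le_trans[OF zero_less_one X1])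
  let ?b = "\<lambda>j. norm (bump_hat ((1 / 2 ^ j) *\<^sub>R \<xi>))"
  let ?m = "\<lambda>j. min ((?X / 2 ^ j) powr s) (2 ^ j / ?X)"
  have tm: "?b j * (2 ^ j) powr (- s) \<le> ?X powr (- s) * (D * ?m j)" for j
  proof -
   let ?t = "?X / 2 ^ j"
   have t0: "0 < ?t" using X0 by simp
   have e: "(2 ^ j) powr (- s) = ?X powr (- s) * ?t powr s"
    using X0 by (simp add: powr_divide powr_minus field_simps)
   have 1: "?t powr s * ?b j \<le> ?t powr s * D" by (intro mult_left_mono b(1)) simp
   have 2: "?t powr s * ?b j \<le> D * (2 ^ j / ?X)"
   proof -
    have "?t powr s * ?b j = (1 / ?t) * (?t powr (s + 1) * ?b j)" using t0 by (simp add: powr_add)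
    also have "\<dots> \<le> (1 / ?t) * D" using t0 by (intro mult_left_mono b(2)) auto
    finally show ?thesis by (simp add: mult.commute)
   qed
   have "?t powr s * ?b j \<le> D * ?m j" using 1 2 by (auto simp: min_def mult.commute)
   then have "?X powr (- s) * (?t powr s * ?b j) \<le> ?X powr (- s) * (D * ?m j)" by (intro mult_left_mono) auto
   then show ?thesis unfolding e by (simp add: mult_ac)
  qed
  note ms = dyadic_min_sum[OF X1 s]
  have sm: "summable (\<lambda>j. ?X powr (- s) * (D * ?m j))" by (intro summable_mult ms(1))
  have "(\<Sum>j. ennreal (?b j * (2 ^ j) powr (- s))) \<le> (\<Sum>j. ennreal (?X powr (- s) * (D * ?m j)))"
   by (intro suminf_le ennreal_leI tm) auto
  also have "\<dots> = ennreal (\<Sum>j. ?X powr (- s) * (D * ?m j))"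
   using D X0 by (intro suminf_ennreal2 sm) auto
  also have "(\<Sum>j. ?X powr (- s) * (D * ?m j)) = ?X powr (- s) * (D * suminf ?m)"
   by (simp only: suminf_mult[OF summable_mult[OF ms(1)]] suminf_mult[OF ms(1)])
  also have "ennreal \<dots> \<le> ennreal (C * ?X powr (- s))"
  proof (rule ennreal_leI)
   have "D * suminf ?m \<le> C" unfolding C_def E_def using ms(2) D by (intro mult_left_mono) auto
   then have "?X powr (- s) * (D * suminf ?m) \<le> ?X powr (- s) * C" by (intro mult_left_mono) auto
   then show "?X powr (- s) * (D * suminf ?m) \<le> C * ?X powr (- s)" by (simp add: mult.commute)
  qed
  finally show "(\<Sum>j. ennreal (?b j * (2 ^ j) powr (- s))) \<le> ennreal (C * ?X powr (- s))" .
 next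
  fix j and \<xi> :: "real^'n"
  have "(1 + norm \<xi>) powr s * norm (bump_hat ((1 / 2 ^ j) *\<^sub>R \<xi>))
    = (2 ^ j) powr s * (((1 + norm \<xi>) / 2 ^ j) powr s * norm (bump_hat ((1 / 2 ^ j) *\<^sub>R \<xi>)))"
   by (simp add: powr_divide)
  also have "\<dots> \<le> (2 ^ j) powr s * C" using b(3)[of \<xi> j] DC by (intro mult_left_mono) auto
  finally show "(1 + norm \<xi>) powr s * norm (bump_hat ((1 / 2 ^ j) *\<^sub>R \<xi>)) \<le> C * (2 ^ j) powr s" by (simp add: mult.commute)
 qed
qed

lemma fourier_sum_AE:
 fixes f :: "'i => real^'n => complex"
 assumes "finite I" "\<And>i. i \<in> I ==> f i \<in> Lp 2 lborel"
 shows "AE \<xi> in lborel. fourier (\<lambda>x. \<Sum>i\<in>I. f i x) \<xi> = (\<Sum>i\<in>I. fourier (f i) \<xi>)"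
 using assms
proof (induction I)
 case empty
 have z: "(\<lambda>x::real^'n. 0::complex) \<in> Lp 2 lborel" by (rule Lp2_zero)
 show ?case using fourier_lin_AE[OF z z, of 0 0] by simp
next
 case (insert i I)
 have 1: "f i \<in> Lp 2 lborel" "(\<lambda>x. \<Sum>i\<in>I. f i x) \<in> Lp 2 lborel" using insert by (auto intro!: Lp2_sum)
 have "AE \<xi> in lborel. fourier (\<lambda>x. \<Sum>i\<in>I. f i x) \<xi> = (\<Sum>i\<in>I. fourier (f i) \<xi>)" using insert by auto
 then show ?case using fourier_lin_AE[OF 1, of 1 1] by eventually_elim (use insert in simp)
qed

text \<open>For partial sums, \<open>fourier_conv_kern\<close> and linearity. On the Fourier side
  the partial sums converge in L2 by Plancherel and almost everywhere by the geometric bound;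
  \<open>l2_limit_unique_AE\<close> identifies the limits.\<close>

lemma
 fixes w :: "nat => real^'n => complex"
 assumes s: "0 < s" and m: "\<And>j. w j \<in> borel_measurable borel" and fin: "level_norm s w < \<infinity>"
 shows synth_Lp2: "synth w \<in> Lp 2 lborel"
  and fourier_synth: "AE \<xi> in lborel. fourier (synth w) \<xi> = (\<Sum>j. bump_hat ((1 / 2 ^ j) *\<^sub>R \<xi>) * fourier (w j) \<xi>)"
  and summable_fourier_synth: "AE \<xi> in lborel. summable (\<lambda>j. norm (bump_hat ((1 / 2 ^ j) *\<^sub>R \<xi>) * fourier (w j) \<xi>))"
proof -
 interpret upper_regular "lborel :: (real^'n) measure" "real CARD('n)" "unit_ball_vol (real CARD('n))"
  by (rule upper_regular_lborel)
 have s': "real CARD('n) - real CARD('n) < 2 * s" using s by simp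
 have "\<exists>C>0. synth w \<in> borel_measurable lborel \<and> l2sq lborel (synth w) \<le> ennreal C * level_norm s w \<and>
  (\<lambda>J. l2sq lborel (\<lambda>x. synth w x - (\<Sum>j<J. conv (kern j) (w j) x))) \<longlonglongrightarrow> 0"
 proof (rule synth_l2[OF s'], goal_cases)
  case (1 C)
  show ?case by (intro exI[of _ C] conjI 1(1) 1(3-5)[OF m fin])
 qed
 then obtain C where C: "0 < C"
  "synth w \<in> borel_measurable lborel" "l2sq lborel (synth w) \<le> ennreal C * level_norm s w"
  "(\<lambda>J. l2sq lborel (\<lambda>x. synth w x - (\<Sum>j<J. conv (kern j) (w j) x))) \<longlonglongrightarrow> 0"
  by (elim exE conjE)
 show syn: "synth w \<in> Lp 2 lborel"
  using C fin by (auto simp: Lp2_iff ennreal_mult_less_top intro: le_less_trans)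
 have wl: "w j \<in> Lp 2 lborel" for j by (rule level_norm_Lp2[OF fin m])
 have cl: "conv (kern j) (w j) \<in> Lp 2 lborel" for j by (rule conv_kern_Lp2[OF wl])
 let ?b = "\<lambda>j \<xi>. bump_hat ((1 / 2 ^ j) *\<^sub>R \<xi>) * fourier (w j) \<xi>"
 have [measurable]: "fourier (w j) \<in> borel_measurable borel" for j by (intro Lp2_borel fourier_Lp2 wl)
 have bm: "?b j \<in> borel_measurable lborel" for j by measurable
 obtain N where N: "level_norm s w = ennreal N" "0 \<le> N" using fin by (cases "level_norm s w") auto
 have bl: "l2sq lborel (?b j) \<le> ennreal (N * (2 powr (- 2 * s)) ^ j)" for j
 proof -
  have "l2sq lborel (?b j) = l2sq lborel (fourier (conv (kern j) (w j)))"
   by (rule l2sq_cong_AE[OF fourier_conv_kern[OF wl], symmetric])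
  also have "\<dots> \<le> l2sq lborel (w j)" using fourier_l2sq_le[OF cl] conv_kern_l2sq_le[OF m] by (rule order_trans)
  also have "\<dots> \<le> ennreal (N * (2 ^ j) powr (- 2 * s))" using N by (intro l2sq_level_le) auto
  finally show ?thesis by (simp add: pow2_powr)
 qed
 have r: "0 < 2 powr (- 2 * s)" "2 powr (- 2 * s) < 1" using s by (auto simp: powr_less_one)
 show sm: "AE \<xi> in lborel. summable (\<lambda>j. norm (?b j \<xi>))"
  by (rule l2_geometric_series(1)[OF bm N(2) r bl])
 have Sl: "(\<lambda>x. \<Sum>j<J. conv (kern j) (w j) x) \<in> Lp 2 lborel" for J by (intro Lp2_sum cl)
 have FS: "AE \<xi> in lborel. fourier (\<lambda>x. \<Sum>j<J. conv (kern j) (w j) x) \<xi> = (\<Sum>j<J. ?b j \<xi>)" for J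
 proof -
  have "AE \<xi> in lborel. \<forall>j\<in>{..<J}. fourier (conv (kern j) (w j)) \<xi> = ?b j \<xi>"
   by (intro AE_finite_allI fourier_conv_kern wl) simp
  moreover have "AE \<xi> in lborel. fourier (\<lambda>x. \<Sum>j<J. conv (kern j) (w j) x) \<xi> = (\<Sum>j<J. fourier (conv (kern j) (w j)) \<xi>)"
   by (rule fourier_sum_AE) (auto intro: cl)
  ultimately show ?thesis by eventually_elim simp
 qed
 have "(\<lambda>J. l2sq lborel (\<lambda>\<xi>. (\<Sum>j<J. ?b j \<xi>) - fourier (synth w) \<xi>)) \<longlonglongrightarrow> 0"
 proof -
  have "l2sq lborel (\<lambda>\<xi>. (\<Sum>j<J. ?b j \<xi>) - fourier (synth w) \<xi>) = l2sq lborel (\<lambda>x. synth w x - (\<Sum>j<J. conv (kern j) (w j) x))" for J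
  proof -
   have "l2sq lborel (\<lambda>\<xi>. (\<Sum>j<J. ?b j \<xi>) - fourier (synth w) \<xi>)
     = l2sq lborel (fourier (\<lambda>x. (-1) * synth w x + 1 * (\<Sum>j<J. conv (kern j) (w j) x)))"
   proof (rule l2sq_cong_AE)
    show "AE \<xi> in lborel. (\<Sum>j<J. ?b j \<xi>) - fourier (synth w) \<xi> = fourier (\<lambda>x. (-1) * synth w x + 1 * (\<Sum>j<J. conv (kern j) (w j) x)) \<xi>"
     using FS[of J] fourier_lin_AE[OF syn Sl, of "-1" 1 J] by eventually_elim simp
   qed
   also have "\<dots> = l2sq lborel (\<lambda>x. (-1) * synth w x + 1 * (\<Sum>j<J. conv (kern j) (w j) x))"
    by (intro l2sq_fourier Lp2_add Lp2_cmult syn Sl)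
   also have "\<dots> = l2sq lborel (\<lambda>x. synth w x - (\<Sum>j<J. conv (kern j) (w j) x))"
    by (simp add: l2sq_def norm_minus_commute)
   finally show ?thesis .
  qed
  then show ?thesis using C(4) by simp
 qed
 moreover have "AE \<xi> in lborel. (\<lambda>J. \<Sum>j<J. ?b j \<xi>) \<longlonglongrightarrow> (\<Sum>j. ?b j \<xi>)"
  using sm by eventually_elim (rule summable_LIMSEQ[OF summable_norm_cancel])
 ultimately have "AE \<xi> in lborel. (\<Sum>j. ?b j \<xi>) = fourier (synth w) \<xi>"
  using fourier_Lp2[OF syn] by (intro l2_limit_unique_AE[of "\<lambda>J \<xi>. \<Sum>j<J. ?b j \<xi>"]) (auto simp: Lp2_iff)
 then show "AE \<xi> in lborel. fourier (synth w) \<xi> = (\<Sum>j. ?b j \<xi>)" by eventually_elim simp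
qed

text \<open>At each frequency, Cauchy-Schwarz over the levels with the weights 2^(-j s) and 2^(j s).
  The first factor is the sum in \<open>multiplier_bounds\<close>; the bound on single entries there
  absorbs what is left of the Sobolev weight in the second. Plancherel then acts level by
  level.\<close>

lemma sob_sq_synth_le:
 assumes s: "0 < s"
 obtains C where "0 < C"
  "\<And>w :: nat => real^'n => complex. (\<And>j. w j \<in> borel_measurable borel) ==> level_norm s w < \<infinity> ==> sob_sq s (synth w) \<le> ennreal C * level_norm s w"
proof -
 obtain C where C: "0 < C"
  "\<And>\<xi>::real^'n. (\<Sum>j. ennreal (norm (bump_hat ((1 / 2 ^ j) *\<^sub>R \<xi>)) * (2 ^ j) powr (- s))) \<le> ennreal (C * (1 + norm \<xi>) powr (- s))"
  "\<And>j (\<xi>::real^'n). (1 + norm \<xi>) powr s * norm (bump_hat ((1 / 2 ^ j) *\<^sub>R \<xi>)) \<le> C * (2 ^ j) powr s"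
  by (rule multiplier_bounds[OF s]) (rule that)
 have "sob_sq s (synth w) \<le> ennreal (C * C) * level_norm s w"
  if m: "\<And>j. w j \<in> borel_measurable borel" and fin: "level_norm s w < \<infinity>" for w :: "nat => real^'n => complex"
 proof -
  have wl: "w j \<in> Lp 2 lborel" for j by (rule level_norm_Lp2[OF fin m])
  have [measurable]: "fourier (w j) \<in> borel_measurable borel" for j by (intro Lp2_borel fourier_Lp2 wl)
  let ?b = "\<lambda>j \<xi>. norm (bump_hat ((1 / 2 ^ j) *\<^sub>R \<xi>))"
  have pt: "ennreal ((1 + (norm \<xi>)\<^sup>2) powr s) * (\<Sum>j. ennreal (?b j \<xi> * norm (fourier (w j) \<xi>)))\<^sup>2
    \<le> (\<Sum>j. ennreal (C * C) * (ennreal ((2 ^ j) powr (2 * s)) * ennreal ((norm (fourier (w j) \<xi>))\<^sup>2)))" for \<xi>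
  proof -
   let ?X = "1 + norm \<xi>"
   have X0: "0 < ?X" by (simp add: add_pos_nonneg)
   let ?f = "\<lambda>j. sqrt (?b j \<xi> * (2 ^ j) powr (- s))"
   let ?g = "\<lambda>j. sqrt (?b j \<xi> * (2 ^ j) powr s) * norm (fourier (w j) \<xi>)"
   have fg: "?b j \<xi> * norm (fourier (w j) \<xi>) = ?f j * ?g j" for j
   proof -
    have "?f j * sqrt (?b j \<xi> * (2 ^ j) powr s) = sqrt ((?b j \<xi>)\<^sup>2 * ((2 ^ j) powr (- s) * (2 ^ j) powr s))"
     by (simp add: real_sqrt_mult[symmetric] power2_eq_square mult_ac)
    also have "\<dots> = ?b j \<xi>" by (simp add: powr_add[symmetric])
    finally show ?thesis by (simp add: mult.assoc[symmetric])
   qed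
   have "(\<Sum>j. ennreal (?b j \<xi> * norm (fourier (w j) \<xi>)))\<^sup>2 = (\<integral>\<^sup>+j. ennreal (?f j * ?g j) \<partial>count_space UNIV)\<^sup>2"
    unfolding fg by (simp add: nn_integral_count_space_nat)
   also have "\<dots> \<le> (\<integral>\<^sup>+j. ennreal ((?f j)\<^sup>2) \<partial>count_space UNIV) * (\<integral>\<^sup>+j. ennreal ((?g j)\<^sup>2) \<partial>count_space UNIV)"
    by (rule nn_integral_Cauchy_Schwarz) auto
   also have "\<dots> = (\<Sum>j. ennreal (?b j \<xi> * (2 ^ j) powr (- s))) * (\<Sum>j. ennreal (?b j \<xi> * (2 ^ j) powr s * (norm (fourier (w j) \<xi>))\<^sup>2))"
    by (simp add: nn_integral_count_space_nat power_mult_distrib)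
   also have "\<dots> \<le> ennreal (C * ?X powr (- s)) * (\<Sum>j. ennreal (?b j \<xi> * (2 ^ j) powr s * (norm (fourier (w j) \<xi>))\<^sup>2))"
    by (intro mult_right_mono C(2)) auto
   finally have 1: "(\<Sum>j. ennreal (?b j \<xi> * norm (fourier (w j) \<xi>)))\<^sup>2 \<le> \<dots>" .
   have "(1 + (norm \<xi>)\<^sup>2) powr s \<le> (?X\<^sup>2) powr s"
    using s by (intro powr_mono2) (auto simp: power2_sum)
   also have "\<dots> = ?X powr s * ?X powr s" using X0 by (simp add: power2_eq_square powr_mult)
   finally have "ennreal ((1 + (norm \<xi>)\<^sup>2) powr s) * (\<Sum>j. ennreal (?b j \<xi> * norm (fourier (w j) \<xi>)))\<^sup>2
     \<le> ennreal (?X powr s * ?X powr s) * (ennreal (C * ?X powr (- s)) * (\<Sum>j. ennreal (?b j \<xi> * (2 ^ j) powr s * (norm (fourier (w j) \<xi>))\<^sup>2)))"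
    using 1 by (intro mult_mono ennreal_leI) auto
   also have "\<dots> = ennreal ((?X powr s * ?X powr s) * (C * ?X powr (- s))) * (\<Sum>j. ennreal (?b j \<xi> * (2 ^ j) powr s * (norm (fourier (w j) \<xi>))\<^sup>2))"
   proof -
    have "ennreal ((?X powr s * ?X powr s) * (C * ?X powr (- s))) = ennreal (?X powr s * ?X powr s) * ennreal (C * ?X powr (- s))"
     by (rule ennreal_mult') simp
    then show ?thesis by (simp only: mult.assoc)
   qed
   also have "(?X powr s * ?X powr s) * (C * ?X powr (- s)) = C * ?X powr s"
    using X0 by (simp add: powr_minus field_simps)
   also have "ennreal (C * ?X powr s) * (\<Sum>j. ennreal (?b j \<xi> * (2 ^ j) powr s * (norm (fourier (w j) \<xi>))\<^sup>2))
     = (\<Sum>j. ennreal (C * ?X powr s) * ennreal (?b j \<xi> * (2 ^ j) powr s * (norm (fourier (w j) \<xi>))\<^sup>2))"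
    by (rule ennreal_suminf_cmult[symmetric])
   also have "\<dots> \<le> (\<Sum>j. ennreal (C * C) * (ennreal ((2 ^ j) powr (2 * s)) * ennreal ((norm (fourier (w j) \<xi>))\<^sup>2)))"
   proof (intro suminf_le allI)
    fix j
    have "C * ?X powr s * (?b j \<xi> * (2 ^ j) powr s * (norm (fourier (w j) \<xi>))\<^sup>2)
      = C * (2 ^ j) powr s * (norm (fourier (w j) \<xi>))\<^sup>2 * (?X powr s * ?b j \<xi>)" by simp
    also have "\<dots> \<le> C * (2 ^ j) powr s * (norm (fourier (w j) \<xi>))\<^sup>2 * (C * (2 ^ j) powr s)"
     using C(1) by (intro mult_left_mono C(3)) auto
    also have "\<dots> = C * C * (((2 ^ j) powr s * (2 ^ j) powr s) * (norm (fourier (w j) \<xi>))\<^sup>2)" by simp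
    also have "(2 ^ j) powr s * (2 ^ j) powr s = (2 ^ j) powr (2 * s)" by (simp only: powr_add[symmetric]) simp
    finally show "ennreal (C * ?X powr s) * ennreal (?b j \<xi> * (2 ^ j) powr s * (norm (fourier (w j) \<xi>))\<^sup>2)
      \<le> ennreal (C * C) * (ennreal ((2 ^ j) powr (2 * s)) * ennreal ((norm (fourier (w j) \<xi>))\<^sup>2))"
     using C(1) by (simp add: ennreal_mult'[symmetric] ennreal_leI)
   qed auto
   finally show ?thesis .
  qed
  have "sob_sq s (synth w) \<le> (\<integral>\<^sup>+\<xi>. ennreal ((1 + (norm \<xi>)\<^sup>2) powr s) * (\<Sum>j. ennreal (?b j \<xi> * norm (fourier (w j) \<xi>)))\<^sup>2 \<partial>lborel)"
   unfolding sob_sq_def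
  proof (rule nn_integral_mono_AE, use fourier_synth[OF s m fin] summable_fourier_synth[OF s m fin] in eventually_elim)
   case (elim \<xi>)
   have "norm (fourier (synth w) \<xi>) \<le> (\<Sum>j. norm (bump_hat ((1 / 2 ^ j) *\<^sub>R \<xi>) * fourier (w j) \<xi>))"
    unfolding elim(1) by (rule summable_norm[OF elim(2)])
   then have "ennreal ((norm (fourier (synth w) \<xi>))\<^sup>2) \<le> ennreal ((\<Sum>j. norm (bump_hat ((1 / 2 ^ j) *\<^sub>R \<xi>) * fourier (w j) \<xi>))\<^sup>2)"
    by (intro ennreal_leI power_mono) auto
   also have "\<dots> = (\<Sum>j. ennreal (?b j \<xi> * norm (fourier (w j) \<xi>)))\<^sup>2"
    unfolding norm_mult[symmetric]
    by (subst suminf_ennreal2[OF _ elim(2)]) (auto simp: ennreal_power suminf_nonneg[OF elim(2)])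
   finally show ?case by (simp add: ennreal_mult' mult_left_mono)
  qed
  also have "\<dots> \<le> (\<integral>\<^sup>+\<xi>. (\<Sum>j. ennreal (C * C) * (ennreal ((2 ^ j) powr (2 * s)) * ennreal ((norm (fourier (w j) \<xi>))\<^sup>2))) \<partial>lborel)"
   by (intro nn_integral_mono pt)
  also have "\<dots> = (\<Sum>j. ennreal (C * C) * (ennreal ((2 ^ j) powr (2 * s)) * l2sq lborel (fourier (w j))))"
   unfolding l2sq_def by (subst nn_integral_suminf) (auto simp: nn_integral_cmult)
  also have "\<dots> = ennreal (C * C) * level_norm s w"
   unfolding level_norm_def l2sq_fourier[OF wl] by (rule ennreal_suminf_cmult)
  finally show ?thesis .
 qed
 then show ?thesis using C(1) by (intro that[of "C * C"]) auto
qed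

section \<open>Band decomposition\<close>

text \<open>The index of the dyadic shell: 0 on the open unit ball, j + 1 where 2^j \<le> |\<xi>| <
  2^(j + 1).\<close>

definition band :: "real^'n => nat" where
 "band \<xi> = (LEAST j. norm \<xi> < 2 ^ j)"

lemma norm_less_band: "norm \<xi> < 2 ^ band \<xi>"
proof -
 obtain j :: nat where "norm \<xi> < 2 ^ j" using real_arch_pow[of 2 "norm \<xi>"] by auto
 then show ?thesis unfolding band_def by (rule LeastI)
qed

lemma band_SucD: "band \<xi> = Suc k ==> 2 ^ k \<le> norm \<xi>"
 using not_less_Least[of k "\<lambda>j. norm \<xi> < 2 ^ j"] unfolding band_def by auto

lemma band_pred_measurable [measurable]: "Measurable.pred borel (\<lambda>\<xi>. band \<xi> = j)"
 unfolding band_def by measurable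

text \<open>Sharp cut-offs do no harm, since the pieces enter through L2 norms. On band j the
  argument of \<open>bump_hat\<close> lies in the unit ball, so the quotient is at most twice the
  transform.\<close>

definition piece_hat :: "(real^'n => complex) => nat => real^'n => complex" where
 "piece_hat u j \<xi> = (if band \<xi> = j then fourier u \<xi> / bump_hat ((1 / 2 ^ j) *\<^sub>R \<xi>) else 0)"

definition pieces :: "(real^'n => complex) => nat => real^'n => complex" where
 "pieces u j = inv_fourier (piece_hat u j)"

lemma bump_hat_band:
 assumes "band \<xi> = j"
 shows "1 / 2 \<le> norm (bump_hat ((1 / 2 ^ j) *\<^sub>R \<xi>))"
 using norm_less_band[of \<xi>] assms by (intro bump_hat_lower) (simp add: field_simps)

lemma piece_hat_norm_le: "norm (piece_hat u j \<xi>) \<le> (if band \<xi> = j then 2 * norm (fourier u \<xi>) else 0)"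
proof (cases "band \<xi> = j")
 case True
 have "norm (fourier u \<xi>) / norm (bump_hat ((1 / 2 ^ j) *\<^sub>R \<xi>)) \<le> norm (fourier u \<xi>) / (1 / 2)"
  using bump_hat_band[OF True] by (intro divide_left_mono) auto
 then show ?thesis using True by (simp add: piece_hat_def norm_divide mult.commute)
qed (simp add: piece_hat_def)

lemma piece_hat_Lp2:
 assumes u: "u \<in> Lp 2 lborel"
 shows "piece_hat u j \<in> Lp 2 lborel"
proof -
 have [measurable]: "fourier u \<in> borel_measurable borel" by (intro Lp2_borel fourier_Lp2 u)
 have m: "piece_hat u j \<in> borel_measurable borel" unfolding piece_hat_def[abs_def] by measurable
 have "l2sq lborel (piece_hat u j) \<le> l2sq lborel (\<lambda>\<xi>. 2 * fourier u \<xi>)"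
  by (rule l2sq_mono) (rule order_trans[OF piece_hat_norm_le], simp add: norm_mult)
 also have "\<dots> < \<infinity>" by (intro Lp2_fin Lp2_cmult fourier_Lp2 u)
 finally show ?thesis using m by (simp add: Lp2_iff)
qed

lemma pieces_Lp2: "u \<in> Lp 2 lborel ==> pieces u j \<in> Lp 2 lborel"
 unfolding pieces_def by (intro inv_fourier_Lp2 piece_hat_Lp2)

lemma pieces_measurable: "u \<in> Lp 2 lborel ==> pieces u j \<in> borel_measurable borel"
 by (intro Lp2_borel pieces_Lp2)

text \<open>The bands are disjoint, so the sum over levels is one integral. On band j, 4^j \<le> 4
  (1 + |\<xi>|^2) accounts for \<open>4 powr s\<close>; the other 4 is the square of the factor in
  \<open>piece_hat_norm_le\<close>.\<close>

lemma level_norm_pieces_le: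
 fixes u :: "real^'n => complex"
 assumes s: "0 \<le> s" and u: "u \<in> Lp 2 lborel"
 shows "level_norm s (pieces u) \<le> ennreal (4 * 4 powr s) * sob_sq s u"
proof -
 have [measurable]: "fourier u \<in> borel_measurable borel" by (intro Lp2_borel fourier_Lp2 u)
 define F where "F \<xi> = ennreal (4 * 4 powr s) * ennreal ((1 + (norm \<xi>)\<^sup>2) powr s * (norm (fourier u \<xi>))\<^sup>2)" for \<xi>
 have [measurable]: "F \<in> borel_measurable borel" unfolding F_def by measurable
 have le: "ennreal ((2 ^ j) powr (2 * s)) * l2sq lborel (pieces u j) \<le> (\<integral>\<^sup>+\<xi>. (if band \<xi> = j then F \<xi> else 0) \<partial>lborel)" for j
 proof -
  have "ennreal ((2 ^ j) powr (2 * s)) * l2sq lborel (pieces u j) = ennreal ((2 ^ j) powr (2 * s)) * l2sq lborel (piece_hat u j)"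
   by (simp add: pieces_def l2sq_inv_fourier[OF piece_hat_Lp2[OF u]])
  also have "\<dots> = (\<integral>\<^sup>+\<xi>. ennreal ((2 ^ j) powr (2 * s)) * ennreal ((norm (piece_hat u j \<xi>))\<^sup>2) \<partial>lborel)"
   unfolding l2sq_def using Lp2_borel[OF piece_hat_Lp2[OF u]] by (intro nn_integral_cmult[symmetric]) auto
  also have "\<dots> \<le> (\<integral>\<^sup>+\<xi>. (if band \<xi> = j then F \<xi> else 0) \<partial>lborel)"
  proof (rule nn_integral_mono)
   fix \<xi> :: "real^'n"
   show "ennreal ((2 ^ j) powr (2 * s)) * ennreal ((norm (piece_hat u j \<xi>))\<^sup>2) \<le> (if band \<xi> = j then F \<xi> else 0)"
   proof (cases "band \<xi> = j")
    case True
    have "(2 ^ j)\<^sup>2 \<le> 4 * (1 + (norm \<xi>)\<^sup>2)"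
    proof (cases j)
     case 0
     then show ?thesis by simp
    next
     case (Suc k)
     then have "2 ^ k \<le> norm \<xi>" using True by (intro band_SucD) simp
     then have le: "(2 ^ k)\<^sup>2 \<le> (norm \<xi>)\<^sup>2" by (intro power_mono) auto
     have "(2 ^ j :: real)\<^sup>2 = 4 * (2 ^ k)\<^sup>2" using Suc by (simp add: power_mult_distrib)
     also have "\<dots> \<le> 4 * (norm \<xi>)\<^sup>2" using le by (rule mult_left_mono) simp
     also have "\<dots> \<le> 4 * (1 + (norm \<xi>)\<^sup>2)" by simp
     finally show ?thesis .
    qed
    then have "((2 ^ j)\<^sup>2) powr s \<le> (4 * (1 + (norm \<xi>)\<^sup>2)) powr s" using s by (intro powr_mono2) auto
    moreover have "((2 ^ j :: real)\<^sup>2) powr s = (2 ^ j) powr (2 * s)"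
     by (simp only: powr_realpow[of "2 ^ j" 2, symmetric] zero_less_power zero_less_numeral powr_powr) simp
    moreover have "(4 * (1 + (norm \<xi>)\<^sup>2)) powr s = 4 powr s * (1 + (norm \<xi>)\<^sup>2) powr s"
     by (rule powr_mult)
    ultimately have a: "(2 ^ j) powr (2 * s) \<le> 4 powr s * (1 + (norm \<xi>)\<^sup>2) powr s" by simp
    have b: "(norm (piece_hat u j \<xi>))\<^sup>2 \<le> 4 * (norm (fourier u \<xi>))\<^sup>2"
     using power_mono[OF piece_hat_norm_le[of u j \<xi>], of 2] True by (simp add: power_mult_distrib)
    have "(2 ^ j) powr (2 * s) * (norm (piece_hat u j \<xi>))\<^sup>2 \<le> (4 powr s * (1 + (norm \<xi>)\<^sup>2) powr s) * (4 * (norm (fourier u \<xi>))\<^sup>2)"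
     by (intro mult_mono a b) auto
    also have "\<dots> = (4 * 4 powr s) * ((1 + (norm \<xi>)\<^sup>2) powr s * (norm (fourier u \<xi>))\<^sup>2)" by simp
    finally show ?thesis using True by (simp add: F_def ennreal_mult'[symmetric] ennreal_leI)
   next
    case False
    then show ?thesis by (simp add: piece_hat_def)
   qed
  qed
  finally show ?thesis .
 qed
 have "level_norm s (pieces u) \<le> (\<Sum>j. \<integral>\<^sup>+\<xi>. (if band \<xi> = j then F \<xi> else 0) \<partial>lborel)"
  unfolding level_norm_def by (intro suminf_le le allI) auto
 also have "\<dots> = (\<integral>\<^sup>+\<xi>. (\<Sum>j. if band \<xi> = j then F \<xi> else 0) \<partial>lborel)"
  by (rule nn_integral_suminf[symmetric]) measurable
 also have "\<dots> = (\<integral>\<^sup>+\<xi>. F \<xi> \<partial>lborel)"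
 proof (rule nn_integral_cong)
  fix \<xi> :: "real^'n"
  have "(\<lambda>j. if j = band \<xi> then F \<xi> else 0) sums F \<xi>" by (rule sums_single)
  then show "(\<Sum>j. if band \<xi> = j then F \<xi> else 0) = F \<xi>" by (simp add: sums_iff eq_commute)
 qed
 also have "\<dots> = ennreal (4 * 4 powr s) * sob_sq s u"
  unfolding F_def sob_sq_def by (rule nn_integral_cmult) measurable
 finally show ?thesis .
qed

lemma level_norm_pieces_finite:
 assumes "0 \<le> s" "u \<in> sobolev s"
 shows "level_norm s (pieces u) < \<infinity>"
 using level_norm_pieces_le[OF assms(1), of u] assms(2)
 by (auto simp: sobolev_iff ennreal_mult_less_top intro: le_less_trans)

text \<open>On the Fourier side one level survives at each frequency, and there the division cancels
  the multiplier.\<close>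

lemma synth_pieces:
 fixes u :: "real^'n => complex"
 assumes s: "0 < s" and u: "u \<in> sobolev s"
 shows "AE x in lborel. synth (pieces u) x = u x"
proof (rule AE_eq_of_fourier_eq)
 have ul: "u \<in> Lp 2 lborel" using u by (simp add: sobolev_iff)
 have fin: "level_norm s (pieces u) < \<infinity>" using level_norm_pieces_finite[of s u] s u by simp
 note m = pieces_measurable[OF ul]
 show "synth (pieces u) \<in> Lp 2 lborel" by (rule synth_Lp2[OF s m fin])
 show "u \<in> Lp 2 lborel" by (rule ul)
 have "AE \<xi> in lborel. \<forall>j. fourier (pieces u j) \<xi> = piece_hat u j \<xi>"
  unfolding pieces_def by (intro AE_all_countable[THEN iffD2] allI fourier_inv_fourier piece_hat_Lp2 ul)
 then show "AE \<xi> in lborel. fourier (synth (pieces u)) \<xi> = fourier u \<xi>"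
  using fourier_synth[OF s m fin]
 proof eventually_elim
  case (elim \<xi>)
  have "bump_hat ((1 / 2 ^ j) *\<^sub>R \<xi>) * fourier (pieces u j) \<xi> = (if j = band \<xi> then fourier u \<xi> else 0)" for j
   using elim(1) bump_hat_band[of \<xi> j] by (auto simp: piece_hat_def)
  then have "fourier (synth (pieces u)) \<xi> = (\<Sum>j. if j = band \<xi> then fourier u \<xi> else 0)" using elim(2) by simp
  also have "\<dots> = fourier u \<xi>" by (rule sums_unique[symmetric]) (rule sums_single)
  finally show ?case .
 qed
qed

lemma inv_fourier_cong_AE:
 assumes "f \<in> Lp 2 lborel" "g \<in> Lp 2 lborel" "AE x in lborel. f x = g x"
 shows "AE x in lborel. inv_fourier f x = inv_fourier g x"
proof -
 have f: "inv_fourier f \<in> Lp 2 lborel" "inv_fourier g \<in> Lp 2 lborel" using assms by (auto intro: inv_fourier_Lp2)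
 show ?thesis
  by (rule AE_eq_of_fourier_eq[OF f])
    (use fourier_inv_fourier[OF assms(1)] fourier_inv_fourier[OF assms(2)] assms(3) in eventually_elim, simp)
qed

lemma inv_fourier_lin_AE:
 assumes f: "f \<in> Lp 2 lborel" and g: "g \<in> Lp 2 lborel"
 shows "AE x in lborel. inv_fourier (\<lambda>\<xi>. a * f \<xi> + b * g \<xi>) x = a * inv_fourier f x + b * inv_fourier g x"
proof (rule AE_eq_of_fourier_eq)
 have m: "(\<lambda>\<xi>. a * f \<xi> + b * g \<xi>) \<in> Lp 2 lborel" by (intro Lp2_add Lp2_cmult f g)
 then show "inv_fourier (\<lambda>\<xi>. a * f \<xi> + b * g \<xi>) \<in> Lp 2 lborel" by (rule inv_fourier_Lp2)
 show "(\<lambda>x. a * inv_fourier f x + b * inv_fourier g x) \<in> Lp 2 lborel" by (intro Lp2_add Lp2_cmult inv_fourier_Lp2 f g)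
 show "AE x in lborel. fourier (inv_fourier (\<lambda>\<xi>. a * f \<xi> + b * g \<xi>)) x = fourier (\<lambda>x. a * inv_fourier f x + b * inv_fourier g x) x"
  using fourier_inv_fourier[OF m] fourier_inv_fourier[OF f] fourier_inv_fourier[OF g]
   fourier_lin_AE[OF inv_fourier_Lp2[OF f] inv_fourier_Lp2[OF g], of a b]
  by eventually_elim simp
qed

lemma conv_lin:
 fixes f g :: "real^'n => complex"
 assumes "loc_int f" "loc_int g"
 shows "conv (kern j) (\<lambda>y. a * f y + b * g y) x = a * conv (kern j) f x + b * conv (kern j) g x"
proof -
 have i: "integrable lborel (\<lambda>y. kern j (x - y) * f y)" "integrable lborel (\<lambda>y. kern j (x - y) * g y)"
  by (intro conv_integrable[OF kern_continuous kern_vanishes] assms)+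
 have "conv (kern j) (\<lambda>y. a * f y + b * g y) x = (\<integral>y. a * (kern j (x - y) * f y) + b * (kern j (x - y) * g y) \<partial>lborel)"
  unfolding conv_def by (simp add: algebra_simps)
 also have "\<dots> = a * conv (kern j) f x + b * conv (kern j) g x"
  using i by (simp add: conv_def)
 finally show ?thesis .
qed

text \<open>Equality at every point, although \<open>pieces\<close> is determined only up to null
  sets, because convolution does not see null sets. Equality for Lebesgue-almost every x would say
  nothing on a null set \<Gamma>.\<close>

lemma conv_pieces_lin:
 fixes u v :: "real^'n => complex"
 assumes u: "u \<in> Lp 2 lborel" and v: "v \<in> Lp 2 lborel"
 shows "conv (kern j) (pieces (\<lambda>x. a * u x + b * v x) j) x = a * conv (kern j) (pieces u j) x + b * conv (kern j) (pieces v j) x"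
proof -
 have uv: "(\<lambda>x. a * u x + b * v x) \<in> Lp 2 lborel" by (intro Lp2_add Lp2_cmult u v)
 have "AE \<xi> in lborel. piece_hat (\<lambda>x. a * u x + b * v x) j \<xi> = a * piece_hat u j \<xi> + b * piece_hat v j \<xi>"
  using fourier_lin_AE[OF u v, of a b] by eventually_elim (simp add: piece_hat_def add_divide_distrib)
 then have "AE x in lborel. pieces (\<lambda>x. a * u x + b * v x) j x = inv_fourier (\<lambda>\<xi>. a * piece_hat u j \<xi> + b * piece_hat v j \<xi>) x"
  unfolding pieces_def by (intro inv_fourier_cong_AE Lp2_add Lp2_cmult piece_hat_Lp2 u v uv)
 then have "AE x in lborel. pieces (\<lambda>x. a * u x + b * v x) j x = a * pieces u j x + b * pieces v j x"
  using inv_fourier_lin_AE[OF piece_hat_Lp2[OF u, of j] piece_hat_Lp2[OF v, of j], of a b]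
  unfolding pieces_def by eventually_elim simp
 then have "conv (kern j) (pieces (\<lambda>x. a * u x + b * v x) j) = conv (kern j) (\<lambda>x. a * pieces u j x + b * pieces v j x)"
  using pieces_measurable[OF u, of j] pieces_measurable[OF v, of j] pieces_measurable[OF uv, of j]
  by (intro conv_cong_AE) auto
 then show ?thesis by (simp add: conv_lin Lp2_loc_int pieces_Lp2 u v)
qed

lemma test_sobolev:
 fixes \<phi> :: "real^'n => complex"
 assumes \<phi>: "\<phi> \<in> test_functions"
 shows "\<phi> \<in> sobolev s"
proof -
 have pm: "\<phi> \<in> borel_measurable borel" using \<phi> by (rule test_measurable)
 have pl: "\<phi> \<in> Lp 2 lborel" using test_integrable(2)[OF \<phi>] pm by (simp add: Lp2_iff)
 have [measurable]: "fourier_integral \<phi> \<in> borel_measurable borel" by (rule fourier_integral_measurable[OF pm])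
 obtain k :: nat where k: "\<bar>s\<bar> \<le> real k" using real_arch_simple by blast
 define \<psi> where "\<psi> \<xi> = of_real ((1 + (norm \<xi>)\<^sup>2) powr (s / 2)) * fourier_integral \<phi> \<xi>" for \<xi>
 have psm: "\<psi> \<in> borel_measurable borel" unfolding \<psi>_def by measurable
 obtain C where C: "\<And>\<xi>. (1 + norm \<xi>) ^ (2 * CARD('n) + k) * norm (fourier_integral \<phi> \<xi>) \<le> C"
  using fourier_integral_decay[OF \<phi>] by blast
 have "(1 + norm \<xi>) ^ (2 * CARD('n)) * norm (\<psi> \<xi>) \<le> C" for \<xi>
 proof -
  have "(1 + (norm \<xi>)\<^sup>2) powr (s / 2) \<le> (1 + (norm \<xi>)\<^sup>2) powr (real k / 2)"
   using k by (intro powr_mono) auto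
  also have "\<dots> \<le> ((1 + norm \<xi>)\<^sup>2) powr (real k / 2)" by (intro powr_mono2) (auto simp: power2_sum)
  also have "\<dots> = (1 + norm \<xi>) ^ k"
  proof -
   have X0: "0 < 1 + norm \<xi>" by (simp add: add_pos_nonneg)
   have "((1 + norm \<xi>)\<^sup>2) powr (real k / 2) = ((1 + norm \<xi>) powr real 2) powr (real k / 2)"
    by (simp only: powr_realpow[OF X0])
   also have "\<dots> = (1 + norm \<xi>) powr real k" by (simp only: powr_powr) simp
   finally show ?thesis by (simp only: powr_realpow[OF X0])
  qed
  finally have "norm (\<psi> \<xi>) \<le> (1 + norm \<xi>) ^ k * norm (fourier_integral \<phi> \<xi>)"
   unfolding \<psi>_def norm_mult norm_of_real by (intro mult_right_mono) auto
  then have "(1 + norm \<xi>) ^ (2 * CARD('n)) * norm (\<psi> \<xi>) \<le> (1 + norm \<xi>) ^ (2 * CARD('n)) * ((1 + norm \<xi>) ^ k * norm (fourier_integral \<phi> \<xi>))"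
   by (intro mult_left_mono) auto
  also have "\<dots> \<le> C" using C[of \<xi>] by (simp add: power_add mult.assoc)
  finally show ?thesis .
 qed
 then have fin: "l2sq lborel \<psi> < \<infinity>" by (rule decay_integrable(2)[OF psm])
 have "sob_sq s \<phi> = l2sq lborel \<psi>"
  unfolding sob_sq_def l2sq_def
 proof (rule nn_integral_cong_AE, use fourier_test_AE[OF \<phi>] in eventually_elim)
  case (elim \<xi>)
  have "((1 + (norm \<xi>)\<^sup>2) powr (s / 2))\<^sup>2 = (1 + (norm \<xi>)\<^sup>2) powr s"
   by (simp add: power2_eq_square powr_add[symmetric])
  then show ?case unfolding elim \<psi>_def norm_mult norm_of_real power_mult_distrib by simp
 qed
 then show ?thesis using fin pl by (simp add: sobolev_iff)
qed

text \<open>Equality everywhere, as the extension property of a trace operator on \<Gamma> requires.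
  The series converges uniformly, so both sides are continuous, and they agree almost everywhere by
  \<open>synth_pieces\<close>.\<close>

lemma synth_pieces_test:
 fixes \<phi> :: "real^'n => complex"
 assumes \<phi>: "\<phi> \<in> test_functions"
 shows "synth (pieces \<phi>) x = \<phi> x"
proof -
 \<comment> \<open>This choice gives 2^(j n) 2^(-2 j s) = 4^(-j), so the terms of the series are at
   most a multiple of 2^(-j).\<close>
 define s where "s = real CARD('n) / 2 + 1"
 have s: "0 < s" by (simp add: s_def)
 have \<phi>s: "\<phi> \<in> sobolev s" by (rule test_sobolev[OF \<phi>])
 then have \<phi>l: "\<phi> \<in> Lp 2 lborel" by (simp add: sobolev_iff)
 have fin: "level_norm s (pieces \<phi>) < \<infinity>" using level_norm_pieces_finite[of s \<phi>] s \<phi>s by simp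
 obtain N where N: "level_norm s (pieces \<phi>) = ennreal N" "0 \<le> N" using fin by (cases "level_norm s (pieces \<phi>)") auto
 obtain B where B: "0 < B" "\<And>b j x. length b \<le> 0 ==>
   norm (iter_deriv b (kern j) (x::real^'n)) \<le> B * (2 ^ j) ^ (CARD('n) + length b)"
  using kern_deriv_bound[of 0] by blast
 have kb: "norm (kern j x) \<le> B * (2 ^ j) ^ CARD('n)" for j and x :: "real^'n" using B(2)[of "[]" j x] by simp
 have bd: "norm (conv (kern j) (pieces \<phi> j) x) \<le> sqrt (B * N) * (1/2) ^ j" for j x
 proof -
  have "ennreal ((norm (conv (kern j) (pieces \<phi> j) x))\<^sup>2) \<le> (\<integral>\<^sup>+y. ennreal (norm (kern j (x - y)) * (norm (pieces \<phi> j y))\<^sup>2) \<partial>lborel)"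
   by (rule conv_kern_sq_bound[OF pieces_measurable[OF \<phi>l]])
  also have "\<dots> \<le> (\<integral>\<^sup>+y. ennreal (B * (2 ^ j) ^ CARD('n)) * ennreal ((norm (pieces \<phi> j y))\<^sup>2) \<partial>lborel)"
   using B(1) by (intro nn_integral_mono) (simp add: ennreal_mult'[symmetric] ennreal_leI mult_right_mono[OF kb])
  also have "\<dots> = ennreal (B * (2 ^ j) ^ CARD('n)) * l2sq lborel (pieces \<phi> j)"
   unfolding l2sq_def using pieces_measurable[OF \<phi>l, of j] by (intro nn_integral_cmult) auto
  also have "\<dots> \<le> ennreal (B * (2 ^ j) ^ CARD('n)) * ennreal (N * (2 ^ j) powr (- 2 * s))"
   using N by (intro mult_left_mono l2sq_level_le) auto
  also have "\<dots> = ennreal (B * N * ((2 ^ j) ^ CARD('n) * (2 ^ j) powr (- 2 * s)))"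
   using B N by (simp add: ennreal_mult'[symmetric] mult_ac)
  also have "(2 ^ j :: real) ^ CARD('n) * (2 ^ j) powr (- 2 * s) = ((1/2) ^ j)\<^sup>2"
  proof -
   have "(2 ^ j :: real) ^ CARD('n) = (2 ^ j) powr real CARD('n)" by (rule powr_realpow[symmetric]) simp
   then have "(2 ^ j :: real) ^ CARD('n) * (2 ^ j) powr (- 2 * s) = (2 ^ j) powr (- 2)"
    by (simp add: powr_add[symmetric] s_def)
   also have "\<dots> = ((1/2) ^ j)\<^sup>2" by (simp add: powr_minus powr_numeral power_divide field_simps)
   finally show ?thesis .
  qed
  finally have "(norm (conv (kern j) (pieces \<phi> j) x))\<^sup>2 \<le> B * N * ((1/2) ^ j)\<^sup>2"
   using B N by (subst (asm) ennreal_le_iff) auto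
  then have "norm (conv (kern j) (pieces \<phi> j) x) \<le> sqrt (B * N * ((1/2) ^ j)\<^sup>2)" by (rule real_le_rsqrt)
  then show ?thesis by (simp add: real_sqrt_mult)
 qed
 have sg: "summable (\<lambda>j. sqrt (B * N) * (1/2) ^ j)" by (intro summable_mult summable_geometric) simp
 have ul: "uniform_limit UNIV (\<lambda>J x. \<Sum>j<J. conv (kern j) (pieces \<phi> j) x) (\<lambda>x. \<Sum>j. conv (kern j) (pieces \<phi> j) x) sequentially"
  by (rule Weierstrass_m_test[OF _ sg]) (rule bd)
 have "continuous_on UNIV (\<lambda>x. \<Sum>j. conv (kern j) (pieces \<phi> j) x)"
  by (rule uniform_limit_theorem[OF _ ul])
    (auto intro!: always_eventually continuous_on_sum conv_kern_continuous Lp2_loc_int pieces_Lp2 \<phi>l)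
 then have c: "continuous_on UNIV (synth (pieces \<phi>))" by (simp add: synth_def[abs_def])
 have cl: "closed {x. synth (pieces \<phi>) x = \<phi> x}"
  using c test_continuous[OF \<phi>] by (intro closed_Collect_eq) auto
 have "AE x in lebesgue. x \<in> {x. synth (pieces \<phi>) x = \<phi> x}"
  using AE_completion[OF synth_pieces[OF s \<phi>s]] by simp
 from mem_closed_if_AE_lebesgue[OF cl this] show ?thesis by simp
qed

section \<open>The trace operator\<close>

text \<open>Dominated convergence for the counting measure on the levels. Cutting levels and domain
  together leaves finitely many pieces of compact support, so their synthesis is a test
  function.\<close>

lemma level_norm_truncation_tendsto:
 fixes w :: "nat => real^'n => complex"
 assumes m: "\<And>j. w j \<in> borel_measurable borel" and fin: "level_norm s w < \<infinity>"
 shows "(\<lambda>k. level_norm s (\<lambda>j x. w j x - (if j < k then w j x * indicator (cball 0 (real k)) x else 0))) \<longlonglongrightarrow> 0"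
proof -
 define D where "D k j x = w j x - (if j < k then w j x * indicator (cball 0 (real k)) x else 0)" for k j x
 let ?c = "\<lambda>j. ennreal ((2 ^ j) powr (2 * s))"
 have Dle: "l2sq lborel (D k j) \<le> l2sq lborel (w j)" for k j
  by (rule l2sq_mono) (auto simp: D_def indicator_def)
 have wl: "w j \<in> Lp 2 lborel" for j by (rule level_norm_Lp2[OF fin m])
 have "(\<lambda>k. \<integral>\<^sup>+j. ?c j * l2sq lborel (D k j) \<partial>count_space UNIV) \<longlonglongrightarrow> (\<integral>\<^sup>+j. 0 \<partial>count_space (UNIV::nat set))"
 proof (rule nn_integral_dominated_convergence[where w="\<lambda>j. ?c j * l2sq lborel (w j)"])
  show "(\<integral>\<^sup>+j. ?c j * l2sq lborel (w j) \<partial>count_space UNIV) < \<infinity>"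
   using fin by (simp add: level_norm_def nn_integral_count_space_nat)
  show "AE j in count_space UNIV. ?c j * l2sq lborel (D k j) \<le> ?c j * l2sq lborel (w j)" for k
   by (intro AE_I2 mult_left_mono Dle) auto
  show "AE j in count_space UNIV. (\<lambda>k. ?c j * l2sq lborel (D k j)) \<longlonglongrightarrow> 0"
  proof (rule AE_I2)
   fix j :: nat
   have "\<forall>\<^sub>F k in sequentially. l2sq lborel (\<lambda>x. w j x * indicator (cball 0 (real k)) x - w j x) = l2sq lborel (D k j)"
    using eventually_gt_at_top[of j]
    by eventually_elim (simp add: D_def[abs_def] l2sq_commute[of lborel "w j"])
   with l2sq_truncation_tendsto[OF wl] have "(\<lambda>k. l2sq lborel (D k j)) \<longlonglongrightarrow> 0"
    by (rule Lim_transform_eventually)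
   then have "(\<lambda>k. ?c j * l2sq lborel (D k j)) \<longlonglongrightarrow> ?c j * 0"
    by (intro tendsto_mult_ennreal tendsto_const) auto
   then show "(\<lambda>k. ?c j * l2sq lborel (D k j)) \<longlonglongrightarrow> 0" by simp
  qed
 qed auto
 then show ?thesis by (simp add: level_norm_def nn_integral_count_space_nat D_def[abs_def])
qed

text \<open>The witness is the value of the canonical series on \<Gamma>. Boundedness combines
  \<open>synth_l2\<close> with \<open>level_norm_pieces_le\<close>; linearity and the extension
  property come from the pointwise lemmas \<open>conv_pieces_lin\<close> and
  \<open>synth_pieces_test\<close>.\<close>

lemma trace_operator_exists:
 fixes \<Gamma> :: "(real^'n) set"
 assumes reg: "upper_regular (hausdorff_on d \<Gamma>) d c" and s: "0 < s" "real CARD('n) - d < 2 * s"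
 shows "is_trace_operator s d \<Gamma> (\<lambda>u. synth (pieces u))"
proof -
 let ?M = "hausdorff_on d \<Gamma>"
 interpret upper_regular ?M d c by (rule reg)
 have fin: "level_norm s (pieces u) < \<infinity>" if "u \<in> sobolev s" for u :: "real^'n => complex"
  using level_norm_pieces_finite[of s u] s that by simp
 have ul: "u \<in> Lp 2 lborel" if "u \<in> sobolev s" for u :: "real^'n => complex" using that by (simp add: sobolev_iff)
 show ?thesis
 proof (rule synth_l2[OF s(2)], goal_cases)
  case (1 C)
  note sm = 1(2)[OF pieces_measurable[OF ul] fin] and me = 1(3)[OF pieces_measurable[OF ul] fin]
   and le = 1(4)[OF pieces_measurable[OF ul] fin]
  have T2: "synth (pieces u) \<in> Lp 2 ?M" if u: "u \<in> sobolev s" for u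
   using me[OF u u] le[OF u u] fin[OF u] by (auto simp: Lp2_iff ennreal_mult_less_top intro: le_less_trans)
  show ?case
   unfolding is_trace_operator_def
  proof (intro conjI ballI allI)
   show "synth (pieces u) \<in> Lp 2 ?M" if u: "u \<in> sobolev s" for u by (rule T2[OF u])
  next
   fix u v :: "real^'n => complex" and a b :: complex
   assume u: "u \<in> sobolev s" and v: "v \<in> sobolev s"
   show "AE x in ?M. synth (pieces (\<lambda>y. a * u y + b * v y)) x = a * synth (pieces u) x + b * synth (pieces v) x"
    using sm[OF u u] sm[OF v v]
   proof eventually_elim
    case (elim x)
    have su: "summable (\<lambda>j. conv (kern j) (pieces u j) x)" "summable (\<lambda>j. conv (kern j) (pieces v j) x)"
     using elim by (auto dest: summable_norm_cancel)
    show ?case unfolding synth_def conv_pieces_lin[OF ul[OF u] ul[OF v]]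
     using suminf_add[OF summable_mult[OF su(1), of a] summable_mult[OF su(2), of b]]
     by (simp add: suminf_mult[OF su(1)] suminf_mult[OF su(2)])
   qed
  next
   have "Lp_norm 2 ?M (synth (pieces u)) \<le> sqrt (C * (4 * 4 powr s)) * sobolev_norm s u" if u: "u \<in> sobolev s" for u
   proof -
    obtain S where S: "sob_sq s u = ennreal S" "0 \<le> S" using u by (cases "sob_sq s u") (auto simp: sobolev_iff)
    have "l2sq ?M (synth (pieces u)) \<le> ennreal C * (ennreal (4 * 4 powr s) * sob_sq s u)"
     using le[OF u u] level_norm_pieces_le[OF less_imp_le[OF s(1)] ul[OF u]] by (meson mult_left_mono order_trans zero_le)
    also have "\<dots> = ennreal ((sqrt (C * (4 * 4 powr s)) * sqrt S)\<^sup>2)"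
     using S 1(1) by (simp add: ennreal_mult'[symmetric] power_mult_distrib mult.assoc)
    finally show ?thesis using S 1(1) T2[OF u]
     by (subst Lp_norm2_le_iff) (auto simp: sobolev_norm_eq[OF ul[OF u]])
   qed
   then show "\<exists>C. \<forall>u\<in>sobolev s. Lp_norm 2 ?M (synth (pieces u)) \<le> C * sobolev_norm s u" by blast
  next
   show "AE x in ?M. synth (pieces \<phi>) x = \<phi> x" if "\<phi> \<in> test_functions" for \<phi>
    by (simp add: synth_pieces_test[OF that])
  qed
 qed
qed

lemma trace_operator_l2sq_le:
 fixes \<Gamma> :: "(real^'n) set"
 assumes T: "is_trace_operator s d \<Gamma> T"
 obtains C where "0 \<le> C" "\<And>u. u \<in> sobolev s ==> l2sq (hausdorff_on d \<Gamma>) (T u) \<le> ennreal C * sob_sq s u"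
proof -
 obtain C where C: "\<And>u. u \<in> sobolev s ==> Lp_norm 2 (hausdorff_on d \<Gamma>) (T u) \<le> C * sobolev_norm s u"
  using T unfolding is_trace_operator_def by blast
 define D where "D = max C 0"
 have "l2sq (hausdorff_on d \<Gamma>) (T u) \<le> ennreal (D\<^sup>2) * sob_sq s u" if u: "u \<in> sobolev s" for u
 proof -
  obtain S where S: "sob_sq s u = ennreal S" "0 \<le> S" using u by (cases "sob_sq s u") (auto simp: sobolev_iff)
  have n: "sobolev_norm s u = sqrt S" using u S by (simp add: sobolev_norm_eq sobolev_iff)
  have "C * sobolev_norm s u \<le> D * sobolev_norm s u" unfolding n D_def using S by (intro mult_right_mono) auto
  then have "Lp_norm 2 (hausdorff_on d \<Gamma>) (T u) \<le> D * sqrt S" using C[OF u] n by simp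
  moreover have "T u \<in> Lp 2 (hausdorff_on d \<Gamma>)" using T u by (simp add: is_trace_operator_def)
  ultimately have "l2sq (hausdorff_on d \<Gamma>) (T u) \<le> ennreal ((D * sqrt S)\<^sup>2)"
   using S by (subst (asm) Lp_norm2_le_iff) (auto simp: D_def)
  then show ?thesis using S by (simp add: power_mult_distrib ennreal_mult')
 qed
 then show ?thesis by (intro that[of "D\<^sup>2"]) auto
qed

text \<open>Trace operators act on functions, not on classes. A difference that vanishes almost
  everywhere has Sobolev norm 0, and boundedness makes its trace 0.\<close>

lemma trace_operator_cong_AE:
 fixes \<Gamma> :: "(real^'n) set"
 assumes T: "is_trace_operator s d \<Gamma> T" and u: "u \<in> sobolev s" and v: "v \<in> sobolev s"
  and eq: "AE x in lborel. u x = v x"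
 shows "AE x in hausdorff_on d \<Gamma>. T u x = T v x"
proof -
 have ul: "u \<in> Lp 2 lborel" "v \<in> Lp 2 lborel" using u v by (auto simp: sobolev_iff)
 have dl: "(\<lambda>y. 1 * u y + (-1) * v y) \<in> Lp 2 lborel" by (intro Lp2_add Lp2_cmult ul)
 have F0: "AE \<xi> in lborel. fourier (\<lambda>y. 1 * u y + (-1) * v y) \<xi> = 0"
  using fourier_lin_AE[OF ul, of 1 "-1"] fourier_cong_AE[OF ul eq] by eventually_elim simp
 have "sob_sq s (\<lambda>y. 1 * u y + (-1) * v y) = (\<integral>\<^sup>+\<xi>. 0 \<partial>(lborel :: (real^'n) measure))"
  unfolding sob_sq_def by (rule nn_integral_cong_AE) (use F0 in eventually_elim, simp)
 then have z: "sob_sq s (\<lambda>y. 1 * u y + (-1) * v y) = 0" by simp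
 then have ds: "(\<lambda>y. 1 * u y + (-1) * v y) \<in> sobolev s" using dl by (simp add: sobolev_iff)
 obtain C where "l2sq (hausdorff_on d \<Gamma>) (T (\<lambda>y. 1 * u y + (-1) * v y)) \<le> ennreal C * sob_sq s (\<lambda>y. 1 * u y + (-1) * v y)"
  using trace_operator_l2sq_le[OF T] ds by blast
 then have "l2sq (hausdorff_on d \<Gamma>) (T (\<lambda>y. 1 * u y + (-1) * v y)) = 0" unfolding z by simp
 moreover have "T (\<lambda>y. 1 * u y + (-1) * v y) \<in> Lp 2 (hausdorff_on d \<Gamma>)" using T ds unfolding is_trace_operator_def by blast
 ultimately have "AE x in hausdorff_on d \<Gamma>. T (\<lambda>y. 1 * u y + (-1) * v y) x = 0"
  by (subst (asm) l2sq_zero_iff) (auto simp: Lp2_iff)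
 moreover have "AE x in hausdorff_on d \<Gamma>. T (\<lambda>y. 1 * u y + (-1) * v y) x = 1 * T u x + (-1) * T v x"
  using T u v unfolding is_trace_operator_def by blast
 ultimately show ?thesis by eventually_elim simp
qed

text \<open>\<open>trace_op\<close> is a choice, so the claim is made for every trace operator T.
  The synthesised truncations \<phi> k are test functions, on which T is restriction; the error
  \<open>synth (D k)\<close> tends to 0 in the Sobolev norm, hence under T, and also in L2 on
  \<Gamma>.\<close>

lemma trace_operator_synth:
 fixes \<Gamma> :: "(real^'n) set"
 assumes reg: "upper_regular (hausdorff_on d \<Gamma>) d c" and s: "0 < s" "real CARD('n) - d < 2 * s"
  and T: "is_trace_operator s d \<Gamma> T"
  and m: "\<And>j. w j \<in> borel_measurable borel" and fin: "level_norm s w < \<infinity>"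
 shows "synth w \<in> sobolev s" "AE x in hausdorff_on d \<Gamma>. T (synth w) x = synth w x"
proof -
 let ?M = "hausdorff_on d \<Gamma>"
 interpret upper_regular ?M d c by (rule reg)
 have "\<exists>C1>0. \<forall>w :: nat => real^'n => complex. (\<forall>j. w j \<in> borel_measurable borel) --> level_norm s w < \<infinity> --> sob_sq s (synth w) \<le> ennreal C1 * level_norm s w"
 proof (rule sob_sq_synth_le[OF s(1)])
  fix C :: real
  assume "0 < C" and C: "\<And>w :: nat => real^'n => complex. (\<And>j. w j \<in> borel_measurable borel) ==> level_norm s w < \<infinity> ==> sob_sq s (synth w) \<le> ennreal C * level_norm s w"
  show ?thesis by (intro exI[of _ C] conjI allI impI C \<open>0 < C\<close>) auto
 qed
 then obtain C1 where C1: "0 < C1" "\<And>w :: nat => real^'n => complex. (\<And>j. w j \<in> borel_measurable borel) ==> level_norm s w < \<infinity> ==> sob_sq s (synth w) \<le> ennreal C1 * level_norm s w"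
  by blast
 have sob: "synth w \<in> sobolev s" if "\<And>j. w j \<in> borel_measurable borel" "level_norm s w < \<infinity>" for w :: "nat => real^'n => complex"
  using C1(2)[OF that] synth_Lp2[OF s(1) that] that(2)
  by (auto simp: sobolev_iff ennreal_mult_less_top intro: le_less_trans)
 show ss: "synth w \<in> sobolev s" by (rule sob[OF m fin])
 obtain C2 where C2: "0 \<le> C2" "\<And>u. u \<in> sobolev s ==> l2sq ?M (T u) \<le> ennreal C2 * sob_sq s u"
  by (rule trace_operator_l2sq_le[OF T]) (rule that)
 interpret L: upper_regular "lborel :: (real^'n) measure" "real CARD('n)" "unit_ball_vol (real CARD('n))"
  by (rule upper_regular_lborel)
 define wk where "wk k j x = (if j < k then w j x * indicator (cball 0 (real k)) x else 0)" for k j x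
 define D where "D k j x = w j x - wk k j x" for k j x
 have wl: "w j \<in> Lp 2 lborel" for j by (rule level_norm_Lp2[OF fin m])
 note m [measurable]
 have wkm [measurable]: "wk k j \<in> borel_measurable borel" for k j unfolding wk_def[abs_def] by measurable
 have Dm: "D k j \<in> borel_measurable borel" for k j unfolding D_def[abs_def] by measurable
 have wkl: "wk k j \<in> Lp 2 lborel" for k j
 proof -
  have "l2sq lborel (wk k j) \<le> l2sq lborel (w j)" by (rule l2sq_mono) (auto simp: wk_def indicator_def)
  then show ?thesis using Lp2_fin[OF wl[of j]] wkm by (auto simp: Lp2_iff)
 qed
 have Dle: "level_norm s (D k) \<le> level_norm s w" for k
  unfolding level_norm_def by (intro suminf_le mult_left_mono l2sq_mono) (auto simp: D_def wk_def indicator_def)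
 have Dfin: "level_norm s (D k) < \<infinity>" for k using Dle fin by (rule le_less_trans)
 have Dlim: "(\<lambda>k. level_norm s (D k)) \<longlonglongrightarrow> 0"
  using level_norm_truncation_tendsto[OF m fin] by (simp add: D_def[abs_def] wk_def[abs_def])
 define \<phi> where "\<phi> k x = (\<Sum>j<k. conv (kern j) (wk k j) x)" for k x
 have sf: "(\<lambda>j. conv (kern j) (wk k j) x) sums \<phi> k x" for k x
  unfolding \<phi>_def by (rule sums_finite) (auto simp: wk_def[abs_def] conv_def)
 have \<phi>t: "\<phi> k \<in> test_functions" for k
 proof (rule test_functionsI)
  show "C_k n (\<phi> k)" for n unfolding \<phi>_def[abs_def] by (intro C_k_sum conv_kern_C_k Lp2_loc_int wkl)
  show "vanishes_beyond (real k + 1) (\<phi> k)"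
   unfolding vanishes_beyond_def
  proof (intro allI impI)
   fix x :: "real^'n" assume x: "real k + 1 < norm x"
   have "conv (kern j) (wk k j) x = 0" for j
   proof (rule conv_kern_const)
    fix y :: "real^'n" assume y: "norm (x - y) < 1 / 2 / 2 ^ j"
    have "norm (x - y) < 1" using y half_power_le_1[of j] by linarith
    then have "real k < norm y" using x norm_triangle_sub[of x y] by simp
    then show "wk k j y = 0" by (auto simp: wk_def)
   qed
   then show "\<phi> k x = 0" by (simp add: \<phi>_def)
  qed
 qed
 \<comment> \<open>A pointwise identity, so that one computation serves both Lebesgue measure and
   the measure on \<Gamma>; summability holds almost everywhere for each of them.\<close>
 have eqD: "synth (D k) x = synth w x - \<phi> k x" if "summable (\<lambda>j. norm (conv (kern j) (w j) x))" for k x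
 proof -
  have "conv (kern j) (D k j) x = conv (kern j) (w j) x - conv (kern j) (wk k j) x" for j
   using conv_lin[OF Lp2_loc_int[OF wl[of j]] Lp2_loc_int[OF wkl[of k j]], of j 1 "-1" x] by (simp add: D_def[abs_def])
  then have "(\<lambda>j. conv (kern j) (D k j) x) sums (synth w x - \<phi> k x)"
   using sums_diff[OF summable_sums[OF summable_norm_cancel[OF that]] sf[of k x]] by (simp add: synth_def)
  then show ?thesis by (simp add: synth_def sums_iff)
 qed
 have eqL: "AE x in lborel. synth (D k) x = synth w x - \<phi> k x" for k
 proof -
  have s': "real CARD('n) - real CARD('n) < 2 * s" using s by simp
  have "AE x in lborel. summable (\<lambda>j. norm (conv (kern j) (w j) x))"
  proof (rule L.synth_l2[OF s'], goal_cases)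
   case (1 C)
   show ?case by (rule 1(2)[OF m fin])
  qed
  then show ?thesis by eventually_elim (rule eqD)
 qed
 have "AE x in ?M. synth w x = T (synth w) x"
 proof (rule synth_l2[OF s(2)], goal_cases)
  case (1 C3)
  have eqM: "AE x in ?M. synth (D k) x = synth w x - \<phi> k x" for k
   using 1(2)[OF m fin] by eventually_elim (rule eqD)
  have Tw: "T (synth w) \<in> borel_measurable ?M" using T ss by (auto simp: is_trace_operator_def Lp2_iff)
  have Sw: "synth w \<in> borel_measurable ?M" by (rule 1(3)[OF m fin])
  have \<phi>m: "\<phi> k \<in> borel_measurable ?M" for k by (rule continuous_imp_measurable[OF test_continuous[OF \<phi>t]])
  have A: "l2sq ?M (\<lambda>x. \<phi> k x - T (synth w) x) \<le> ennreal (C2 * C1) * level_norm s (D k)" for k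
  proof -
   let ?d = "\<lambda>y. 1 * synth w y + (-1) * \<phi> k y"
   have \<phi>s: "\<phi> k \<in> sobolev s" by (rule test_sobolev[OF \<phi>t])
   have dl: "?d \<in> Lp 2 lborel" using ss \<phi>s by (intro Lp2_add Lp2_cmult) (auto simp: sobolev_iff)
   have "sob_sq s ?d = sob_sq s (synth (D k))"
   proof (rule sob_sq_cong_AE[OF dl synth_Lp2[OF s(1) Dm Dfin]])
    show "AE x in lborel. ?d x = synth (D k) x" using eqL[of k] by eventually_elim simp
   qed
   also have "\<dots> \<le> ennreal C1 * level_norm s (D k)" by (rule C1(2)[OF Dm Dfin])
   finally have d: "sob_sq s ?d \<le> ennreal C1 * level_norm s (D k)" .
   then have ds: "?d \<in> sobolev s" using dl Dfin[of k] by (auto simp: sobolev_iff ennreal_mult_less_top intro: le_less_trans)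
   have l: "AE x in ?M. T ?d x = 1 * T (synth w) x + (-1) * T (\<phi> k) x"
    using T ss \<phi>s unfolding is_trace_operator_def by blast
   have p: "AE x in ?M. T (\<phi> k) x = \<phi> k x" using T \<phi>t unfolding is_trace_operator_def by blast
   have "l2sq ?M (\<lambda>x. \<phi> k x - T (synth w) x) = l2sq ?M (\<lambda>x. T (synth w) x - \<phi> k x)" by (rule l2sq_commute)
   also have "\<dots> = l2sq ?M (T ?d)"
    by (rule l2sq_cong_AE) (use l p in eventually_elim, simp)
   also have "\<dots> \<le> ennreal C2 * sob_sq s ?d" by (rule C2(2)[OF ds])
   also have "\<dots> \<le> ennreal C2 * (ennreal C1 * level_norm s (D k))" by (intro mult_left_mono d) auto
   finally show ?thesis using C1(1) C2(1) by (simp add: ennreal_mult' mult.assoc)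
  qed
  have Alim: "(\<lambda>k. l2sq ?M (\<lambda>x. \<phi> k x - T (synth w) x)) \<longlonglongrightarrow> 0"
  proof (rule tendsto_sandwich[OF _ _ tendsto_const])
   show "\<forall>\<^sub>F k in sequentially. l2sq ?M (\<lambda>x. \<phi> k x - T (synth w) x) \<le> ennreal (C2 * C1) * level_norm s (D k)"
    by (intro always_eventually allI A)
   have "(\<lambda>k. ennreal (C2 * C1) * level_norm s (D k)) \<longlonglongrightarrow> ennreal (C2 * C1) * 0"
    by (intro tendsto_mult_ennreal tendsto_const Dlim) auto
   then show "(\<lambda>k. ennreal (C2 * C1) * level_norm s (D k)) \<longlonglongrightarrow> 0" by simp
  qed auto
  have B: "l2sq ?M (\<lambda>x. \<phi> k x - synth w x) \<le> ennreal C3 * level_norm s (D k)" for k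
  proof -
   have "l2sq ?M (\<lambda>x. \<phi> k x - synth w x) = l2sq ?M (\<lambda>x. synth w x - \<phi> k x)" by (rule l2sq_commute)
   also have "\<dots> = l2sq ?M (synth (D k))" by (rule l2sq_cong_AE) (use eqM[of k] in eventually_elim, simp)
   also have "\<dots> \<le> ennreal C3 * level_norm s (D k)" by (rule 1(4)[OF Dm Dfin])
   finally show ?thesis .
  qed
  have Blim: "(\<lambda>k. l2sq ?M (\<lambda>x. \<phi> k x - synth w x)) \<longlonglongrightarrow> 0"
  proof (rule tendsto_sandwich[OF _ _ tendsto_const])
   show "\<forall>\<^sub>F k in sequentially. l2sq ?M (\<lambda>x. \<phi> k x - synth w x) \<le> ennreal C3 * level_norm s (D k)"
    by (intro always_eventually allI B)
   have "(\<lambda>k. ennreal C3 * level_norm s (D k)) \<longlonglongrightarrow> ennreal C3 * 0"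
    by (intro tendsto_mult_ennreal tendsto_const Dlim) auto
   then show "(\<lambda>k. ennreal C3 * level_norm s (D k)) \<longlonglongrightarrow> 0" by simp
  qed auto
  have "l2sq ?M (\<lambda>x. synth w x - T (synth w) x) \<le> 2 * l2sq ?M (\<lambda>x. \<phi> k x - T (synth w) x) + 2 * l2sq ?M (\<lambda>x. \<phi> k x - synth w x)" for k
  proof -
   have "l2sq ?M (\<lambda>x. (\<phi> k x - T (synth w) x) - (\<phi> k x - synth w x)) \<le> 2 * l2sq ?M (\<lambda>x. \<phi> k x - T (synth w) x) + 2 * l2sq ?M (\<lambda>x. \<phi> k x - synth w x)"
    using Tw Sw \<phi>m by (intro l2sq_diff) auto
   then show ?thesis by simp
  qed
  moreover have "(\<lambda>k. 2 * l2sq ?M (\<lambda>x. \<phi> k x - T (synth w) x) + 2 * l2sq ?M (\<lambda>x. \<phi> k x - synth w x)) \<longlonglongrightarrow> 2 * 0 + 2 * 0"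
   by (intro tendsto_add tendsto_mult_ennreal tendsto_const Alim Blim) auto
  ultimately have "l2sq ?M (\<lambda>x. synth w x - T (synth w) x) \<le> 2 * 0 + 2 * 0"
   by (intro LIMSEQ_le_const) auto
  then have "l2sq ?M (\<lambda>x. synth w x - T (synth w) x) = 0" by simp
  then have "AE x in ?M. synth w x - T (synth w) x = 0"
   using Tw Sw by (subst (asm) l2sq_zero_iff) auto
  then show ?case by eventually_elim simp
 qed
 then show "AE x in ?M. T (synth w) x = synth w x" by eventually_elim simp
qed

text \<open>Joins the two uniqueness facts: T is determined on the series by
  \<open>trace_operator_synth\<close>, and on other representatives of it by
  \<open>trace_operator_cong_AE\<close>.\<close>

lemma trace_op_synth:
 fixes \<Gamma> :: "(real^'n) set"
 assumes reg: "upper_regular (hausdorff_on d \<Gamma>) d c" and s: "0 < s" "real CARD('n) - d < 2 * s"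
  and m: "\<And>j. w j \<in> borel_measurable borel" and fin: "level_norm s w < \<infinity>"
  and u: "u \<in> sobolev s" "AE x in lborel. synth w x = u x"
 shows "AE x in hausdorff_on d \<Gamma>. trace_op s d \<Gamma> u x = synth w x"
proof -
 have T: "is_trace_operator s d \<Gamma> (trace_op s d \<Gamma>)"
  unfolding trace_op_def using trace_operator_exists[OF reg s] by (rule someI[of "is_trace_operator s d \<Gamma>"])
 note S = trace_operator_synth[OF reg s T m fin]
 have "AE x in hausdorff_on d \<Gamma>. trace_op s d \<Gamma> (synth w) x = trace_op s d \<Gamma> u x"
  by (rule trace_operator_cong_AE[OF T S(1) u])
 with S(2) show ?thesis by eventually_elim simp
qed

section \<open>Dyadic boxes\<close>

text \<open>A cube in coordinates rescaled to unit side: R = 1/2 gives the dyadic cube, R = 3/2 its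
  triple. Enlargements become additions to R, see \<open>dbox_shift\<close>.\<close>

definition dbox :: "real => nat => int^'n => (real^'n) set" where
 "dbox R \<nu> m = {x. \<forall>i. \<bar>2 ^ \<nu> * x $ i - (of_int (m $ i) + 1 / 2)\<bar> \<le> R}"

lemma dilated_cube_3: "dilated_cube 3 \<nu> m = dbox (3 / 2) \<nu> m"
proof -
 have p: "2 powr (- real \<nu>) = 1 / 2 ^ \<nu>" by (simp add: powr_minus powr_realpow divide_inverse)
 have pos: "(0::real) < 2 ^ \<nu>" by simp
 have cub: "y \<in> dyadic_cube \<nu> m \<longleftrightarrow> (\<forall>i. \<bar>2 ^ \<nu> * y $ i - (of_int (m $ i) + 1 / 2)\<bar> \<le> 1 / 2)" for y :: "real^'a"
 proof -
  have "(2 powr (- real \<nu>) * of_int (m $ i) \<le> y $ i \<and> y $ i \<le> 2 powr (- real \<nu>) * (of_int (m $ i) + 1))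
    \<longleftrightarrow> \<bar>2 ^ \<nu> * y $ i - (of_int (m $ i) + 1 / 2)\<bar> \<le> 1 / 2" for i
   unfolding p using pos by (auto simp: field_simps abs_le_iff)
  then show ?thesis unfolding dyadic_cube_def mem_box_cart by simp
 qed
 have cen: "2 ^ \<nu> * cube_centre \<nu> m $ i = of_int (m $ i) + 1 / 2" for i
  unfolding cube_centre_def p by simp
 show ?thesis
 proof (intro set_eqI iffI)
  fix x assume "x \<in> dilated_cube 3 \<nu> m"
  then obtain y where y: "y \<in> dyadic_cube \<nu> m" "x = cube_centre \<nu> m + 3 *\<^sub>R (y - cube_centre \<nu> m)"
   by (auto simp: dilated_cube_def)
  have "2 ^ \<nu> * x $ i - (of_int (m $ i) + 1 / 2) = 3 * (2 ^ \<nu> * y $ i - (of_int (m $ i) + 1 / 2))" for i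
   using cen[of i] unfolding y(2) by (simp add: algebra_simps)
  then have "\<bar>2 ^ \<nu> * x $ i - (of_int (m $ i) + 1 / 2)\<bar> = 3 * \<bar>2 ^ \<nu> * y $ i - (of_int (m $ i) + 1 / 2)\<bar>" for i
   by (simp only: abs_mult abs_numeral)
  moreover have "\<bar>2 ^ \<nu> * y $ i - (of_int (m $ i) + 1 / 2)\<bar> \<le> 1 / 2" for i using y(1) unfolding cub by blast
  ultimately show "x \<in> dbox (3 / 2) \<nu> m" unfolding dbox_def by (smt (verit) mem_Collect_eq field_sum_of_halves)
 next
  fix x assume x: "x \<in> dbox (3 / 2) \<nu> m"
  define y where "y = cube_centre \<nu> m + (1 / 3) *\<^sub>R (x - cube_centre \<nu> m)"
  have "2 ^ \<nu> * y $ i - (of_int (m $ i) + 1 / 2) = (1 / 3) * (2 ^ \<nu> * x $ i - (of_int (m $ i) + 1 / 2))" for i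
   using cen[of i] unfolding y_def by (simp add: algebra_simps)
  then have y3: "\<bar>2 ^ \<nu> * y $ i - (of_int (m $ i) + 1 / 2)\<bar> = (1 / 3) * \<bar>2 ^ \<nu> * x $ i - (of_int (m $ i) + 1 / 2)\<bar>" for i
   by (simp only: abs_mult abs_divide abs_numeral abs_one)
  have x3: "\<bar>2 ^ \<nu> * x $ i - (of_int (m $ i) + 1 / 2)\<bar> \<le> 3 / 2" for i using x unfolding dbox_def by blast
  then have "\<bar>2 ^ \<nu> * y $ i - (of_int (m $ i) + 1 / 2)\<bar> \<le> 1 / 2" for i unfolding y3 using x3[of i] by simp
  then have "y \<in> dyadic_cube \<nu> m" unfolding cub by blast
  moreover have "x = cube_centre \<nu> m + 3 *\<^sub>R (y - cube_centre \<nu> m)" by (simp add: y_def)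
  ultimately show "x \<in> dilated_cube 3 \<nu> m" unfolding dilated_cube_def by blast
 qed
qed

lemma closed_dbox: "closed (dbox R \<nu> m)"
proof -
 have "dbox R \<nu> m = (\<Inter>i. {x. \<bar>2 ^ \<nu> * x $ i - (of_int (m $ i) + 1 / 2)\<bar> \<le> R})"
  by (auto simp: dbox_def)
 moreover have "closed {x::real^'a. \<bar>2 ^ \<nu> * x $ i - (of_int (m $ i) + 1 / 2)\<bar> \<le> R}" for i
  by (intro closed_Collect_le continuous_intros)
 ultimately show ?thesis by auto
qed

lemma dbox_shift:
 assumes "x \<in> dbox R \<nu> m" "2 ^ \<nu> * norm (x - y) \<le> r"
 shows "y \<in> dbox (R + r) \<nu> m"
 unfolding dbox_def
proof (intro CollectI allI)
 fix i
 have "\<bar>2 ^ \<nu> * y $ i - (of_int (m $ i) + 1 / 2)\<bar> \<le> \<bar>2 ^ \<nu> * x $ i - (of_int (m $ i) + 1 / 2)\<bar> + 2 ^ \<nu> * \<bar>(x - y) $ i\<bar>"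
 proof -
  have "2 ^ \<nu> * y $ i - (of_int (m $ i) + 1 / 2) = (2 ^ \<nu> * x $ i - (of_int (m $ i) + 1 / 2)) - 2 ^ \<nu> * ((x - y) $ i)"
   by (simp add: algebra_simps)
  then show ?thesis using abs_triangle_ineq4[of "2 ^ \<nu> * x $ i - (of_int (m $ i) + 1 / 2)" "2 ^ \<nu> * ((x - y) $ i)"]
   by (simp add: abs_mult)
 qed
 also have "\<dots> \<le> R + r"
 proof (rule add_mono)
  show "\<bar>2 ^ \<nu> * x $ i - (of_int (m $ i) + 1 / 2)\<bar> \<le> R" using assms(1) by (simp add: dbox_def)
  have "2 ^ \<nu> * \<bar>(x - y) $ i\<bar> \<le> 2 ^ \<nu> * norm (x - y)" by (intro mult_left_mono component_le_norm_cart) simp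
  then show "2 ^ \<nu> * \<bar>(x - y) $ i\<bar> \<le> r" using assms(2) by linarith
 qed
 finally show "\<bar>2 ^ \<nu> * y $ i - (of_int (m $ i) + 1 / 2)\<bar> \<le> R + r" .
qed

lemma dbox_mono: "R \<le> R' ==> dbox R \<nu> m \<subseteq> dbox R' \<nu> m"
 by (auto simp: dbox_def intro: order_trans)

lemma finite_int_vec:
 fixes A :: "'n::finite => int set"
 assumes "\<And>i. finite (A i)"
 shows "finite {m :: int^'n. \<forall>i. m $ i \<in> A i}" "card {m :: int^'n. \<forall>i. m $ i \<in> A i} \<le> (\<Prod>i\<in>UNIV. card (A i))"
proof -
 have inj: "inj_on (\<lambda>m :: int^'n. \<lambda>i. m $ i) {m. \<forall>i. m $ i \<in> A i}" by (auto simp: inj_on_def vec_eq_iff fun_eq_iff)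
 have im: "(\<lambda>m :: int^'n. \<lambda>i. m $ i) ` {m. \<forall>i. m $ i \<in> A i} \<subseteq> PiE UNIV A" by auto
 have fin: "finite (PiE UNIV A)" using assms by (intro finite_PiE) auto
 show "finite {m :: int^'n. \<forall>i. m $ i \<in> A i}"
  using finite_imageD[OF finite_subset[OF im fin] inj] .
 show "card {m :: int^'n. \<forall>i. m $ i \<in> A i} \<le> (\<Prod>i\<in>UNIV. card (A i))"
  using card_inj_on_le[OF inj im fin] by (simp add: card_PiE)
qed

text \<open>A sequence cofinal among the finite index sets. Unconditional sums over m thereby become
  sequential limits, to which the lemmas of Fatou type apply.\<close>

definition int_cube :: "nat => (int^'n) set" where
 "int_cube k = {m. \<forall>i. m $ i \<in> {- int k..int k}}"

lemma finite_int_cube: "finite (int_cube k)"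
 unfolding int_cube_def by (rule finite_int_vec(1)) simp

lemma int_cube_mono: "k \<le> l ==> int_cube k \<subseteq> int_cube l"
proof
 fix m :: "int^'a" assume kl: "k \<le> l" and m: "m \<in> int_cube k"
 have "m $ i \<in> {- int l..int l}" for i
 proof -
  have "m $ i \<in> {- int k..int k}" using m by (simp add: int_cube_def)
  then show ?thesis using kl by simp
 qed
 then show "m \<in> int_cube l" by (simp add: int_cube_def)
qed

lemma int_cube_exhausts:
 fixes F :: "(int^'n) set"
 assumes "finite F"
 shows "\<exists>k. F \<subseteq> int_cube k"
 using assms
proof induction
 case (insert m F)
 then obtain k where k: "F \<subseteq> int_cube k" by blast
 define l where "l = nat (Max (range (\<lambda>i. \<bar>m $ i\<bar>)))"
 have "\<bar>m $ i\<bar> \<le> int l" for i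
 proof -
  have "\<bar>m $ i\<bar> \<le> Max (range (\<lambda>i. \<bar>m $ i\<bar>))" by (rule Max_ge) auto
  moreover have "0 \<le> \<bar>m $ i\<bar>" by simp
  ultimately show ?thesis unfolding l_def by linarith
 qed
 then have "m \<in> int_cube l" by (auto simp: int_cube_def abs_le_iff) (metis minus_le_iff)
 then have "m \<in> int_cube (max k l)" using int_cube_mono[of l "max k l"] by auto
 moreover have "F \<subseteq> int_cube (max k l)" using k int_cube_mono[of k "max k l"] by auto
 ultimately show ?case by blast
qed simp

lemma filterlim_int_cube: "filterlim int_cube (finite_subsets_at_top (UNIV :: (int^'n) set)) sequentially"
 unfolding filterlim_iff eventually_finite_subsets_at_top
proof (intro allI impI)
 fix P :: "(int^'n) set => bool"
 assume "\<exists>X. finite X \<and> X \<subseteq> UNIV \<and> (\<forall>Y. finite Y \<and> X \<subseteq> Y \<and> Y \<subseteq> UNIV --> P Y)"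
 then obtain X where X: "finite X" "\<And>Y. finite Y ==> X \<subseteq> Y ==> P Y" by auto
 obtain k where k: "X \<subseteq> int_cube k" using int_cube_exhausts[OF X(1)] by blast
 show "\<forall>\<^sub>F k in sequentially. P (int_cube k)"
  using eventually_ge_at_top[of k]
 proof eventually_elim
  case (elim l)
  then show ?case using k int_cube_mono[of k l] by (intro X(2) finite_int_cube) auto
 qed
qed

lemma countable_int_vec: "countable (UNIV :: (int^'n) set)"
proof -
 have "countable {m :: int^'n. \<forall>i. m $ i \<in> UNIV}" by (rule countable_vector) simp
 then show ?thesis by simp
qed

text \<open>Half-open cubes: every point lies in exactly one cell, whereas closed dyadic cubes
  overlap on their faces.\<close>

definition cell :: "nat => real^'n => int^'n" where
 "cell \<nu> x = (\<chi> i. \<lfloor>2 ^ \<nu> * x $ i\<rfloor>)"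

definition cell_set :: "nat => (int^'n) set => (real^'n) set" where
 "cell_set \<nu> S = {x. cell \<nu> x \<in> S}"

lemma cell_set_measurable [measurable]: "finite S ==> cell_set \<nu> S \<in> sets borel"
proof -
 assume S: "finite S"
 have "{x. cell \<nu> x = m} \<in> sets borel" for m :: "int^'a"
 proof -
  have "{x. cell \<nu> x = m} = (\<Inter>i. {x. \<lfloor>2 ^ \<nu> * x $ i\<rfloor> = m $ i})"
   by (auto simp: cell_def vec_eq_iff)
  moreover have "{x::real^'a. \<lfloor>2 ^ \<nu> * x $ i\<rfloor> = m $ i} \<in> sets borel" for i by measurable
  ultimately show ?thesis by (auto intro!: sets.countable_INT)
 qed
 then have "(\<Union>m\<in>S. {x. cell \<nu> x = m}) \<in> sets borel" using S by (intro sets.finite_UN) auto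
 moreover have "(\<Union>m\<in>S. {x. cell \<nu> x = m}) = cell_set \<nu> S" by (auto simp: cell_set_def)
 ultimately show ?thesis by simp
qed

lemma cell_set_dbox: "cell_set \<nu> {m} \<subseteq> dbox (1 / 2) \<nu> m"
proof
 fix x assume "x \<in> cell_set \<nu> {m}"
 then have m: "m = cell \<nu> x" by (simp add: cell_set_def)
 show "x \<in> dbox (1 / 2) \<nu> m"
  unfolding dbox_def
 proof (intro CollectI allI)
  fix i
  have "of_int (m $ i) \<le> 2 ^ \<nu> * x $ i" "2 ^ \<nu> * x $ i < of_int (m $ i) + 1"
   unfolding m cell_def by (simp_all add: floor_correct)
  then show "\<bar>2 ^ \<nu> * x $ i - (of_int (m $ i) + 1 / 2)\<bar> \<le> 1 / 2" by linarith
 qed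
qed

lemma emeasure_dbox_half: "emeasure lborel (dbox (1 / 2) \<nu> (m :: int^'n)) = ennreal ((1 / 2 ^ \<nu>) ^ CARD('n))"
proof -
 let ?a = "(\<chi> i. of_int (m $ i) / 2 ^ \<nu>) :: real^'n" and ?b = "(\<chi> i. (of_int (m $ i) + 1) / 2 ^ \<nu>) :: real^'n"
 have pos: "(0::real) < 2 ^ \<nu>" by simp
 have "x \<in> dbox (1 / 2) \<nu> m \<longleftrightarrow> x \<in> cbox ?a ?b" for x :: "real^'n"
 proof -
  have "\<bar>2 ^ \<nu> * x $ i - (of_int (m $ i) + 1 / 2)\<bar> \<le> 1 / 2 \<longleftrightarrow> of_int (m $ i) / 2 ^ \<nu> \<le> x $ i \<and> x $ i \<le> (of_int (m $ i) + 1) / 2 ^ \<nu>" for i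
   using pos by (auto simp: field_simps abs_le_iff)
  then show ?thesis unfolding dbox_def mem_box_cart by simp
 qed
 then have e: "dbox (1 / 2) \<nu> m = cbox ?a ?b" by blast
 have le: "?a \<bullet> b \<le> ?b \<bullet> b" if "b \<in> Basis" for b :: "real^'n"
  using that pos by (auto simp: Basis_vec_def inner_axis divide_right_mono)
 have "emeasure lborel (cbox ?a ?b) = ennreal (\<Prod>b\<in>Basis. (?b - ?a) \<bullet> b)"
  using le by (subst emeasure_lborel_cbox_eq) auto
 also have "(\<Prod>b\<in>Basis. (?b - ?a) \<bullet> b) = (\<Prod>b\<in>(Basis :: (real^'n) set). 1 / 2 ^ \<nu>)"
  by (intro prod.cong refl) (auto simp: Basis_vec_def inner_axis diff_divide_distrib[symmetric])
 also have "\<dots> = (1 / 2 ^ \<nu>) ^ CARD('n)" by simp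
 finally show ?thesis by (simp add: e)
qed

section \<open>Mollified pieces are combinations of smooth atoms\<close>

text \<open>Cauchy-Schwarz on one cell: the derivative of the kernel is at most A 2^(\<nu> (n +
  |b|)), and the cell contributes the square root of its volume, at most 2^(-\<nu> n / 2).\<close>

lemma cell_piece_bounds:
 obtains A where "0 < A"
  "\<And>\<nu> (m::int^'n) w b x. w \<in> Lp 2 lborel ==> length b \<le> K ==>
   norm (iter_deriv b (conv (kern \<nu>) (\<lambda>y. w y * indicator (cell_set \<nu> {m}) y)) x)
    \<le> A * (2 ^ \<nu>) powr (real CARD('n) / 2 + real (length b)) * sqrt (enn2real (l2sq lborel (\<lambda>y. w y * indicator (cell_set \<nu> {m}) y)))"
proof -
 obtain A where A: "0 < A" "\<And>b j x. length b \<le> K ==>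
   norm (iter_deriv b (kern j) (x::real^'n)) \<le> A * (2 ^ j) ^ (CARD('n) + length b)"
  using kern_deriv_bound[of K] by blast
 have "norm (iter_deriv b (conv (kern \<nu>) (\<lambda>y. w y * indicator (cell_set \<nu> {m}) y)) x)
    \<le> A * (2 ^ \<nu>) powr (real CARD('n) / 2 + real (length b)) * sqrt (enn2real (l2sq lborel (\<lambda>y. w y * indicator (cell_set \<nu> {m}) y)))"
  if w: "w \<in> Lp 2 lborel" and b: "length b \<le> K" for \<nu> and m :: "int^'n" and w b x
 proof -
  let ?E = "cell_set \<nu> {m}"
  let ?w = "\<lambda>y. w y * indicator ?E y"
  have [measurable]: "w \<in> borel_measurable borel" using w by (rule Lp2_borel)
  have Em [measurable]: "?E \<in> sets borel" by (rule cell_set_measurable) simp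
  have wm: "?w \<in> borel_measurable borel" by measurable
  have "l2sq lborel ?w \<le> l2sq lborel w" by (rule l2sq_mono) (auto simp: indicator_def)
  then have wl: "?w \<in> Lp 2 lborel" using Lp2_fin[OF w] wm by (auto simp: Lp2_iff)
  obtain W where W: "l2sq lborel ?w = ennreal W" "0 \<le> W" using Lp2_fin[OF wl] by (cases "l2sq lborel ?w") auto
  define D where "D = A * (2 ^ \<nu>) ^ (CARD('n) + length b)"
  have D0: "0 \<le> D" using A by (simp add: D_def)
  have Dm [measurable]: "iter_deriv b (kern \<nu>) \<in> borel_measurable (borel :: (real^'n) measure)"
   by (intro borel_measurable_continuous_onI iter_deriv_continuous[OF kern_C_k order_refl])
  have "iter_deriv b (conv (kern \<nu>) ?w) x = conv (iter_deriv b (kern \<nu>)) ?w x"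
   by (rule fun_cong[OF conv_iter_deriv[OF kern_C_k kern_vanishes Lp2_loc_int[OF wl]]])
  then have "ennreal (norm (iter_deriv b (conv (kern \<nu>) ?w) x)) \<le> (\<integral>\<^sup>+y. ennreal (norm (iter_deriv b (kern \<nu>) (x - y) * ?w y)) \<partial>lborel)"
   unfolding conv_def
   by (cases "integrable lborel (\<lambda>y. iter_deriv b (kern \<nu>) (x - y) * ?w y)")
     (auto dest: integral_norm_bound_ennreal simp: not_integrable_integral_eq)
  also have "\<dots> \<le> (\<integral>\<^sup>+y. ennreal (indicator ?E y * (D * norm (w y * indicator ?E y))) \<partial>lborel)"
  proof (intro nn_integral_mono ennreal_leI)
   fix y
   show "norm (iter_deriv b (kern \<nu>) (x - y) * ?w y) \<le> indicator ?E y * (D * norm (w y * indicator ?E y))"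
    using A(2)[OF b, of \<nu> "x - y"] unfolding D_def[symmetric]
    by (cases "y \<in> ?E") (auto simp: norm_mult intro!: mult_right_mono)
  qed
  finally have "(ennreal (norm (iter_deriv b (conv (kern \<nu>) ?w) x)))\<^sup>2 \<le> (\<integral>\<^sup>+y. ennreal (indicator ?E y * (D * norm (w y * indicator ?E y))) \<partial>lborel)\<^sup>2"
   by (rule power_mono) simp
  also have "\<dots> \<le> (\<integral>\<^sup>+y. ennreal ((indicator ?E y)\<^sup>2) \<partial>lborel) * (\<integral>\<^sup>+y. ennreal ((D * norm (w y * indicator ?E y))\<^sup>2) \<partial>lborel)"
   using D0 by (intro nn_integral_Cauchy_Schwarz) auto
  also have "(\<integral>\<^sup>+y. ennreal ((indicator ?E y)\<^sup>2) \<partial>lborel) = (\<integral>\<^sup>+y. indicator ?E y \<partial>lborel)"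
   by (intro nn_integral_cong) (auto simp: indicator_def)
  also have "\<dots> = emeasure lborel ?E" by (rule nn_integral_indicator) simp
  also have "(\<integral>\<^sup>+y. ennreal ((D * norm (w y * indicator ?E y))\<^sup>2) \<partial>lborel) = ennreal (D\<^sup>2) * l2sq lborel ?w"
   unfolding l2sq_def power_mult_distrib by (subst nn_integral_cmult[symmetric]) (auto simp: ennreal_mult')
  also have "emeasure lborel ?E * (ennreal (D\<^sup>2) * l2sq lborel ?w) \<le> ennreal ((1 / 2 ^ \<nu>) ^ CARD('n)) * (ennreal (D\<^sup>2) * l2sq lborel ?w)"
  proof (rule mult_right_mono)
   have "emeasure lborel ?E \<le> emeasure lborel (dbox (1 / 2) \<nu> m)"
    by (rule emeasure_mono[OF cell_set_dbox]) (simp add: closed_dbox)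
   then show "emeasure lborel ?E \<le> ennreal ((1 / 2 ^ \<nu>) ^ CARD('n))" by (simp add: emeasure_dbox_half)
  qed simp
  also have "\<dots> = ennreal ((1 / 2 ^ \<nu>) ^ CARD('n) * (D\<^sup>2 * W))"
   unfolding W(1) using W(2) by (simp add: ennreal_mult'[symmetric])
  finally have "(norm (iter_deriv b (conv (kern \<nu>) ?w) x))\<^sup>2 \<le> (1 / 2 ^ \<nu>) ^ CARD('n) * (D\<^sup>2 * W)"
   using W(2) by (simp add: ennreal_power)
  then have "norm (iter_deriv b (conv (kern \<nu>) ?w) x) \<le> sqrt ((1 / 2 ^ \<nu>) ^ CARD('n) * (D\<^sup>2 * W))" by (rule real_le_rsqrt)
  also have "\<dots> = D * sqrt ((1 / 2 ^ \<nu>) ^ CARD('n)) * sqrt W" using D0 by (simp add: real_sqrt_mult)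
  also have "D * sqrt ((1 / 2 ^ \<nu>) ^ CARD('n)) = A * (2 ^ \<nu>) powr (real CARD('n) / 2 + real (length b))"
  proof -
   define X :: real where "X = 2 ^ \<nu>"
   have p: "0 < X" by (simp add: X_def)
   have "(1 / X) ^ CARD('n) = inverse (X powr real CARD('n))" by (simp only: powr_realpow[OF p] power_one_over inverse_eq_divide)
   also have "\<dots> = X powr (- real CARD('n))" by (simp only: powr_minus)
   finally have "sqrt ((1 / X) ^ CARD('n)) = (X powr (- real CARD('n))) powr (1 / 2)" using p by (simp add: powr_half_sqrt)
   then have 1: "sqrt ((1 / X) ^ CARD('n)) = X powr (- real CARD('n) / 2)" by (simp add: powr_powr)
   have 2: "X ^ (CARD('n) + length b) = X powr (real (CARD('n) + length b))"
    using p by (rule powr_realpow[symmetric])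
   have 3: "real (CARD('n) + length b) + - real CARD('n) / 2 = real CARD('n) / 2 + real (length b)" by simp
   show ?thesis unfolding D_def X_def[symmetric] 1 2 mult.assoc powr_add[symmetric] 3 ..
  qed
  finally show ?thesis using W by simp
 qed
 with A(1) show ?thesis by (rule that)
qed

lemma sum_l2sq_cells:
 fixes w :: "real^'n => complex"
 assumes w: "w \<in> borel_measurable borel" and S: "finite S"
 shows "(\<Sum>m\<in>S. l2sq lborel (\<lambda>y. w y * indicator (cell_set \<nu> {m}) y)) = l2sq lborel (\<lambda>y. w y * indicator (cell_set \<nu> S) y)"
proof -
 note w [measurable]
 have [measurable]: "cell_set \<nu> {m} \<in> sets borel" for m :: "int^'n" by (rule cell_set_measurable) simp
 have "(\<Sum>m\<in>S. l2sq lborel (\<lambda>y. w y * indicator (cell_set \<nu> {m}) y)) = (\<integral>\<^sup>+y. (\<Sum>m\<in>S. ennreal ((norm (w y * indicator (cell_set \<nu> {m}) y))\<^sup>2)) \<partial>lborel)"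
  unfolding l2sq_def by (rule nn_integral_sum[symmetric]) measurable
 also have "\<dots> = l2sq lborel (\<lambda>y. w y * indicator (cell_set \<nu> S) y)"
  unfolding l2sq_def
 proof (rule nn_integral_cong)
  fix y
  have "(\<Sum>m\<in>S. ennreal ((norm (w y * indicator (cell_set \<nu> {m}) y))\<^sup>2)) = (\<Sum>m\<in>S. if m = cell \<nu> y then ennreal ((norm (w y))\<^sup>2) else 0)"
   by (intro sum.cong refl) (auto simp: cell_set_def)
  also have "\<dots> = ennreal ((norm (w y * indicator (cell_set \<nu> S) y))\<^sup>2)"
   using S by (auto simp: cell_set_def)
  finally show "(\<Sum>m\<in>S. ennreal ((norm (w y * indicator (cell_set \<nu> {m}) y))\<^sup>2)) = ennreal ((norm (w y * indicator (cell_set \<nu> S) y))\<^sup>2)" .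
 qed
 finally show ?thesis .
qed

lemma conv_sum:
 assumes "finite S" "\<And>i. i \<in> S ==> loc_int (g i)"
 shows "conv (kern j) (\<lambda>y. \<Sum>i\<in>S. c i * g i y) x = (\<Sum>i\<in>S. c i * conv (kern j) (g i) x)"
proof -
 have i: "integrable lborel (\<lambda>y. c i * (kern j (x - y) * g i y))" if "i \<in> S" for i
  by (intro integrable_mult_right conv_integrable[OF kern_continuous kern_vanishes] assms that)
 have "conv (kern j) (\<lambda>y. \<Sum>i\<in>S. c i * g i y) x = (\<integral>y. (\<Sum>i\<in>S. c i * (kern j (x - y) * g i y)) \<partial>lborel)"
  unfolding conv_def by (simp add: sum_distrib_left mult_ac)
 also have "\<dots> = (\<Sum>i\<in>S. \<integral>y. c i * (kern j (x - y) * g i y) \<partial>lborel)"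
  by (rule Bochner_Integration.integral_sum) (rule i)
 finally show ?thesis by (simp add: conv_def)
qed

text \<open>The error decreases as S grows, so convergence along the sequence
  \<open>int_cube k\<close>, which dominated convergence provides, gives convergence along all
  finite sets.\<close>

lemma cell_truncation_tendsto:
 fixes w :: "real^'n => complex"
 assumes w: "w \<in> Lp 2 lborel"
 shows "((\<lambda>S. l2sq lborel (\<lambda>y. w y * indicator (cell_set \<nu> S) y - w y)) \<longlongrightarrow> 0) (finite_subsets_at_top UNIV)"
proof (rule order_tendstoI)
 have wm [measurable]: "w \<in> borel_measurable borel" using w by (rule Lp2_borel)
 have cm [measurable]: "cell_set \<nu> (int_cube k) \<in> sets (borel :: (real^'n) measure)" for k by (intro cell_set_measurable finite_int_cube)
 fix e :: ennreal assume e: "0 < e"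
 have "(\<lambda>k. \<integral>\<^sup>+x. ennreal ((norm (w x * indicator (cell_set \<nu> (int_cube k)) x - w x))\<^sup>2) \<partial>lborel) \<longlonglongrightarrow> (\<integral>\<^sup>+x. (0::ennreal) \<partial>(lborel :: (real^'n) measure))"
 proof (rule nn_integral_dominated_convergence[where w="\<lambda>x. ennreal ((norm (w x))\<^sup>2)"])
  show "(\<integral>\<^sup>+x. ennreal ((norm (w x))\<^sup>2) \<partial>lborel) < \<infinity>" using Lp2_fin[OF w] by (simp add: l2sq_def)
  show "AE x in lborel. (\<lambda>k. ennreal ((norm (w x * indicator (cell_set \<nu> (int_cube k)) x - w x))\<^sup>2)) \<longlonglongrightarrow> 0"
  proof (rule AE_I2, rule tendsto_eventually)
   fix x :: "real^'n"
   obtain N where N: "{cell \<nu> x} \<subseteq> int_cube N" using int_cube_exhausts[of "{cell \<nu> x}"] by auto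
   show "\<forall>\<^sub>F k in sequentially. ennreal ((norm (w x * indicator (cell_set \<nu> (int_cube k)) x - w x))\<^sup>2) = 0"
    using eventually_ge_at_top[of N]
   proof eventually_elim
    case (elim k)
    then have "x \<in> cell_set \<nu> (int_cube k)" using N int_cube_mono[of N k] by (auto simp: cell_set_def)
    then show ?case by simp
   qed
  qed
  show "AE x in lborel. ennreal ((norm (w x * indicator (cell_set \<nu> (int_cube j)) x - w x))\<^sup>2) \<le> ennreal ((norm (w x))\<^sup>2)" for j
   by (rule AE_I2) (auto simp: indicator_def)
 qed measurable
 then have "(\<lambda>k. l2sq lborel (\<lambda>x. w x * indicator (cell_set \<nu> (int_cube k)) x - w x)) \<longlonglongrightarrow> 0" by (simp add: l2sq_def)
 then have "\<forall>\<^sub>F k in sequentially. l2sq lborel (\<lambda>x. w x * indicator (cell_set \<nu> (int_cube k)) x - w x) < e"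
  using e by (rule order_tendstoD(2))
 then obtain k where k: "l2sq lborel (\<lambda>x. w x * indicator (cell_set \<nu> (int_cube k)) x - w x) < e"
  by (auto simp: eventually_sequentially)
 show "\<forall>\<^sub>F S in finite_subsets_at_top UNIV. l2sq lborel (\<lambda>y. w y * indicator (cell_set \<nu> S) y - w y) < e"
  unfolding eventually_finite_subsets_at_top
 proof (intro exI[of _ "int_cube k"] conjI allI impI finite_int_cube subset_UNIV)
  fix S :: "(int^'n) set" assume "finite S \<and> int_cube k \<subseteq> S \<and> S \<subseteq> UNIV"
  then have "l2sq lborel (\<lambda>y. w y * indicator (cell_set \<nu> S) y - w y) \<le> l2sq lborel (\<lambda>x. w x * indicator (cell_set \<nu> (int_cube k)) x - w x)"
   by (intro l2sq_mono) (auto simp: indicator_def cell_set_def)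
  then show "l2sq lborel (\<lambda>y. w y * indicator (cell_set \<nu> S) y - w y) < e" using k by (rule le_less_trans)
 qed
qed simp

text \<open>The mollification of \<open>w \<nu>\<close> restricted to one cell is a multiple of an
  atom, the multiple being governed by the L2 mass on the cell; disjointness of the cells adds these
  masses up to the level norm.\<close>

lemma besov_of_synth:
 assumes reg: "upper_regular (M :: (real^'n) measure) d c" and \<alpha>: "0 < \<alpha>" and s: "s = \<alpha> + (real CARD('n) - d) / 2" "0 \<le> s"
 obtains C where "0 < C"
  "\<And>w f. (\<forall>j. w j \<in> borel_measurable borel) ==> level_norm s w < \<infinity> ==> f \<in> Lp 2 M ==> AE x in M. f x = synth w x ==>
   \<exists>l a. l \<in> b_seq 2 2 \<and> (\<forall>\<nu> m. is_atom K \<alpha> 2 d \<nu> m (a \<nu> m)) \<and> atomic_sum 2 M l a f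
    \<and> ennreal ((b_norm 2 2 l)\<^sup>2) \<le> ennreal C * level_norm s w"
proof -
 interpret upper_regular M d c by (rule reg)
 obtain A where A: "0 < A"
  "\<And>\<nu> (m::int^'n) w b x. w \<in> Lp 2 lborel ==> length b \<le> K ==>
   norm (iter_deriv b (conv (kern \<nu>) (\<lambda>y. w y * indicator (cell_set \<nu> {m}) y)) x)
    \<le> A * (2 ^ \<nu>) powr (real CARD('n) / 2 + real (length b)) * sqrt (enn2real (l2sq lborel (\<lambda>y. w y * indicator (cell_set \<nu> {m}) y)))"
  by (rule cell_piece_bounds) (rule that)
 have s2: "real CARD('n) - d < 2 * s" using \<alpha> s by (simp add: field_simps)
 show ?thesis
 proof (rule that[of "A\<^sup>2"])
  show "0 < A\<^sup>2" using A by simp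
  fix w :: "nat => real^'n => complex" and f
  assume wm: "\<forall>j. w j \<in> borel_measurable borel" and fin: "level_norm s w < \<infinity>" and f: "f \<in> Lp 2 M" and fs: "AE x in M. f x = synth w x"
  have wl: "w j \<in> Lp 2 lborel" for j using level_norm_Lp2[OF fin] wm by auto
  define p where "p \<nu> m = (\<lambda>y. w \<nu> y * indicator (cell_set \<nu> {m}) y)" for \<nu> and m :: "int^'n"
  have cellm [measurable]: "finite S ==> cell_set \<nu> S \<in> sets (borel :: (real^'n) measure)" for \<nu> S by (rule cell_set_measurable)
  have trl: "(\<lambda>y. w \<nu> y * indicator (cell_set \<nu> S) y) \<in> Lp 2 lborel" if "finite S" for \<nu> S
  proof -
   have "l2sq lborel (\<lambda>y. w \<nu> y * indicator (cell_set \<nu> S) y) \<le> l2sq lborel (w \<nu>)" by (rule l2sq_mono) (auto simp: indicator_def)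
   moreover have "(\<lambda>y. w \<nu> y * indicator (cell_set \<nu> S) y) \<in> borel_measurable borel"
    by (intro borel_measurable_times borel_measurable_indicator cellm that) (use wm in blast)
   ultimately show ?thesis using Lp2_fin[OF wl[of \<nu>]] by (auto simp: Lp2_iff)
  qed
  have pl: "p \<nu> m \<in> Lp 2 lborel" for \<nu> m unfolding p_def by (rule trl) simp
  \<comment> \<open>The power of 2^\<nu> fits the normalisation of atoms, because n/2 - s = d/2 -
    \<alpha>.\<close>
  define \<Lambda> where "\<Lambda> \<nu> m = A * (2 ^ \<nu>) powr s * sqrt (enn2real (l2sq lborel (p \<nu> m)))" for \<nu> m
  define l where "l \<nu> m = complex_of_real (\<Lambda> \<nu> m)" for \<nu> m
  define a where "a \<nu> m x = (if \<Lambda> \<nu> m = 0 then 0 else (1 / l \<nu> m) * conv (kern \<nu>) (p \<nu> m) x)" for \<nu> m x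
  have L0: "0 \<le> \<Lambda> \<nu> m" for \<nu> m using A by (simp add: \<Lambda>_def)
  have bnd: "norm (iter_deriv b (conv (kern \<nu>) (p \<nu> m)) x) \<le> \<Lambda> \<nu> m * (2 ^ \<nu>) powr (real CARD('n) / 2 - s + real (length b))"
   if "length b \<le> K" for b \<nu> m x
  proof -
   have "(2 ^ \<nu> :: real) powr (real CARD('n) / 2 + real (length b)) = (2 ^ \<nu>) powr s * (2 ^ \<nu>) powr (real CARD('n) / 2 - s + real (length b))"
    by (simp add: powr_add[symmetric])
   then show ?thesis using A(2)[where \<nu>=\<nu> and m=m and b=b and x=x, OF wl[of \<nu>] that] unfolding p_def[symmetric] \<Lambda>_def by (simp add: mult_ac)
  qed
  \<comment> \<open>A zero coefficient makes the mollified cell vanish, by \<open>bnd\<close>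
    without derivatives, so the default atom 0 is consistent.\<close>
  have la: "l \<nu> m * a \<nu> m x = conv (kern \<nu>) (p \<nu> m) x" for \<nu> m x
  proof (cases "\<Lambda> \<nu> m = 0")
   case True
   then show ?thesis using bnd[of "[]" \<nu> m x] by (simp add: l_def)
  qed (simp add: a_def l_def)
  \<comment> \<open>In units of the cube side: 1/2 for the cell and at most 1 for the kernel give
    the 3/2 of the tripled cube.\<close>
  have cont: "conv (kern \<nu>) (p \<nu> m) y = 0" if "y \<notin> dbox (3/2) \<nu> m" for \<nu> m y
  proof (rule conv_kern_const)
   fix z :: "real^'n" assume z: "norm (y - z) < 1 / 2 / 2 ^ \<nu>"
   have "z \<notin> cell_set \<nu> {m}"
   proof
    assume "z \<in> cell_set \<nu> {m}"
    then have "z \<in> dbox (1/2) \<nu> m" using cell_set_dbox by blast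
    moreover have "2 ^ \<nu> * norm (z - y) \<le> 1" using z by (simp add: field_simps norm_minus_commute)
    ultimately have "y \<in> dbox (1/2 + 1) \<nu> m" by (rule dbox_shift)
    then show False using that by simp
   qed
   then show "p \<nu> m z = 0" by (simp add: p_def)
  qed
  have ck: "C_k k (a \<nu> m)" for k \<nu> m
  proof (cases "\<Lambda> \<nu> m = 0")
   case True
   then show ?thesis by (simp add: a_def[abs_def] C_k_zero)
  next
   case False
   have "C_k k (\<lambda>x. (1 / l \<nu> m) * conv (kern \<nu>) (p \<nu> m) (1 *\<^sub>R x))"
    by (rule C_k_scaled[OF conv_kern_C_k[OF Lp2_loc_int[OF pl]]])
   then show ?thesis using False by (simp add: a_def[abs_def])
  qed
  have idz: "iter_deriv b (\<lambda>x::real^'n. 0::complex) y = 0" for b :: "'n list" and y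
   by (rule iter_deriv_local_zero[of UNIV]) auto
  have atom: "is_atom K \<alpha> 2 d \<nu> m (a \<nu> m)" for \<nu> m
   unfolding is_atom_def
  proof (intro conjI allI impI ck)
   show "supp (a \<nu> m) \<subseteq> dilated_cube 3 \<nu> m"
    unfolding supp_def dilated_cube_3
    by (rule closure_minimal[OF _ closed_dbox]) (use cont in \<open>auto simp: a_def split: if_splits\<close>)
   fix b :: "'n list" and x assume b: "length b \<le> K"
   have e: "2 powr (- real \<nu> * (\<alpha> - real (length b) - d / 2)) = (2 ^ \<nu> :: real) powr (real CARD('n) / 2 - s + real (length b))"
    by (simp add: powr_realpow[symmetric] powr_powr s field_simps)
   show "norm (iter_deriv b (a \<nu> m) x) \<le> 2 powr (- real \<nu> * (\<alpha> - real (length b) - d / 2))"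
   proof (cases "\<Lambda> \<nu> m = 0")
    case True
    then show ?thesis by (simp add: a_def[abs_def] idz)
   next
    case False
    then have pos: "0 < \<Lambda> \<nu> m" using L0[of \<nu> m] by simp
    have "a \<nu> m = (\<lambda>x. (1 / l \<nu> m) * conv (kern \<nu>) (p \<nu> m) (1 *\<^sub>R x))" using False by (simp add: a_def[abs_def])
    then have "iter_deriv b (a \<nu> m) x = (of_real 1 ^ length b * (1 / l \<nu> m)) * iter_deriv b (conv (kern \<nu>) (p \<nu> m)) (1 *\<^sub>R x)"
     by (simp only: iter_deriv_scaled[OF conv_kern_C_k[OF Lp2_loc_int[OF pl]]])
    then have "norm (iter_deriv b (a \<nu> m) x) = norm (iter_deriv b (conv (kern \<nu>) (p \<nu> m)) x) / \<Lambda> \<nu> m"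
     using pos by (simp add: norm_mult norm_divide l_def)
    also have "\<dots> \<le> (\<Lambda> \<nu> m * (2 ^ \<nu>) powr (real CARD('n) / 2 - s + real (length b))) / \<Lambda> \<nu> m"
     using pos by (intro divide_right_mono bnd b) auto
    also have "\<dots> = 2 powr (- real \<nu> * (\<alpha> - real (length b) - d / 2))" unfolding e using pos by simp
    finally show ?thesis .
   qed
  qed
  obtain N where N: "level_norm s w = ennreal N" "0 \<le> N" using fin by (cases "level_norm s w") auto
  define W where "W \<nu> = A\<^sup>2 * ((2 ^ \<nu>) powr (2 * s) * enn2real (l2sq lborel (w \<nu>)))" for \<nu>
  have W0: "0 \<le> W \<nu>" for \<nu> by (simp add: W_def)
  have nl: "norm (l \<nu> m) powr 2 = A\<^sup>2 * ((2 ^ \<nu>) powr (2 * s) * enn2real (l2sq lborel (p \<nu> m)))" for \<nu> m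
  proof -
   have "((2 ^ \<nu> :: real) powr s)\<^sup>2 = (2 ^ \<nu>) powr (2 * s)" by (simp add: power2_eq_square powr_add[symmetric])
   then show ?thesis unfolding powr_2_eq l_def norm_of_real by (simp add: \<Lambda>_def power_mult_distrib mult.assoc)
  qed
  have fsum: "(\<Sum>m\<in>S. norm (l \<nu> m) powr 2) \<le> W \<nu>" if S: "finite S" for S \<nu>
  proof -
   have pf: "l2sq lborel (p \<nu> m) = ennreal (enn2real (l2sq lborel (p \<nu> m)))" for m
    using Lp2_fin[OF pl[of \<nu> m]] by (simp add: less_top)
   have "ennreal (\<Sum>m\<in>S. enn2real (l2sq lborel (p \<nu> m))) = (\<Sum>m\<in>S. l2sq lborel (p \<nu> m))"
    by (subst pf) (simp add: sum_ennreal)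
   also have "\<dots> = l2sq lborel (\<lambda>y. w \<nu> y * indicator (cell_set \<nu> S) y)"
    unfolding p_def using wm by (intro sum_l2sq_cells S) auto
   also have "\<dots> \<le> l2sq lborel (w \<nu>)" by (rule l2sq_mono) (auto simp: indicator_def)
   also have "\<dots> = ennreal (enn2real (l2sq lborel (w \<nu>)))" using Lp2_fin[OF wl[of \<nu>]] by (simp add: less_top)
   finally have "(\<Sum>m\<in>S. enn2real (l2sq lborel (p \<nu> m))) \<le> enn2real (l2sq lborel (w \<nu>))" by simp
   then have "A\<^sup>2 * ((2 ^ \<nu>) powr (2 * s) * (\<Sum>m\<in>S. enn2real (l2sq lborel (p \<nu> m)))) \<le> W \<nu>"
    unfolding W_def by (intro mult_left_mono) auto
   then show ?thesis by (simp add: nl sum_distrib_left)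
  qed
  have so: "(\<lambda>m. norm (l \<nu> m) powr 2) summable_on UNIV" for \<nu>
   by (rule nonneg_bdd_above_summable_on) (auto intro!: bdd_aboveI[of _ "W \<nu>"] simp del: powr_numeral powr_2_eq simp: fsum)
  have is_le: "(\<Sum>\<^sub>\<infinity>m. norm (l \<nu> m) powr 2) \<le> W \<nu>" for \<nu>
   by (rule infsum_le_finite_sums[OF so fsum])
  have is0: "0 \<le> (\<Sum>\<^sub>\<infinity>m. norm (l \<nu> m) powr 2)" for \<nu> by (rule infsum_nonneg) simp
  have Wsum: "(\<Sum>\<nu>. ennreal (W \<nu>)) = ennreal (A\<^sup>2) * level_norm s w"
  proof -
   have "ennreal (W \<nu>) = ennreal (A\<^sup>2) * (ennreal ((2 ^ \<nu>) powr (2 * s)) * l2sq lborel (w \<nu>))" for \<nu>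
    using Lp2_fin[OF wl[of \<nu>]] by (simp add: W_def ennreal_mult' less_top)
   then show ?thesis unfolding level_norm_def by simp
  qed
  have Wsm: "summable W"
   by (rule summable_suminf_not_top) (use W0 Wsum N in \<open>auto simp: ennreal_mult_eq_top_iff\<close>)
  have Wtot: "ennreal (suminf W) = ennreal (A\<^sup>2) * level_norm s w"
   using suminf_ennreal2[OF W0 Wsm] Wsum by simp
  have pe: "(\<Sum>\<^sub>\<infinity>m. norm (l \<nu> m) powr 2) powr (2 / 2) = (\<Sum>\<^sub>\<infinity>m. norm (l \<nu> m) powr 2)" for \<nu> using is0[of \<nu>] by simp
  have ssm: "summable (\<lambda>\<nu>. \<Sum>\<^sub>\<infinity>m. norm (l \<nu> m) powr 2)"
   by (rule summable_comparison_test'[OF Wsm, of 0]) (use is_le is0 in simp)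
  have bs: "l \<in> b_seq 2 2" unfolding b_seq_def using so ssm by (simp only: pe mem_Collect_eq simp_thms)
  have bn: "ennreal ((b_norm 2 2 l)\<^sup>2) \<le> ennreal (A\<^sup>2) * level_norm s w"
  proof -
   have t0: "0 \<le> (\<Sum>\<nu>. \<Sum>\<^sub>\<infinity>m. norm (l \<nu> m) powr 2)" by (intro suminf_nonneg ssm is0)
   have "(b_norm 2 2 l)\<^sup>2 = (\<Sum>\<nu>. \<Sum>\<^sub>\<infinity>m. norm (l \<nu> m) powr 2)"
    unfolding b_norm_def pe using t0 by (simp add: powr_half_sqrt)
   also have "\<dots> \<le> suminf W" by (intro suminf_le is_le ssm Wsm)
   finally show ?thesis unfolding Wtot[symmetric] by (rule ennreal_leI)
  qed
  have cl: "conv (kern \<nu>) g \<in> Lp 2 M" if "g \<in> Lp 2 lborel" for \<nu> g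
  proof (rule l2sq_conv_kern_le)
   fix K0 :: real
   assume K0: "\<And>j w. w \<in> borel_measurable borel ==> l2sq M (conv (kern j) w) \<le> ennreal (K0 * (2 ^ j) powr (real CARD('n) - d)) * l2sq lborel w"
   have "l2sq M (conv (kern \<nu>) g) < \<infinity>"
    using K0[OF Lp2_borel[OF that], of \<nu>] Lp2_fin[OF that] by (auto simp: ennreal_mult_less_top intro: le_less_trans)
   then show ?thesis using conv_kern_measurable[OF that] by (simp add: Lp2_iff)
  qed
  \<comment> \<open>At each level the sum over m converges to the mollification of all of
    \<open>w \<nu>\<close>, since mollification is bounded from Lebesgue L2 into L2 of
    \<open>M\<close>; across levels it is the convergence in \<open>synth_l2\<close>.\<close>
  have at_sum: "atomic_sum 2 M l a f"
   unfolding atomic_sum_def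
  proof (intro exI[of _ "\<lambda>\<nu>. conv (kern \<nu>) (w \<nu>)"] conjI allI)
   fix \<nu>
   have e: "(\<Sum>m\<in>S. l \<nu> m * a \<nu> m x) = (\<Sum>m\<in>S. conv (kern \<nu>) (p \<nu> m) x)" for S x by (simp add: la)
   have eS: "(\<Sum>m\<in>S. conv (kern \<nu>) (p \<nu> m) x) = conv (kern \<nu>) (\<lambda>y. w \<nu> y * indicator (cell_set \<nu> S) y) x" if S: "finite S" for S x
   proof -
    have "(\<Sum>m\<in>S. 1 * conv (kern \<nu>) (p \<nu> m) x) = conv (kern \<nu>) (\<lambda>y. \<Sum>m\<in>S. 1 * p \<nu> m y) x"
     by (rule conv_sum[symmetric, OF S]) (intro Lp2_loc_int pl)
    also have "(\<lambda>y. \<Sum>m\<in>S. 1 * p \<nu> m y) = (\<lambda>y. w \<nu> y * indicator (cell_set \<nu> S) y)"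
    proof
     fix y
     have "(\<Sum>m\<in>S. 1 * p \<nu> m y) = (\<Sum>m\<in>S. if m = cell \<nu> y then w \<nu> y else 0)"
      by (intro sum.cong refl) (auto simp: p_def cell_set_def)
     then show "(\<Sum>m\<in>S. 1 * p \<nu> m y) = w \<nu> y * indicator (cell_set \<nu> S) y" using S by (auto simp: cell_set_def)
    qed
    finally show ?thesis by simp
   qed
   show "Lp_tendsto 2 M (\<lambda>S x. \<Sum>m\<in>S. l \<nu> m * a \<nu> m x) (conv (kern \<nu>) (w \<nu>)) (finite_subsets_at_top UNIV)"
    unfolding Lp_tendsto_2_iff e
   proof (intro conjI allI)
    show "conv (kern \<nu>) (w \<nu>) \<in> Lp 2 M" by (rule cl[OF wl])
    show "(\<lambda>x. \<Sum>m\<in>S. conv (kern \<nu>) (p \<nu> m) x) \<in> Lp 2 M" for S by (intro Lp2_sum cl pl)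
    show "((\<lambda>S. l2sq M (\<lambda>x. (\<Sum>m\<in>S. conv (kern \<nu>) (p \<nu> m) x) - conv (kern \<nu>) (w \<nu>) x)) \<longlongrightarrow> 0) (finite_subsets_at_top UNIV)"
    proof (rule l2sq_conv_kern_le)
     fix K0 :: real
     assume K0: "\<And>j w. w \<in> borel_measurable borel ==> l2sq M (conv (kern j) w) \<le> ennreal (K0 * (2 ^ j) powr (real CARD('n) - d)) * l2sq lborel w"
     let ?k = "ennreal (K0 * (2 ^ \<nu>) powr (real CARD('n) - d))"
     show ?thesis
     proof (rule tendsto_sandwich[OF _ _ tendsto_const])
      show "\<forall>\<^sub>F S in finite_subsets_at_top UNIV. l2sq M (\<lambda>x. (\<Sum>m\<in>S. conv (kern \<nu>) (p \<nu> m) x) - conv (kern \<nu>) (w \<nu>) x)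
      \<le> ?k * l2sq lborel (\<lambda>y. w \<nu> y * indicator (cell_set \<nu> S) y - w \<nu> y)"
      proof (rule eventually_finite_subsets_at_top_weakI)
      fix S :: "(int^'n) set" assume elim: "finite S"
      have g: "(\<lambda>y. w \<nu> y * indicator (cell_set \<nu> S) y - w \<nu> y) \<in> Lp 2 lborel" by (intro Lp2_diff trl elim wl)
      have "(\<Sum>m\<in>S. conv (kern \<nu>) (p \<nu> m) x) - conv (kern \<nu>) (w \<nu>) x = conv (kern \<nu>) (\<lambda>y. w \<nu> y * indicator (cell_set \<nu> S) y - w \<nu> y) x" for x
      using conv_lin[OF Lp2_loc_int[OF trl[OF elim, of \<nu>]] Lp2_loc_int[OF wl[of \<nu>]], of \<nu> 1 "-1" x] by (simp add: eS[OF elim])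
      then show "l2sq M (\<lambda>x. (\<Sum>m\<in>S. conv (kern \<nu>) (p \<nu> m) x) - conv (kern \<nu>) (w \<nu>) x)
      \<le> ?k * l2sq lborel (\<lambda>y. w \<nu> y * indicator (cell_set \<nu> S) y - w \<nu> y)"
      using K0[OF Lp2_borel[OF g], of \<nu>] by simp
      qed
      have "((\<lambda>S. ?k * l2sq lborel (\<lambda>y. w \<nu> y * indicator (cell_set \<nu> S) y - w \<nu> y)) \<longlongrightarrow> ?k * 0) (finite_subsets_at_top UNIV)"
      by (intro tendsto_mult_ennreal tendsto_const cell_truncation_tendsto wl) auto
      then show "((\<lambda>S. ?k * l2sq lborel (\<lambda>y. w \<nu> y * indicator (cell_set \<nu> S) y - w \<nu> y)) \<longlongrightarrow> 0) (finite_subsets_at_top UNIV)" by simp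
     qed auto
    qed
   qed
  next
   show "Lp_tendsto 2 M (\<lambda>N x. \<Sum>\<nu><N. conv (kern \<nu>) (w \<nu>) x) f sequentially"
    unfolding Lp_tendsto_2_iff
   proof (intro conjI allI f)
    show "(\<lambda>x. \<Sum>\<nu><N. conv (kern \<nu>) (w \<nu>) x) \<in> Lp 2 M" for N by (intro Lp2_sum cl wl)
    have wm': "\<And>j. w j \<in> borel_measurable borel" using wm by blast
    have "(\<lambda>J. l2sq M (\<lambda>x. synth w x - (\<Sum>j<J. conv (kern j) (w j) x))) \<longlonglongrightarrow> 0"
    proof (rule synth_l2[OF s2], goal_cases)
     case (1 C)
     show ?case by (rule 1(5)[OF wm' fin])
    qed
    moreover have "l2sq M (\<lambda>x. (\<Sum>j<J. conv (kern j) (w j) x) - f x) = l2sq M (\<lambda>x. synth w x - (\<Sum>j<J. conv (kern j) (w j) x))" for J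
     unfolding l2sq_commute[of M "synth w"]
     by (rule l2sq_cong_AE) (use fs in eventually_elim, simp)
    ultimately show "(\<lambda>J. l2sq M (\<lambda>x. (\<Sum>j<J. conv (kern j) (w j) x) - f x)) \<longlonglongrightarrow> 0" by simp
   qed
  qed
  show "\<exists>l a. l \<in> b_seq 2 2 \<and> (\<forall>\<nu> m. is_atom K \<alpha> 2 d \<nu> m (a \<nu> m)) \<and> atomic_sum 2 M l a f
    \<and> ennreal ((b_norm 2 2 l)\<^sup>2) \<le> ennreal (A\<^sup>2) * level_norm s w"
   using bs atom at_sum bn by (intro exI[of _ l] exI[of _ a]) simp
 qed
qed

section \<open>Atoms as sums of mollified pieces\<close>

lemma bounded_dbox: "bounded (dbox R \<nu> (m :: int^'n))"
proof -
 have "dbox R \<nu> m \<subseteq> cbox (\<chi> i. (of_int (m $ i) + 1 / 2 - R) / 2 ^ \<nu>) (\<chi> i. (of_int (m $ i) + 1 / 2 + R) / 2 ^ \<nu>)"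
 proof
  fix x assume x: "x \<in> dbox R \<nu> m"
  have "(of_int (m $ i) + 1 / 2 - R) / 2 ^ \<nu> \<le> x $ i \<and> x $ i \<le> (of_int (m $ i) + 1 / 2 + R) / 2 ^ \<nu>" for i
  proof -
   have "\<bar>2 ^ \<nu> * x $ i - (of_int (m $ i) + 1 / 2)\<bar> \<le> R" using x unfolding dbox_def by blast
   then have "of_int (m $ i) + 1 / 2 - R \<le> x $ i * 2 ^ \<nu>" "x $ i * 2 ^ \<nu> \<le> of_int (m $ i) + 1 / 2 + R"
    unfolding mult.commute[of "x $ i"] by linarith+
   then show ?thesis by (simp only: pos_divide_le_eq pos_le_divide_eq zero_less_power zero_less_numeral simp_thms)
  qed
  then show "x \<in> cbox (\<chi> i. (of_int (m $ i) + 1 / 2 - R) / 2 ^ \<nu>) (\<chi> i. (of_int (m $ i) + 1 / 2 + R) / 2 ^ \<nu>)"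
   by (simp only: mem_box_cart vec_lambda_beta) blast
 qed
 then show ?thesis by (rule bounded_subset[OF bounded_cbox])
qed

text \<open>Commutativity lets the derivatives fall on \<open>g\<close>, so that bounds for
  \<open>g\<close> and not for the kernel enter.\<close>

lemma conv_kern_iter_deriv:
 assumes "C_k (length b) g" "vanishes_beyond R g"
 shows "iter_deriv b (conv (kern j) g) = conv (kern j) (iter_deriv b g)"
proof -
 have [measurable]: "g \<in> borel_measurable borel" "iter_deriv b g \<in> borel_measurable borel"
  by (intro borel_measurable_continuous_onI C_k_continuous[OF assms(1)] iter_deriv_continuous[OF assms(1) order_refl])+
 have "iter_deriv b (conv (kern j) g) = iter_deriv b (conv g (kern j))"
  by (subst conv_commute) auto
 also have "\<dots> = conv (iter_deriv b g) (kern j)"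
  by (rule conv_iter_deriv[OF assms continuous_loc_int[OF kern_continuous]])
 also have "\<dots> = conv (kern j) (iter_deriv b g)" by (rule conv_commute) auto
 finally show ?thesis .
qed

text \<open>What remains of an atom after its mollifications at the levels \<nu>, \<nu> + M, \<nu> +
  2 M and so on have been removed one after another, each computed from the current
  remainder.\<close>

primrec resid :: "nat => nat => (real^'n => complex) => nat => real^'n => complex" where
 "resid M \<nu> a 0 = a"
| "resid M \<nu> a (Suc i) = (\<lambda>x. resid M \<nu> a i x - conv (kern (\<nu> + M * i)) (resid M \<nu> a i) x)"

lemma resid_C_k: "C_k K a ==> C_k K (resid M \<nu> a i)"
proof (induction i)
 case (Suc i)
 have "C_k K (\<lambda>x. 1 * resid M \<nu> a i x + (-1) * conv (kern (\<nu> + M * i)) (resid M \<nu> a i) x)"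
  using Suc by (intro C_k_lin conv_kern_C_k continuous_loc_int C_k_continuous) auto
 then show ?case by simp
qed simp

lemma resid_continuous: "C_k K a ==> continuous_on UNIV (resid M \<nu> a i)"
 by (rule C_k_continuous[OF resid_C_k])

lemma resid_telescope: "(\<Sum>i<N. conv (kern (\<nu> + M * i)) (resid M \<nu> a i) x) = a x - resid M \<nu> a N x"
 by (induction N) auto

text \<open>Step i widens the support by at most (1/2)^(i + 1) cube sides, so from 3/2 = 5/2 - 1 it
  never reaches beyond 5/2.\<close>

lemma resid_support:
 assumes a: "\<And>x. a x \<noteq> 0 ==> x \<in> dbox (3 / 2) \<nu> m" and M: "1 \<le> M"
 shows "resid M \<nu> a i x \<noteq> 0 ==> x \<in> dbox (5 / 2 - (1 / 2) ^ i) \<nu> m"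
proof (induction i arbitrary: x)
 case (Suc i)
 have s: "(1 / 2 :: real) ^ Suc i \<le> (1 / 2) ^ i" by (rule power_decreasing) auto
 have "\<exists>y. norm (x - y) < 1 / 2 / 2 ^ (\<nu> + M * i) \<and> resid M \<nu> a i y \<noteq> 0"
 proof (rule ccontr)
  assume *: "\<nexists>y. norm (x - y) < 1 / 2 / 2 ^ (\<nu> + M * i) \<and> resid M \<nu> a i y \<noteq> 0"
  then have "conv (kern (\<nu> + M * i)) (resid M \<nu> a i) x = 0" by (intro conv_kern_const) blast
  moreover have "resid M \<nu> a i x = 0" using *[unfolded not_ex, THEN spec, of x] by simp
  ultimately show False using Suc.prems by simp
 qed
 then obtain y where y: "norm (x - y) < 1 / 2 / 2 ^ (\<nu> + M * i)" "resid M \<nu> a i y \<noteq> 0" by blast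
 have "2 ^ \<nu> * norm (y - x) \<le> (1 / 2) ^ Suc i"
 proof -
  have "2 ^ \<nu> * norm (y - x) \<le> 2 ^ \<nu> * (1 / 2 / 2 ^ (\<nu> + M * i))"
   using y(1) by (intro mult_left_mono less_imp_le) (simp_all add: norm_minus_commute)
  also have "\<dots> = (1 / 2) ^ Suc (M * i)" by (simp add: power_add power_one_over)
  also have "\<dots> \<le> (1 / 2) ^ Suc i" using M by (intro power_decreasing) auto
  finally show ?thesis .
 qed
 then have "x \<in> dbox (5 / 2 - (1 / 2) ^ i + (1 / 2) ^ Suc i) \<nu> m" by (rule dbox_shift[OF Suc.IH[OF y(2)]])
 moreover have "5 / 2 - (1 / 2) ^ i + (1 / 2) ^ Suc i = (5 / 2 - (1 / 2) ^ Suc i :: real)" by simp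
 ultimately show ?case by simp
qed (use a in simp)

lemma resid_vanishes:
 fixes a :: "real^'n => complex"
 assumes a: "\<And>x. a x \<noteq> 0 ==> x \<in> dbox (3 / 2) \<nu> m" and M: "1 \<le> M"
 shows "\<exists>R. \<forall>i. vanishes_beyond R (resid M \<nu> a i)"
proof -
 obtain R where R: "\<And>x. x \<in> dbox (5 / 2) \<nu> m ==> norm x \<le> R"
  using bounded_dbox[of "5 / 2" \<nu> m] by (auto simp: bounded_iff)
 have "vanishes_beyond R (resid M \<nu> a i)" for i
  unfolding vanishes_beyond_def
 proof (intro allI impI)
  fix x :: "real^'n" assume x: "R < norm x"
  have "dbox (5 / 2 - (1 / 2) ^ i) \<nu> m \<subseteq> dbox (5 / 2) \<nu> m" by (rule dbox_mono) simp
  then show "resid M \<nu> a i x = 0" using resid_support[OF a M, where i=i and x=x] R[of x] x by force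
 qed
 then show ?thesis by blast
qed

text \<open>Induction on u, the number of derivatives not yet taken. For u = 0 each subtraction at
  most doubles the bound; otherwise \<open>conv_kern_diff_bound\<close> trades one more derivative
  of the previous remainder for a factor 2^(-\<nu> - M (i - 1)). With \<open>b = []\<close> and u =
  K the gain is of order K.\<close>

lemma resid_bound:
 fixes a :: "real^'n => complex"
 assumes a: "\<And>x. a x \<noteq> 0 ==> x \<in> dbox (3 / 2) \<nu> m" and M: "1 \<le> M" and C: "C_k K a"
  and D: "\<And>b x. length b \<le> K ==> norm (iter_deriv b a x) \<le> (2 ^ \<nu>) ^ length b * D"
  and b: "u \<le> K" "length b = K - u"
 shows "norm (iter_deriv b (resid M \<nu> a i) x)
  \<le> (real CARD('n) * (2 ^ M) ^ K) ^ u * 2 ^ i * (2 ^ \<nu>) ^ (K - u) * (1 / 2 ^ (M * i)) ^ u * D"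
proof -
 \<comment> \<open>The factor n comes from \<open>conv_kern_diff_bound\<close>; (2^M)^K pays for
   passing from i - 1 to i in the decaying factor.\<close>
 define G where "G = real CARD('n) * (2 ^ M) ^ K"
 have n1: "1 \<le> real CARD('n)" by simp
 have YK: "(1::real) \<le> (2 ^ M) ^ K" by (intro one_le_power) simp
 have G1: "1 \<le> G" unfolding G_def using mult_mono[OF n1 YK] by simp
 have D0: "0 \<le> D" using order_trans[OF norm_ge_zero D[of "[]"]] by simp
 obtain R where R: "\<And>i. vanishes_beyond R (resid M \<nu> a i)" using resid_vanishes[OF a M] by blast
 have step: "iter_deriv b (resid M \<nu> a (Suc i)) x = iter_deriv b (resid M \<nu> a i) x - conv (kern (\<nu> + M * i)) (iter_deriv b (resid M \<nu> a i)) x"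
  if "length b \<le> K" for b i x
 proof -
  have Cb: "C_k (length b) (resid M \<nu> a i)" using resid_C_k[OF C] that by (rule C_k_mono)
  have "resid M \<nu> a (Suc i) = (\<lambda>x. 1 * resid M \<nu> a i x + (-1) * conv (kern (\<nu> + M * i)) (resid M \<nu> a i) x)" by simp
  then have "iter_deriv b (resid M \<nu> a (Suc i)) = (\<lambda>x. 1 * iter_deriv b (resid M \<nu> a i) x + (-1) * iter_deriv b (conv (kern (\<nu> + M * i)) (resid M \<nu> a i)) x)"
   by (simp only: iter_deriv_lin[OF Cb conv_kern_C_k[OF continuous_loc_int[OF resid_continuous[OF C]]]])
  then show ?thesis by (simp add: conv_kern_iter_deriv[OF Cb R])
 qed
 have "norm (iter_deriv b (resid M \<nu> a i) x) \<le> G ^ u * 2 ^ i * (2 ^ \<nu>) ^ (K - u) * (1 / 2 ^ (M * i)) ^ u * D"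
  using b
 proof (induction u arbitrary: b i x)
  case 0
  then have l: "length b = K" by simp
  have "norm (iter_deriv b (resid M \<nu> a i) x) \<le> 2 ^ i * ((2 ^ \<nu>) ^ K * D)"
  proof (induction i arbitrary: x)
   case 0
   then show ?case using D[of b x] l by simp
  next
   case (Suc i)
   have "norm (conv (kern (\<nu> + M * i)) (iter_deriv b (resid M \<nu> a i)) x) \<le> 2 ^ i * ((2 ^ \<nu>) ^ K * D)"
    using D0 l by (intro conv_kern_bound Suc borel_measurable_continuous_onI iter_deriv_continuous[OF resid_C_k[OF C]]) auto
   then show ?case unfolding step[OF eq_refl[OF l]]
    using Suc[of x] norm_triangle_ineq4[of "iter_deriv b (resid M \<nu> a i) x" "conv (kern (\<nu> + M * i)) (iter_deriv b (resid M \<nu> a i)) x"]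
    by simp
  qed
  then show ?case by (simp add: mult_ac)
 next
  case (Suc u)
  then have l: "length b \<le> K" "1 + length b \<le> K" "K - u = Suc (K - Suc u)" by auto
  show ?case
  proof (cases i)
   case 0
   have "norm (iter_deriv b a x) \<le> 1 * ((2 ^ \<nu>) ^ (K - Suc u) * D)" using D[OF l(1), of x] Suc.prems by simp
   also have "\<dots> \<le> G ^ Suc u * ((2 ^ \<nu>) ^ (K - Suc u) * D)"
    using D0 by (intro mult_right_mono one_le_power G1) auto
   finally show ?thesis unfolding 0 by (simp add: mult_ac)
  next
   case (Suc i')
   define p q Z where "p = (2::real) ^ \<nu>" and "q = (2::real) ^ (M * i')"
    and "Z = G ^ u * 2 ^ i' * p ^ (K - Suc u) * (1 / q) ^ Suc u * D"
   have pq: "0 < p" "0 < q" by (simp_all add: p_def q_def)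
   have Z0: "0 \<le> Z" unfolding Z_def using G1 D0 pq by (intro mult_nonneg_nonneg zero_le_power) auto
   let ?r = "resid M \<nu> a i'"
   have "norm (iter_deriv b ?r x - conv (kern (\<nu> + M * i')) (iter_deriv b ?r) x)
    \<le> real CARD('n) * (G ^ u * 2 ^ i' * (2 ^ \<nu>) ^ (K - u) * (1 / 2 ^ (M * i')) ^ u * D) / 2 ^ (\<nu> + M * i')"
   proof (rule conv_kern_diff_bound)
    show "C_k (Suc 0) (iter_deriv b ?r)"
     by (rule C_k_iter_deriv) (rule C_k_mono[OF resid_C_k[OF C]], use l in simp)
    fix k y
    show "norm (partial_deriv k (iter_deriv b ?r) y) \<le> G ^ u * 2 ^ i' * (2 ^ \<nu>) ^ (K - u) * (1 / 2 ^ (M * i')) ^ u * D"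
     using Suc.IH[of "k # b" i' y] Suc.prems by simp
   qed
   also have "\<dots> = real CARD('n) * Z"
    unfolding power_add p_def[symmetric] q_def[symmetric] Z_def l(3) using pq by (simp add: field_simps)
   also have "\<dots> \<le> (2 * G * (1 / 2 ^ M) ^ Suc u) * Z"
   proof (rule mult_right_mono[OF _ Z0])
    have "(2 ^ M :: real) ^ Suc u \<le> (2 ^ M) ^ K" using Suc.prems by (intro power_increasing) auto
    then have "real CARD('n) * (2 ^ M) ^ Suc u \<le> G" unfolding G_def by (intro mult_left_mono) auto
    then have "real CARD('n) \<le> G / (2 ^ M) ^ Suc u" by (subst pos_le_divide_eq) auto
    also have "\<dots> = G * (1 / 2 ^ M) ^ Suc u" by (simp add: power_divide)
    also have "\<dots> \<le> 2 * G * (1 / 2 ^ M) ^ Suc u" using G1 by (intro mult_right_mono) auto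
    finally show "real CARD('n) \<le> 2 * G * (1 / 2 ^ M) ^ Suc u" .
   qed
   also have "\<dots> = G ^ Suc u * 2 ^ i * (2 ^ \<nu>) ^ (K - Suc u) * (1 / 2 ^ (M * i)) ^ Suc u * D"
   proof -
    have "(1 / 2 ^ (M * i) :: real) ^ Suc u = (1 / 2 ^ M) ^ Suc u * (1 / q) ^ Suc u"
     unfolding power_mult_distrib[symmetric] Suc q_def by (simp add: power_add)
    then show ?thesis unfolding Z_def p_def[symmetric] by (simp add: Suc)
   qed
   finally show ?thesis unfolding Suc step[OF l(1)] .
  qed
 qed
 then show ?thesis by (simp only: G_def)
qed

text \<open>The loss 2^i in \<open>resid_bound\<close> is (2^(M i))^(1/M), that is 1/M of the K
  orders gained; \<kappa> exceeds \<alpha> once M > 1 / (K - \<alpha>).\<close>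

lemma atom_pieces:
 assumes K: "\<alpha> < real K" and \<alpha>: "0 < \<alpha>"
 obtains \<kappa> Q where "\<alpha> < \<kappa>" "0 < Q"
  "\<And>\<nu> m (a :: real^'n => complex). is_atom K \<alpha> 2 d \<nu> m a ==> \<exists>\<omega>. (\<forall>j. continuous_on UNIV (\<omega> j)) \<and>
    (\<forall>j x. \<omega> j x \<noteq> 0 --> \<nu> \<le> j \<and> x \<in> dbox (5 / 2) \<nu> m) \<and>
    (\<forall>j x. \<nu> \<le> j --> norm (\<omega> j x) \<le> Q * (2 ^ \<nu>) powr (d / 2 - \<alpha>) * (2 ^ j / 2 ^ \<nu>) powr (- \<kappa>)) \<and>
    (\<forall>x. (\<lambda>j. conv (kern j) (\<omega> j) x) sums a x)"
proof -
 obtain M0 :: nat where M0: "1 / (real K - \<alpha>) < real M0" using reals_Archimedean2 by blast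
 define M where "M = Suc M0"
 have M: "1 \<le> M" "0 < real M" "1 / (real K - \<alpha>) < real M" using M0 by (simp_all add: M_def)
 define \<kappa> where "\<kappa> = real K - 1 / real M"
 have \<kappa>: "\<alpha> < \<kappa>" using M K by (simp add: \<kappa>_def field_simps)
 define Q where "Q = (real CARD('n) * (2 ^ M) ^ K) ^ K"
 have Q0: "0 < Q" by (simp add: Q_def)
 show ?thesis
 proof (rule that[OF \<kappa> Q0])
  fix \<nu> m and a :: "real^'n => complex" assume atom: "is_atom K \<alpha> 2 d \<nu> m a"
  define D where "D = (2 ^ \<nu> :: real) powr (d / 2 - \<alpha>)"
  have D0: "0 \<le> D" by (simp add: D_def)
  have a: "x \<in> dbox (3 / 2) \<nu> m" if "a x \<noteq> 0" for x
  proof -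
   have "x \<in> supp a" using that closure_subset[of "{x. a x \<noteq> 0}"] by (auto simp: supp_def)
   then show ?thesis using atom unfolding is_atom_def dilated_cube_3 by blast
  qed
  have C: "C_k K a" using atom by (simp add: is_atom_def)
  have Db: "norm (iter_deriv b a x) \<le> (2 ^ \<nu>) ^ length b * D" if "length b \<le> K" for b x
  proof -
   have X: "(0::real) < 2 ^ \<nu>" "(2::real) ^ \<nu> = 2 powr real \<nu>" by (simp_all add: powr_realpow)
   have "2 powr (- real \<nu> * (\<alpha> - real (length b) - d / 2)) = (2 ^ \<nu> :: real) powr (real (length b) + (d / 2 - \<alpha>))"
    unfolding X(2) powr_powr by (simp add: algebra_simps)
   also have "\<dots> = (2 ^ \<nu>) ^ length b * D" unfolding powr_add D_def powr_realpow[OF X(1)] ..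
   finally show ?thesis using atom that unfolding is_atom_def by metis
  qed
  have rb: "norm (resid M \<nu> a i x) \<le> Q * D * (2 ^ (M * i)) powr (- \<kappa>)" for i x
  proof -
   have "norm (iter_deriv [] (resid M \<nu> a i) x)
    \<le> (real CARD('n) * (2 ^ M) ^ K) ^ K * 2 ^ i * (2 ^ \<nu>) ^ (K - K) * (1 / 2 ^ (M * i)) ^ K * D"
    by (rule resid_bound[OF a M(1) C Db]) auto
   then have 1: "norm (resid M \<nu> a i x) \<le> Q * D * (2 ^ i * (1 / 2 ^ (M * i)) ^ K)" by (simp add: Q_def mult_ac)
   define q where "q = (2::real) ^ (M * i)"
   have q: "0 < q" "q = 2 powr real (M * i)" by (simp_all add: q_def powr_realpow del: of_nat_mult)
   have "q powr (1 / real M) = 2 powr real i" unfolding q(2) powr_powr using M(2) by simp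
   then have "q powr (1 / real M) = 2 ^ i" by (simp add: powr_realpow)
   moreover have "(1 / q) ^ K = q powr (- real K)"
    by (simp only: powr_minus powr_realpow[OF q(1)] power_one_over inverse_eq_divide)
   moreover have "q powr (1 / real M) * q powr (- real K) = q powr (- \<kappa>)" by (simp add: \<kappa>_def powr_add[symmetric])
   ultimately show ?thesis using 1 unfolding q_def[symmetric] by simp
  qed
  \<comment> \<open>The remainders sit at the levels \<nu> + M i; all other levels receive
    0.\<close>
  define \<omega> where "\<omega> j = (if \<nu> \<le> j \<and> M dvd (j - \<nu>) then resid M \<nu> a ((j - \<nu>) div M) else (\<lambda>x. 0))" for j
  have \<omega>1: "\<omega> (\<nu> + M * i) = resid M \<nu> a i" for i using M by (simp add: \<omega>_def)
  have \<omega>2: "j \<notin> range (\<lambda>i. \<nu> + M * i) ==> \<omega> j = (\<lambda>x. 0)" for j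
  proof (rule ccontr)
   assume j: "j \<notin> range (\<lambda>i. \<nu> + M * i)" and "\<omega> j \<noteq> (\<lambda>x. 0)"
   then have "\<nu> \<le> j" "M dvd (j - \<nu>)" by (auto simp: \<omega>_def split: if_splits)
   then obtain k where "j - \<nu> = M * k" by blast
   then have "j = \<nu> + M * k" using \<open>\<nu> \<le> j\<close> by simp
   then show False using j by blast
  qed
  have cases: "(\<exists>i. j = \<nu> + M * i) \<or> \<omega> j = (\<lambda>x. 0)" for j using \<omega>2[of j] by auto
  show "\<exists>\<omega>. (\<forall>j. continuous_on UNIV (\<omega> j)) \<and>
    (\<forall>j x. \<omega> j x \<noteq> 0 --> \<nu> \<le> j \<and> x \<in> dbox (5 / 2) \<nu> m) \<and>
    (\<forall>j x. \<nu> \<le> j --> norm (\<omega> j x) \<le> Q * (2 ^ \<nu>) powr (d / 2 - \<alpha>) * (2 ^ j / 2 ^ \<nu>) powr (- \<kappa>)) \<and>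
    (\<forall>x. (\<lambda>j. conv (kern j) (\<omega> j) x) sums a x)"
   unfolding D_def[symmetric]
  proof (intro exI[of _ \<omega>] conjI allI impI)
   show "continuous_on UNIV (\<omega> j)" for j by (simp add: \<omega>_def resid_continuous[OF C])
   have "dbox (5 / 2 - (1 / 2) ^ i) \<nu> m \<subseteq> dbox (5 / 2) \<nu> m" for i by (rule dbox_mono) simp
   then show "\<omega> j x \<noteq> 0 ==> x \<in> dbox (5 / 2) \<nu> m" for j x
    using resid_support[OF a M(1), where i="(j - \<nu>) div M" and x=x] by (auto simp: \<omega>_def split: if_splits)
   show "\<omega> j x \<noteq> 0 ==> \<nu> \<le> j" for j x by (auto simp: \<omega>_def split: if_splits)
   show "norm (\<omega> j x) \<le> Q * D * (2 ^ j / 2 ^ \<nu>) powr - \<kappa>" for j x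
    using cases[of j]
   proof (elim disjE exE)
    fix i assume j: "j = \<nu> + M * i"
    show ?thesis using rb[of i x] unfolding j \<omega>1 by (simp add: power_add)
   qed (use Q0 D0 in simp)
   fix x
   have "(\<lambda>N. resid M \<nu> a N x) \<longlonglongrightarrow> 0"
   proof (rule tendsto_norm_zero_cancel)
    define \<rho> where "\<rho> = (2 powr (- \<kappa>) :: real) ^ M"
    have e: "(2 ^ (M * i) :: real) powr (- \<kappa>) = \<rho> ^ i" for i
     unfolding pow2_powr \<rho>_def by (rule power_mult)
    have "2 powr (- \<kappa>) < (1::real)" using \<kappa> \<alpha> by (simp add: powr_less_one)
    moreover have "\<rho> \<le> (2 powr (- \<kappa>)) ^ 1" unfolding \<rho>_def using M(1) calculation by (intro power_decreasing) auto
    ultimately have "\<rho> < 1" "0 \<le> \<rho>" by (simp_all add: \<rho>_def)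
    then have lim: "(\<lambda>i. Q * D * \<rho> ^ i) \<longlonglongrightarrow> 0"
     by (intro tendsto_mult_right_zero LIMSEQ_power_zero) simp
    show "(\<lambda>N. norm (resid M \<nu> a N x)) \<longlonglongrightarrow> 0"
    proof (rule tendsto_sandwich[OF _ _ tendsto_const lim])
     show "\<forall>\<^sub>F N in sequentially. norm (resid M \<nu> a N x) \<le> Q * D * \<rho> ^ N"
      using rb[where x=x] unfolding e by (intro always_eventually allI)
    qed simp
   qed
   then have "(\<lambda>N. a x - resid M \<nu> a N x) \<longlonglongrightarrow> a x - 0" by (rule tendsto_diff[OF tendsto_const])
   then have "(\<lambda>i. conv (kern (\<nu> + M * i)) (\<omega> (\<nu> + M * i)) x) sums a x"
    unfolding sums_def \<omega>1 resid_telescope by simp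
   moreover have "strict_mono (\<lambda>i. \<nu> + M * i)" using M by (auto simp: strict_mono_def)
   moreover have "conv (kern j) (\<omega> j) x = 0" if "j \<notin> range (\<lambda>i. \<nu> + M * i)" for j
    by (simp add: \<omega>2[OF that] conv_def)
   ultimately show "(\<lambda>j. conv (kern j) (\<omega> j) x) sums a x"
    using sums_mono_reindex[of "\<lambda>i. \<nu> + M * i" "\<lambda>j. conv (kern j) (\<omega> j) x"] by simp
  qed
 qed
qed

section \<open>From atoms to mollified pieces\<close>

text \<open>The radius 3 = 5/2 + 1/2 leaves room for the kernel: all pieces that mollification sees
  from x have their index here. The set is finite, so sums over m become finite at each
  point.\<close>

definition box_idx :: "nat => real^'n => (int^'n) set" where
 "box_idx \<nu> x = {m. x \<in> dbox 3 \<nu> m}"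

lemma box_idx_finite: "finite (box_idx \<nu> (x :: real^'n))"
 and card_box_idx: "card (box_idx \<nu> (x :: real^'n)) \<le> 7 ^ CARD('n)"
proof -
 \<comment> \<open>Each coordinate of m is confined to an interval of length 6, which holds at most
   7 integers.\<close>
 define A where "A i = {\<lceil>2 ^ \<nu> * x $ i - 7 / 2\<rceil>..\<lfloor>2 ^ \<nu> * x $ i + 5 / 2\<rfloor>}" for i
 have sub: "box_idx \<nu> x \<subseteq> {m. \<forall>i. m $ i \<in> A i}"
 proof
  fix m assume m: "m \<in> box_idx \<nu> x"
  have "m $ i \<in> A i" for i
  proof -
   have "\<bar>2 ^ \<nu> * x $ i - (of_int (m $ i) + 1 / 2)\<bar> \<le> 3" using m unfolding box_idx_def dbox_def by blast
   then have "2 ^ \<nu> * x $ i - 7 / 2 \<le> of_int (m $ i)" "of_int (m $ i) \<le> 2 ^ \<nu> * x $ i + 5 / 2" by linarith+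
   then show ?thesis by (simp add: A_def ceiling_le_iff le_floor_iff)
  qed
  then show "m \<in> {m. \<forall>i. m $ i \<in> A i}" by simp
 qed
 have fA: "finite (A i)" for i by (simp add: A_def)
 have cA: "card (A i) \<le> 7" for i
 proof -
  define t where "t = 2 ^ \<nu> * x $ i"
  have "\<lfloor>t + 5 / 2\<rfloor> - \<lceil>t - 7 / 2\<rceil> \<le> 6" by linarith
  then show ?thesis by (simp add: A_def t_def[symmetric])
 qed
 show "finite (box_idx \<nu> x)" by (rule finite_subset[OF sub finite_int_vec(1)[OF fA]])
 have "card (box_idx \<nu> x) \<le> card {m. \<forall>i. m $ i \<in> A i}" by (rule card_mono[OF finite_int_vec(1)[OF fA] sub])
 also have "\<dots> \<le> (\<Prod>i\<in>UNIV. card (A i))" by (rule finite_int_vec(2)[OF fA])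
 also have "\<dots> \<le> (\<Prod>i\<in>(UNIV :: 'n set). 7)" by (intro prod_mono conjI cA) simp
 finally show "card (box_idx \<nu> x) \<le> 7 ^ CARD('n)" by simp
qed

lemma sum_box_idx_tendsto:
 fixes g :: "int^'n => complex"
 assumes "\<And>m. g m \<noteq> 0 ==> x \<in> dbox 3 \<nu> m"
 shows "(\<lambda>k. \<Sum>m\<in>int_cube k. g m) \<longlonglongrightarrow> (\<Sum>m\<in>box_idx \<nu> x. g m)"
proof (rule tendsto_eventually)
 obtain N where N: "box_idx \<nu> x \<subseteq> int_cube N" using int_cube_exhausts[OF box_idx_finite] by blast
 show "\<forall>\<^sub>F k in sequentially. (\<Sum>m\<in>int_cube k. g m) = (\<Sum>m\<in>box_idx \<nu> x. g m)"
  using eventually_ge_at_top[of N]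
 proof eventually_elim
  case (elim k)
  show ?case
   by (rule sum.mono_neutral_right[OF finite_int_cube]) (use N int_cube_mono[OF elim] assms in \<open>auto simp: box_idx_def\<close>)
 qed
qed

text \<open>The index set varies with x; measurability comes from the sums over the fixed sets
  \<open>int_cube k\<close>, which at each x are eventually equal to this one.\<close>

lemma sum_box_idx_measurable:
 fixes g :: "int^'n => real^'n => complex"
 assumes [measurable]: "\<And>m. g m \<in> borel_measurable N" and "\<And>m x. g m x \<noteq> 0 ==> x \<in> dbox 3 \<nu> m"
 shows "(\<lambda>x. \<Sum>m\<in>box_idx \<nu> x. g m x) \<in> borel_measurable N"
proof (rule borel_measurable_LIMSEQ_metric)
 show "(\<lambda>k. \<Sum>m\<in>int_cube k. g m x) \<longlonglongrightarrow> (\<Sum>m\<in>box_idx \<nu> x. g m x)" for x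
  by (rule sum_box_idx_tendsto) (rule assms(2))
qed measurable

lemma sum_norm_box_idx_measurable:
 fixes l :: "int^'n => complex"
 assumes "\<And>f :: real^'n => complex. f \<in> borel_measurable borel ==> f \<in> borel_measurable N"
 shows "(\<lambda>x. \<Sum>m\<in>box_idx \<nu> x. norm (l m)) \<in> borel_measurable N"
proof -
 have [measurable]: "dbox 3 \<nu> m \<in> sets (borel :: (real^'n) measure)" for m by (simp add: closed_dbox)
 have "(\<lambda>x. \<Sum>m\<in>box_idx \<nu> x. complex_of_real (norm (l m)) * indicator (dbox 3 \<nu> m) x) \<in> borel_measurable N"
 proof (rule sum_box_idx_measurable)
  fix m show "(\<lambda>x. complex_of_real (norm (l m)) * indicator (dbox 3 \<nu> m) x) \<in> borel_measurable N"
   by (rule assms) measurable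
 qed (auto simp: indicator_def split: if_splits)
 then have "(\<lambda>x. Re (\<Sum>m\<in>box_idx \<nu> x. complex_of_real (norm (l m)) * indicator (dbox 3 \<nu> m) x)) \<in> borel_measurable N"
  by measurable
 moreover have "Re (\<Sum>m\<in>box_idx \<nu> x. complex_of_real (norm (l m)) * indicator (dbox 3 \<nu> m) x) = (\<Sum>m\<in>box_idx \<nu> x. norm (l m))" for x
  unfolding Re_sum by (intro sum.cong refl) (simp add: box_idx_def)
 ultimately show ?thesis by simp
qed

text \<open>Bounded overlap: with at most 7^n terms, the square of the sum is at most 7^n times the
  sum of the squares, and the latter is integrated box by box.\<close>

lemma nn_integral_box_sum:
 fixes l :: "int^'n => complex" and N :: "(real^'n) measure"
 assumes dm: "\<And>m. (\<lambda>x. indicator (dbox 3 \<nu> m) x :: ennreal) \<in> borel_measurable N"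
  and e: "\<And>m. (\<integral>\<^sup>+x. indicator (dbox 3 \<nu> m) x \<partial>N) \<le> ennreal B" and B: "0 \<le> B"
  and sm: "(\<lambda>m. (norm (l m))\<^sup>2) summable_on UNIV"
 shows "(\<integral>\<^sup>+x. ennreal ((\<Sum>m\<in>box_idx \<nu> x. norm (l m))\<^sup>2) \<partial>N) \<le> ennreal (7 ^ CARD('n) * B * (\<Sum>\<^sub>\<infinity>m. (norm (l m))\<^sup>2))"
proof -
 let ?c = "7 ^ CARD('n) :: real"
 have "ennreal ((\<Sum>m\<in>box_idx \<nu> x. norm (l m))\<^sup>2) \<le> (\<integral>\<^sup>+m. ennreal (?c * (norm (l m))\<^sup>2) * indicator (dbox 3 \<nu> m) x \<partial>count_space UNIV)" for x
 proof -
  have "(\<Sum>m\<in>box_idx \<nu> x. norm (l m))\<^sup>2 \<le> (\<Sum>m\<in>box_idx \<nu> x. (norm (l m))\<^sup>2) * real (card (box_idx \<nu> x))"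
   using sum_squared_le_sum_of_squares[of "\<lambda>m. norm (l m)" "box_idx \<nu> x"] by simp
  also have "\<dots> \<le> (\<Sum>m\<in>box_idx \<nu> x. (norm (l m))\<^sup>2) * ?c"
  proof (rule mult_left_mono)
   show "real (card (box_idx \<nu> x)) \<le> ?c" using of_nat_mono[OF card_box_idx[of \<nu> x], where 'a=real] by simp
  qed (simp add: sum_nonneg)
  finally have "ennreal ((\<Sum>m\<in>box_idx \<nu> x. norm (l m))\<^sup>2) \<le> ennreal (\<Sum>m\<in>box_idx \<nu> x. ?c * (norm (l m))\<^sup>2)"
   unfolding sum_distrib_right mult.commute[of ?c] by (rule ennreal_leI)
  also have "\<dots> = (\<Sum>m\<in>box_idx \<nu> x. ennreal (?c * (norm (l m))\<^sup>2) * indicator (dbox 3 \<nu> m) x)"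
  proof -
   have "(\<Sum>m\<in>box_idx \<nu> x. ennreal (?c * (norm (l m))\<^sup>2) * indicator (dbox 3 \<nu> m) x) = (\<Sum>m\<in>box_idx \<nu> x. ennreal (?c * (norm (l m))\<^sup>2))"
    by (intro sum.cong refl) (simp add: box_idx_def)
   then show ?thesis by (simp only: sum_ennreal[OF mult_nonneg_nonneg[OF zero_le_power[OF zero_le_numeral] zero_le_power2]])
  qed
  also have "\<dots> = (\<integral>\<^sup>+m. ennreal (?c * (norm (l m))\<^sup>2) * indicator (dbox 3 \<nu> m) x \<partial>count_space UNIV)"
   by (rule nn_integral_count_space'[symmetric, OF box_idx_finite]) (auto simp: box_idx_def)
  finally show ?thesis .
 qed
 then have "(\<integral>\<^sup>+x. ennreal ((\<Sum>m\<in>box_idx \<nu> x. norm (l m))\<^sup>2) \<partial>N)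
  \<le> (\<integral>\<^sup>+x. (\<integral>\<^sup>+m. ennreal (?c * (norm (l m))\<^sup>2) * indicator (dbox 3 \<nu> m) x \<partial>count_space UNIV) \<partial>N)"
  by (rule nn_integral_mono)
 also have "\<dots> = (\<integral>\<^sup>+m. (\<integral>\<^sup>+x. ennreal (?c * (norm (l m))\<^sup>2) * indicator (dbox 3 \<nu> m) x \<partial>N) \<partial>count_space UNIV)"
  by (rule nn_integral_count_space_nn_integral[OF countable_int_vec]) (intro borel_measurable_times_ennreal borel_measurable_const dm)
 also have "\<dots> = (\<integral>\<^sup>+m. ennreal (?c * (norm (l m))\<^sup>2) * (\<integral>\<^sup>+x. indicator (dbox 3 \<nu> m) x \<partial>N) \<partial>count_space UNIV)"
  by (intro nn_integral_cong nn_integral_cmult dm)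
 also have "\<dots> \<le> (\<integral>\<^sup>+m. ennreal (?c * (norm (l m))\<^sup>2) * ennreal B \<partial>count_space UNIV)"
  by (intro nn_integral_mono mult_left_mono e) auto
 also have "\<dots> = (\<integral>\<^sup>+m. ennreal (?c * B) * ennreal ((norm (l m))\<^sup>2) \<partial>count_space UNIV)"
  using B by (intro nn_integral_cong) (simp add: ennreal_mult'[symmetric] mult_ac)
 also have "\<dots> = ennreal (?c * B) * (\<integral>\<^sup>+m. ennreal ((norm (l m))\<^sup>2) \<partial>count_space UNIV)"
  by (rule nn_integral_cmult) simp
 also have "(\<integral>\<^sup>+m. ennreal ((norm (l m))\<^sup>2) \<partial>count_space UNIV) = ennreal (\<Sum>\<^sub>\<infinity>m. (norm (l m))\<^sup>2)"
 proof -
  have a: "Infinite_Set_Sum.abs_summable_on (\<lambda>m. (norm (l m))\<^sup>2) UNIV"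
   unfolding abs_summable_equivalent[symmetric] using sm by simp
  show ?thesis unfolding infsetsum_infsum[OF a, symmetric] by (rule nn_integral_conv_infsetsum[OF a]) simp
 qed
 finally show ?thesis using B by (simp add: ennreal_mult'[symmetric])
qed

context upper_regular
begin

text \<open>After rescaling, the box is a translate of a fixed cube, covered by finitely many balls
  of radius 1/2; their number does not depend on \<nu> and m.\<close>

lemma emeasure_dbox_le:
 obtains C where "0 < C" "\<And>\<nu> m. emeasure M {x \<in> space M. x \<in> dbox R \<nu> m} \<le> ennreal (C * (2 ^ \<nu>) powr (- d))"
proof -
 let ?B = "cbox (\<chi> i. - R) (\<chi> i. R) :: (real^'n) set"
 obtain F :: "(real^'n) set" where F: "finite F" "?B \<subseteq> (\<Union>z\<in>F. ball z (1 / 2))"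
  using compact_cbox[of "(\<chi> i. - R) :: real^'n" "\<chi> i. R"] unfolding compact_eq_totally_bounded by (auto dest: spec[of _ "1 / 2"])
 define C where "C = real (card F) * c + 1"
 have C0: "0 < C" unfolding C_def using c_nonneg by (intro add_nonneg_pos mult_nonneg_nonneg) auto
 have "emeasure M {x \<in> space M. x \<in> dbox R \<nu> m} \<le> ennreal (C * (2 ^ \<nu>) powr (- d))" for \<nu> m
 proof -
  define p where "p = (2::real) ^ \<nu>"
  have p: "0 < p" "1 \<le> p" by (simp_all add: p_def)
  define cen :: "real^'n" where "cen = (\<chi> i. (of_int (m $ i) + 1 / 2) / p)"
  let ?b = "\<lambda>z. {x \<in> space M. dist (cen + (1 / p) *\<^sub>R z) x \<le> 1 / 2 / p}"
  have sub: "{x \<in> space M. x \<in> dbox R \<nu> m} \<subseteq> (\<Union>z\<in>F. ?b z)"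
  proof
   fix x assume x: "x \<in> {x \<in> space M. x \<in> dbox R \<nu> m}"
   define y :: "real^'n" where "y = (\<chi> i. p * x $ i - (of_int (m $ i) + 1 / 2))"
   have "\<bar>y $ i\<bar> \<le> R" for i using x by (simp add: y_def dbox_def p_def)
   then have "y \<in> ?B" unfolding mem_box_cart by (auto simp: abs_le_iff minus_le_iff)
   then obtain z where z: "z \<in> F" "dist z y < 1 / 2" using F(2) by auto
   have "cen + (1 / p) *\<^sub>R z - x = (1 / p) *\<^sub>R (z - y)"
    using p by (simp add: vec_eq_iff cen_def y_def field_simps)
   then have "dist (cen + (1 / p) *\<^sub>R z) x = norm (z - y) / p" using p by (simp add: dist_norm)
   also have "\<dots> \<le> 1 / 2 / p" using z(2) p by (intro divide_right_mono) (auto simp: dist_norm)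
   finally show "x \<in> (\<Union>z\<in>F. ?b z)" using z x by blast
  qed
  have "emeasure M {x \<in> space M. x \<in> dbox R \<nu> m} \<le> emeasure M (\<Union>z\<in>F. ?b z)"
   by (rule emeasure_mono[OF sub]) (intro sets.finite_UN F sets_dist_le)
  also have "\<dots> \<le> (\<Sum>z\<in>F. emeasure M (?b z))"
   by (intro emeasure_subadditive_finite F image_subsetI sets_dist_le)
  also have "\<dots> \<le> (\<Sum>z\<in>F. ennreal (c * (1 / 2 / p) powr d))"
   using p by (intro sum_mono emeasure_ball_le) (auto simp: field_simps)
  also have "\<dots> = ennreal (real (card F) * (c * (1 / 2 / p) powr d))"
   using c_nonneg by (simp add: ennreal_mult' ennreal_of_nat_eq_real_of_nat)
  also have "\<dots> \<le> ennreal (C * p powr (- d))"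
  proof (rule ennreal_leI)
   have "(1 / 2 / p) powr d \<le> (1 / p) powr d" using p d_nonneg by (intro powr_mono2) (auto simp: field_simps)
   also have "(1 / p) powr d = p powr (- d)" using p by (simp add: powr_minus_divide powr_divide)
   finally have "real (card F) * (c * (1 / 2 / p) powr d) \<le> real (card F) * (c * p powr (- d))"
    using c_nonneg by (intro mult_left_mono) auto
   also have "\<dots> \<le> C * p powr (- d)" by (simp add: C_def algebra_simps)
   finally show "real (card F) * (c * (1 / 2 / p) powr d) \<le> C * p powr (- d)" .
  qed
  finally show ?thesis unfolding p_def .
 qed
 with C0 show ?thesis by (rule that)
qed

end

section \<open>Two-sided regularity and regrouping of the pieces\<close>

text \<open>The upper bound controls traces; the lower bound added here controls the volume of
  neighbourhoods of \<open>space M\<close>.\<close>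

locale regular = upper_regular M d c for M :: "(real^'n) measure" and d c +
 fixes c1 :: real
 assumes c1_pos: "0 < c1"
  and emeasure_ball_ge: "\<And>x r. x \<in> space M ==> 0 < r ==> r \<le> 1 ==> ennreal (c1 * r powr d) \<le> emeasure M {y \<in> space M. dist x y \<le> r}"
begin

definition near :: "nat => (real^'n) set" where
 "near j = (\<Union>y\<in>space M. ball y (1 / 2 ^ j))"

lemma near_sets [measurable]: "near j \<in> sets borel"
 unfolding near_def by (intro borel_open open_UN ballI open_ball)

text \<open>A point of \<open>near j\<close> sees a fixed proportion of the measure of a ball of radius \<open>2 / 2 ^ j\<close>,
 so Tonelli's theorem turns the mass of the box into the volume of its neighbourhood.\<close>

lemma lebesgue_near_dbox:
 obtains C where "0 < C"
  "\<And>\<nu> m j. \<nu> \<le> j ==> emeasure lborel (near j \<inter> dbox 3 \<nu> m) \<le> ennreal (C * ((2 ^ j) powr (d - real CARD('n)) * (2 ^ \<nu>) powr (- d)))"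
proof -
 obtain C5 where C5: "0 < C5" "\<And>\<nu> m. emeasure M {x \<in> space M. x \<in> dbox 5 \<nu> m} \<le> ennreal (C5 * (2 ^ \<nu>) powr (- d))"
  by (rule emeasure_dbox_le) (rule that)
 define V where "V = unit_ball_vol (real CARD('n)) * 2 ^ CARD('n)"
 have V0: "0 < V" by (simp add: V_def)
 define C where "C = V * C5 / c1"
 have C0: "0 < C" using V0 C5 c1_pos by (simp add: C_def)
 have "emeasure lborel (near j \<inter> dbox 3 \<nu> m) \<le> ennreal (C * ((2 ^ j) powr (d - real CARD('n)) * (2 ^ \<nu>) powr (- d)))"
  if \<nu>j: "\<nu> \<le> j" for \<nu> m j
 proof -
  define p q where "p = (2::real) ^ \<nu>" and "q = (2::real) ^ j"
  have pq: "0 < p" "0 < q" "1 \<le> q" "p \<le> q" using \<nu>j by (simp_all add: p_def q_def)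
  define f :: "real^'n => real^'n => ennreal" where
   "f y x = indicator (dbox 5 \<nu> m) y * indicator {t. t \<le> 2 / q} (dist y x)" for y x
  have [measurable]: "dbox R \<nu> m \<in> sets (borel :: (real^'n) measure)" for R by (simp add: closed_dbox)
  have [measurable]: "{t. t \<le> 2 / q} \<in> sets borel" by simp
  have f1: "fst \<in> M \<Otimes>\<^sub>M (lborel :: (real^'n) measure) \<rightarrow>\<^sub>M borel" by (rule fst_measurable)
  have f2: "snd \<in> M \<Otimes>\<^sub>M (lborel :: (real^'n) measure) \<rightarrow>\<^sub>M borel" using measurable_snd[of M lborel] by simp
  have f3: "(\<lambda>z. dist (fst z) (snd z)) \<in> borel_measurable (M \<Otimes>\<^sub>M (lborel :: (real^'n) measure))"
   by (intro borel_measurable_dist f1 f2)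
  have fm: "case_prod f \<in> borel_measurable (M \<Otimes>\<^sub>M (lborel :: (real^'n) measure))"
   unfolding f_def case_prod_unfold
  proof (rule borel_measurable_times_ennreal)
   show "(\<lambda>z. indicator (dbox 5 \<nu> m) (fst z) :: ennreal) \<in> borel_measurable (M \<Otimes>\<^sub>M (lborel :: (real^'n) measure))"
    by (rule measurable_compose[OF f1]) measurable
   show "(\<lambda>z. indicator {t. t \<le> 2 / q} (dist (fst z) (snd z)) :: ennreal) \<in> borel_measurable (M \<Otimes>\<^sub>M (lborel :: (real^'n) measure))"
    by (rule measurable_compose[OF f3]) measurable
  qed
  \<comment> \<open>If y0 in \<open>space M\<close> is within 1/q of x, the ball of radius 1/q
    around y0 lies in the ball of radius 2/q around x, and in the box of radius 5 = 3 + 2 because p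
    \<le> q.\<close>
  have low: "ennreal (c1 * (1 / q) powr d) * indicator (near j \<inter> dbox 3 \<nu> m) x \<le> (\<integral>\<^sup>+y. f y x \<partial>M)" for x
  proof (cases "x \<in> near j \<inter> dbox 3 \<nu> m")
   case True
   then obtain y0 where y0: "y0 \<in> space M" "dist y0 x < 1 / q" by (auto simp: near_def q_def)
   have "ennreal (c1 * (1 / q) powr d) \<le> emeasure M {y \<in> space M. dist y0 y \<le> 1 / q}"
    using y0 pq by (intro emeasure_ball_ge) (auto simp: field_simps)
   also have "\<dots> = (\<integral>\<^sup>+y. indicator {y \<in> space M. dist y0 y \<le> 1 / q} y \<partial>M)"
    by (rule nn_integral_indicator[symmetric]) (rule sets_dist_le)
   also have "\<dots> \<le> (\<integral>\<^sup>+y. f y x \<partial>M)"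
   proof (rule nn_integral_mono)
    fix y assume "y \<in> space M"
    show "indicator {y \<in> space M. dist y0 y \<le> 1 / q} y \<le> f y x"
    proof (cases "dist y0 y \<le> 1 / q")
     case le: True
     have d: "dist y x \<le> 2 / q" using le y0(2) dist_triangle[of y x y0] by (simp add: dist_commute)
     have "p * norm (x - y) \<le> p * (2 / q)" using d pq by (intro mult_left_mono) (auto simp: dist_norm norm_minus_commute)
     also have "\<dots> \<le> 2" using pq by (simp add: field_simps)
     finally have "y \<in> dbox (3 + 2) \<nu> m" using True unfolding p_def by (intro dbox_shift[of x]) auto
     then show ?thesis using d by (simp add: f_def indicator_def)
    qed simp
   qed
   finally show ?thesis using True by simp
  qed simp
  have "ennreal (c1 * (1 / q) powr d) * emeasure lborel (near j \<inter> dbox 3 \<nu> m)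
   = (\<integral>\<^sup>+x. ennreal (c1 * (1 / q) powr d) * indicator (near j \<inter> dbox 3 \<nu> m) x \<partial>lborel)"
   by (rule nn_integral_cmult_indicator[symmetric]) simp
  also have "\<dots> \<le> (\<integral>\<^sup>+x. (\<integral>\<^sup>+y. f y x \<partial>M) \<partial>lborel)" by (intro nn_integral_mono low)
  also have "\<dots> = (\<integral>\<^sup>+y. (\<integral>\<^sup>+x. f y x \<partial>lborel) \<partial>M)" by (rule Tonelli_M[OF fm, symmetric])
  also have "\<dots> = (\<integral>\<^sup>+y. ennreal (V * (1 / q) ^ CARD('n)) * indicator {x \<in> space M. x \<in> dbox 5 \<nu> m} y \<partial>M)"
  proof (rule nn_integral_cong)
   fix y assume y: "y \<in> space M"
   have "(\<integral>\<^sup>+x. f y x \<partial>lborel) = (\<integral>\<^sup>+x. indicator (dbox 5 \<nu> m) y * indicator (cball y (2 / q)) x \<partial>lborel)"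
    unfolding f_def by (intro nn_integral_cong arg_cong2[where f="(*)"] refl) (simp add: indicator_def)
   also have "\<dots> = indicator (dbox 5 \<nu> m) y * emeasure lborel (cball y (2 / q))"
    by (rule nn_integral_cmult_indicator) simp
   also have "emeasure lborel (cball y (2 / q)) = ennreal (V * (1 / q) ^ CARD('n))"
    using pq by (simp add: emeasure_cball V_def power_divide)
   finally show "(\<integral>\<^sup>+x. f y x \<partial>lborel) = ennreal (V * (1 / q) ^ CARD('n)) * indicator {x \<in> space M. x \<in> dbox 5 \<nu> m} y"
    using y by (simp add: indicator_def)
  qed
  also have "\<dots> = ennreal (V * (1 / q) ^ CARD('n)) * emeasure M {x \<in> space M. x \<in> dbox 5 \<nu> m}"
  proof (rule nn_integral_cmult_indicator)
   have "{x \<in> space M. x \<in> dbox 5 \<nu> m} = (\<lambda>x. x) -` dbox 5 \<nu> m \<inter> space M" by auto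
   then show "{x \<in> space M. x \<in> dbox 5 \<nu> m} \<in> sets M" using measurable_sets[OF id_measurable, of "dbox 5 \<nu> m"] by simp
  qed
  also have "\<dots> \<le> ennreal (V * (1 / q) ^ CARD('n)) * ennreal (C5 * p powr (- d))"
   unfolding p_def by (intro mult_left_mono C5) simp
  also have "\<dots> = ennreal (V * (1 / q) ^ CARD('n) * (C5 * p powr (- d)))" using V0 pq by (intro ennreal_mult'[symmetric]) auto
  finally have main: "ennreal (c1 * (1 / q) powr d) * emeasure lborel (near j \<inter> dbox 3 \<nu> m) \<le> ennreal (V * (1 / q) ^ CARD('n) * (C5 * p powr (- d)))" .
  have a0: "0 < c1 * (1 / q) powr d" using c1_pos pq by simp
  have eq: "V * (1 / q) ^ CARD('n) * (C5 * p powr (- d)) / (c1 * (1 / q) powr d) = C * (q powr (d - real CARD('n)) * p powr (- d))"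
  proof -
   have 1: "(1 / q) powr d = inverse (q powr d)" using pq by (simp add: powr_divide inverse_eq_divide)
   have 2: "(1 / q) ^ CARD('n) = inverse (q powr real CARD('n))" using pq by (simp add: powr_realpow power_divide inverse_eq_divide)
   have 3: "q powr (d - real CARD('n)) = q powr d / q powr real CARD('n)" by (rule powr_diff)
   have "0 < q powr d" "0 < q powr real CARD('n)" using pq by simp_all
   then show ?thesis using c1_pos unfolding C_def 1 2 3 by (simp add: divide_inverse mult_ac)
  qed
  show ?thesis
  proof (cases "emeasure lborel (near j \<inter> dbox 3 \<nu> m)")
   case (real e)
   have "c1 * (1 / q) powr d * e \<le> V * (1 / q) ^ CARD('n) * (C5 * p powr (- d))"
    using main real a0 V0 C5 pq by (simp add: ennreal_mult'[symmetric])
   then have "e \<le> V * (1 / q) ^ CARD('n) * (C5 * p powr (- d)) / (c1 * (1 / q) powr d)"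
    using a0 by (simp only: pos_le_divide_eq mult.commute[of e])
   then show ?thesis unfolding eq real p_def[symmetric] q_def[symmetric] by (rule ennreal_leI)
  next
   case top
   then show ?thesis using main a0 c1_pos pq(2) by (simp add: ennreal_mult_top top_unique)
  qed
 qed
 with C0 show ?thesis by (rule that)
qed

end

context regular
begin

text \<open>Collects the pieces of level j of all atoms. The cut to \<open>near j\<close> does not
  change the mollification on \<open>space M\<close>, and it is what makes the L2 norm small
  enough.\<close>

definition glue :: "(nat => int^'n => complex) => (nat => int^'n => nat => real^'n => complex) => nat => real^'n => complex" where
 "glue l \<omega> j x = indicator (near j) x * (\<Sum>\<nu>\<le>j. \<Sum>m\<in>box_idx \<nu> x. l \<nu> m * \<omega> \<nu> m j x)"

lemma glue_measurable:
 assumes c: "\<And>\<nu> m j. continuous_on UNIV (\<omega> \<nu> m j)" and supp: "\<And>\<nu> m j x. \<omega> \<nu> m j x \<noteq> 0 ==> x \<in> dbox (5 / 2) \<nu> m"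
 shows "glue l \<omega> j \<in> borel_measurable borel"
proof -
 have "(\<lambda>x. \<Sum>m\<in>box_idx \<nu> x. l \<nu> m * \<omega> \<nu> m j x) \<in> borel_measurable borel" for \<nu>
 proof (rule sum_box_idx_measurable)
  show "(\<lambda>x. l \<nu> m * \<omega> \<nu> m j x) \<in> borel_measurable borel" for m
   by (intro borel_measurable_continuous_onI continuous_on_mult continuous_on_const c)
  show "l \<nu> m * \<omega> \<nu> m j x \<noteq> 0 ==> x \<in> dbox 3 \<nu> m" for m x
   using supp[of \<nu> m j x] dbox_mono[of "5 / 2" 3 \<nu> m] by auto
 qed
 then have "(\<lambda>x. indicator (near j) x * (\<Sum>\<nu>\<le>j. \<Sum>m\<in>box_idx \<nu> x. l \<nu> m * \<omega> \<nu> m j x)) \<in> borel_measurable borel"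
  by (intro borel_measurable_times borel_measurable_indicator borel_measurable_sum near_sets)
 moreover have "glue l \<omega> j = (\<lambda>x. indicator (near j) x * (\<Sum>\<nu>\<le>j. \<Sum>m\<in>box_idx \<nu> x. l \<nu> m * \<omega> \<nu> m j x))"
  by (rule ext) (rule glue_def)
 ultimately show ?thesis by (simp only:)
qed

text \<open>From x in \<open>space M\<close> the kernel sees only points of \<open>near j\<close>. A
  piece that is nonzero at such a point y has both x and y in its box of radius 3, so the index set
  of x serves all these y.\<close>

lemma conv_glue:
 assumes c: "\<And>\<nu> m j. continuous_on UNIV (\<omega> \<nu> m j)" and supp: "\<And>\<nu> m j x. \<omega> \<nu> m j x \<noteq> 0 ==> x \<in> dbox (5 / 2) \<nu> m"
  and x: "x \<in> space M"
 shows "conv (kern j) (glue l \<omega> j) x = (\<Sum>\<nu>\<le>j. \<Sum>m\<in>box_idx \<nu> x. l \<nu> m * conv (kern j) (\<omega> \<nu> m j) x)"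
proof -
 define g where "g \<nu> y = (\<Sum>m\<in>box_idx \<nu> x. l \<nu> m * \<omega> \<nu> m j y)" for \<nu> y
 have li: "loc_int (\<omega> \<nu> m j)" for \<nu> m by (rule continuous_loc_int[OF c])
 have lg: "loc_int (g \<nu>)" for \<nu>
  unfolding g_def by (intro continuous_loc_int continuous_on_sum continuous_on_mult continuous_on_const c)
 have cg: "conv (kern j) (g \<nu>) x = (\<Sum>m\<in>box_idx \<nu> x. l \<nu> m * conv (kern j) (\<omega> \<nu> m j) x)" for \<nu>
  unfolding g_def by (rule conv_sum[OF box_idx_finite li])
 have "conv (kern j) (glue l \<omega> j) x = conv (kern j) (\<lambda>y. \<Sum>\<nu>\<le>j. 1 * g \<nu> y) x"
 proof (rule conv_kern_cong)
  fix y assume y: "norm (x - y) < 1 / 2 / 2 ^ j"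
  have "(1 / 2 / 2 ^ j :: real) \<le> 1 / 2 ^ j" by (simp add: field_simps)
  then have "dist x y < 1 / 2 ^ j" using y unfolding dist_norm by (rule less_le_trans[rotated])
  then have near: "y \<in> near j" using x unfolding near_def by auto
  have inner: "(\<Sum>m\<in>box_idx \<nu> y. l \<nu> m * \<omega> \<nu> m j y) = g \<nu> y" if "\<nu> \<le> j" for \<nu>
   unfolding g_def
  proof (rule sum.mono_neutral_cong[OF box_idx_finite box_idx_finite])
   have *: "m \<in> box_idx \<nu> y \<inter> box_idx \<nu> x" if "\<omega> \<nu> m j y \<noteq> 0" for m
   proof -
    have y5: "y \<in> dbox (5 / 2) \<nu> m" using that by (rule supp)
    have "2 ^ \<nu> * norm (y - x) \<le> 2 ^ j * (1 / 2 / 2 ^ j)"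
     using y \<open>\<nu> \<le> j\<close> by (intro mult_mono power_increasing) (simp_all add: norm_minus_commute)
    then have "x \<in> dbox (5 / 2 + 1 / 2) \<nu> m" by (intro dbox_shift[OF y5]) simp
    then show ?thesis using y5 dbox_mono[of "5 / 2" 3 \<nu> m] by (auto simp: box_idx_def)
   qed
   fix m
   show "m \<in> box_idx \<nu> x - box_idx \<nu> y ==> l \<nu> m * \<omega> \<nu> m j y = 0" using *[of m] by auto
   show "m \<in> box_idx \<nu> y - box_idx \<nu> x ==> l \<nu> m * \<omega> \<nu> m j y = 0" using *[of m] by auto
  qed simp
  show "glue l \<omega> j y = (\<Sum>\<nu>\<le>j. 1 * g \<nu> y)" using near by (simp add: glue_def inner)
 qed
 also have "\<dots> = (\<Sum>\<nu>\<le>j. 1 * conv (kern j) (g \<nu>) x)" by (rule conv_sum) (simp_all add: lg)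
 finally show ?thesis by (simp add: cg)
qed

text \<open>Cauchy-Schwarz over \<nu> with the weights q^(j - \<nu>) at each point, then
  \<open>nn_integral_box_sum\<close> on \<open>near j\<close>. The volume bound 2^(j (d - n))
  2^(-\<nu> d) cancels the powers of 2 coming from s and from the atoms, and what is left is the
  convolution of the level sums with a geometric sequence.\<close>

lemma level_norm_glue_le:
 assumes s: "s = \<alpha> + (real CARD('n) - d) / 2" and \<kappa>: "\<alpha> < \<kappa>" and Q: "0 < Q"
 obtains C where "0 < C"
  "\<And>l \<omega>. (\<forall>\<nu> m j. continuous_on UNIV (\<omega> \<nu> m j)) ==> (\<forall>\<nu> m j x. \<omega> \<nu> m j x \<noteq> 0 --> x \<in> dbox (5 / 2) \<nu> m) ==>
   (\<forall>\<nu> m j x. \<nu> \<le> j --> norm (\<omega> \<nu> m j x) \<le> Q * (2 ^ \<nu>) powr (d / 2 - \<alpha>) * (2 ^ j / 2 ^ \<nu>) powr (- \<kappa>)) ==>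
   (\<forall>\<nu>. (\<lambda>m. (norm (l \<nu> m))\<^sup>2) summable_on UNIV) ==> summable (\<lambda>\<nu>. \<Sum>\<^sub>\<infinity>m. (norm (l \<nu> m))\<^sup>2) ==>
   level_norm s (glue l \<omega>) \<le> ennreal (C * (\<Sum>\<nu>. \<Sum>\<^sub>\<infinity>m. (norm (l \<nu> m))\<^sup>2))"
proof -
 obtain C3 where C3: "0 < C3"
  "\<And>\<nu> m j. \<nu> \<le> j ==> emeasure lborel (near j \<inter> dbox 3 \<nu> m) \<le> ennreal (C3 * ((2 ^ j) powr (d - real CARD('n)) * (2 ^ \<nu>) powr (- d)))"
  by (rule lebesgue_near_dbox) (rule that)
 \<comment> \<open>The surplus \<kappa> - \<alpha> is the rate at which an atom of level \<nu> fades
   at later levels, measured against the weight of the space.\<close>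
 define q where "q = (2::real) powr (\<alpha> - \<kappa>)"
 have q: "0 < q" "q < 1" using \<kappa> by (simp_all add: q_def powr_less_one)
 define E where "E = Q\<^sup>2 * (1 / (1 - q))"
 have E0: "0 < E" using Q q by (simp add: E_def)
 define A where "A = E * (7 ^ CARD('n) * C3)"
 have A0: "0 < A" using E0 C3 by (simp add: A_def)
 have C0: "0 < A * (1 / (1 - q))" using A0 q by simp
 show ?thesis
 proof (rule that[OF C0])
  fix l :: "nat => int^'n => complex" and \<omega> :: "nat => int^'n => nat => real^'n => complex"
  assume bd: "\<forall>\<nu> m j x. \<nu> \<le> j --> norm (\<omega> \<nu> m j x) \<le> Q * (2 ^ \<nu>) powr (d / 2 - \<alpha>) * (2 ^ j / 2 ^ \<nu>) powr (- \<kappa>)"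
   and sm: "\<forall>\<nu>. (\<lambda>m. (norm (l \<nu> m))\<^sup>2) summable_on UNIV" and sL: "summable (\<lambda>\<nu>. \<Sum>\<^sub>\<infinity>m. (norm (l \<nu> m))\<^sup>2)"
  define S where "S \<nu> x = (\<Sum>m\<in>box_idx \<nu> x. norm (l \<nu> m))" for \<nu> x
  have S0: "0 \<le> S \<nu> x" for \<nu> x by (simp add: S_def sum_nonneg)
  have Sm [measurable]: "S \<nu> \<in> borel_measurable borel" for \<nu>
   unfolding S_def by (rule sum_norm_box_idx_measurable)
  define L where "L \<nu> = (\<Sum>\<^sub>\<infinity>m. (norm (l \<nu> m))\<^sup>2)" for \<nu>
  have L0: "0 \<le> L \<nu>" for \<nu> unfolding L_def by (rule infsum_nonneg) simp
  have sL': "summable L" using sL unfolding L_def[abs_def] .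
  define e where "e j \<nu> = E * (2 ^ j) powr (- 2 * \<alpha>) * q ^ (j - \<nu>) * (2 ^ \<nu>) powr d" for j \<nu> :: nat
  have e0: "0 \<le> e j \<nu>" for j \<nu> using E0 q by (simp add: e_def)
  have pw: "(norm (glue l \<omega> j x))\<^sup>2 \<le> (\<Sum>\<nu>\<le>j. e j \<nu> * (indicat_real (near j) x * (S \<nu> x)\<^sup>2))" for j x
  proof (cases "x \<in> near j")
   case True
   define t h where "t \<nu> = q ^ (j - \<nu>)" and "h \<nu> = (2 ^ \<nu>) powr (d / 2) * S \<nu> x" for \<nu>
   have t0: "0 \<le> t \<nu>" for \<nu> using q by (simp add: t_def)
   \<comment> \<open>With 2^j = 2^\<nu> 2^(j - \<nu>) the powers separate into the weight of level
     j, the decay in j - \<nu>, and 2^(\<nu> d / 2), which the measure of a box will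
     balance.\<close>
   have ident: "(2 ^ \<nu>) powr (d / 2 - \<alpha>) * (2 ^ j / 2 ^ \<nu>) powr (- \<kappa>) = (2 ^ j) powr (- \<alpha>) * (t \<nu> * (2 ^ \<nu>) powr (d / 2))"
    if "\<nu> \<le> j" for \<nu>
   proof -
    define p z where "p = (2::real) ^ \<nu>" and "z = (2::real) ^ (j - \<nu>)"
    have pz: "0 < p" "0 < z" "2 ^ j = p * z" using that by (simp_all add: p_def z_def power_add[symmetric])
    have 1: "t \<nu> = z powr (\<alpha> - \<kappa>)" unfolding t_def z_def pow2_powr q_def ..
    have 2: "(p * z) powr (- \<alpha>) = p powr (- \<alpha>) * z powr (- \<alpha>)" using pz by (simp add: powr_mult)
    have 3: "p powr (d / 2 - \<alpha>) = p powr (- \<alpha>) * p powr (d / 2)" "z powr (- \<kappa>) = z powr (- \<alpha>) * z powr (\<alpha> - \<kappa>)"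
     by (simp_all add: powr_add[symmetric])
    have 4: "p * z / p = z" using pz by simp
    show ?thesis unfolding p_def[symmetric] pz(3) 4 1 2 3 by (simp only: mult_ac)
   qed
   have "norm (glue l \<omega> j x) \<le> (\<Sum>\<nu>\<le>j. norm (\<Sum>m\<in>box_idx \<nu> x. l \<nu> m * \<omega> \<nu> m j x))"
    using True by (simp add: glue_def norm_sum)
   also have "\<dots> \<le> (\<Sum>\<nu>\<le>j. (Q * (2 ^ j) powr (- \<alpha>)) * (t \<nu> * h \<nu>))"
   proof (rule sum_mono)
    fix \<nu> assume "\<nu> \<in> {..j}"
    then have \<nu>: "\<nu> \<le> j" by simp
    have "norm (\<Sum>m\<in>box_idx \<nu> x. l \<nu> m * \<omega> \<nu> m j x) \<le> (\<Sum>m\<in>box_idx \<nu> x. norm (l \<nu> m) * (Q * (2 ^ \<nu>) powr (d / 2 - \<alpha>) * (2 ^ j / 2 ^ \<nu>) powr (- \<kappa>)))"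
     unfolding norm_mult[symmetric] using bd \<nu> by (intro sum_norm_le) (simp add: norm_mult mult_left_mono)
    also have "\<dots> = S \<nu> x * (Q * ((2 ^ \<nu>) powr (d / 2 - \<alpha>) * (2 ^ j / 2 ^ \<nu>) powr (- \<kappa>)))"
     unfolding S_def sum_distrib_right[symmetric] by (simp only: mult.assoc)
    also have "\<dots> = (Q * (2 ^ j) powr (- \<alpha>)) * (t \<nu> * h \<nu>)" unfolding ident[OF \<nu>] h_def by (simp only: mult_ac)
    finally show "norm (\<Sum>m\<in>box_idx \<nu> x. l \<nu> m * \<omega> \<nu> m j x) \<le> (Q * (2 ^ j) powr (- \<alpha>)) * (t \<nu> * h \<nu>)" .
   qed
   also have "\<dots> = (Q * (2 ^ j) powr (- \<alpha>)) * (\<Sum>\<nu>\<le>j. t \<nu> * h \<nu>)" by (rule sum_distrib_left[symmetric])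
   finally have "(norm (glue l \<omega> j x))\<^sup>2 \<le> ((Q * (2 ^ j) powr (- \<alpha>)) * (\<Sum>\<nu>\<le>j. t \<nu> * h \<nu>))\<^sup>2" by (rule power_mono) simp
   also have "\<dots> = (Q\<^sup>2 * (2 ^ j) powr (- 2 * \<alpha>)) * (\<Sum>\<nu>\<le>j. t \<nu> * h \<nu>)\<^sup>2"
   proof -
    have "((2 ^ j :: real) powr (- \<alpha>))\<^sup>2 = (2 ^ j) powr (- 2 * \<alpha>)" by (simp add: power2_eq_square powr_add[symmetric])
    then show ?thesis by (simp only: power_mult_distrib)
   qed
   also have "(\<Sum>\<nu>\<le>j. t \<nu> * h \<nu>)\<^sup>2 \<le> (1 / (1 - q)) * (\<Sum>\<nu>\<le>j. t \<nu> * (h \<nu>)\<^sup>2)"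
   proof -
    have "(\<Sum>\<nu>\<le>j. t \<nu> * h \<nu>)\<^sup>2 = (\<Sum>\<nu>\<le>j. sqrt (t \<nu>) * (sqrt (t \<nu>) * h \<nu>))\<^sup>2"
     using t0 by (simp add: mult.assoc[symmetric])
    also have "\<dots> \<le> (\<Sum>\<nu>\<le>j. (sqrt (t \<nu>))\<^sup>2) * (\<Sum>\<nu>\<le>j. (sqrt (t \<nu>) * h \<nu>)\<^sup>2)" by (rule Cauchy_Schwarz_ineq_sum)
    also have "\<dots> = (\<Sum>\<nu>\<le>j. t \<nu>) * (\<Sum>\<nu>\<le>j. t \<nu> * (h \<nu>)\<^sup>2)" using t0 by (simp add: power_mult_distrib)
    also have "\<dots> \<le> (1 / (1 - q)) * (\<Sum>\<nu>\<le>j. t \<nu> * (h \<nu>)\<^sup>2)"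
    proof (rule mult_right_mono)
     have "(\<Sum>\<nu>\<le>j. t \<nu>) = (\<Sum>i\<in>{..j}. q ^ i)"
      unfolding t_def by (rule sum.reindex_bij_witness[of _ "\<lambda>i. j - i" "\<lambda>i. j - i"]) auto
     also have "\<dots> \<le> (\<Sum>i. q ^ i)" using q by (intro sum_le_suminf summable_geometric) auto
     also have "\<dots> = 1 / (1 - q)" using q by (intro suminf_geometric) simp
     finally show "(\<Sum>\<nu>\<le>j. t \<nu>) \<le> 1 / (1 - q)" .
    qed (use t0 in \<open>simp add: sum_nonneg\<close>)
    finally show ?thesis .
   qed
   also have "(Q\<^sup>2 * (2 ^ j) powr (- 2 * \<alpha>)) * ((1 / (1 - q)) * (\<Sum>\<nu>\<le>j. t \<nu> * (h \<nu>)\<^sup>2)) = (\<Sum>\<nu>\<le>j. e j \<nu> * (S \<nu> x)\<^sup>2)"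
   proof -
    have "(h \<nu>)\<^sup>2 = (2 ^ \<nu>) powr d * (S \<nu> x)\<^sup>2" for \<nu>
     unfolding h_def power_mult_distrib by (simp add: power2_eq_square powr_add[symmetric])
    then show ?thesis unfolding sum_distrib_left e_def E_def t_def by (intro sum.cong refl) (simp only: mult_ac)
   qed
   finally show ?thesis using True Q by (simp add: mult_left_mono)
  qed (simp add: glue_def)
  have lev: "ennreal ((2 ^ j) powr (2 * s)) * l2sq lborel (glue l \<omega> j) \<le> ennreal (\<Sum>\<nu>\<le>j. A * (L \<nu> * q ^ (j - \<nu>)))" for j
  proof -
   have "l2sq lborel (glue l \<omega> j) \<le> (\<integral>\<^sup>+x. ennreal (\<Sum>\<nu>\<le>j. e j \<nu> * (indicat_real (near j) x * (S \<nu> x)\<^sup>2)) \<partial>lborel)"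
    unfolding l2sq_def by (intro nn_integral_mono ennreal_leI pw)
   also have "\<dots> = (\<integral>\<^sup>+x. (\<Sum>\<nu>\<le>j. ennreal (e j \<nu>) * (indicator (near j) x * ennreal ((S \<nu> x)\<^sup>2))) \<partial>lborel)"
   proof (rule nn_integral_cong)
    fix x
    have "ennreal (\<Sum>\<nu>\<le>j. e j \<nu> * (indicat_real (near j) x * (S \<nu> x)\<^sup>2)) = (\<Sum>\<nu>\<le>j. ennreal (e j \<nu> * (indicat_real (near j) x * (S \<nu> x)\<^sup>2)))"
     by (rule sum_ennreal[symmetric]) (intro mult_nonneg_nonneg e0 indicator_pos_le zero_le_power2)
    also have "\<dots> = (\<Sum>\<nu>\<le>j. ennreal (e j \<nu>) * (indicator (near j) x * ennreal ((S \<nu> x)\<^sup>2)))"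
     by (intro sum.cong refl) (simp add: ennreal_mult' e0 indicator_def)
    finally show "ennreal (\<Sum>\<nu>\<le>j. e j \<nu> * (indicat_real (near j) x * (S \<nu> x)\<^sup>2)) = (\<Sum>\<nu>\<le>j. ennreal (e j \<nu>) * (indicator (near j) x * ennreal ((S \<nu> x)\<^sup>2)))" .
   qed
   also have "\<dots> = (\<Sum>\<nu>\<le>j. \<integral>\<^sup>+x. ennreal (e j \<nu>) * (indicator (near j) x * ennreal ((S \<nu> x)\<^sup>2)) \<partial>lborel)"
    by (rule nn_integral_sum) measurable
   also have "\<dots> = (\<Sum>\<nu>\<le>j. ennreal (e j \<nu>) * (\<integral>\<^sup>+x. indicator (near j) x * ennreal ((S \<nu> x)\<^sup>2) \<partial>lborel))"
    by (intro sum.cong refl nn_integral_cmult) measurable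
   also have "\<dots> \<le> (\<Sum>\<nu>\<le>j. ennreal (e j \<nu>) * ennreal (7 ^ CARD('n) * (C3 * ((2 ^ j) powr (d - real CARD('n)) * (2 ^ \<nu>) powr (- d))) * L \<nu>))"
   proof (intro sum_mono mult_left_mono)
    fix \<nu> assume "\<nu> \<in> {..j}"
    then have \<nu>: "\<nu> \<le> j" by simp
    have bm: "dbox 3 \<nu> m \<in> sets (borel :: (real^'n) measure)" for m by (simp add: closed_dbox)
    have "(\<integral>\<^sup>+x. indicator (near j) x * ennreal ((S \<nu> x)\<^sup>2) \<partial>lborel) = (\<integral>\<^sup>+x. ennreal ((S \<nu> x)\<^sup>2) \<partial>density lborel (indicator (near j)))"
     by (rule nn_integral_density[symmetric]) measurable
    also have "\<dots> \<le> ennreal (7 ^ CARD('n) * (C3 * ((2 ^ j) powr (d - real CARD('n)) * (2 ^ \<nu>) powr (- d))) * L \<nu>)"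
     unfolding S_def L_def
    proof (rule nn_integral_box_sum)
     show "(\<lambda>x. indicator (dbox 3 \<nu> m) x :: ennreal) \<in> borel_measurable (density lborel (indicator (near j)))" for m
      using bm by simp
     show "(\<integral>\<^sup>+x. indicator (dbox 3 \<nu> m) x \<partial>density lborel (indicator (near j))) \<le> ennreal (C3 * ((2 ^ j) powr (d - real CARD('n)) * (2 ^ \<nu>) powr (- d)))" for m
     proof -
      have "(\<integral>\<^sup>+x. indicator (dbox 3 \<nu> m) x \<partial>density lborel (indicator (near j))) = (\<integral>\<^sup>+x. indicator (near j) x * indicator (dbox 3 \<nu> m) x \<partial>lborel)"
      using bm by (intro nn_integral_density) auto
      also have "\<dots> = (\<integral>\<^sup>+x. indicator (near j \<inter> dbox 3 \<nu> m) x \<partial>lborel)"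
      by (intro nn_integral_cong) (simp add: indicator_def)
      also have "\<dots> = emeasure lborel (near j \<inter> dbox 3 \<nu> m)" using bm by (intro nn_integral_indicator) auto
      finally show ?thesis using C3(2)[OF \<nu>] by simp
     qed
    qed (use C3 sm in auto)
    finally show "(\<integral>\<^sup>+x. indicator (near j) x * ennreal ((S \<nu> x)\<^sup>2) \<partial>lborel) \<le> ennreal (7 ^ CARD('n) * (C3 * ((2 ^ j) powr (d - real CARD('n)) * (2 ^ \<nu>) powr (- d))) * L \<nu>)" .
   qed simp
   also have "\<dots> = ennreal (\<Sum>\<nu>\<le>j. e j \<nu> * (7 ^ CARD('n) * (C3 * ((2 ^ j) powr (d - real CARD('n)) * (2 ^ \<nu>) powr (- d))) * L \<nu>))"
   proof -
    have "0 \<le> e j \<nu> * (7 ^ CARD('n) * (C3 * ((2 ^ j) powr (d - real CARD('n)) * (2 ^ \<nu>) powr (- d))) * L \<nu>)" for \<nu>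
     using C3 L0 e0 by simp
    then show ?thesis unfolding ennreal_mult'[OF e0, symmetric] by (rule sum_ennreal)
   qed
   finally have "ennreal ((2 ^ j) powr (2 * s)) * l2sq lborel (glue l \<omega> j)
    \<le> ennreal ((2 ^ j) powr (2 * s)) * ennreal (\<Sum>\<nu>\<le>j. e j \<nu> * (7 ^ CARD('n) * (C3 * ((2 ^ j) powr (d - real CARD('n)) * (2 ^ \<nu>) powr (- d))) * L \<nu>))"
    by (rule mult_left_mono) simp
   also have "\<dots> = ennreal ((2 ^ j) powr (2 * s) * (\<Sum>\<nu>\<le>j. e j \<nu> * (7 ^ CARD('n) * (C3 * ((2 ^ j) powr (d - real CARD('n)) * (2 ^ \<nu>) powr (- d))) * L \<nu>)))"
    by (rule ennreal_mult'[symmetric]) simp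
   also have "(2 ^ j) powr (2 * s) * (\<Sum>\<nu>\<le>j. e j \<nu> * (7 ^ CARD('n) * (C3 * ((2 ^ j) powr (d - real CARD('n)) * (2 ^ \<nu>) powr (- d))) * L \<nu>)) = (\<Sum>\<nu>\<le>j. A * (L \<nu> * q ^ (j - \<nu>)))"
    unfolding sum_distrib_left
   proof (intro sum.cong refl)
    fix \<nu>
    have "(2 ^ j :: real) powr (2 * s) * ((2 ^ j) powr (- 2 * \<alpha>) * (2 ^ j) powr (d - real CARD('n))) = (2 ^ j) powr (2 * s + (- 2 * \<alpha> + (d - real CARD('n))))"
     by (simp only: powr_add)
    \<comment> \<open>The value of s enters here: its extra (n - d) / 2 orders are exactly
      compensated by the small volume of the neighbourhood.\<close>
    also have "2 * s + (- 2 * \<alpha> + (d - real CARD('n))) = 0" unfolding s by (simp add: field_simps)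
    finally have 1: "(2 ^ j :: real) powr (2 * s) * ((2 ^ j) powr (- 2 * \<alpha>) * (2 ^ j) powr (d - real CARD('n))) = 1" by simp
    have 2: "(2 ^ \<nu> :: real) powr d * (2 ^ \<nu>) powr (- d) = 1" by (simp add: powr_add[symmetric])
    have "(2 ^ j) powr (2 * s) * (e j \<nu> * (7 ^ CARD('n) * (C3 * ((2 ^ j) powr (d - real CARD('n)) * (2 ^ \<nu>) powr (- d))) * L \<nu>))
     = A * (L \<nu> * q ^ (j - \<nu>)) * ((2 ^ j) powr (2 * s) * ((2 ^ j) powr (- 2 * \<alpha>) * (2 ^ j) powr (d - real CARD('n)))) * ((2 ^ \<nu>) powr d * (2 ^ \<nu>) powr (- d))"
     unfolding A_def e_def by (simp only: mult_ac)
    then show "(2 ^ j) powr (2 * s) * (e j \<nu> * (7 ^ CARD('n) * (C3 * ((2 ^ j) powr (d - real CARD('n)) * (2 ^ \<nu>) powr (- d))) * L \<nu>)) = A * (L \<nu> * q ^ (j - \<nu>))"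
     unfolding 1 2 by simp
   qed
   finally show ?thesis .
  qed
  \<comment> \<open>The sum over j is the Cauchy product of the level sums \<open>L\<close> with the
    geometric series in q.\<close>
  have cp: "(\<lambda>j. \<Sum>\<nu>\<le>j. L \<nu> * q ^ (j - \<nu>)) sums (suminf L * (\<Sum>k. q ^ k))"
   by (rule Cauchy_product_sums) (use sL' L0 q in \<open>auto simp: summable_geometric\<close>)
  have "(\<Sum>k. q ^ k) = 1 / (1 - q)" using q by (intro suminf_geometric) simp
  with cp have "(\<lambda>j. A * (\<Sum>\<nu>\<le>j. L \<nu> * q ^ (j - \<nu>))) sums (A * (suminf L * (1 / (1 - q))))" by (intro sums_mult) simp
  then have cs: "(\<lambda>j. \<Sum>\<nu>\<le>j. A * (L \<nu> * q ^ (j - \<nu>))) sums (A * (suminf L * (1 / (1 - q))))" by (simp only: sum_distrib_left)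
  have n0: "0 \<le> (\<Sum>\<nu>\<le>j. A * (L \<nu> * q ^ (j - \<nu>)))" for j
   using A0 L0 q by (intro sum_nonneg mult_nonneg_nonneg zero_le_power) auto
  have "level_norm s (glue l \<omega>) \<le> (\<Sum>j. ennreal (\<Sum>\<nu>\<le>j. A * (L \<nu> * q ^ (j - \<nu>))))"
   unfolding level_norm_def by (intro suminf_le lev) auto
  also have "\<dots> = ennreal (A * (suminf L * (1 / (1 - q))))"
   using suminf_ennreal2[OF n0 sums_summable[OF cs]] sums_unique[OF cs] by simp
  finally show "level_norm s (glue l \<omega>) \<le> ennreal (A * (1 / (1 - q)) * (\<Sum>\<nu>. \<Sum>\<^sub>\<infinity>m. (norm (l \<nu> m))\<^sup>2))"
   unfolding L_def by (simp only: mult_ac)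
 qed
qed

text \<open>Tannery's theorem interchanges the sums over j and \<nu>: for each \<nu> the partial
  sums over j tend to the contribution of the atoms and are dominated by Q G / (1 - \<rho>),
  summable in \<nu>.\<close>

lemma synth_glue:
 assumes c: "\<And>\<nu> m j. continuous_on UNIV (\<omega> \<nu> m j)" and supp: "\<And>\<nu> m j x. \<omega> \<nu> m j x \<noteq> 0 ==> \<nu> \<le> j \<and> x \<in> dbox (5 / 2) \<nu> m"
  and bd: "\<And>\<nu> m j x. \<nu> \<le> j ==> norm (\<omega> \<nu> m j x) \<le> Q * (2 ^ \<nu>) powr (d / 2 - \<alpha>) * (2 ^ j / 2 ^ \<nu>) powr (- \<kappa>)"
  and Q: "0 < Q" and \<kappa>: "0 < \<kappa>"
  and sums: "\<And>\<nu> m. (\<lambda>j. conv (kern j) (\<omega> \<nu> m j) x) sums a \<nu> m x"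
  and x: "x \<in> space M" and sS: "summable (\<lambda>\<nu>. (2 ^ \<nu>) powr (d / 2 - \<alpha>) * (\<Sum>m\<in>box_idx \<nu> x. norm (l \<nu> m)))"
 shows "synth (glue l \<omega>) x = (\<Sum>\<nu>. \<Sum>m\<in>box_idx \<nu> x. l \<nu> m * a \<nu> m x)"
proof -
 define T where "T j \<nu> = (\<Sum>m\<in>box_idx \<nu> x. l \<nu> m * conv (kern j) (\<omega> \<nu> m j) x)" for j \<nu>
 define G where "G \<nu> = (2 ^ \<nu>) powr (d / 2 - \<alpha>) * (\<Sum>m\<in>box_idx \<nu> x. norm (l \<nu> m))" for \<nu>
 define \<rho> where "\<rho> = (2::real) powr (- \<kappa>)"
 have \<rho>: "0 < \<rho>" "\<rho> < 1" using \<kappa> by (simp_all add: \<rho>_def powr_less_one)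
 have G0: "0 \<le> G \<nu>" for \<nu> by (simp add: G_def sum_nonneg)
 \<comment> \<open>An atom of level \<nu> has no pieces below \<nu>; hence the double sums truncated
   at J run over finitely many pairs and can be rearranged.\<close>
 have T0: "T j \<nu> = 0" if "j < \<nu>" for j \<nu>
 proof -
  have "conv (kern j) (\<omega> \<nu> m j) x = 0" for m
   by (rule conv_kern_const) (use supp[of \<nu> m j] that in force)
  then show ?thesis by (simp add: T_def)
 qed
 have Tb: "norm (T j \<nu>) \<le> Q * G \<nu> * \<rho> ^ (j - \<nu>)" if \<nu>j: "\<nu> \<le> j" for j \<nu>
 proof -
  have e: "(2 ^ j / 2 ^ \<nu> :: real) powr (- \<kappa>) = \<rho> ^ (j - \<nu>)"
   using \<nu>j pow2_powr[of "j - \<nu>" "- \<kappa>"] by (simp add: \<rho>_def power_diff)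
  have "norm (T j \<nu>) \<le> (\<Sum>m\<in>box_idx \<nu> x. norm (l \<nu> m) * (Q * (2 ^ \<nu>) powr (d / 2 - \<alpha>) * \<rho> ^ (j - \<nu>)))"
   unfolding T_def
  proof (rule sum_norm_le)
   fix m
   have "norm (conv (kern j) (\<omega> \<nu> m j) x) \<le> Q * (2 ^ \<nu>) powr (d / 2 - \<alpha>) * \<rho> ^ (j - \<nu>)"
    using bd[OF \<nu>j, of m, unfolded e] Q \<rho>
    by (intro conv_kern_bound borel_measurable_continuous_onI c) auto
   then show "norm (l \<nu> m * conv (kern j) (\<omega> \<nu> m j) x) \<le> norm (l \<nu> m) * (Q * (2 ^ \<nu>) powr (d / 2 - \<alpha>) * \<rho> ^ (j - \<nu>))"
    unfolding norm_mult by (rule mult_left_mono) simp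
  qed
  also have "\<dots> = Q * G \<nu> * \<rho> ^ (j - \<nu>)" unfolding G_def sum_distrib_right[symmetric] by (simp only: mult_ac)
  finally show ?thesis .
 qed
 define P where "P \<nu> J = (\<Sum>j<J. T j \<nu>)" for \<nu> J
 have Pb: "norm (P \<nu> J) \<le> Q * G \<nu> * (1 / (1 - \<rho>))" for \<nu> J
 proof -
  have "norm (P \<nu> J) = norm (\<Sum>j\<in>{\<nu>..<J}. T j \<nu>)"
   unfolding P_def by (intro arg_cong[where f=norm] sum.mono_neutral_right) (auto simp: T0)
  also have "\<dots> \<le> (\<Sum>j\<in>{\<nu>..<J}. Q * G \<nu> * \<rho> ^ (j - \<nu>))" by (rule sum_norm_le) (simp add: Tb)
  also have "\<dots> = (\<Sum>i\<in>{0..<J - \<nu>}. Q * G \<nu> * \<rho> ^ i)"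
   by (rule sum.reindex_bij_witness[of _ "\<lambda>i. i + \<nu>" "\<lambda>j. j - \<nu>"]) auto
  also have "\<dots> = Q * G \<nu> * (\<Sum>i\<in>{0..<J - \<nu>}. \<rho> ^ i)" by (rule sum_distrib_left[symmetric])
  also have "\<dots> \<le> Q * G \<nu> * (1 / (1 - \<rho>))"
  proof (rule mult_left_mono)
   have "(\<Sum>i\<in>{0..<J - \<nu>}. \<rho> ^ i) \<le> (\<Sum>i. \<rho> ^ i)" using \<rho> by (intro sum_le_suminf summable_geometric) auto
   also have "\<dots> = 1 / (1 - \<rho>)" using \<rho> by (intro suminf_geometric) simp
   finally show "(\<Sum>i\<in>{0..<J - \<nu>}. \<rho> ^ i) \<le> 1 / (1 - \<rho>)" .
  qed (use Q G0 in simp)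
  finally show ?thesis .
 qed
 define f where "f \<nu> = (\<Sum>m\<in>box_idx \<nu> x. l \<nu> m * a \<nu> m x)" for \<nu>
 have lim: "(\<lambda>J. P \<nu> J) \<longlonglongrightarrow> f \<nu>" for \<nu>
  unfolding P_def T_def f_def sums_def[symmetric] by (intro sums_sum sums_mult sums)
 have "summable (\<lambda>\<nu>. Q * G \<nu> * (1 / (1 - \<rho>)))" unfolding G_def by (intro summable_mult summable_mult2 sS)
 then have tan: "(\<lambda>J. \<Sum>\<nu>. P \<nu> J) \<longlonglongrightarrow> suminf f"
  using tannerys_theorem[where a=P and b=f and M="\<lambda>\<nu>. Q * G \<nu> * (1 / (1 - \<rho>))" and F=sequentially, OF lim] Pb
  by (simp add: always_eventually split_def)
 have "(\<Sum>\<nu>. P \<nu> J) = (\<Sum>j<J. conv (kern j) (glue l \<omega> j) x)" for J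
 proof -
  have "(\<Sum>\<nu>. P \<nu> J) = (\<Sum>\<nu><J. P \<nu> J)" by (rule suminf_finite) (auto simp: P_def T0)
  also have "\<dots> = (\<Sum>j<J. \<Sum>\<nu><J. T j \<nu>)" unfolding P_def by (rule sum.swap)
  also have "\<dots> = (\<Sum>j<J. \<Sum>\<nu>\<le>j. T j \<nu>)" by (intro sum.cong refl sum.mono_neutral_right) (auto simp: T0)
  also have "\<dots> = (\<Sum>j<J. conv (kern j) (glue l \<omega> j) x)"
   unfolding T_def using supp by (intro sum.cong refl conv_glue[symmetric] c x) blast
  finally show ?thesis .
 qed
 with tan have "(\<lambda>j. conv (kern j) (glue l \<omega> j) x) sums suminf f" unfolding sums_def by simp
 then show ?thesis unfolding synth_def f_def[symmetric] by (rule sums_unique[symmetric])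
qed

end

context regular
begin

text \<open>An atomic sum is given through L2 limits. Almost everywhere they are identified with
  pointwise sums, which \<open>synth_glue\<close> turns into a synthesised series, bounded by
  \<open>level_norm_glue_le\<close>.\<close>

lemma synth_of_atoms:
 assumes \<alpha>: "0 < \<alpha>" and K: "\<alpha> < real K" and s: "s = \<alpha> + (real CARD('n) - d) / 2"
 obtains C where "0 < C"
  "\<And>l a f. l \<in> b_seq 2 2 ==> \<forall>\<nu> m. is_atom K \<alpha> 2 d \<nu> m (a \<nu> m) ==> atomic_sum 2 M l a f ==>
   \<exists>w. (\<forall>j. w j \<in> borel_measurable borel) \<and> level_norm s w \<le> ennreal (C * (b_norm 2 2 l)\<^sup>2) \<and> (AE x in M. synth w x = f x)"
proof -
 obtain \<kappa> Q where \<kappa>: "\<alpha> < \<kappa>" and Q: "0 < Q" and pieces: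
  "\<And>\<nu> m (a :: real^'n => complex). is_atom K \<alpha> 2 d \<nu> m a ==> \<exists>\<omega>. (\<forall>j. continuous_on UNIV (\<omega> j)) \<and>
    (\<forall>j x. \<omega> j x \<noteq> 0 --> \<nu> \<le> j \<and> x \<in> dbox (5 / 2) \<nu> m) \<and>
    (\<forall>j x. \<nu> \<le> j --> norm (\<omega> j x) \<le> Q * (2 ^ \<nu>) powr (d / 2 - \<alpha>) * (2 ^ j / 2 ^ \<nu>) powr (- \<kappa>)) \<and>
    (\<forall>x. (\<lambda>j. conv (kern j) (\<omega> j) x) sums a x)"
  by (rule atom_pieces[OF K \<alpha>]) (rule that)
 obtain C where C: "0 < C"
  "\<And>l \<omega>. (\<forall>\<nu> m j. continuous_on UNIV (\<omega> \<nu> m j)) ==> (\<forall>\<nu> m j x. \<omega> \<nu> m j x \<noteq> 0 --> x \<in> dbox (5 / 2) \<nu> m) ==>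
   (\<forall>\<nu> m j x. \<nu> \<le> j --> norm (\<omega> \<nu> m j x) \<le> Q * (2 ^ \<nu>) powr (d / 2 - \<alpha>) * (2 ^ j / 2 ^ \<nu>) powr (- \<kappa>)) ==>
   (\<forall>\<nu>. (\<lambda>m. (norm (l \<nu> m))\<^sup>2) summable_on UNIV) ==> summable (\<lambda>\<nu>. \<Sum>\<^sub>\<infinity>m. (norm (l \<nu> m))\<^sup>2) ==>
   level_norm s (glue l \<omega>) \<le> ennreal (C * (\<Sum>\<nu>. \<Sum>\<^sub>\<infinity>m. (norm (l \<nu> m))\<^sup>2))"
  by (rule level_norm_glue_le[OF s \<kappa> Q]) (rule that)
 obtain C3 where C3: "0 < C3" "\<And>\<nu> m. emeasure M {x \<in> space M. x \<in> dbox 3 \<nu> m} \<le> ennreal (C3 * (2 ^ \<nu>) powr (- d))"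
  by (rule emeasure_dbox_le) (rule that)
 show ?thesis
 proof (rule that[OF C(1)])
  fix l :: "nat => int^'n => complex" and a :: "nat => int^'n => real^'n => complex" and f
  assume l: "l \<in> b_seq 2 2" and atoms: "\<forall>\<nu> m. is_atom K \<alpha> 2 d \<nu> m (a \<nu> m)" and asum: "atomic_sum 2 M l a f"
  define \<Omega> where "\<Omega> \<nu> m = (SOME \<omega>. (\<forall>j. continuous_on UNIV (\<omega> j)) \<and>
    (\<forall>j x. \<omega> j x \<noteq> 0 --> \<nu> \<le> j \<and> x \<in> dbox (5 / 2) \<nu> m) \<and>
    (\<forall>j x. \<nu> \<le> j --> norm (\<omega> j x) \<le> Q * (2 ^ \<nu>) powr (d / 2 - \<alpha>) * (2 ^ j / 2 ^ \<nu>) powr (- \<kappa>)) \<and>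
    (\<forall>x. (\<lambda>j. conv (kern j) (\<omega> j) x) sums a \<nu> m x))" for \<nu> m
  have \<Omega>: "(\<forall>j. continuous_on UNIV (\<Omega> \<nu> m j)) \<and>
    (\<forall>j x. \<Omega> \<nu> m j x \<noteq> 0 --> \<nu> \<le> j \<and> x \<in> dbox (5 / 2) \<nu> m) \<and>
    (\<forall>j x. \<nu> \<le> j --> norm (\<Omega> \<nu> m j x) \<le> Q * (2 ^ \<nu>) powr (d / 2 - \<alpha>) * (2 ^ j / 2 ^ \<nu>) powr (- \<kappa>)) \<and>
    (\<forall>x. (\<lambda>j. conv (kern j) (\<Omega> \<nu> m j) x) sums a \<nu> m x)" for \<nu> m
   using someI_ex[OF pieces[OF atoms[rule_format, of \<nu> m]]] unfolding \<Omega>_def .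
  have \<Omega>1: "continuous_on UNIV (\<Omega> \<nu> m j)" for \<nu> m j using \<Omega> by blast
  have \<Omega>2: "\<Omega> \<nu> m j x \<noteq> 0 ==> \<nu> \<le> j \<and> x \<in> dbox (5 / 2) \<nu> m" for \<nu> m j x using \<Omega> by blast
  have \<Omega>3: "\<nu> \<le> j ==> norm (\<Omega> \<nu> m j x) \<le> Q * (2 ^ \<nu>) powr (d / 2 - \<alpha>) * (2 ^ j / 2 ^ \<nu>) powr (- \<kappa>)" for \<nu> m j x using \<Omega> by blast
  have \<Omega>4: "(\<lambda>j. conv (kern j) (\<Omega> \<nu> m j) x) sums a \<nu> m x" for \<nu> m x using \<Omega> by blast
  define L where "L \<nu> = (\<Sum>\<^sub>\<infinity>m. (norm (l \<nu> m))\<^sup>2)" for \<nu>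
  have L0: "0 \<le> L \<nu>" for \<nu> unfolding L_def by (rule infsum_nonneg) simp
  have pe: "L \<nu> powr (2 / 2) = L \<nu>" for \<nu> using L0[of \<nu>] by simp
  have sm: "(\<lambda>m. (norm (l \<nu> m))\<^sup>2) summable_on UNIV" for \<nu>
   using l unfolding b_seq_def powr_2_eq by blast
  have sL: "summable L"
   using l unfolding b_seq_def mem_Collect_eq powr_2_eq L_def[symmetric] pe by blast
  have bn: "(b_norm 2 2 l)\<^sup>2 = suminf L"
   unfolding b_norm_def powr_2_eq L_def[symmetric] pe using suminf_nonneg[OF sL L0] by (simp add: powr_half_sqrt)
  let ?w = "glue l \<Omega>"
  have wm: "?w j \<in> borel_measurable borel" for j using \<Omega>1 \<Omega>2 by (intro glue_measurable) blast+
  have "level_norm s ?w \<le> ennreal (C * (\<Sum>\<nu>. \<Sum>\<^sub>\<infinity>m. (norm (l \<nu> m))\<^sup>2))"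
   by (rule C(2)) (use \<Omega>1 \<Omega>2 \<Omega>3 sm sL L_def[abs_def] in auto)
  then have lev: "level_norm s ?w \<le> ennreal (C * (b_norm 2 2 l)\<^sup>2)" unfolding bn L_def .
  define D where "D \<nu> = (2 ^ \<nu> :: real) powr (d / 2 - \<alpha>)" for \<nu> :: nat
  have D0: "0 \<le> D \<nu>" for \<nu> by (simp add: D_def)
  have ab: "norm (a \<nu> m x) \<le> D \<nu>" for \<nu> m x
  proof -
   have "norm (iter_deriv [] (a \<nu> m) x) \<le> 2 powr (- real \<nu> * (\<alpha> - real (length ([] :: 'n list)) - d / 2))"
    using atoms unfolding is_atom_def by (metis list.size(3) le0)
   also have "\<dots> = D \<nu>"
   proof -
    have X: "(2::real) ^ \<nu> = 2 powr real \<nu>" by (simp add: powr_realpow)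
    show ?thesis unfolding D_def X powr_powr by (simp add: algebra_simps)
   qed
   finally show ?thesis by simp
  qed
  have asup: "x \<in> dbox 3 \<nu> m" if "a \<nu> m x \<noteq> 0" for \<nu> m x
  proof -
   have "x \<in> supp (a \<nu> m)" using that closure_subset[of "{x. a \<nu> m x \<noteq> 0}"] by (auto simp: supp_def)
   then have "x \<in> dbox (3 / 2) \<nu> m" using atoms unfolding is_atom_def dilated_cube_3 by blast
   then show ?thesis using dbox_mono[of "3 / 2" 3 \<nu> m] by auto
  qed
  define S where "S \<nu> x = (\<Sum>m\<in>box_idx \<nu> x. norm (l \<nu> m))" for \<nu> x
  have S0: "0 \<le> S \<nu> x" for \<nu> x by (simp add: S_def sum_nonneg)
  have Sm: "S \<nu> \<in> borel_measurable M" for \<nu>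
   unfolding S_def by (rule sum_norm_box_idx_measurable) (rule borel_imp_measurable)
  \<comment> \<open>A majorant of the terms of level \<nu>. Its squared norm is O(r^\<nu>), the
    measure of a box turning D^2 into 2^(-2 \<alpha> \<nu>); so \<alpha> > 0 yields the summability
    that \<open>synth_glue\<close> asks for.\<close>
  define F where "F \<nu> x = complex_of_real (D \<nu> * S \<nu> x)" for \<nu> x
  have Fm: "F \<nu> \<in> borel_measurable M" for \<nu> unfolding F_def using Sm[of \<nu>] by measurable
  define r where "r = (2::real) powr (- 2 * \<alpha>)"
  have r: "0 < r" "r < 1" using \<alpha> by (simp_all add: r_def powr_less_one)
  define B where "B = 7 ^ CARD('n) * C3 * suminf L"
  have B0: "0 \<le> B" using C3 suminf_nonneg[OF sL L0] by (simp add: B_def)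
  have Fb: "l2sq M (F \<nu>) \<le> ennreal (B * r ^ \<nu>)" for \<nu>
  proof -
   have bm: "dbox 3 \<nu> m \<in> sets (borel :: (real^'n) measure)" for m by (simp add: closed_dbox)
   have "l2sq M (F \<nu>) = (\<integral>\<^sup>+x. ennreal ((D \<nu>)\<^sup>2) * ennreal ((S \<nu> x)\<^sup>2) \<partial>M)"
    unfolding l2sq_def F_def norm_of_real power2_abs power_mult_distrib by (intro nn_integral_cong ennreal_mult') simp
   also have "\<dots> = ennreal ((D \<nu>)\<^sup>2) * (\<integral>\<^sup>+x. ennreal ((S \<nu> x)\<^sup>2) \<partial>M)"
    using Sm[of \<nu>] by (intro nn_integral_cmult) measurable
   also have "\<dots> \<le> ennreal ((D \<nu>)\<^sup>2) * ennreal (7 ^ CARD('n) * (C3 * (2 ^ \<nu>) powr (- d)) * L \<nu>)"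
   proof (rule mult_left_mono)
    show "(\<integral>\<^sup>+x. ennreal ((S \<nu> x)\<^sup>2) \<partial>M) \<le> ennreal (7 ^ CARD('n) * (C3 * (2 ^ \<nu>) powr (- d)) * L \<nu>)"
     unfolding S_def L_def
    proof (rule nn_integral_box_sum)
     show "(\<lambda>x. indicator (dbox 3 \<nu> m) x :: ennreal) \<in> borel_measurable M" for m
      using bm by (intro borel_imp_measurable borel_measurable_indicator) auto
     have sets: "{x \<in> space M. x \<in> dbox 3 \<nu> m} \<in> sets M" for m
     proof -
      have "{x \<in> space M. x \<in> dbox 3 \<nu> m} = (\<lambda>x. x) -` dbox 3 \<nu> m \<inter> space M" by auto
      then show ?thesis using measurable_sets[OF id_measurable bm] by simp
     qed
     show "(\<integral>\<^sup>+x. indicator (dbox 3 \<nu> m) x \<partial>M) \<le> ennreal (C3 * (2 ^ \<nu>) powr (- d))" for m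
     proof -
      have "(\<integral>\<^sup>+x. indicator (dbox 3 \<nu> m) x \<partial>M) = (\<integral>\<^sup>+x. indicator {x \<in> space M. x \<in> dbox 3 \<nu> m} x \<partial>M)"
      by (rule nn_integral_cong) (simp add: indicator_def)
      also have "\<dots> = emeasure M {x \<in> space M. x \<in> dbox 3 \<nu> m}" by (rule nn_integral_indicator[OF sets])
      finally show ?thesis using C3(2)[of \<nu> m] by simp
     qed
    qed (use C3 sm in auto)
   qed simp
   also have "\<dots> = ennreal ((D \<nu>)\<^sup>2 * (7 ^ CARD('n) * (C3 * (2 ^ \<nu>) powr (- d)) * L \<nu>))" by (rule ennreal_mult'[symmetric]) simp
   also have "\<dots> \<le> ennreal (B * r ^ \<nu>)"
   proof (rule ennreal_leI)
    have "(D \<nu>)\<^sup>2 * (2 ^ \<nu>) powr (- d) = (2 ^ \<nu>) powr ((d / 2 - \<alpha>) + (d / 2 - \<alpha>) + (- d))"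
     unfolding D_def power2_eq_square by (simp only: powr_add)
    also have "\<dots> = r ^ \<nu>" unfolding r_def pow2_powr[symmetric] by (rule arg_cong2[where f="(powr)"]) simp_all
    finally have 1: "(D \<nu>)\<^sup>2 * (2 ^ \<nu>) powr (- d) = r ^ \<nu>" .
    have "L \<nu> = sum L {\<nu>}" by simp
    also have "\<dots> \<le> suminf L" by (rule sum_le_suminf[OF sL]) (use L0 in auto)
    finally have 2: "L \<nu> \<le> suminf L" .
    have "(D \<nu>)\<^sup>2 * (7 ^ CARD('n) * (C3 * (2 ^ \<nu>) powr (- d)) * L \<nu>) = (7 ^ CARD('n) * C3) * ((D \<nu>)\<^sup>2 * (2 ^ \<nu>) powr (- d)) * L \<nu>"
     by (simp only: mult_ac)
    also have "\<dots> \<le> (7 ^ CARD('n) * C3) * r ^ \<nu> * suminf L"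
     unfolding 1 using C3 r 2 by (intro mult_left_mono) auto
    also have "\<dots> = B * r ^ \<nu>" unfolding B_def by (simp only: mult_ac)
    finally show "(D \<nu>)\<^sup>2 * (7 ^ CARD('n) * (C3 * (2 ^ \<nu>) powr (- d)) * L \<nu>) \<le> B * r ^ \<nu>" .
   qed
   finally show ?thesis .
  qed
  have AE1: "AE x in M. summable (\<lambda>\<nu>. norm (F \<nu> x))" by (rule l2_geometric_series(1)[OF Fm B0 r Fb])
  obtain g where g: "\<And>\<nu>. Lp_tendsto 2 M (\<lambda>S x. \<Sum>m\<in>S. l \<nu> m * a \<nu> m x) (g \<nu>) (finite_subsets_at_top UNIV)"
   and gf: "Lp_tendsto 2 M (\<lambda>N x. \<Sum>\<nu><N. g \<nu> x) f sequentially"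
   using asum unfolding atomic_sum_def by blast
  \<comment> \<open>Along \<open>int_cube\<close> the L2 limit over finite sets becomes a sequential
    one, while at each point the sums are eventually constant.\<close>
  have "AE x in M. (\<Sum>m\<in>box_idx \<nu> x. l \<nu> m * a \<nu> m x) = g \<nu> x" for \<nu>
  proof (rule l2_limit_unique_AE)
   show "(\<lambda>x. \<Sum>m\<in>int_cube k. l \<nu> m * a \<nu> m x) \<in> borel_measurable M" for k
    using g[of \<nu>] unfolding Lp_tendsto_2_iff Lp2_iff by blast
   show "g \<nu> \<in> borel_measurable M" using g[of \<nu>] unfolding Lp_tendsto_2_iff Lp2_iff by blast
   have "((\<lambda>S. l2sq M (\<lambda>x. (\<Sum>m\<in>S. l \<nu> m * a \<nu> m x) - g \<nu> x)) \<longlongrightarrow> 0) (finite_subsets_at_top UNIV)"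
    using g[of \<nu>] unfolding Lp_tendsto_2_iff by blast
   then show "(\<lambda>k. l2sq M (\<lambda>x. (\<Sum>m\<in>int_cube k. l \<nu> m * a \<nu> m x) - g \<nu> x)) \<longlonglongrightarrow> 0"
    by (rule filterlim_compose) (rule filterlim_int_cube)
   show "AE x in M. (\<lambda>k. \<Sum>m\<in>int_cube k. l \<nu> m * a \<nu> m x) \<longlonglongrightarrow> (\<Sum>m\<in>box_idx \<nu> x. l \<nu> m * a \<nu> m x)"
    by (intro AE_I2 sum_box_idx_tendsto) (use asup in auto)
  qed
  then have AE2: "AE x in M. \<forall>\<nu>. (\<Sum>m\<in>box_idx \<nu> x. l \<nu> m * a \<nu> m x) = g \<nu> x" by (simp add: AE_all_countable)
  have AE3: "AE x in M. (\<lambda>N. \<Sum>\<nu><N. g \<nu> x) \<longlonglongrightarrow> (\<Sum>\<nu>. \<Sum>m\<in>box_idx \<nu> x. l \<nu> m * a \<nu> m x)"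
   using AE1 AE2
  proof eventually_elim
   case (elim x)
   have "summable (\<lambda>\<nu>. \<Sum>m\<in>box_idx \<nu> x. l \<nu> m * a \<nu> m x)"
   proof (rule summable_comparison_test'[OF elim(1), of 0])
    fix \<nu>
    have "norm (\<Sum>m\<in>box_idx \<nu> x. l \<nu> m * a \<nu> m x) \<le> (\<Sum>m\<in>box_idx \<nu> x. norm (l \<nu> m) * D \<nu>)"
     by (intro sum_norm_le) (simp add: norm_mult mult_left_mono ab)
    also have "\<dots> = D \<nu> * S \<nu> x" unfolding S_def sum_distrib_right[symmetric] by (rule mult.commute)
    also have "\<dots> = norm (F \<nu> x)" unfolding F_def norm_of_real using D0 S0 by simp
    finally show "norm (\<Sum>m\<in>box_idx \<nu> x. l \<nu> m * a \<nu> m x) \<le> norm (F \<nu> x)" .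
   qed
   from summable_LIMSEQ[OF this] show ?case using elim(2) by simp
  qed
  have AE4: "AE x in M. (\<Sum>\<nu>. \<Sum>m\<in>box_idx \<nu> x. l \<nu> m * a \<nu> m x) = f x"
  proof (rule l2_limit_unique_AE[OF _ _ _ AE3])
   show "(\<lambda>x. \<Sum>\<nu><N. g \<nu> x) \<in> borel_measurable M" for N using gf unfolding Lp_tendsto_2_iff Lp2_iff by blast
  qed (use gf in \<open>auto simp: Lp_tendsto_2_iff Lp2_iff\<close>)
  have "AE x in M. synth ?w x = f x"
   using AE1 AE4 AE_space
  proof eventually_elim
   case (elim x)
   have "summable (\<lambda>\<nu>. (2 ^ \<nu>) powr (d / 2 - \<alpha>) * (\<Sum>m\<in>box_idx \<nu> x. norm (l \<nu> m)))"
    using elim(1) D0 S0 unfolding F_def norm_of_real by (simp add: D_def S_def abs_mult sum_nonneg)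
   then have "synth ?w x = (\<Sum>\<nu>. \<Sum>m\<in>box_idx \<nu> x. l \<nu> m * a \<nu> m x)"
    using \<kappa> \<alpha> by (intro synth_glue[where \<omega>=\<Omega> and a=a and x=x and Q=Q and \<alpha>=\<alpha> and \<kappa>=\<kappa>] \<Omega>1 \<Omega>2 \<Omega>3 \<Omega>4 Q elim(3)) auto
   then show ?case using elim(2) by simp
  qed
  with wm lev show "\<exists>w. (\<forall>j. w j \<in> borel_measurable borel) \<and> level_norm s w \<le> ennreal (C * (b_norm 2 2 l)\<^sup>2) \<and> (AE x in M. synth w x = f x)"
   by blast
 qed
qed

end

section \<open>Hausdorff measure on a d-set, and the comparison of the two spaces\<close>

text \<open>A d-set controls balls centred in \<Gamma>. A ball of radius r that meets \<Gamma> is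
  contained in one of radius 2 r with centre in \<Gamma>; this is the origin of the restriction to
  radii up to 1/2 and of the factor 2^d.\<close>

lemma regular_hausdorff_on:
 fixes \<Gamma> :: "(real^'n) set"
 assumes "d_set d \<Gamma>" "0 < d"
 obtains c c1 where "regular (hausdorff_on d \<Gamma>) d c c1"
proof -
 let ?H = "hausdorff_measure d :: (real^'n) measure" and ?M = "hausdorff_on d \<Gamma>"
 have cl: "closed \<Gamma>" using assms(1) by (simp add: d_set_def)
 obtain c1 c2 where c: "0 < c1" "0 < c2" and
  lo: "\<And>x r. x \<in> \<Gamma> ==> 0 < r ==> r \<le> 1 ==> ennreal (c1 * r powr d) \<le> emeasure ?H (\<Gamma> \<inter> cball x r)" and
  up: "\<And>x r. x \<in> \<Gamma> ==> 0 < r ==> r \<le> 1 ==> emeasure ?H (\<Gamma> \<inter> cball x r) \<le> ennreal (c2 * r powr d)"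
  using assms(1) unfolding d_set_def by blast
 have sH: "sets ?H = sets borel" "space ?H = UNIV"
  unfolding hausdorff_measure_def by (simp_all add: sets.sigma_sets_eq[of borel, simplified] sets_measure_of_conv space_measure_of_conv)
 have G: "\<Gamma> \<in> sets ?H" using cl by (simp add: sH)
 have spM: "space ?M = \<Gamma>" by (simp add: hausdorff_on_def space_restrict_space sH)
 have em: "emeasure ?M {x \<in> space ?M. dist y x \<le> r} = emeasure ?H (\<Gamma> \<inter> cball y r)" for y r
 proof -
  have "{x \<in> space ?M. dist y x \<le> r} = \<Gamma> \<inter> cball y r" by (auto simp: spM)
  then show ?thesis unfolding hausdorff_on_def using G by (simp add: emeasure_restrict_space sH)
 qed
 have sM: "\<Gamma> \<inter> cball y r \<in> sets ?M" for y r
  unfolding hausdorff_on_def using G by (simp add: sets_restrict_space_iff sH cl)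
 have upper: "emeasure ?M {x \<in> space ?M. dist y x \<le> r} \<le> ennreal (c2 * 2 powr d * r powr d)" if r: "0 < r" "r \<le> 1 / 2" for y r
 proof (cases "\<Gamma> \<inter> cball y r = {}")
  case True
  then show ?thesis unfolding em by simp
 next
  case False
  then obtain z where z: "z \<in> \<Gamma>" "dist y z \<le> r" by auto
  have "\<Gamma> \<inter> cball y r \<subseteq> \<Gamma> \<inter> cball z (2 * r)"
  proof
   fix x assume "x \<in> \<Gamma> \<inter> cball y r"
   then show "x \<in> \<Gamma> \<inter> cball z (2 * r)" using z(2) dist_triangle[of z x y] by (auto simp: dist_commute)
  qed
  then have "emeasure ?H (\<Gamma> \<inter> cball y r) \<le> emeasure ?H (\<Gamma> \<inter> cball z (2 * r))" by (rule emeasure_mono) (simp add: sH cl)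
  also have "\<dots> \<le> ennreal (c2 * (2 * r) powr d)" using r by (intro up z) auto
  finally show ?thesis unfolding em using r by (simp add: powr_mult mult.assoc)
 qed
 \<comment> \<open>Balls of radius 1/2 around a countable dense set cover \<Gamma> and have finite
   measure; this gives sigma-finiteness, on which Tonelli's theorem for \<open>M\<close>
   rests.\<close>
 obtain D :: "(real^'n) set" where D: "countable D" "\<And>X. open X ==> X \<noteq> {} ==> \<exists>d\<in>D. d \<in> X"
  using countable_dense_exists by blast
 have sf: "sigma_finite_measure ?M"
 proof
  show "\<exists>A. countable A \<and> A \<subseteq> sets ?M \<and> \<Union> A = space ?M \<and> (\<forall>a\<in>A. emeasure ?M a \<noteq> \<infinity>)"
  proof (intro exI[of _ "(\<lambda>y. \<Gamma> \<inter> cball y (1 / 2)) ` D"] conjI ballI)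
   show "countable ((\<lambda>y. \<Gamma> \<inter> cball y (1 / 2)) ` D)" using D(1) by simp
   show "(\<lambda>y. \<Gamma> \<inter> cball y (1 / 2)) ` D \<subseteq> sets ?M" using sM by blast
   have "x \<in> \<Union> ((\<lambda>y. \<Gamma> \<inter> cball y (1 / 2)) ` D)" if "x \<in> \<Gamma>" for x
    using D(2)[of "ball x (1 / 2)"] that by (force simp: dist_commute)
   then show "\<Union> ((\<lambda>y. \<Gamma> \<inter> cball y (1 / 2)) ` D) = space ?M" unfolding spM by blast
   fix A assume "A \<in> (\<lambda>y. \<Gamma> \<inter> cball y (1 / 2)) ` D"
   then obtain y where "A = \<Gamma> \<inter> cball y (1 / 2)" by blast
   then have "A = {x \<in> space ?M. dist y x \<le> 1 / 2}" by (auto simp: spM)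
   then show "emeasure ?M A \<noteq> \<infinity>" using upper[of "1 / 2" y] by (auto simp: top_unique)
  qed
 qed
 interpret sigma_finite_measure ?M by (rule sf)
 have "regular ?M d (c2 * 2 powr d) c1"
 proof unfold_locales
  show "(\<lambda>x. x) \<in> ?M \<rightarrow>\<^sub>M borel"
   unfolding hausdorff_on_def by (rule measurable_restrict_space1) (simp add: measurable_def sH)
  show "0 \<le> d" "0 \<le> c2 * 2 powr d" "0 < c1" using assms c by simp_all
  show "0 < r ==> r \<le> 1 / 2 ==> emeasure ?M {x \<in> space ?M. dist y x \<le> r} \<le> ennreal (c2 * 2 powr d * r powr d)" for y r by (rule upper)
  show "x \<in> space ?M ==> 0 < r ==> r \<le> 1 ==> ennreal (c1 * r powr d) \<le> emeasure ?M {y \<in> space ?M. dist x y \<le> r}" for x r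
   unfolding em using lo by (simp add: spM)
 qed
 then show ?thesis by (rule that)
qed

lemma b_norm_nonneg: "0 \<le> b_norm p q l"
 by (simp add: b_norm_def)

lemma sobolev_norm_nonneg: "0 \<le> sobolev_norm s u"
 by (simp add: sobolev_norm_def)

theorem corollaryA4:
  fixes \<Gamma> :: "(real^'n) set" and \<alpha> d :: real and K :: nat
  assumes "\<alpha> > 0"
    and "0 < d" and "d < real CARD('n)"
    and "d_set d \<Gamma>"
    and "preserves_Markov \<Gamma>"
    and "int K > \<lfloor>\<alpha>\<rfloor>"
  shows "trace_space \<alpha> d \<Gamma> = besov K \<alpha> 2 2 d \<Gamma> \<and>
    (\<exists>c>0. \<exists>C>0. \<forall>f\<in>trace_space \<alpha> d \<Gamma>.
       c * besov_norm K \<alpha> 2 2 d \<Gamma> f \<le> trace_space_norm \<alpha> d \<Gamma> f \<and>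
       trace_space_norm \<alpha> d \<Gamma> f \<le> C * besov_norm K \<alpha> 2 2 d \<Gamma> f)"
proof -
 let ?M = "hausdorff_on d \<Gamma>"
 define s where "s = trace_exponent \<alpha> d \<Gamma>"
 have s: "s = \<alpha> + (real CARD('n) - d) / 2" by (simp add: s_def trace_exponent_def)
 have s0: "0 < s" and s2: "real CARD('n) - d < 2 * s" using assms(1-3) by (simp_all add: s field_simps)
 have K: "\<alpha> < real K" using assms(6) by linarith
 obtain c c1 where "regular ?M d c c1" by (rule regular_hausdorff_on[OF assms(4,2)])
 then interpret regular ?M d c c1 .
 have ur: "upper_regular ?M d c" by unfold_locales
 obtain C1 where C1: "0 < C1"
  "\<And>w f. (\<forall>j. w j \<in> borel_measurable borel) ==> level_norm s w < \<infinity> ==> f \<in> Lp 2 ?M ==> AE x in ?M. f x = synth w x ==>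
   \<exists>l a. l \<in> b_seq 2 2 \<and> (\<forall>\<nu> m. is_atom K \<alpha> 2 d \<nu> m (a \<nu> m)) \<and> atomic_sum 2 ?M l a f
    \<and> ennreal ((b_norm 2 2 l)\<^sup>2) \<le> ennreal C1 * level_norm s w"
  by (rule besov_of_synth[OF ur assms(1) s less_imp_le[OF s0]]) (rule that)
 obtain C2 where C2: "0 < C2"
  "\<And>l a f. l \<in> b_seq 2 2 ==> \<forall>\<nu> m. is_atom K \<alpha> 2 d \<nu> m (a \<nu> m) ==> atomic_sum 2 ?M l a f ==>
   \<exists>w. (\<forall>j. w j \<in> borel_measurable borel) \<and> level_norm s w \<le> ennreal (C2 * (b_norm 2 2 l)\<^sup>2) \<and> (AE x in ?M. synth w x = f x)"
  by (rule synth_of_atoms[OF assms(1) K s]) (rule that)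
 have "\<exists>C>0. \<forall>w :: nat => real^'n => complex. (\<forall>j. w j \<in> borel_measurable borel) --> level_norm s w < \<infinity> --> sob_sq s (synth w) \<le> ennreal C * level_norm s w"
 proof (rule sob_sq_synth_le[OF s0, where 'n='n], goal_cases)
  case (1 C)
  show ?case
  proof (intro exI[of _ C] conjI allI impI)
   fix w :: "nat => real^'n => complex" assume "\<forall>j. w j \<in> borel_measurable borel" "level_norm s w < \<infinity>"
   then show "sob_sq s (synth w) \<le> ennreal C * level_norm s w" by (intro 1(2)) auto
  qed (rule 1(1))
 qed
 then obtain C3 where C3: "0 < C3" "\<And>w :: nat => real^'n => complex. \<forall>j. w j \<in> borel_measurable borel ==> level_norm s w < \<infinity> ==> sob_sq s (synth w) \<le> ennreal C3 * level_norm s w"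
  by blast
 define CA where "CA = sqrt (C1 * (4 * 4 powr s))"
 define CB where "CB = sqrt (C3 * C2)"
 have CA0: "0 < CA" and CB0: "0 < CB" using C1(1) C2(1) C3(1) by (simp_all add: CA_def CB_def)
 \<comment> \<open>Sobolev to Besov: the pieces of any preimage u synthesise to u, so their series
   equals f on \<Gamma> and is then cut into atoms.\<close>
 have A: "\<exists>l\<in>besov_coeffs K \<alpha> 2 2 d \<Gamma> f. b_norm 2 2 l \<le> CA * sobolev_norm s u"
  if f: "f \<in> Lp 2 ?M" and u: "u \<in> trace_preimages s d \<Gamma> f" for f u
 proof -
  have us: "u \<in> sobolev s" and uf: "AE x in ?M. trace_op s d \<Gamma> u x = f x" using u by (auto simp: trace_preimages_def)
  have ul: "u \<in> Lp 2 lborel" and uf': "sob_sq s u < \<infinity>" using us by (auto simp: sobolev_iff)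
  have pm: "\<And>j. pieces u j \<in> borel_measurable borel" by (rule pieces_measurable[OF ul])
  have fin: "level_norm s (pieces u) < \<infinity>" using s0 us by (intro level_norm_pieces_finite) auto
  have "AE x in ?M. trace_op s d \<Gamma> u x = synth (pieces u) x"
   by (rule trace_op_synth[OF ur s0 s2 pm fin us synth_pieces[OF s0 us]])
  with uf have "AE x in ?M. f x = synth (pieces u) x" by eventually_elim simp
  with C1(2)[of "pieces u" f] pm fin f obtain l a where la: "l \<in> b_seq 2 2" "\<forall>\<nu> m. is_atom K \<alpha> 2 d \<nu> m (a \<nu> m)"
    "atomic_sum 2 ?M l a f" "ennreal ((b_norm 2 2 l)\<^sup>2) \<le> ennreal C1 * level_norm s (pieces u)"
   by blast
  obtain e where e: "sob_sq s u = ennreal e" "0 \<le> e" using uf' by (cases "sob_sq s u") auto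
  have "ennreal ((b_norm 2 2 l)\<^sup>2) \<le> ennreal C1 * (ennreal (4 * 4 powr s) * sob_sq s u)"
   using la(4) by (rule order_trans) (intro mult_left_mono level_norm_pieces_le less_imp_le[OF s0] ul, simp)
  also have "\<dots> = ennreal (C1 * (4 * 4 powr s) * e)"
   unfolding e(1) using C1(1) e(2) by (simp add: ennreal_mult'[symmetric] mult.assoc)
  finally have "(b_norm 2 2 l)\<^sup>2 \<le> C1 * (4 * 4 powr s) * e" using C1(1) e(2) by simp
  then have "b_norm 2 2 l \<le> sqrt (C1 * (4 * 4 powr s) * e)" by (rule real_le_rsqrt)
  also have "\<dots> = CA * sobolev_norm s u" using e by (simp add: CA_def real_sqrt_mult sobolev_norm_eq[OF ul])
  finally show ?thesis using la(1-3) unfolding besov_coeffs_def by blast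
 qed
 \<comment> \<open>Besov to Sobolev: the series that \<open>synth_of_atoms\<close> builds from the
   atoms is itself a preimage of f.\<close>
 have B: "f \<in> Lp 2 ?M \<and> (\<exists>u\<in>trace_preimages s d \<Gamma> f. sobolev_norm s u \<le> CB * b_norm 2 2 l)"
  if l: "l \<in> besov_coeffs K \<alpha> 2 2 d \<Gamma> f" for f l
 proof -
  obtain a where a: "l \<in> b_seq 2 2" "\<forall>\<nu> m. is_atom K \<alpha> 2 d \<nu> m (a \<nu> m)" "atomic_sum 2 ?M l a f"
   using l unfolding besov_coeffs_def by blast
  have f: "f \<in> Lp 2 ?M" using a(3) unfolding atomic_sum_def Lp_tendsto_def by blast
  obtain w where w: "\<forall>j. w j \<in> borel_measurable borel" "level_norm s w \<le> ennreal (C2 * (b_norm 2 2 l)\<^sup>2)" "AE x in ?M. synth w x = f x"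
   using C2(2)[OF a] by blast
  have fin: "level_norm s w < \<infinity>" using w(2) by (rule le_less_trans) simp
  have wm: "\<And>j. w j \<in> borel_measurable borel" using w(1) by blast
  have us: "synth w \<in> sobolev s"
   by (rule trace_operator_synth(1)[OF ur s0 s2 trace_operator_exists[OF ur s0 s2] wm fin])
  have "AE x in ?M. trace_op s d \<Gamma> (synth w) x = synth w x"
   by (rule trace_op_synth[OF ur s0 s2 wm fin us]) simp
  with w(3) have "AE x in ?M. trace_op s d \<Gamma> (synth w) x = f x" by eventually_elim simp
  with us have mem: "synth w \<in> trace_preimages s d \<Gamma> f" by (simp add: trace_preimages_def)
  have ul: "synth w \<in> Lp 2 lborel" and uf: "sob_sq s (synth w) < \<infinity>" using us by (auto simp: sobolev_iff)
  obtain e where e: "sob_sq s (synth w) = ennreal e" "0 \<le> e" using uf by (cases "sob_sq s (synth w)") auto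
  have "sob_sq s (synth w) \<le> ennreal C3 * ennreal (C2 * (b_norm 2 2 l)\<^sup>2)"
   using C3(2)[OF w(1) fin] by (rule order_trans) (intro mult_left_mono w(2), simp)
  also have "\<dots> = ennreal (C3 * C2 * (b_norm 2 2 l)\<^sup>2)" using C3(1) by (simp add: ennreal_mult'[symmetric] mult.assoc)
  finally have "e \<le> C3 * C2 * (b_norm 2 2 l)\<^sup>2" unfolding e(1) using C3(1) C2(1) by simp
  then have "sqrt e \<le> sqrt (C3 * C2 * (b_norm 2 2 l)\<^sup>2)" by simp
  also have "\<dots> = CB * b_norm 2 2 l" by (simp add: CB_def real_sqrt_mult b_norm_nonneg)
  finally have "sobolev_norm s (synth w) \<le> CB * b_norm 2 2 l" using e by (simp add: sobolev_norm_eq[OF ul])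
  with f mem show ?thesis by blast
 qed
 have eq: "trace_space \<alpha> d \<Gamma> = besov K \<alpha> 2 2 d \<Gamma>"
 proof (intro set_eqI iffI)
  fix f assume "f \<in> trace_space \<alpha> d \<Gamma>"
  then show "f \<in> besov K \<alpha> 2 2 d \<Gamma>" using A[of f] unfolding trace_space_def besov_def s_def[symmetric] by blast
 next
  fix f assume "f \<in> besov K \<alpha> 2 2 d \<Gamma>"
  then show "f \<in> trace_space \<alpha> d \<Gamma>" using B[of _ f] unfolding trace_space_def besov_def s_def[symmetric] by blast
 qed
 \<comment> \<open>\<open>A\<close> finds coefficients for each preimage and \<open>B\<close> a
   preimage for each family of coefficients; the infima, over nonempty sets bounded below by 0,
   inherit both estimates.\<close>
 have norms: "1 / CA * besov_norm K \<alpha> 2 2 d \<Gamma> f \<le> trace_space_norm \<alpha> d \<Gamma> f \<and> trace_space_norm \<alpha> d \<Gamma> f \<le> CB * besov_norm K \<alpha> 2 2 d \<Gamma> f"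
  if f: "f \<in> trace_space \<alpha> d \<Gamma>" for f
 proof -
  have fl: "f \<in> Lp 2 ?M" and ne1: "trace_preimages s d \<Gamma> f \<noteq> {}" using f unfolding trace_space_def s_def[symmetric] by auto
  have ne2: "besov_coeffs K \<alpha> 2 2 d \<Gamma> f \<noteq> {}" using f unfolding eq besov_def by simp
  have bb1: "bdd_below ((\<lambda>u. sobolev_norm s u) ` trace_preimages s d \<Gamma> f)" by (rule bdd_belowI2[of _ 0]) (rule sobolev_norm_nonneg)
  have bb2: "bdd_below ((\<lambda>l. b_norm 2 2 l) ` besov_coeffs K \<alpha> 2 2 d \<Gamma> f)" by (rule bdd_belowI2[of _ 0]) (rule b_norm_nonneg)
  have "1 / CA * besov_norm K \<alpha> 2 2 d \<Gamma> f \<le> trace_space_norm \<alpha> d \<Gamma> f"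
   unfolding trace_space_norm_def s_def[symmetric]
  proof (rule cINF_greatest[OF ne1])
   fix u assume "u \<in> trace_preimages s d \<Gamma> f"
   then obtain l where l: "l \<in> besov_coeffs K \<alpha> 2 2 d \<Gamma> f" "b_norm 2 2 l \<le> CA * sobolev_norm s u" using A[OF fl] by blast
   have "besov_norm K \<alpha> 2 2 d \<Gamma> f \<le> b_norm 2 2 l" unfolding besov_norm_def by (rule cINF_lower[OF bb2 l(1)])
   then show "1 / CA * besov_norm K \<alpha> 2 2 d \<Gamma> f \<le> sobolev_norm s u" using l(2) CA0 by (simp add: field_simps)
  qed
  moreover have "1 / CB * trace_space_norm \<alpha> d \<Gamma> f \<le> besov_norm K \<alpha> 2 2 d \<Gamma> f"
   unfolding besov_norm_def
  proof (rule cINF_greatest[OF ne2])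
   fix l assume "l \<in> besov_coeffs K \<alpha> 2 2 d \<Gamma> f"
   then obtain u where u: "u \<in> trace_preimages s d \<Gamma> f" "sobolev_norm s u \<le> CB * b_norm 2 2 l" using B by blast
   have "trace_space_norm \<alpha> d \<Gamma> f \<le> sobolev_norm s u" unfolding trace_space_norm_def s_def[symmetric] by (rule cINF_lower[OF bb1 u(1)])
   then show "1 / CB * trace_space_norm \<alpha> d \<Gamma> f \<le> b_norm 2 2 l" using u(2) CB0 by (simp add: field_simps)
  qed
  ultimately show ?thesis using CB0 by (simp add: field_simps)
 qed
 show ?thesis
  using eq norms CA0 CB0 by (intro conjI exI[of _ "1 / CA"] exI[of _ CB]) auto
qed

end
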